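(* Let $\mathbf{k}$ be a commutative ring, let $\mathfrak{g}$ be an $\mathbb{S}$-module over $\mathbf{k}$ and let $\circ:\mathfrak{g}\otimes_{\mathbb{S}}\mathfrak{g}\to\mathfrak{g}$ be a binary operation (a morphism of $\mathbb{S}$-modules). Let $\{\,,\}$ be the ($\mathbb{S}$-equivariant, $\mathbf{k}[t]$-linear) twisted skew-symmetric bracket on $\Sigma\mathfrak{g}[t]$ determined by $$\{x^{(0)},y^{(0)}\}=(x\circ y)^{(|x|+1)}\,t-(12)^{|y|+1,|x|+1}\,(y\circ x)^{(|y|+1)}\,t$$ for homogeneous $x,y\in\mathfrak{g}$. Then $\{\,,\}$ defines a twisted Lie algebra structure on $\Sigma\mathfrak{g}[t]$ over $\mathbf{k}[t]$ if and only if $\circ$ defines a twisted pre-Lie algebra structure on $\mathfrak{g}$. In this case, $\Sigma\mathfrak{g}[t]$ is itself a twisted pre-Lie algebra, under the $\mathbf{k}[t]$-linear operation $$x^{(0)}\circ y^{(0)}:=(x\circ y)^{(|x|+1)}\,t$$ (with the convention $t\circ u=0=u\circ t$ for products with the bare parameter $t$).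
   Context: An $\mathbb{S}$-module is an $\mathbb{N}$-graded $\mathbf{k}$-module $M=\bigoplus_{m\ge0}M_m$ with an action of $S_m$ on each $M_m$ by $\mathbf{k}$-module automorphisms; morphisms are graded and equivariant. $M\otimes_{\mathbb{S}}N=\bigoplus_p\bigoplus_{m+n=p}\operatorname{Ind}_{S_m\times S_n}^{S_p}M_m\otimes N_n$. For $i_1+\cdots+i_n=r$ and $\sigma\in S_n$, $\sigma^{i_1,\dots,i_n}\in S_r$ is the block permutation moving the $j$-th of the consecutive blocks of sizes $i_1,\dots,i_n$ to the $\sigma(j)$-th place, preserving order within blocks. A twisted Lie algebra is an $\mathbb{S}$-module with a bracket (a morphism $\mathfrak{h}\otimes_{\mathbb{S}}\mathfrak{h}\to\mathfrak{h}$) satisfying $\{x,y\}=-(12)^{|y|,|x|}\{y,x\}$ (twisted skew-symmetry) and $\{x,\{y,z\}\}+(123)^{|y|,|z|,|x|}\{y,\{z,x\}\}+(132)^{|z|,|x|,|y|}\{z,\{x,y\}\}=0$ for homogeneous elements. A twisted pre-Lie algebra is an $\mathbb{S}$-module with a morphism $\circ:\mathfrak{h}\otimes_{\mathbb{S}}\mathfrak{h}\to\mathfrak{h}$ satisfying $(x\circ y)\circ z-x\circ(y\circ z)=(23)^{|x|,|z|,|y|}\bigl((x\circ z)\circ y-x\circ(z\circ y)\bigr)$. The suspension $\Sigma\mathfrak{g}$ is the $\mathbb{S}$-module with $(\Sigma\mathfrak{g})_0=0$, $(\Sigma\mathfrak{g})_{m+1}=\operatorname{Ind}_{S_m\times S_1}^{S_{m+1}}\mathfrak{g}_m$.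 As a $\mathbf{k}$-module $(\Sigma\mathfrak{g})_{m+1}=\mathfrak{g}_m\oplus\bigoplus_{i=1}^m(i,i+1,\dots,m+1)\mathfrak{g}_m$. For $x\in\mathfrak{g}_m$ put $x^{(0)}:=x\in(\Sigma\mathfrak{g})_{m+1}$, $x^{(i)}:=(i,i+1,\dots,m+1)\,x\in(\Sigma\mathfrak{g})_{m+1}$ for $1\le i\le m$, and $x^{(m+1)}:=x^{(0)}$. (Heuristically $x^{(0)}$ is "$xs$" with a parameter $s$ of degree one in the last position, and $x^{(i)}$ has $s$ in position $i$.) $\mathbf{k}[t]$ is the twisted commutative algebra with $|t|=1$ and trivial $S_m$-action on $t^m$, and $\Sigma\mathfrak{g}[t]:=\Sigma\mathfrak{g}\otimes_{\mathbb{S}}\mathbf{k}[t]$ is the $\mathbf{k}[t]$-module freely generated by $\Sigma\mathfrak{g}$ in $\mathbb{S}$-modules; left and right multiplication by $t$ are related by $tf=(12)^{|f|,1}\,ft$. A twisted Lie structure over $\mathbf{k}[t]$ is one whose bracket is $\mathbf{k}[t]$-linear: $\{tf,g\}=t\{f,g\}$. $\mathbf{k}[t]$-linearity of $\circ$ on $\Sigma\mathfrak{g}[t]$ means $(ut)\circ v=u\circ(tv)$, $t(u\circ v)=(tu)\circ v$ and $(u\circ v)t=u\circ(vt)$ for all $u,v$. *)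

theory Defs
  imports
    "HOL-Algebra.Module"
    "HOL-Algebra.AbelCoset"
    "HOL-Algebra.Group_Action"
    "HOL-Algebra.Sym_Groups"
begin

text \<open>
  Modules are records over HOL-Algebra rings. Linear maps, actions and morphisms are extensional
  functions (equal to \<^const>\<open>undefined\<close> off the carrier), as in \<^const>\<open>BijGroup\<close>, so that they
  are determined by their values on the carrier.
\<close>

section \<open>Modules given by generators and relations\<close>

definition linear_maps ::
    "('a, 'r) ring_scheme \<Rightarrow> ('a, 'b) module \<Rightarrow> ('a, 'c) module \<Rightarrow> ('b \<Rightarrow> 'c) set"
  where "linear_maps R M N =
    {f \<in> carrier M \<rightarrow>\<^sub>E carrier N.
      (\<forall>x\<in>carrier M. \<forall>y\<in>carrier M. f (x \<oplus>\<^bsub>M\<^esub> y) = f x \<oplus>\<^bsub>N\<^esub> f y) \<and>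
      (\<forall>c\<in>carrier R. \<forall>x\<in>carrier M. f (c \<odot>\<^bsub>M\<^esub> x) = c \<odot>\<^bsub>N\<^esub> f x)}"

text \<open>The ring fields \<^const>\<open>monoid.mult\<close> and \<^const>\<open>one\<close> of a module record carry no meaning.\<close>

definition free_module :: "('a, 'r) ring_scheme \<Rightarrow> 'x set \<Rightarrow> ('a, 'x \<Rightarrow> 'a) module"
  where "free_module R X =
    \<lparr> carrier = {f \<in> X \<rightarrow>\<^sub>E carrier R. finite {x \<in> X. f x \<noteq> \<zero>\<^bsub>R\<^esub>}},
      monoid.mult = undefined, one = undefined,
      zero = (\<lambda>x\<in>X. \<zero>\<^bsub>R\<^esub>),
      add = (\<lambda>f h. \<lambda>x\<in>X. f x \<oplus>\<^bsub>R\<^esub> h x),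
      smult = (\<lambda>c f. \<lambda>x\<in>X. c \<otimes>\<^bsub>R\<^esub> f x) \<rparr>"

definition basis_vec :: "('a, 'r) ring_scheme \<Rightarrow> 'x set \<Rightarrow> 'x \<Rightarrow> 'x \<Rightarrow> 'a"
  where "basis_vec R X x = (\<lambda>y\<in>X. if y = x then \<one>\<^bsub>R\<^esub> else \<zero>\<^bsub>R\<^esub>)"

definition submodule_generated ::
    "('a, 'r) ring_scheme \<Rightarrow> ('a, 'b) module \<Rightarrow> 'b set \<Rightarrow> 'b set"
  where "submodule_generated R M S = \<Inter>{K. submodule K R M \<and> S \<subseteq> K}"

definition quotient_module :: "('a, 'b) module \<Rightarrow> 'b set \<Rightarrow> ('a, 'b set) module"
  where "quotient_module M K =
    \<lparr> carrier = a_rcosets\<^bsub>M\<^esub> K,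
      monoid.mult = undefined, one = undefined,
      zero = K,
      add = (\<lambda>A B. A <+>\<^bsub>M\<^esub> B),
      smult = (\<lambda>c A. \<Union>a\<in>A. K +>\<^bsub>M\<^esub> (c \<odot>\<^bsub>M\<^esub> a)) \<rparr>"

definition presented_module ::
    "('a, 'r) ring_scheme \<Rightarrow> 'x set \<Rightarrow> ('x \<Rightarrow> 'a) set \<Rightarrow> ('a, ('x \<Rightarrow> 'a) set) module"
  where "presented_module R X S =
    quotient_module (free_module R X) (submodule_generated R (free_module R X) S)"

definition presented_gen ::
    "('a, 'r) ring_scheme \<Rightarrow> 'x set \<Rightarrow> ('x \<Rightarrow> 'a) set \<Rightarrow> 'x \<Rightarrow> ('x \<Rightarrow> 'a) set"
  where "presented_gen R X S x =
    submodule_generated R (free_module R X) S +>\<^bsub>free_module R X\<^esub> basis_vec R X x"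

text \<open>
  The linear map out of a presented module that sends the class of each generator \<open>x\<close> to \<open>\<phi> x\<close>;
  it is only meaningful if \<open>\<phi>\<close> respects the relations, which makes the image of every coset
  a singleton.
\<close>

definition presented_map ::
    "('a, 'r) ring_scheme \<Rightarrow> 'x set \<Rightarrow> ('x \<Rightarrow> 'a) set \<Rightarrow> ('a, 'b) module \<Rightarrow> ('x \<Rightarrow> 'b)
      \<Rightarrow> ('x \<Rightarrow> 'a) set \<Rightarrow> 'b"
  where "presented_map R X S N \<phi> =
    (\<lambda>A\<in>carrier (presented_module R X S).
      the_elem ((\<lambda>f. \<Oplus>\<^bsub>N\<^esub>x\<in>{x\<in>X. f x \<noteq> \<zero>\<^bsub>R\<^esub>}. f x \<odot>\<^bsub>N\<^esub> \<phi> x) ` A))"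

section \<open>Tensor products, induced modules and finite direct sums\<close>

type_synonym ('a, 'b, 'c) tensor = "('b \<times> 'c \<Rightarrow> 'a) set"

definition tensor_rels ::
    "('a, 'r) ring_scheme \<Rightarrow> ('a, 'b) module \<Rightarrow> ('a, 'c) module \<Rightarrow> ('b \<times> 'c \<Rightarrow> 'a) set"
  where "tensor_rels R M N =
    (let X = carrier M \<times> carrier N; F = free_module R X; e = basis_vec R X in
      {e (x \<oplus>\<^bsub>M\<^esub> x', y) \<ominus>\<^bsub>F\<^esub> (e (x, y) \<oplus>\<^bsub>F\<^esub> e (x', y)) | x x' y.
        x \<in> carrier M \<and> x' \<in> carrier M \<and> y \<in> carrier N} \<union>
      {e (x, y \<oplus>\<^bsub>N\<^esub> y') \<ominus>\<^bsub>F\<^esub> (e (x, y) \<oplus>\<^bsub>F\<^esub> e (x, y')) | x y y'.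
        x \<in> carrier M \<and> y \<in> carrier N \<and> y' \<in> carrier N} \<union>
      {e (c \<odot>\<^bsub>M\<^esub> x, y) \<ominus>\<^bsub>F\<^esub> (c \<odot>\<^bsub>F\<^esub> e (x, y)) | c x y.
        c \<in> carrier R \<and> x \<in> carrier M \<and> y \<in> carrier N} \<union>
      {e (x, c \<odot>\<^bsub>N\<^esub> y) \<ominus>\<^bsub>F\<^esub> (c \<odot>\<^bsub>F\<^esub> e (x, y)) | c x y.
        c \<in> carrier R \<and> x \<in> carrier M \<and> y \<in> carrier N})"

definition tensor_module ::
    "('a, 'r) ring_scheme \<Rightarrow> ('a, 'b) module \<Rightarrow> ('a, 'c) module \<Rightarrow> ('a, ('a, 'b, 'c) tensor) module"
  where "tensor_module R M N =
    presented_module R (carrier M \<times> carrier N) (tensor_rels R M N)"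

definition tensor_gen ::
    "('a, 'r) ring_scheme \<Rightarrow> ('a, 'b) module \<Rightarrow> ('a, 'c) module \<Rightarrow> 'b \<Rightarrow> 'c \<Rightarrow> ('a, 'b, 'c) tensor"
  where "tensor_gen R M N x y =
    presented_gen R (carrier M \<times> carrier N) (tensor_rels R M N) (x, y)"

definition tensor_map ::
    "('a, 'r) ring_scheme \<Rightarrow> ('a, 'b) module \<Rightarrow> ('a, 'c) module \<Rightarrow> ('b \<Rightarrow> 'b) \<Rightarrow> ('c \<Rightarrow> 'c)
      \<Rightarrow> ('a, 'b, 'c) tensor \<Rightarrow> ('a, 'b, 'c) tensor"
  where "tensor_map R M N f h =
    presented_map R (carrier M \<times> carrier N) (tensor_rels R M N) (tensor_module R M N)
      (\<lambda>(x, y). tensor_gen R M N (f x) (h y))"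

type_synonym ('a, 'g, 'v) induced = "('g \<times> 'v \<Rightarrow> 'a) set"

text \<open>
  \<open>Ind\<close> from \<open>H\<close> to \<open>G\<close> along a homomorphism \<open>\<iota>\<close> is the tensor product of the group algebra of
  \<open>G\<close> with \<open>V\<close> over the group algebra of \<open>H\<close>, where \<open>h\<close> acts on \<open>V\<close> by \<open>\<alpha> h\<close>. The generator
  \<open>(g, v)\<close> stands for \<open>g v\<close>.
\<close>

definition ind_rels ::
    "('a, 'r) ring_scheme \<Rightarrow> 'g monoid \<Rightarrow> 'h monoid \<Rightarrow> ('h \<Rightarrow> 'g) \<Rightarrow> ('a, 'v) module
      \<Rightarrow> ('h \<Rightarrow> 'v \<Rightarrow> 'v) \<Rightarrow> ('g \<times> 'v \<Rightarrow> 'a) set"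
  where "ind_rels R G H \<iota> V \<alpha> =
    (let X = carrier G \<times> carrier V; F = free_module R X; e = basis_vec R X in
      {e (g, v \<oplus>\<^bsub>V\<^esub> w) \<ominus>\<^bsub>F\<^esub> (e (g, v) \<oplus>\<^bsub>F\<^esub> e (g, w)) | g v w.
        g \<in> carrier G \<and> v \<in> carrier V \<and> w \<in> carrier V} \<union>
      {e (g, c \<odot>\<^bsub>V\<^esub> v) \<ominus>\<^bsub>F\<^esub> (c \<odot>\<^bsub>F\<^esub> e (g, v)) | c g v.
        c \<in> carrier R \<and> g \<in> carrier G \<and> v \<in> carrier V} \<union>
      {e (g \<otimes>\<^bsub>G\<^esub> \<iota> h, v) \<ominus>\<^bsub>F\<^esub> e (g, \<alpha> h v) | g h v.
        g \<in> carrier G \<and> h \<in> carrier H \<and> v \<in> carrier V})"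

definition ind_module ::
    "('a, 'r) ring_scheme \<Rightarrow> 'g monoid \<Rightarrow> 'h monoid \<Rightarrow> ('h \<Rightarrow> 'g) \<Rightarrow> ('a, 'v) module
      \<Rightarrow> ('h \<Rightarrow> 'v \<Rightarrow> 'v) \<Rightarrow> ('a, ('a, 'g, 'v) induced) module"
  where "ind_module R G H \<iota> V \<alpha> =
    presented_module R (carrier G \<times> carrier V) (ind_rels R G H \<iota> V \<alpha>)"

definition ind_gen ::
    "('a, 'r) ring_scheme \<Rightarrow> 'g monoid \<Rightarrow> 'h monoid \<Rightarrow> ('h \<Rightarrow> 'g) \<Rightarrow> ('a, 'v) module
      \<Rightarrow> ('h \<Rightarrow> 'v \<Rightarrow> 'v) \<Rightarrow> 'g \<Rightarrow> 'v \<Rightarrow> ('a, 'g, 'v) induced"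
  where "ind_gen R G H \<iota> V \<alpha> g v =
    presented_gen R (carrier G \<times> carrier V) (ind_rels R G H \<iota> V \<alpha>) (g, v)"

definition ind_map ::
    "('a, 'r) ring_scheme \<Rightarrow> 'g monoid \<Rightarrow> 'h monoid \<Rightarrow> ('h \<Rightarrow> 'g) \<Rightarrow> ('a, 'v) module
      \<Rightarrow> ('h \<Rightarrow> 'v \<Rightarrow> 'v) \<Rightarrow> ('a, 'b) module \<Rightarrow> ('g \<Rightarrow> 'v \<Rightarrow> 'b) \<Rightarrow> ('a, 'g, 'v) induced \<Rightarrow> 'b"
  where "ind_map R G H \<iota> V \<alpha> N \<phi> =
    presented_map R (carrier G \<times> carrier V) (ind_rels R G H \<iota> V \<alpha>) N (\<lambda>(g, v). \<phi> g v)"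

definition ind_act ::
    "('a, 'r) ring_scheme \<Rightarrow> 'g monoid \<Rightarrow> 'h monoid \<Rightarrow> ('h \<Rightarrow> 'g) \<Rightarrow> ('a, 'v) module
      \<Rightarrow> ('h \<Rightarrow> 'v \<Rightarrow> 'v) \<Rightarrow> 'g \<Rightarrow> ('a, 'g, 'v) induced \<Rightarrow> ('a, 'g, 'v) induced"
  where "ind_act R G H \<iota> V \<alpha> k =
    ind_map R G H \<iota> V \<alpha> (ind_module R G H \<iota> V \<alpha>)
      (\<lambda>g v. ind_gen R G H \<iota> V \<alpha> (k \<otimes>\<^bsub>G\<^esub> g) v)"

text \<open>The direct sum for a finite index set \<open>I\<close>; it is used for no other index set.\<close>

definition direct_sum :: "'i set \<Rightarrow> ('i \<Rightarrow> ('a, 'b) module) \<Rightarrow> ('a, 'i \<Rightarrow> 'b) module"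
  where "direct_sum I M =
    \<lparr> carrier = (\<Pi>\<^sub>E i\<in>I. carrier (M i)),
      monoid.mult = undefined, one = undefined,
      zero = (\<lambda>i\<in>I. \<zero>\<^bsub>M i\<^esub>),
      add = (\<lambda>u v. \<lambda>i\<in>I. u i \<oplus>\<^bsub>M i\<^esub> v i),
      smult = (\<lambda>c u. \<lambda>i\<in>I. c \<odot>\<^bsub>M i\<^esub> u i) \<rparr>"

section \<open>Permutations\<close>

definition perm_cross :: "nat \<Rightarrow> (nat \<Rightarrow> nat) \<times> (nat \<Rightarrow> nat) \<Rightarrow> nat \<Rightarrow> nat"
  where "perm_cross m = (\<lambda>(\<sigma>, \<tau>) i. if i \<le> m then \<sigma> i else m + \<tau> (i - m))"

abbreviation young_group :: "nat \<Rightarrow> nat \<Rightarrow> ((nat \<Rightarrow> nat) \<times> (nat \<Rightarrow> nat)) monoid"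
  where "young_group m n \<equiv> sym_group m \<times>\<times> sym_group n"

text \<open>
  Position \<open>q\<close> lies in the \<open>j\<close>-th block (counting from 1). The target of that block starts after
  all the blocks \<open>l\<close> with \<open>\<sigma> l < \<sigma> j\<close>.
\<close>

definition block_perm :: "(nat \<Rightarrow> nat) \<Rightarrow> nat list \<Rightarrow> nat \<Rightarrow> nat"
  where "block_perm \<sigma> ds q =
    (if q \<in> {1..sum_list ds} then
       let j = (LEAST j. q \<le> sum_list (take j ds)) in
         (\<Sum>l | l \<in> {1..length ds} \<and> \<sigma> l < \<sigma> j. ds ! (l - 1)) + (q - sum_list (take (j - 1) ds))
     else q)"

section \<open>S-modules\<close>

text \<open>
  The degree \<open>m\<close> part is \<open>component M m\<close>, and \<open>\<sigma>\<close> acts on it by \<open>sym_act M m \<sigma>\<close>. All the structures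
  below only involve homogeneous elements, and the degree of an element is passed explicitly.
\<close>

record ('a, 'b) smodule =
  component :: "nat \<Rightarrow> ('a, 'b) module"
  sym_act :: "nat \<Rightarrow> (nat \<Rightarrow> nat) \<Rightarrow> 'b \<Rightarrow> 'b"

abbreviation hom_elts :: "('a, 'b) smodule \<Rightarrow> nat \<Rightarrow> 'b set"
  where "hom_elts M m \<equiv> carrier (component M m)"

definition S_module :: "('a, 'r) ring_scheme \<Rightarrow> ('a, 'b) smodule \<Rightarrow> bool"
  where "S_module R M \<longleftrightarrow>
    (\<forall>m. module R (component M m) \<and>
         group_action (sym_group m) (hom_elts M m) (sym_act M m) \<and>
         (\<forall>\<sigma>\<in>carrier (sym_group m).
            sym_act M m \<sigma> \<in> linear_maps R (component M m) (component M m)))"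

definition S_morphisms ::
    "('a, 'r) ring_scheme \<Rightarrow> ('a, 'b) smodule \<Rightarrow> ('a, 'c) smodule \<Rightarrow> (nat \<Rightarrow> 'b \<Rightarrow> 'c) set"
  where "S_morphisms R M N =
    {f. \<forall>m. f m \<in> linear_maps R (component M m) (component N m) \<and>
            (\<forall>\<sigma>\<in>carrier (sym_group m). \<forall>x\<in>hom_elts M m.
               f m (sym_act M m \<sigma> x) = sym_act N m \<sigma> (f m x))}"

subsection \<open>Tensor product\<close>

type_synonym ('a, 'b, 'c) S_tensor_part = "('a, nat \<Rightarrow> nat, ('a, 'b, 'c) tensor) induced"
type_synonym ('a, 'b, 'c) S_tensor = "nat \<times> nat \<Rightarrow> ('a, 'b, 'c) S_tensor_part"

definition tensor_young_act ::
    "('a, 'r) ring_scheme \<Rightarrow> ('a, 'b) smodule \<Rightarrow> ('a, 'c) smodule \<Rightarrow> nat \<Rightarrow> nat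
      \<Rightarrow> (nat \<Rightarrow> nat) \<times> (nat \<Rightarrow> nat) \<Rightarrow> ('a, 'b, 'c) tensor \<Rightarrow> ('a, 'b, 'c) tensor"
  where "tensor_young_act R M N m n =
    (\<lambda>(\<sigma>, \<tau>). tensor_map R (component M m) (component N n) (sym_act M m \<sigma>) (sym_act N n \<tau>))"

definition S_tensor_part ::
    "('a, 'r) ring_scheme \<Rightarrow> ('a, 'b) smodule \<Rightarrow> ('a, 'c) smodule \<Rightarrow> nat \<Rightarrow> nat
      \<Rightarrow> ('a, ('a, 'b, 'c) S_tensor_part) module"
  where "S_tensor_part R M N m n =
    ind_module R (sym_group (m + n)) (young_group m n) (perm_cross m)
      (tensor_module R (component M m) (component N n)) (tensor_young_act R M N m n)"

definition S_tensor_part_gen ::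
    "('a, 'r) ring_scheme \<Rightarrow> ('a, 'b) smodule \<Rightarrow> ('a, 'c) smodule \<Rightarrow> nat \<Rightarrow> nat
      \<Rightarrow> (nat \<Rightarrow> nat) \<Rightarrow> ('a, 'b, 'c) tensor \<Rightarrow> ('a, 'b, 'c) S_tensor_part"
  where "S_tensor_part_gen R M N m n =
    ind_gen R (sym_group (m + n)) (young_group m n) (perm_cross m)
      (tensor_module R (component M m) (component N n)) (tensor_young_act R M N m n)"

definition S_tensor_part_act ::
    "('a, 'r) ring_scheme \<Rightarrow> ('a, 'b) smodule \<Rightarrow> ('a, 'c) smodule \<Rightarrow> nat \<Rightarrow> nat
      \<Rightarrow> (nat \<Rightarrow> nat) \<Rightarrow> ('a, 'b, 'c) S_tensor_part \<Rightarrow> ('a, 'b, 'c) S_tensor_part"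
  where "S_tensor_part_act R M N m n =
    ind_act R (sym_group (m + n)) (young_group m n) (perm_cross m)
      (tensor_module R (component M m) (component N n)) (tensor_young_act R M N m n)"

abbreviation bidegrees :: "nat \<Rightarrow> (nat \<times> nat) set"
  where "bidegrees p \<equiv> {(m, n). m + n = p}"

definition S_tensor ::
    "('a, 'r) ring_scheme \<Rightarrow> ('a, 'b) smodule \<Rightarrow> ('a, 'c) smodule
      \<Rightarrow> ('a, ('a, 'b, 'c) S_tensor) smodule"
  where "S_tensor R M N =
    (let T = (\<lambda>p. direct_sum (bidegrees p) (\<lambda>(m, n). S_tensor_part R M N m n)) in
      \<lparr> component = T,
        sym_act = (\<lambda>p \<rho>. \<lambda>u\<in>carrier (T p). \<lambda>(m, n)\<in>bidegrees p. S_tensor_part_act R M N m n \<rho> (u (m, n))) \<rparr>)"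

definition S_tensor_gen ::
    "('a, 'r) ring_scheme \<Rightarrow> ('a, 'b) smodule \<Rightarrow> ('a, 'c) smodule \<Rightarrow> nat \<Rightarrow> nat
      \<Rightarrow> 'b \<Rightarrow> 'c \<Rightarrow> ('a, 'b, 'c) S_tensor"
  where "S_tensor_gen R M N m n x y =
    (\<lambda>(m', n')\<in>bidegrees (m + n).
      if (m', n') = (m, n)
      then S_tensor_part_gen R M N m n id (tensor_gen R (component M m) (component N n) x y)
      else \<zero>\<^bsub>S_tensor_part R M N m' n'\<^esub>)"

text \<open>For a binary operation \<open>\<mu>\<close> on \<open>M\<close>, the product of \<open>x\<close> of degree \<open>m\<close> with \<open>y\<close> of degree \<open>n\<close>.\<close>

definition S_prod ::
    "('a, 'r) ring_scheme \<Rightarrow> ('a, 'b) smodule \<Rightarrow> (nat \<Rightarrow> ('a, 'b, 'b) S_tensor \<Rightarrow> 'b)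
      \<Rightarrow> nat \<Rightarrow> nat \<Rightarrow> 'b \<Rightarrow> 'b \<Rightarrow> 'b"
  where "S_prod R M \<mu> m n x y = \<mu> (m + n) (S_tensor_gen R M M m n x y)"

subsection \<open>Twisted Lie and pre-Lie algebras\<close>

text \<open>\<^term>\<open>cycle_of_list [1, 2, 3]\<close> sends 1 to 2, 2 to 3 and 3 to 1.\<close>

definition twisted_skew_symmetric ::
    "('a, 'r) ring_scheme \<Rightarrow> ('a, 'b) smodule \<Rightarrow> (nat \<Rightarrow> ('a, 'b, 'b) S_tensor \<Rightarrow> 'b) \<Rightarrow> bool"
  where "twisted_skew_symmetric R M br \<longleftrightarrow>
    (\<forall>a b. \<forall>x\<in>hom_elts M a. \<forall>y\<in>hom_elts M b.
      S_prod R M br a b x y =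
      \<ominus>\<^bsub>component M (a + b)\<^esub>
        sym_act M (a + b) (block_perm (cycle_of_list [1, 2]) [b, a]) (S_prod R M br b a y x))"

definition twisted_Jacobi ::
    "('a, 'r) ring_scheme \<Rightarrow> ('a, 'b) smodule \<Rightarrow> (nat \<Rightarrow> ('a, 'b, 'b) S_tensor \<Rightarrow> 'b) \<Rightarrow> bool"
  where "twisted_Jacobi R M br \<longleftrightarrow>
    (\<forall>a b c. \<forall>x\<in>hom_elts M a. \<forall>y\<in>hom_elts M b. \<forall>z\<in>hom_elts M c.
      S_prod R M br a (b + c) x (S_prod R M br b c y z)
      \<oplus>\<^bsub>component M (a + b + c)\<^esub>
      sym_act M (a + b + c) (block_perm (cycle_of_list [1, 2, 3]) [b, c, a])
        (S_prod R M br b (c + a) y (S_prod R M br c a z x))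
      \<oplus>\<^bsub>component M (a + b + c)\<^esub>
      sym_act M (a + b + c) (block_perm (cycle_of_list [1, 3, 2]) [c, a, b])
        (S_prod R M br c (a + b) z (S_prod R M br a b x y))
      = \<zero>\<^bsub>component M (a + b + c)\<^esub>)"

definition twisted_Lie_algebra ::
    "('a, 'r) ring_scheme \<Rightarrow> ('a, 'b) smodule \<Rightarrow> (nat \<Rightarrow> ('a, 'b, 'b) S_tensor \<Rightarrow> 'b) \<Rightarrow> bool"
  where "twisted_Lie_algebra R M br \<longleftrightarrow>
    S_module R M \<and> br \<in> S_morphisms R (S_tensor R M M) M \<and>
    twisted_skew_symmetric R M br \<and> twisted_Jacobi R M br"

definition twisted_preLie_algebra ::
    "('a, 'r) ring_scheme \<Rightarrow> ('a, 'b) smodule \<Rightarrow> (nat \<Rightarrow> ('a, 'b, 'b) S_tensor \<Rightarrow> 'b) \<Rightarrow> bool"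
  where "twisted_preLie_algebra R M \<mu> \<longleftrightarrow>
    S_module R M \<and> \<mu> \<in> S_morphisms R (S_tensor R M M) M \<and>
    (\<forall>a b c. \<forall>x\<in>hom_elts M a. \<forall>y\<in>hom_elts M b. \<forall>z\<in>hom_elts M c.
      S_prod R M \<mu> (a + b) c (S_prod R M \<mu> a b x y) z
      \<ominus>\<^bsub>component M (a + b + c)\<^esub>
      S_prod R M \<mu> a (b + c) x (S_prod R M \<mu> b c y z)
      = sym_act M (a + b + c) (block_perm (cycle_of_list [2, 3]) [a, c, b])
          (S_prod R M \<mu> (a + c) b (S_prod R M \<mu> a c x z) y
           \<ominus>\<^bsub>component M (a + b + c)\<^esub>
           S_prod R M \<mu> a (c + b) x (S_prod R M \<mu> c b z y)))"

subsection \<open>Suspension\<close>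

type_synonym ('a, 'b) susp = "('a, nat \<Rightarrow> nat, 'b) induced"

definition suspension ::
    "('a, 'r) ring_scheme \<Rightarrow> ('a, 'b) smodule \<Rightarrow> ('a, ('a, 'b) susp) smodule"
  where "suspension R g =
    \<lparr> component = (\<lambda>p. case p of
        0 \<Rightarrow> presented_module R {} {}
      | Suc m \<Rightarrow> ind_module R (sym_group (Suc m)) (young_group m 1) (perm_cross m)
                   (component g m) (\<lambda>(\<sigma>, \<tau>). sym_act g m \<sigma>)),
      sym_act = (\<lambda>p \<rho>. case p of
        0 \<Rightarrow> (\<lambda>u\<in>carrier (presented_module R {} {}). u)
      | Suc m \<Rightarrow> ind_act R (sym_group (Suc m)) (young_group m 1) (perm_cross m)
                   (component g m) (\<lambda>(\<sigma>, \<tau>). sym_act g m \<sigma>) \<rho>) \<rparr>"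

text \<open>For \<open>x\<close> of degree \<open>m\<close>, the element written \<open>x\<close> with superscript \<open>(i)\<close>, where \<open>0 \<le> i \<le> m + 1\<close>.\<close>

definition susp_elt ::
    "('a, 'r) ring_scheme \<Rightarrow> ('a, 'b) smodule \<Rightarrow> nat \<Rightarrow> nat \<Rightarrow> 'b \<Rightarrow> ('a, 'b) susp"
  where "susp_elt R g m i x =
    (let x0 = ind_gen R (sym_group (Suc m)) (young_group m 1) (perm_cross m)
                (component g m) (\<lambda>(\<sigma>, \<tau>). sym_act g m \<sigma>) id x
     in if 1 \<le> i \<and> i \<le> m
        then sym_act (suspension R g) (Suc m) (cycle_of_list [i..<m + 2]) x0
        else x0)"

subsection \<open>Free modules over the polynomials in a parameter of degree one\<close>

text \<open>The scalar \<open>c\<close> in degree \<open>n\<close> stands for \<open>c t^n\<close>.\<close>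

definition poly_t :: "('a, 'r) ring_scheme \<Rightarrow> ('a, 'a) smodule"
  where "poly_t R =
    \<lparr> component = (\<lambda>n. \<lparr> carrier = carrier R, monoid.mult = monoid.mult R, one = one R,
                           zero = zero R, add = add R, smult = monoid.mult R \<rparr>),
      sym_act = (\<lambda>n \<sigma>. \<lambda>c\<in>carrier R. c) \<rparr>"

type_synonym ('a, 'b) susp_t = "('a, ('a, 'b) susp, 'a) S_tensor"

definition suspension_t ::
    "('a, 'r) ring_scheme \<Rightarrow> ('a, 'b) smodule \<Rightarrow> ('a, ('a, 'b) susp_t) smodule"
  where "suspension_t R g = S_tensor R (suspension R g) (poly_t R)"

text \<open>The element \<open>f t^0\<close> for \<open>f\<close> of degree \<open>m\<close>.\<close>

definition susp_incl ::
    "('a, 'r) ring_scheme \<Rightarrow> ('a, 'b) smodule \<Rightarrow> nat \<Rightarrow> ('a, 'b) susp \<Rightarrow> ('a, 'b) susp_t"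
  where "susp_incl R g m f = S_tensor_gen R (suspension R g) (poly_t R) m 0 f \<one>\<^bsub>R\<^esub>"

text \<open>
  Right multiplication by \<open>t\<close> on the degree \<open>p\<close> part is the linear map sending
  \<open>\<pi> (f \<otimes> c t^n)\<close> to \<open>(\<pi> \<times> id) (f \<otimes> c t^(n+1))\<close>. The second tensor factor is the same module for
  \<open>t^n\<close> and \<open>t^(n+1)\<close>, so the tensor \<open>v\<close> stays as it is.
\<close>

definition rmult_t ::
    "('a, 'r) ring_scheme \<Rightarrow> ('a, 'b) smodule \<Rightarrow> nat \<Rightarrow> ('a, 'b) susp_t \<Rightarrow> ('a, 'b) susp_t"
  where "rmult_t R g p u =
    (let M = suspension R g; K = poly_t R in
     (\<lambda>(m, n)\<in>bidegrees (Suc p).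
       (case n of
         0 \<Rightarrow> \<zero>\<^bsub>S_tensor_part R M K m 0\<^esub>
       | Suc n' \<Rightarrow>
           ind_map R (sym_group (m + n')) (young_group m n') (perm_cross m)
             (tensor_module R (component M m) (component K n')) (tensor_young_act R M K m n')
             (S_tensor_part R M K m (Suc n'))
             (\<lambda>\<pi> v. S_tensor_part_gen R M K m (Suc n') (perm_cross p (\<pi>, id)) v)
             (u (m, n')))))"

definition lmult_t ::
    "('a, 'r) ring_scheme \<Rightarrow> ('a, 'b) smodule \<Rightarrow> nat \<Rightarrow> ('a, 'b) susp_t \<Rightarrow> ('a, 'b) susp_t"
  where "lmult_t R g p u =
    sym_act (suspension_t R g) (Suc p) (block_perm (cycle_of_list [1, 2]) [p, 1]) (rmult_t R g p u)"

definition bracket_t_linear ::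
    "('a, 'r) ring_scheme \<Rightarrow> ('a, 'b) smodule
      \<Rightarrow> (nat \<Rightarrow> ('a, ('a, 'b) susp_t, ('a, 'b) susp_t) S_tensor \<Rightarrow> ('a, 'b) susp_t) \<Rightarrow> bool"
  where "bracket_t_linear R g br \<longleftrightarrow>
    (let P = S_prod R (suspension_t R g) br in
     \<forall>a b. \<forall>u\<in>hom_elts (suspension_t R g) a. \<forall>v\<in>hom_elts (suspension_t R g) b.
       P (Suc a) b (lmult_t R g a u) v = lmult_t R g (a + b) (P a b u v))"

definition product_t_linear ::
    "('a, 'r) ring_scheme \<Rightarrow> ('a, 'b) smodule
      \<Rightarrow> (nat \<Rightarrow> ('a, ('a, 'b) susp_t, ('a, 'b) susp_t) S_tensor \<Rightarrow> ('a, 'b) susp_t) \<Rightarrow> bool"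
  where "product_t_linear R g \<mu> \<longleftrightarrow>
    (let P = S_prod R (suspension_t R g) \<mu> in
     \<forall>a b. \<forall>u\<in>hom_elts (suspension_t R g) a. \<forall>v\<in>hom_elts (suspension_t R g) b.
       P (Suc a) b (rmult_t R g a u) v = P a (Suc b) u (lmult_t R g b v) \<and>
       lmult_t R g (a + b) (P a b u v) = P (Suc a) b (lmult_t R g a u) v \<and>
       rmult_t R g (a + b) (P a b u v) = P a (Suc b) u (rmult_t R g b v))"

definition twisted_Lie_algebra_over_t ::
    "('a, 'r) ring_scheme \<Rightarrow> ('a, 'b) smodule
      \<Rightarrow> (nat \<Rightarrow> ('a, ('a, 'b) susp_t, ('a, 'b) susp_t) S_tensor \<Rightarrow> ('a, 'b) susp_t) \<Rightarrow> bool"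
  where "twisted_Lie_algebra_over_t R g br \<longleftrightarrow>
    twisted_Lie_algebra R (suspension_t R g) br \<and> bracket_t_linear R g br"

text \<open>
  For \<open>w\<close> of degree \<open>m\<close> in \<open>g\<close>, the element of degree \<open>m + 2\<close> obtained by multiplying \<open>w\<close> with
  superscript \<open>(i)\<close> by \<open>t\<close> from the right.
\<close>

definition susp_elt_t ::
    "('a, 'r) ring_scheme \<Rightarrow> ('a, 'b) smodule \<Rightarrow> nat \<Rightarrow> nat \<Rightarrow> 'b \<Rightarrow> ('a, 'b) susp_t"
  where "susp_elt_t R g m i w =
    rmult_t R g (m + 1) (susp_incl R g (m + 1) (susp_elt R g m i w))"

definition is_suspension_bracket ::
    "('a, 'r) ring_scheme \<Rightarrow> ('a, 'b) smodule \<Rightarrow> (nat \<Rightarrow> ('a, 'b, 'b) S_tensor \<Rightarrow> 'b)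
      \<Rightarrow> (nat \<Rightarrow> ('a, ('a, 'b) susp_t, ('a, 'b) susp_t) S_tensor \<Rightarrow> ('a, 'b) susp_t) \<Rightarrow> bool"
  where "is_suspension_bracket R g circ br \<longleftrightarrow>
    (let T = suspension_t R g in
     br \<in> S_morphisms R (S_tensor R T T) T \<and>
     twisted_skew_symmetric R T br \<and>
     bracket_t_linear R g br \<and>
     (\<forall>a b. \<forall>x\<in>hom_elts g a. \<forall>y\<in>hom_elts g b.
       S_prod R T br (a + 1) (b + 1)
         (susp_incl R g (a + 1) (susp_elt R g a 0 x)) (susp_incl R g (b + 1) (susp_elt R g b 0 y))
       = susp_elt_t R g (a + b) (a + 1) (S_prod R g circ a b x y)
         \<ominus>\<^bsub>component T (a + b + 2)\<^esub>
         sym_act T (a + b + 2) (block_perm (cycle_of_list [1, 2]) [b + 1, a + 1])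
           (susp_elt_t R g (b + a) (b + 1) (S_prod R g circ b a y x))))"

definition is_suspension_product ::
    "('a, 'r) ring_scheme \<Rightarrow> ('a, 'b) smodule \<Rightarrow> (nat \<Rightarrow> ('a, 'b, 'b) S_tensor \<Rightarrow> 'b)
      \<Rightarrow> (nat \<Rightarrow> ('a, ('a, 'b) susp_t, ('a, 'b) susp_t) S_tensor \<Rightarrow> ('a, 'b) susp_t) \<Rightarrow> bool"
  where "is_suspension_product R g circ \<mu> \<longleftrightarrow>
    (let T = suspension_t R g in
     \<mu> \<in> S_morphisms R (S_tensor R T T) T \<and>
     product_t_linear R g \<mu> \<and>
     (\<forall>a b. \<forall>x\<in>hom_elts g a. \<forall>y\<in>hom_elts g b.
       S_prod R T \<mu> (a + 1) (b + 1)
         (susp_incl R g (a + 1) (susp_elt R g a 0 x)) (susp_incl R g (b + 1) (susp_elt R g b 0 y))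
       = susp_elt_t R g (a + b) (a + 1) (S_prod R g circ a b x y)))"

end

theory Submission
  imports Defs
begin

text \<open>
  The idea is to read everything in terms of labelled positions. The degree \<open>p\<close> part of \<open>\<Sigma>g[t]\<close> is spanned by
  elements consisting of some \<open>x\<close> in \<open>g\<close> whose labels sit at positions given by an injection \<open>f\<close>, of \<open>s\<close> at
  a further position \<open>i\<close>, and of \<open>t\<close> at all other positions. The product of \<open>(f, i, x)\<close> and \<open>(h, j, y)\<close>
  juxtaposes the positions, forms \<open>x \<circ> y\<close>, keeps \<open>s\<close> at \<open>i\<close> and turns the \<open>s\<close> at \<open>j\<close> into a \<open>t\<close>.
  In other words \<open>\<Sigma>g[t]\<close> is \<open>g\<close> tensored with the pointed sets, which form an associative right-commutative
  (permutative) algebra, so a pre-Lie product on \<open>g\<close> yields one on \<open>\<Sigma>g[t]\<close>, whose commutator is the bracket.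
  Conversely, the three parts of the Jacobi identity for \<open>x\<close>, \<open>y\<close>, \<open>z\<close> in which \<open>s\<close> sits at the position coming
  from \<open>x\<close>, \<open>y\<close> or \<open>z\<close> lie in different direct summands, and each of them is an instance of the pre-Lie identity.
\<close>

section \<open>Linear algebra with explicit carriers: maps that can be compared on
  generators\<close>

section \<open>Additive and linear maps\<close>

text \<open>Every module here is a quotient by relations, nested several levels deep: a finite
  direct sum of modules induced from tensor products, whose first factor is again induced. Elements
  have no normal form, so maps come from universal properties and equations are checked on
  generators. The facts that carry the argument are therefore \<open>susp_t_lift\<close> and
  \<open>susp_t_ext\<close>: apart from linearity in \<open>x\<close>, the only relation between the
  generators \<open>(f, i, x)\<close> is \<open>(f o \<sigma>, i, x) = (f, i, \<sigma> x)\<close>.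
  How the \<open>t\<close>'s fill the other positions leaves no trace, because \<open>S_n\<close>
  acts trivially on \<open>t^n\<close>. Hence the place of \<open>s\<close> is an invariant of a
  generator, which is what separates the summands in the converse. The block permutations in the
  axioms serve to bring the blocks of different bracketings into one common order; once positions
  are absolute, they disappear. The bracket and the product are prescribed only on pairs
  \<open>x^(0)\<close>, \<open>y^(0)\<close>. They are determined everywhere since these elements
  generate under the symmetric groups and multiplication by \<open>t\<close>, and equivariance,
  \<open>k[t]\<close>-linearity and, for the bracket, skew-symmetry carry the values along.\<close>

definition additive :: "('b, 'm) ring_scheme \<Rightarrow> ('c, 'n) ring_scheme \<Rightarrow> ('b \<Rightarrow> 'c) \<Rightarrow> bool"
  where "additive M N f \<longleftrightarrow> abelian_group M \<and> abelian_group N \<and> f \<in> carrier M \<rightarrow> carrier N \<and>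
    (\<forall>x\<in>carrier M. \<forall>y\<in>carrier M. f (x \<oplus>\<^bsub>M\<^esub> y) = f x \<oplus>\<^bsub>N\<^esub> f y)"

lemma additiveI:
  assumes "abelian_group M" "abelian_group N" "\<And>x. x \<in> carrier M \<Longrightarrow> f x \<in> carrier N"
    "\<And>x y. x \<in> carrier M \<Longrightarrow> y \<in> carrier M \<Longrightarrow> f (x \<oplus>\<^bsub>M\<^esub> y) = f x \<oplus>\<^bsub>N\<^esub> f y"
  shows "additive M N f"
  using assms by (auto simp: additive_def)

lemma additive_closed: "additive M N f \<Longrightarrow> x \<in> carrier M \<Longrightarrow> f x \<in> carrier N"
  by (auto simp: additive_def)

lemma additive_add:
  "additive M N f \<Longrightarrow> x \<in> carrier M \<Longrightarrow> y \<in> carrier M \<Longrightarrow> f (x \<oplus>\<^bsub>M\<^esub> y) = f x \<oplus>\<^bsub>N\<^esub> f y"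
  by (auto simp: additive_def)

lemma additive_hom: "additive M N f \<Longrightarrow> abelian_group_hom M N f"
  unfolding additive_def
  by (intro abelian_group_homI group_hom.intro group_hom_axioms.intro)
    (auto simp: hom_def abelian_group.a_group)

lemma additive_zero: "additive M N f \<Longrightarrow> f \<zero>\<^bsub>M\<^esub> = \<zero>\<^bsub>N\<^esub>"
  by (rule abelian_group_hom.hom_zero[OF additive_hom])

lemma additive_neg: "additive M N f \<Longrightarrow> x \<in> carrier M \<Longrightarrow> f (\<ominus>\<^bsub>M\<^esub> x) = \<ominus>\<^bsub>N\<^esub> f x"
  by (rule abelian_group_hom.hom_a_inv[OF additive_hom])

lemma additive_diff:
  "additive M N f \<Longrightarrow> x \<in> carrier M \<Longrightarrow> y \<in> carrier M \<Longrightarrow> f (x \<ominus>\<^bsub>M\<^esub> y) = f x \<ominus>\<^bsub>N\<^esub> f y"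
  using additive_add[of M N f x "\<ominus>\<^bsub>M\<^esub> y"] additive_neg[of M N f y]
  by (simp add: a_minus_def additive_def abelian_group.a_inv_closed)

lemma (in abelian_group) diff_eq_zero: "x \<in> carrier G \<Longrightarrow> y \<in> carrier G \<Longrightarrow> x \<ominus> y = \<zero> \<longleftrightarrow> x = y"
  using minus_equality[of x "\<ominus> y"] by (auto simp: minus_eq r_neg)

text \<open>Elements of \<open>linear_maps\<close> must be extensional, so they are not closed under
  writing down plain sums and composites. Additive maps are, which is why comparisons on generators
  are made with them; scalars are later absorbed into the generators.\<close>

lemma additive_comp: "additive M N f \<Longrightarrow> additive N L h \<Longrightarrow> additive M L (\<lambda>x. h (f x))"
  by (auto simp: additive_def Pi_iff)

lemma additive_plus:
  assumes "additive M N f" "additive M N h"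
  shows "additive M N (\<lambda>x. f x \<oplus>\<^bsub>N\<^esub> h x)"
proof -
  interpret N: abelian_group N using assms by (simp add: additive_def)
  show ?thesis using assms
    by (auto simp: additive_def Pi_iff N.a_ac)
qed

lemma additive_uminus:
  assumes "additive M N f"
  shows "additive M N (\<lambda>x. \<ominus>\<^bsub>N\<^esub> f x)"
proof -
  interpret N: abelian_group N using assms by (simp add: additive_def)
  show ?thesis using assms
    by (auto simp: additive_def Pi_iff N.minus_add)
qed

lemma additive_minus:
  "additive M N f \<Longrightarrow> additive M N h \<Longrightarrow> additive M N (\<lambda>x. f x \<ominus>\<^bsub>N\<^esub> h x)"
  unfolding a_minus_def by (intro additive_plus additive_uminus)

lemma additive_ident: "abelian_group M \<Longrightarrow> additive M M (\<lambda>x. x)"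
  by (simp add: additive_def)

lemma additive_const_zero: "abelian_group M \<Longrightarrow> abelian_group N \<Longrightarrow> additive M N (\<lambda>x. \<zero>\<^bsub>N\<^esub>)"
  by (intro additiveI) (auto simp: abelian_group.axioms(1) abelian_monoid.zero_closed abelian_monoid.l_zero)

lemma module_abelian_group: "module R M \<Longrightarrow> abelian_group M"
  by (simp add: module_def)

lemma linear_mapsI:
  assumes "\<And>x. x \<in> carrier M \<Longrightarrow> f x \<in> carrier N"
    "\<And>x. x \<notin> carrier M \<Longrightarrow> f x = undefined"
    "\<And>x y. x \<in> carrier M \<Longrightarrow> y \<in> carrier M \<Longrightarrow> f (x \<oplus>\<^bsub>M\<^esub> y) = f x \<oplus>\<^bsub>N\<^esub> f y"
    "\<And>c x. c \<in> carrier R \<Longrightarrow> x \<in> carrier M \<Longrightarrow> f (c \<odot>\<^bsub>M\<^esub> x) = c \<odot>\<^bsub>N\<^esub> f x"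
  shows "f \<in> linear_maps R M N"
  using assms by (auto simp: linear_maps_def PiE_iff extensional_def)

lemma linear_mapsI':
  assumes "module R M" "\<And>x. x \<in> carrier M \<Longrightarrow> f x \<in> carrier N"
    "\<And>x y. x \<in> carrier M \<Longrightarrow> y \<in> carrier M \<Longrightarrow> f (x \<oplus>\<^bsub>M\<^esub> y) = f x \<oplus>\<^bsub>N\<^esub> f y"
    "\<And>c x. c \<in> carrier R \<Longrightarrow> x \<in> carrier M \<Longrightarrow> f (c \<odot>\<^bsub>M\<^esub> x) = c \<odot>\<^bsub>N\<^esub> f x"
  shows "(\<lambda>x\<in>carrier M. f x) \<in> linear_maps R M N"
proof -
  interpret M: module R M by fact
  show ?thesis using assms(2-) by (intro linear_mapsI) auto
qed

lemma linear_closed: "f \<in> linear_maps R M N \<Longrightarrow> x \<in> carrier M \<Longrightarrow> f x \<in> carrier N"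
  by (auto simp: linear_maps_def)

lemma linear_add:
  "f \<in> linear_maps R M N \<Longrightarrow> x \<in> carrier M \<Longrightarrow> y \<in> carrier M \<Longrightarrow>
    f (x \<oplus>\<^bsub>M\<^esub> y) = f x \<oplus>\<^bsub>N\<^esub> f y"
  by (auto simp: linear_maps_def)

lemma linear_smult:
  "f \<in> linear_maps R M N \<Longrightarrow> c \<in> carrier R \<Longrightarrow> x \<in> carrier M \<Longrightarrow>
    f (c \<odot>\<^bsub>M\<^esub> x) = c \<odot>\<^bsub>N\<^esub> f x"
  by (auto simp: linear_maps_def)

lemma linear_undefined: "f \<in> linear_maps R M N \<Longrightarrow> x \<notin> carrier M \<Longrightarrow> f x = undefined"
  by (auto simp: linear_maps_def)

lemma linear_eqI:
  "f \<in> linear_maps R M N \<Longrightarrow> h \<in> linear_maps R M N' \<Longrightarrow> (\<And>x. x \<in> carrier M \<Longrightarrow> f x = h x) \<Longrightarrow> f = h"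
  by (metis ext linear_undefined)

lemma linear_additive:
  "f \<in> linear_maps R M N \<Longrightarrow> module R M \<Longrightarrow> module R N \<Longrightarrow> additive M N f"
  by (auto simp: additive_def linear_maps_def module_abelian_group)

lemma linear_zero:
  "f \<in> linear_maps R M N \<Longrightarrow> module R M \<Longrightarrow> module R N \<Longrightarrow> f \<zero>\<^bsub>M\<^esub> = \<zero>\<^bsub>N\<^esub>"
  by (rule additive_zero[OF linear_additive])

section \<open>Free modules\<close>

lemma free_simps:
  "carrier (free_module R X) = {f \<in> X \<rightarrow>\<^sub>E carrier R. finite {x \<in> X. f x \<noteq> \<zero>\<^bsub>R\<^esub>}}"
  "\<zero>\<^bsub>free_module R X\<^esub> = (\<lambda>x\<in>X. \<zero>\<^bsub>R\<^esub>)"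
  "f \<oplus>\<^bsub>free_module R X\<^esub> h = (\<lambda>x\<in>X. f x \<oplus>\<^bsub>R\<^esub> h x)"
  "c \<odot>\<^bsub>free_module R X\<^esub> f = (\<lambda>x\<in>X. c \<otimes>\<^bsub>R\<^esub> f x)"
  by (simp_all add: free_module_def)

context cring
begin

lemma free_fun_in_carrier:
  assumes "\<And>x. x \<in> X \<Longrightarrow> f x \<in> carrier R" "finite A" "\<And>x. x \<in> X \<Longrightarrow> x \<notin> A \<Longrightarrow> f x = \<zero>"
  shows "(\<lambda>x\<in>X. f x) \<in> carrier (free_module R X)"
proof -
  have "finite {x \<in> X. (\<lambda>x\<in>X. f x) x \<noteq> \<zero>}"
    using assms(3) by (intro finite_subset[OF _ assms(2)]) auto
  then show ?thesis using assms(1) by (simp add: free_simps)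
qed

lemma free_add_closed:
  assumes "f \<in> carrier (free_module R X)" "h \<in> carrier (free_module R X)"
  shows "(\<lambda>x\<in>X. f x \<oplus> h x) \<in> carrier (free_module R X)"
  using assms by (intro free_fun_in_carrier[where A = "{x\<in>X. f x \<noteq> \<zero>} \<union> {x\<in>X. h x \<noteq> \<zero>}"])
    (auto simp: free_simps PiE_iff)

lemma free_smult_closed:
  assumes "f \<in> carrier (free_module R X)" "c \<in> carrier R"
  shows "(\<lambda>x\<in>X. c \<otimes> f x) \<in> carrier (free_module R X)"
  using assms by (intro free_fun_in_carrier[where A = "{x\<in>X. f x \<noteq> \<zero>}"])
    (auto simp: free_simps PiE_iff)

lemma free_at: "f \<in> carrier (free_module R X) \<Longrightarrow> x \<in> X \<Longrightarrow> f x \<in> carrier R"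
  by (auto simp: free_simps)

lemma free_ext:
  "f \<in> carrier (free_module R X) \<Longrightarrow> h \<in> carrier (free_module R X) \<Longrightarrow>
    (\<And>x. x \<in> X \<Longrightarrow> f x = h x) \<Longrightarrow> f = h"
  by (auto simp: free_simps intro: PiE_ext)

lemma module_free_module: "module R (free_module R X)"
proof (intro moduleI abelian_groupI is_cring)
  let ?F = "free_module R X"
  show z: "\<zero>\<^bsub>?F\<^esub> \<in> carrier ?F"
    unfolding free_simps(2) by (rule free_fun_in_carrier[where A = "{}"]) auto
  fix f assume f: "f \<in> carrier ?F"
  show "\<zero>\<^bsub>?F\<^esub> \<oplus>\<^bsub>?F\<^esub> f = f"
    using f by (intro free_ext[of _ X] free_add_closed[OF z f, folded free_simps(3)])
      (auto simp: free_simps(2-) free_at)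
  show "\<one> \<odot>\<^bsub>?F\<^esub> f = f"
    using f by (intro free_ext[of _ X]) (auto simp: free_simps(2-) free_at free_smult_closed)
  have "(\<lambda>x\<in>X. \<ominus> f x) \<in> carrier ?F"
    using f by (intro free_fun_in_carrier[where A = "{x\<in>X. f x \<noteq> \<zero>}"]) (auto simp: free_simps PiE_iff)
  then show "\<exists>y\<in>carrier ?F. y \<oplus>\<^bsub>?F\<^esub> f = \<zero>\<^bsub>?F\<^esub>"
    by (rule bexI[rotated]) (auto simp: free_simps(2-) free_at[OF f] l_neg intro!: restrict_ext)
  fix h assume h: "h \<in> carrier ?F"
  show "f \<oplus>\<^bsub>?F\<^esub> h \<in> carrier ?F" using f h by (simp add: free_simps(2-) free_add_closed)
  show "f \<oplus>\<^bsub>?F\<^esub> h = h \<oplus>\<^bsub>?F\<^esub> f" using f h by (auto simp: free_simps(2-) free_at a_comm intro!: restrict_ext)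
  {
    fix k assume k: "k \<in> carrier ?F"
    show "f \<oplus>\<^bsub>?F\<^esub> h \<oplus>\<^bsub>?F\<^esub> k = f \<oplus>\<^bsub>?F\<^esub> (h \<oplus>\<^bsub>?F\<^esub> k)"
      using f h k by (auto simp: free_simps(2-) free_at a_assoc intro!: restrict_ext)
  }
  fix c assume c: "c \<in> carrier R"
  show "c \<odot>\<^bsub>?F\<^esub> f \<in> carrier ?F" using f c by (simp add: free_simps(2-) free_smult_closed)
  show "c \<odot>\<^bsub>?F\<^esub> (f \<oplus>\<^bsub>?F\<^esub> h) = (c \<odot>\<^bsub>?F\<^esub> f) \<oplus>\<^bsub>?F\<^esub> (c \<odot>\<^bsub>?F\<^esub> h)"
    using f h c by (auto simp: free_simps(2-) free_at r_distr intro!: restrict_ext)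
  fix d assume d: "d \<in> carrier R"
  show "(c \<oplus> d) \<odot>\<^bsub>?F\<^esub> f = (c \<odot>\<^bsub>?F\<^esub> f) \<oplus>\<^bsub>?F\<^esub> (d \<odot>\<^bsub>?F\<^esub> f)"
    using f c d by (auto simp: free_simps(2-) free_at l_distr intro!: restrict_ext)
  show "(c \<otimes> d) \<odot>\<^bsub>?F\<^esub> f = c \<odot>\<^bsub>?F\<^esub> (d \<odot>\<^bsub>?F\<^esub> f)"
    using f c d by (auto simp: free_simps(2-) free_at m_assoc intro!: restrict_ext)
qed

lemma basis_vec_closed: "basis_vec R X x \<in> carrier (free_module R X)"
  unfolding basis_vec_def by (rule free_fun_in_carrier[where A = "{x}"]) auto

text \<open>The expression under the image in \<open>presented_map\<close>, the linear extension of
  \<open>\<phi>\<close>. Its index set is the support of \<open>f\<close> and so varies with the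
  argument.\<close>

definition free_eval :: "'x set \<Rightarrow> ('a, 'n) module \<Rightarrow> ('x \<Rightarrow> 'n) \<Rightarrow> ('x \<Rightarrow> 'a) \<Rightarrow> 'n"
  where "free_eval X N \<phi> f = (\<Oplus>\<^bsub>N\<^esub>x\<in>{x\<in>X. f x \<noteq> \<zero>}. f x \<odot>\<^bsub>N\<^esub> \<phi> x)"

text \<open>Positions outside the support contribute zero. The enlargement is needed because the
  supports of two functions and of their sum differ, whereas linearity compares sums over one index
  set.\<close>

lemma free_eval_superset:
  assumes N: "module R N" and \<phi>: "\<phi> \<in> X \<rightarrow> carrier N" and f: "f \<in> carrier (free_module R X)"
    and A: "finite A" "A \<subseteq> X" "{x\<in>X. f x \<noteq> \<zero>} \<subseteq> A"
  shows "free_eval X N \<phi> f = (\<Oplus>\<^bsub>N\<^esub>x\<in>A. f x \<odot>\<^bsub>N\<^esub> \<phi> x)"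
proof -
  interpret N: module R N by fact
  show ?thesis unfolding free_eval_def
    using A \<phi> free_at[OF f] by (intro N.add.finprod_mono_neutral_cong_left) (auto simp: Pi_iff subset_iff)
qed

lemma free_eval_linear:
  assumes N: "module R N" and \<phi>: "\<phi> \<in> X \<rightarrow> carrier N"
  shows "(\<lambda>f\<in>carrier (free_module R X). free_eval X N \<phi> f) \<in> linear_maps R (free_module R X) N"
proof -
  interpret N: module R N by fact
  let ?F = "free_module R X"
  interpret F: module R ?F by (rule module_free_module)
  show ?thesis
  proof (intro linear_mapsI' F.module_axioms)
    fix f assume f: "f \<in> carrier ?F"
    let ?S = "\<lambda>f. {x \<in> X. f x \<noteq> \<zero>}"
    have fin: "finite (?S f)" if "f \<in> carrier ?F" for f using that by (simp add: free_simps)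
    show "free_eval X N \<phi> f \<in> carrier N"
      unfolding free_eval_def using \<phi> free_at[OF f] by (intro N.finsum_closed) auto
    {
      fix h assume h: "h \<in> carrier ?F"
      let ?A = "?S f \<union> ?S h"
      have A: "finite ?A" "?A \<subseteq> X" using fin f h by auto
      have "free_eval X N \<phi> (f \<oplus>\<^bsub>?F\<^esub> h) = (\<Oplus>\<^bsub>N\<^esub>x\<in>?A. (f \<oplus>\<^bsub>?F\<^esub> h) x \<odot>\<^bsub>N\<^esub> \<phi> x)"
        using f h A by (intro free_eval_superset N \<phi>) (auto simp: free_simps(2-) free_add_closed)
      also have "\<dots> = (\<Oplus>\<^bsub>N\<^esub>x\<in>?A. f x \<odot>\<^bsub>N\<^esub> \<phi> x \<oplus>\<^bsub>N\<^esub> h x \<odot>\<^bsub>N\<^esub> \<phi> x)"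
        using \<phi> f h by (intro N.finsum_cong') (auto simp: free_simps(2-) free_at N.smult_l_distr Pi_iff)
      also have "\<dots> = (\<Oplus>\<^bsub>N\<^esub>x\<in>?A. f x \<odot>\<^bsub>N\<^esub> \<phi> x) \<oplus>\<^bsub>N\<^esub> (\<Oplus>\<^bsub>N\<^esub>x\<in>?A. h x \<odot>\<^bsub>N\<^esub> \<phi> x)"
        using \<phi> f h by (intro N.finsum_addf) (auto simp: free_at Pi_iff)
      also have "(\<Oplus>\<^bsub>N\<^esub>x\<in>?A. f x \<odot>\<^bsub>N\<^esub> \<phi> x) = free_eval X N \<phi> f"
        using f A by (intro free_eval_superset[symmetric] N \<phi>) auto
      also have "(\<Oplus>\<^bsub>N\<^esub>x\<in>?A. h x \<odot>\<^bsub>N\<^esub> \<phi> x) = free_eval X N \<phi> h"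
        using h A by (intro free_eval_superset[symmetric] N \<phi>) auto
      finally show "free_eval X N \<phi> (f \<oplus>\<^bsub>?F\<^esub> h) = free_eval X N \<phi> f \<oplus>\<^bsub>N\<^esub> free_eval X N \<phi> h" .
    }
    fix c assume c: "c \<in> carrier R"
    have "free_eval X N \<phi> (c \<odot>\<^bsub>?F\<^esub> f) = (\<Oplus>\<^bsub>N\<^esub>x\<in>?S f. (c \<odot>\<^bsub>?F\<^esub> f) x \<odot>\<^bsub>N\<^esub> \<phi> x)"
      using f c fin by (intro free_eval_superset N \<phi>) (auto simp: free_simps(2-) free_smult_closed)
    also have "\<dots> = (\<Oplus>\<^bsub>N\<^esub>x\<in>?S f. c \<odot>\<^bsub>N\<^esub> (f x \<odot>\<^bsub>N\<^esub> \<phi> x))"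
      using \<phi> f c by (intro N.finsum_cong') (auto simp: free_simps(2-) free_at N.smult_assoc1 Pi_iff)
    also have "\<dots> = c \<odot>\<^bsub>N\<^esub> free_eval X N \<phi> f"
      unfolding free_eval_def using \<phi> f c fin
      by (intro N.finsum_smult_ldistr[symmetric]) (auto simp: free_at Pi_iff)
    finally show "free_eval X N \<phi> (c \<odot>\<^bsub>?F\<^esub> f) = c \<odot>\<^bsub>N\<^esub> free_eval X N \<phi> f" .
  qed
qed

lemma free_eval_basis:
  assumes N: "module R N" and \<phi>: "\<phi> \<in> X \<rightarrow> carrier N" and x: "x \<in> X"
  shows "free_eval X N \<phi> (basis_vec R X x) = \<phi> x"
proof -
  interpret N: module R N by fact
  have "free_eval X N \<phi> (basis_vec R X x) = (\<Oplus>\<^bsub>N\<^esub>y\<in>{x}. basis_vec R X x y \<odot>\<^bsub>N\<^esub> \<phi> y)"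
    using x by (intro free_eval_superset N \<phi> basis_vec_closed) (auto simp: basis_vec_def)
  also have "\<dots> = \<phi> x" using \<phi> x by (subst N.finsum_insert) (auto simp: Pi_iff basis_vec_def)
  finally show ?thesis .
qed

lemma free_eval_basis_self:
  assumes f: "f \<in> carrier (free_module R X)"
  shows "free_eval X (free_module R X) (basis_vec R X) f = f"
proof -
  let ?F = "free_module R X"
  interpret F: module R ?F by (rule module_free_module)
  have *: "finite A \<Longrightarrow> A \<subseteq> X \<Longrightarrow>
    (\<Oplus>\<^bsub>?F\<^esub>x\<in>A. f x \<odot>\<^bsub>?F\<^esub> basis_vec R X x) = (\<lambda>x\<in>X. if x \<in> A then f x else \<zero>)" for A
  proof (induction A rule: finite_induct)
    case empty
    then show ?case by (simp add: free_simps)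
  next
    case (insert y A)
    then show ?case using f
      by (subst F.finsum_insert)
        (auto simp: Pi_iff basis_vec_closed free_at subset_iff, auto simp: free_simps(2-) basis_vec_def free_at intro!: restrict_ext)
  qed
  have "(\<lambda>x\<in>X. if x \<in> {x\<in>X. f x \<noteq> \<zero>} then f x else \<zero>) = f"
    using f by (auto simp: free_simps extensional_def PiE_def fun_eq_iff)
  then show ?thesis
    unfolding free_eval_def using f by (subst *) (auto simp: free_simps)
qed

lemma free_induct [consumes 1, case_names zero add smult basis]:
  assumes "f \<in> carrier (free_module R X)"
    and "Q \<zero>\<^bsub>free_module R X\<^esub>"
    and add: "\<And>f h. f \<in> carrier (free_module R X) \<Longrightarrow> h \<in> carrier (free_module R X) \<Longrightarrow> Q f \<Longrightarrow> Q h \<Longrightarrow> Q (f \<oplus>\<^bsub>free_module R X\<^esub> h)"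
    and smult: "\<And>c f. c \<in> carrier R \<Longrightarrow> f \<in> carrier (free_module R X) \<Longrightarrow> Q f \<Longrightarrow> Q (c \<odot>\<^bsub>free_module R X\<^esub> f)"
    and basis: "\<And>x. x \<in> X \<Longrightarrow> Q (basis_vec R X x)"
  shows "Q f"
proof -
  let ?F = "free_module R X"
  interpret F: module R ?F by (rule module_free_module)
  have *: "finite A \<Longrightarrow> A \<subseteq> X \<Longrightarrow> Q (\<Oplus>\<^bsub>?F\<^esub>x\<in>A. f x \<odot>\<^bsub>?F\<^esub> basis_vec R X x)" for A
  proof (induction A rule: finite_induct)
    case empty
    then show ?case using assms(2) by simp
  next
    case (insert y A)
    then show ?case using assms(1)
      by (subst F.finsum_insert)
        (auto simp: Pi_iff basis_vec_closed free_at subset_iff intro!: add smult basis F.finsum_closed)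
  qed
  have "Q (free_eval X ?F (basis_vec R X) f)"
    unfolding free_eval_def using assms(1) by (intro *) (auto simp: free_simps)
  then show ?thesis by (simp add: free_eval_basis_self[OF assms(1)])
qed

section \<open>Modules by generators and relations, and maps out of them\<close>

section \<open>Quotients and presentations\<close>

lemma submodule_abelian_subgroup:
  assumes "module R M" "submodule K R M"
  shows "abelian_subgroup K M"
  using assms by (intro abelian_subgroupI3 additive_subgroup.intro)
    (auto simp: submodule_def module_abelian_group)

text \<open>\<open>quotient_module\<close> defines a scalar multiple as a union over all
  representatives. The union collapses because representatives of one coset differ by an element of
  \<open>K\<close>, and so do their multiples by \<open>c\<close>.\<close>

lemma quotient_smult:
  assumes M: "module R M" and K: "submodule K R M" and c: "c \<in> carrier R" and x: "x \<in> carrier M"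
  shows "(\<Union>a\<in>K +>\<^bsub>M\<^esub> x. K +>\<^bsub>M\<^esub> (c \<odot>\<^bsub>M\<^esub> a)) = K +>\<^bsub>M\<^esub> (c \<odot>\<^bsub>M\<^esub> x)"
proof -
  interpret M: module R M by fact
  interpret K: abelian_subgroup K M using M K by (rule submodule_abelian_subgroup)
  have "K +>\<^bsub>M\<^esub> (c \<odot>\<^bsub>M\<^esub> a) = K +>\<^bsub>M\<^esub> (c \<odot>\<^bsub>M\<^esub> x)" if a: "a \<in> K +>\<^bsub>M\<^esub> x" for a
  proof -
    have ac: "a \<in> carrier M" using K.a_elemrcos_carrier[OF x a] .
    have "a \<oplus>\<^bsub>M\<^esub> \<ominus>\<^bsub>M\<^esub> x \<in> K" using K.a_rcos_module_imp[OF x a] .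
    then have "c \<odot>\<^bsub>M\<^esub> (a \<oplus>\<^bsub>M\<^esub> \<ominus>\<^bsub>M\<^esub> x) \<in> K" using c by (rule submodule.smult_closed[OF K, rotated])
    then have "c \<odot>\<^bsub>M\<^esub> a \<oplus>\<^bsub>M\<^esub> \<ominus>\<^bsub>M\<^esub> (c \<odot>\<^bsub>M\<^esub> x) \<in> K"
      using c ac x by (simp add: M.smult_r_distr M.smult_r_minus)
    then have "c \<odot>\<^bsub>M\<^esub> a \<in> K +>\<^bsub>M\<^esub> (c \<odot>\<^bsub>M\<^esub> x)"
      using c ac x by (intro K.a_rcos_module_rev) auto
    then show ?thesis using c x by (intro K.a_repr_independence'[symmetric]) auto
  qed
  moreover have "x \<in> K +>\<^bsub>M\<^esub> x" using x by (rule K.a_rcos_self)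
  ultimately show ?thesis by blast
qed

lemma
  assumes M: "module R M" and K: "submodule K R M"
  shows module_quotient: "module R (quotient_module M K)"
    and quotient_proj_linear:
      "(\<lambda>x\<in>carrier M. K +>\<^bsub>M\<^esub> x) \<in> linear_maps R M (quotient_module M K)"
    and quotient_carrier: "carrier (quotient_module M K) = (\<lambda>x. K +>\<^bsub>M\<^esub> x) ` carrier M"
    and quotient_zero: "k \<in> K \<Longrightarrow> K +>\<^bsub>M\<^esub> k = \<zero>\<^bsub>quotient_module M K\<^esub>"
proof -
  interpret M: module R M by fact
  interpret K: abelian_subgroup K M using M K by (rule submodule_abelian_subgroup)
  let ?Q = "quotient_module M K"
  let ?q = "\<lambda>x. K +>\<^bsub>M\<^esub> x"
  show car: "carrier ?Q = ?q ` carrier M"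
    by (auto simp: quotient_module_def A_RCOSETS_def' image_iff)
  show z: "?q k = \<zero>\<^bsub>?Q\<^esub>" if "k \<in> K" for k
    using K.a_rcos_const[OF that] by (simp add: quotient_module_def)
  have z': "\<zero>\<^bsub>?Q\<^esub> = ?q \<zero>\<^bsub>M\<^esub>" using z[of "\<zero>\<^bsub>M\<^esub>"] by simp
  have add: "?q x \<oplus>\<^bsub>?Q\<^esub> ?q y = ?q (x \<oplus>\<^bsub>M\<^esub> y)" if "x \<in> carrier M" "y \<in> carrier M" for x y
    using K.a_rcos_sum[OF that] by (simp add: quotient_module_def)
  have sm: "c \<odot>\<^bsub>?Q\<^esub> ?q x = ?q (c \<odot>\<^bsub>M\<^esub> x)" if "c \<in> carrier R" "x \<in> carrier M" for c x
    using quotient_smult[OF M K that] by (simp add: quotient_module_def)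
  show "module R ?Q"
  proof (intro moduleI abelian_groupI is_cring)
    show "\<exists>y\<in>carrier ?Q. y \<oplus>\<^bsub>?Q\<^esub> x = \<zero>\<^bsub>?Q\<^esub>" if x: "x \<in> carrier ?Q" for x
    proof -
      obtain a where a: "a \<in> carrier M" "x = ?q a" using x by (auto simp: car)
      then show ?thesis by (intro bexI[of _ "?q (\<ominus>\<^bsub>M\<^esub> a)"]) (auto simp: car z' add M.l_neg)
    qed
    show "x \<oplus>\<^bsub>?Q\<^esub> y = y \<oplus>\<^bsub>?Q\<^esub> x" if "x \<in> carrier ?Q" "y \<in> carrier ?Q" for x y
      using that by (auto simp only: car add M.a_comm)
  qed (auto simp: car z' add sm M.a_assoc M.smult_l_distr M.smult_r_distr M.smult_assoc1)
  show "restrict ?q (carrier M) \<in> linear_maps R M ?Q"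
    by (rule linear_mapsI'[OF M]) (auto simp: car add sm)
qed

lemma submodule_generated:
  assumes M: "module R M" and S: "S \<subseteq> carrier M"
  shows "submodule (submodule_generated R M S) R M" "S \<subseteq> submodule_generated R M S"
proof -
  interpret M: module R M by fact
  let ?G = "submodule_generated R M S"
  \<comment> \<open>The carrier itself belongs to the intersected family, which keeps the
    intersection inside the carrier.\<close>
  have c: "carrier M \<in> {K. submodule K R M \<and> S \<subseteq> K}"
    using S M.carrier_is_submodule by auto
  show "submodule ?G R M"
  proof (rule M.submoduleI)
    show "?G \<subseteq> carrier M" using c by (auto simp: submodule_generated_def)
    show "\<zero>\<^bsub>M\<^esub> \<in> ?G"
      by (auto simp: submodule_generated_def submodule_def dest: subgroup.one_closed)
  qed (auto simp: submodule_generated_def intro: M.submoduleE)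
  show "S \<subseteq> ?G" by (auto simp: submodule_generated_def)
qed

lemma submodule_generated_least: "submodule K R M \<Longrightarrow> S \<subseteq> K \<Longrightarrow> submodule_generated R M S \<subseteq> K"
  by (auto simp: submodule_generated_def)

lemma linear_kernel_submodule:
  assumes f: "f \<in> linear_maps R M N" and M: "module R M" and N: "module R N"
  shows "submodule {x \<in> carrier M. f x = \<zero>\<^bsub>N\<^esub>} R M"
proof -
  interpret M: module R M by fact
  interpret N: module R N by fact
  show ?thesis using linear_zero[OF f M N] additive_neg[OF linear_additive[OF f M N]]
    by (intro M.submoduleI) (auto simp: linear_add[OF f] linear_smult[OF f])
qed

context
  fixes X :: "'x set" and S
  assumes S: "S \<subseteq> carrier (free_module R X)"
begin

lemma module_presented: "module R (presented_module R X S)"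
  unfolding presented_module_def
  by (intro module_quotient submodule_generated module_free_module S)

text \<open>As a value of the projection, a generator falls under the linearity of that map, which
  is restricted to the carrier so as to lie in \<open>linear_maps\<close>.\<close>

lemma presented_gen_eq:
  "presented_gen R X S x =
    (\<lambda>f\<in>carrier (free_module R X). submodule_generated R (free_module R X) S +>\<^bsub>free_module R X\<^esub> f) (basis_vec R X x)"
  by (simp add: presented_gen_def basis_vec_closed)

lemma presented_proj_linear:
  "(\<lambda>f\<in>carrier (free_module R X). submodule_generated R (free_module R X) S +>\<^bsub>free_module R X\<^esub> f)
    \<in> linear_maps R (free_module R X) (presented_module R X S)"
  unfolding presented_module_def
  by (intro quotient_proj_linear submodule_generated module_free_module S)

lemma presented_gen_closed: "presented_gen R X S x \<in> carrier (presented_module R X S)"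
  unfolding presented_gen_eq by (rule linear_closed[OF presented_proj_linear basis_vec_closed])

lemma presented_rel:
  assumes "s \<in> S"
  shows "(\<lambda>f\<in>carrier (free_module R X). submodule_generated R (free_module R X) S +>\<^bsub>free_module R X\<^esub> f) s
    = \<zero>\<^bsub>presented_module R X S\<^esub>"
proof -
  note G = submodule_generated[OF module_free_module S]
  show ?thesis
    using quotient_zero[OF module_free_module G(1), of s] assms S G(2)
    by (simp add: presented_module_def subset_iff)
qed

lemma presented_induct [consumes 1, case_names zero add smult gen]:
  assumes u: "u \<in> carrier (presented_module R X S)"
    and zero: "Q \<zero>\<^bsub>presented_module R X S\<^esub>"
    and add: "\<And>u v. u \<in> carrier (presented_module R X S) \<Longrightarrow> v \<in> carrier (presented_module R X S) \<Longrightarrow>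
      Q u \<Longrightarrow> Q v \<Longrightarrow> Q (u \<oplus>\<^bsub>presented_module R X S\<^esub> v)"
    and smult: "\<And>c u. c \<in> carrier R \<Longrightarrow> u \<in> carrier (presented_module R X S) \<Longrightarrow> Q u \<Longrightarrow>
      Q (c \<odot>\<^bsub>presented_module R X S\<^esub> u)"
    and gen: "\<And>x. x \<in> X \<Longrightarrow> Q (presented_gen R X S x)"
  shows "Q u"
proof -
  let ?F = "free_module R X"
  let ?q = "\<lambda>f\<in>carrier ?F. submodule_generated R ?F S +>\<^bsub>?F\<^esub> f"
  obtain f where f: "f \<in> carrier ?F" "u = ?q f"
    using u quotient_carrier[OF module_free_module submodule_generated(1)[OF module_free_module S]]
    by (auto simp: presented_module_def)
  note q = presented_proj_linear
  interpret F: module R ?F by (rule module_free_module)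
  have "Q (?q f)" using f(1)
  proof (induction rule: free_induct)
    case zero
    then show ?case using assms(2) linear_zero[OF q module_free_module module_presented] by simp
  next
    case (add f h)
    then show ?case using assms(3) linear_add[OF q] linear_closed[OF q] by presburger
  next
    case (smult c f)
    then show ?case using assms(4) linear_smult[OF q] linear_closed[OF q] by presburger
  next
    case (basis x)
    then show ?case using gen[of x] by (simp only: presented_gen_eq)
  qed
  then show ?thesis using f by simp
qed

text \<open>The evaluation kills \<open>S\<close>, and its kernel is a submodule, so it kills the
  submodule generated by \<open>S\<close> and is constant on cosets. The image that
  \<open>presented_map\<close> feeds to \<open>the_elem\<close> is thus a singleton.\<close>

lemma presented_map:
  assumes N: "module R N" and \<phi>: "\<phi> \<in> X \<rightarrow> carrier N"
    and rel: "\<And>s. s \<in> S \<Longrightarrow> (\<lambda>f\<in>carrier (free_module R X). free_eval X N \<phi> f) s = \<zero>\<^bsub>N\<^esub>"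
  shows "presented_map R X S N \<phi> \<in> linear_maps R (presented_module R X S) N"
    and "x \<in> X \<Longrightarrow> presented_map R X S N \<phi> (presented_gen R X S x) = \<phi> x"
proof -
  let ?F = "free_module R X"
  let ?K = "submodule_generated R ?F S"
  let ?e = "\<lambda>f\<in>carrier ?F. free_eval X N \<phi> f"
  let ?P = "presented_module R X S"
  let ?q = "\<lambda>f\<in>carrier ?F. ?K +>\<^bsub>?F\<^esub> f"
  note q = presented_proj_linear
  note e = free_eval_linear[OF N \<phi>]
  interpret F: module R ?F by (rule module_free_module)
  interpret N: module R N by fact
  have Ks: "submodule ?K R ?F" by (intro submodule_generated F.module_axioms S)
  interpret K: abelian_subgroup ?K ?F using F.module_axioms Ks by (rule submodule_abelian_subgroup)
  have "?K \<subseteq> {x \<in> carrier ?F. ?e x = \<zero>\<^bsub>N\<^esub>}"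
    using S rel by (intro submodule_generated_least linear_kernel_submodule[OF e F.module_axioms N]) blast
  then have K0: "?e k = \<zero>\<^bsub>N\<^esub>" if "k \<in> ?K" for k using that by auto
  have const: "free_eval X N \<phi> h = ?e f" if f: "f \<in> carrier ?F" and h: "h \<in> ?K +>\<^bsub>?F\<^esub> f" for f h
  proof -
    have hc: "h \<in> carrier ?F" using K.a_elemrcos_carrier[OF f h] .
    have "?e (h \<oplus>\<^bsub>?F\<^esub> \<ominus>\<^bsub>?F\<^esub> f) = \<zero>\<^bsub>N\<^esub>" by (rule K0) (rule K.a_rcos_module_imp[OF f h])
    then have "?e h \<ominus>\<^bsub>N\<^esub> ?e f = \<zero>\<^bsub>N\<^esub>"
      using additive_diff[OF linear_additive[OF e F.module_axioms N] hc f] by (simp add: a_minus_def)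
    then have "?e h = ?e f" using linear_closed[OF e] hc f by (simp only: N.diff_eq_zero)
    then show ?thesis using hc by simp
  qed
  have map: "presented_map R X S N \<phi> (?q f) = ?e f" if f: "f \<in> carrier ?F" for f
  proof -
    have "free_eval X N \<phi> ` (?K +>\<^bsub>?F\<^esub> f) = {?e f}"
    proof (intro equalityI subsetI)
      show "y \<in> free_eval X N \<phi> ` (?K +>\<^bsub>?F\<^esub> f)" if "y \<in> {?e f}" for y
        using that const[OF f K.a_rcos_self[OF f]] K.a_rcos_self[OF f] by (metis image_eqI singletonD)
    qed (use const[OF f] in auto)
    then show ?thesis using f linear_closed[OF q f]
      by (simp add: presented_map_def free_eval_def[abs_def])
  qed
  have car: "\<exists>f\<in>carrier ?F. u = ?q f" if "u \<in> carrier ?P" for u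
    using that quotient_carrier[OF F.module_axioms Ks] by (auto simp: presented_module_def)
  show "presented_map R X S N \<phi> \<in> linear_maps R ?P N"
  proof (rule linear_mapsI)
    fix u assume u: "u \<in> carrier ?P"
    obtain f where f: "f \<in> carrier ?F" "u = ?q f" using car u by blast
    show "presented_map R X S N \<phi> u \<in> carrier N"
      unfolding f(2) map[OF f(1)] by (rule linear_closed[OF e f(1)])
    {
      fix v assume v: "v \<in> carrier ?P"
      obtain h where h: "h \<in> carrier ?F" "v = ?q h" using car v by blast
      show "presented_map R X S N \<phi> (u \<oplus>\<^bsub>?P\<^esub> v) = presented_map R X S N \<phi> u \<oplus>\<^bsub>N\<^esub> presented_map R X S N \<phi> v"
        unfolding f(2) h(2) linear_add[OF q f(1) h(1), symmetric]
        unfolding map[OF f(1)] map[OF h(1)] map[OF F.a_closed[OF f(1) h(1)]]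
        by (rule linear_add[OF e f(1) h(1)])
    }
    fix c assume c: "c \<in> carrier R"
    show "presented_map R X S N \<phi> (c \<odot>\<^bsub>?P\<^esub> u) = c \<odot>\<^bsub>N\<^esub> presented_map R X S N \<phi> u"
      unfolding f(2) linear_smult[OF q c f(1), symmetric]
      unfolding map[OF f(1)] map[OF F.smult_closed[OF c f(1)]]
      by (rule linear_smult[OF e c f(1)])
  qed (simp add: presented_map_def)
  show "presented_map R X S N \<phi> (presented_gen R X S x) = \<phi> x" if "x \<in> X"
    unfolding presented_gen_eq map[OF basis_vec_closed]
    using free_eval_basis[OF N \<phi> that] by (simp add: basis_vec_closed)
qed

end

end

section \<open>Tensor products and induction by their universal properties\<close>

section \<open>Tensor products and induced modules\<close>

context cring
begin

text \<open>The relations of \<open>tensor_rels\<close> and \<open>ind_rels\<close> have just these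
  three shapes, so that compatibility of a map with them reduces to equations between values of
  \<open>\<phi>\<close>.\<close>

lemma free_eval_rels:
  assumes N: "module R N" and \<phi>: "\<phi> \<in> X \<rightarrow> carrier N" and a: "a \<in> X" "b \<in> X"
  shows "\<phi> a = \<phi> b \<Longrightarrow> (\<lambda>f\<in>carrier (free_module R X). free_eval X N \<phi> f)
      (basis_vec R X a \<ominus>\<^bsub>free_module R X\<^esub> basis_vec R X b) = \<zero>\<^bsub>N\<^esub>"
    and "k \<in> carrier R \<Longrightarrow> \<phi> a = k \<odot>\<^bsub>N\<^esub> \<phi> b \<Longrightarrow> (\<lambda>f\<in>carrier (free_module R X). free_eval X N \<phi> f)
      (basis_vec R X a \<ominus>\<^bsub>free_module R X\<^esub> (k \<odot>\<^bsub>free_module R X\<^esub> basis_vec R X b)) = \<zero>\<^bsub>N\<^esub>"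
    and "c \<in> X \<Longrightarrow> \<phi> a = \<phi> b \<oplus>\<^bsub>N\<^esub> \<phi> c \<Longrightarrow> (\<lambda>f\<in>carrier (free_module R X). free_eval X N \<phi> f)
      (basis_vec R X a \<ominus>\<^bsub>free_module R X\<^esub> (basis_vec R X b \<oplus>\<^bsub>free_module R X\<^esub> basis_vec R X c)) = \<zero>\<^bsub>N\<^esub>"
proof -
  let ?F = "free_module R X"
  let ?e = "\<lambda>f\<in>carrier ?F. free_eval X N \<phi> f"
  interpret F: module R ?F by (rule module_free_module)
  interpret N: module R N by fact
  note e = free_eval_linear[OF N \<phi>]
  note d = additive_diff[OF linear_additive[OF e F.module_axioms N]]
  have b: "?e (basis_vec R X x) = \<phi> x" if "x \<in> X" for x
    using free_eval_basis[OF N \<phi> that] by (simp add: basis_vec_closed)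
  have c: "\<phi> x \<in> carrier N" if "x \<in> X" for x using \<phi> that by auto
  note bc = basis_vec_closed[of X]
  have z: "x \<ominus>\<^bsub>N\<^esub> x = \<zero>\<^bsub>N\<^esub>" if "x \<in> carrier N" for x
    using that by (simp add: a_minus_def N.r_neg)
  show "?e (basis_vec R X a \<ominus>\<^bsub>?F\<^esub> basis_vec R X b) = \<zero>\<^bsub>N\<^esub>" if "\<phi> a = \<phi> b"
    using d[OF bc bc, of a b] that a z[OF c] by (simp only: b)
  show "?e (basis_vec R X a \<ominus>\<^bsub>?F\<^esub> (k \<odot>\<^bsub>?F\<^esub> basis_vec R X b)) = \<zero>\<^bsub>N\<^esub>"
    if "k \<in> carrier R" "\<phi> a = k \<odot>\<^bsub>N\<^esub> \<phi> b"
  proof -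
    have k: "k \<odot>\<^bsub>?F\<^esub> basis_vec R X b \<in> carrier ?F" using that bc by simp
    show ?thesis using d[OF bc k, of a] that linear_smult[OF e that(1) bc] a z[OF c[OF a(1)]] by (simp only: b)
  qed
  show "?e (basis_vec R X a \<ominus>\<^bsub>?F\<^esub> (basis_vec R X b \<oplus>\<^bsub>?F\<^esub> basis_vec R X c)) = \<zero>\<^bsub>N\<^esub>"
    if "c \<in> X" "\<phi> a = \<phi> b \<oplus>\<^bsub>N\<^esub> \<phi> c"
  proof -
    have k: "basis_vec R X b \<oplus>\<^bsub>?F\<^esub> basis_vec R X c \<in> carrier ?F" using bc by simp
    show ?thesis using d[OF bc k, of a] that linear_add[OF e bc bc] a z[OF c[OF a(1)]] by (simp only: b)
  qed
qed

text \<open>The counterpart for the classes of the generators: the same three shapes of relation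
  become equations in the presented module.\<close>

lemma presented_gen_rels:
  assumes S: "S \<subseteq> carrier (free_module R X)"
  shows "basis_vec R X a \<ominus>\<^bsub>free_module R X\<^esub> basis_vec R X b \<in> S \<Longrightarrow>
      presented_gen R X S a = presented_gen R X S b"
    and "k \<in> carrier R \<Longrightarrow> basis_vec R X a \<ominus>\<^bsub>free_module R X\<^esub> (k \<odot>\<^bsub>free_module R X\<^esub> basis_vec R X b) \<in> S \<Longrightarrow>
      presented_gen R X S a = k \<odot>\<^bsub>presented_module R X S\<^esub> presented_gen R X S b"
    and "basis_vec R X a \<ominus>\<^bsub>free_module R X\<^esub> (basis_vec R X b \<oplus>\<^bsub>free_module R X\<^esub> basis_vec R X c) \<in> S \<Longrightarrow>
      presented_gen R X S a = presented_gen R X S b \<oplus>\<^bsub>presented_module R X S\<^esub> presented_gen R X S c"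
proof -
  let ?F = "free_module R X"
  let ?P = "presented_module R X S"
  let ?q = "\<lambda>f\<in>carrier ?F. submodule_generated R ?F S +>\<^bsub>?F\<^esub> f"
  note P = module_presented[OF S]
  interpret F: module R ?F by (rule module_free_module)
  interpret P: module R ?P by fact
  note q = presented_proj_linear[OF S]
  note d = additive_diff[OF linear_additive[OF q F.module_axioms P]]
  note bc = basis_vec_closed[of X]
  have eq: "?q f = ?q h" if "f \<ominus>\<^bsub>?F\<^esub> h \<in> S" "f \<in> carrier ?F" "h \<in> carrier ?F" for f h
  proof -
    have "?q f \<ominus>\<^bsub>?P\<^esub> ?q h = \<zero>\<^bsub>?P\<^esub>" using presented_rel[OF S that(1)] d[OF that(2,3)] by (simp only:)
    then show ?thesis using linear_closed[OF q] that by (simp only: P.diff_eq_zero)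
  qed
  show "presented_gen R X S a = presented_gen R X S b" if "basis_vec R X a \<ominus>\<^bsub>?F\<^esub> basis_vec R X b \<in> S"
    unfolding presented_gen_eq[OF S] by (rule eq[OF that bc bc])
  show "presented_gen R X S a = k \<odot>\<^bsub>?P\<^esub> presented_gen R X S b"
    if "k \<in> carrier R" "basis_vec R X a \<ominus>\<^bsub>?F\<^esub> (k \<odot>\<^bsub>?F\<^esub> basis_vec R X b) \<in> S"
    unfolding presented_gen_eq[OF S] using eq[OF that(2) bc] that(1) bc linear_smult[OF q that(1) bc] by simp
  show "presented_gen R X S a = presented_gen R X S b \<oplus>\<^bsub>?P\<^esub> presented_gen R X S c"
    if "basis_vec R X a \<ominus>\<^bsub>?F\<^esub> (basis_vec R X b \<oplus>\<^bsub>?F\<^esub> basis_vec R X c) \<in> S"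
    unfolding presented_gen_eq[OF S] using eq[OF that bc] bc linear_add[OF q bc bc] by simp
qed

text \<open>If multiples of generators are generators, scalars need no case of their own in an
  induction. The induction is carried out for all multiples of \<open>u\<close> at once, which turns
  the scalar case into associativity, and then the multiple by one is taken.\<close>

lemma presented_induct_absorb:
  assumes S: "S \<subseteq> carrier (free_module R X)"
    and absorb: "\<And>c x. c \<in> carrier R \<Longrightarrow> x \<in> X \<Longrightarrow>
      \<exists>y\<in>X. c \<odot>\<^bsub>presented_module R X S\<^esub> presented_gen R X S x = presented_gen R X S y"
    and u: "u \<in> carrier (presented_module R X S)"
    and zero: "Q \<zero>\<^bsub>presented_module R X S\<^esub>"
    and add: "\<And>u v. u \<in> carrier (presented_module R X S) \<Longrightarrow> v \<in> carrier (presented_module R X S) \<Longrightarrow>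
      Q u \<Longrightarrow> Q v \<Longrightarrow> Q (u \<oplus>\<^bsub>presented_module R X S\<^esub> v)"
    and gen: "\<And>x. x \<in> X \<Longrightarrow> Q (presented_gen R X S x)"
  shows "Q u"
proof -
  interpret P: module R "presented_module R X S" by (rule module_presented[OF S])
  have "\<forall>c\<in>carrier R. Q (c \<odot>\<^bsub>presented_module R X S\<^esub> u)"
    using u
  proof (induction rule: presented_induct[OF S, consumes 1, case_names zero add smult gen])
    case (add u v)
    then show ?case by (simp add: P.smult_r_distr assms(5))
  next
    case (smult c u)
    then show ?case by (simp add: P.smult_assoc1[symmetric])
  next
    case (gen x)
    then show ?case using absorb[of _ x] assms(6) by fastforce
  qed (simp add: zero)
  then have "Q (\<one> \<odot>\<^bsub>presented_module R X S\<^esub> u)" by blast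
  then show ?thesis using u by simp
qed

end

definition bilinear ::
    "('a, 'r) ring_scheme \<Rightarrow> ('a, 'b) module \<Rightarrow> ('a, 'c) module \<Rightarrow> ('a, 'd) module \<Rightarrow> ('b \<Rightarrow> 'c \<Rightarrow> 'd) \<Rightarrow> bool"
  where "bilinear R M N L B \<longleftrightarrow>
    (\<forall>x\<in>carrier M. \<forall>y\<in>carrier N. B x y \<in> carrier L) \<and>
    (\<forall>x\<in>carrier M. \<forall>x'\<in>carrier M. \<forall>y\<in>carrier N. B (x \<oplus>\<^bsub>M\<^esub> x') y = B x y \<oplus>\<^bsub>L\<^esub> B x' y) \<and>
    (\<forall>x\<in>carrier M. \<forall>y\<in>carrier N. \<forall>y'\<in>carrier N. B x (y \<oplus>\<^bsub>N\<^esub> y') = B x y \<oplus>\<^bsub>L\<^esub> B x y') \<and>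
    (\<forall>c\<in>carrier R. \<forall>x\<in>carrier M. \<forall>y\<in>carrier N. B (c \<odot>\<^bsub>M\<^esub> x) y = c \<odot>\<^bsub>L\<^esub> B x y) \<and>
    (\<forall>c\<in>carrier R. \<forall>x\<in>carrier M. \<forall>y\<in>carrier N. B x (c \<odot>\<^bsub>N\<^esub> y) = c \<odot>\<^bsub>L\<^esub> B x y)"

lemma bilinearD:
  assumes "bilinear R M N L B"
  shows "x \<in> carrier M \<Longrightarrow> y \<in> carrier N \<Longrightarrow> B x y \<in> carrier L"
    "x \<in> carrier M \<Longrightarrow> x' \<in> carrier M \<Longrightarrow> y \<in> carrier N \<Longrightarrow> B (x \<oplus>\<^bsub>M\<^esub> x') y = B x y \<oplus>\<^bsub>L\<^esub> B x' y"
    "x \<in> carrier M \<Longrightarrow> y \<in> carrier N \<Longrightarrow> y' \<in> carrier N \<Longrightarrow> B x (y \<oplus>\<^bsub>N\<^esub> y') = B x y \<oplus>\<^bsub>L\<^esub> B x y'"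
    "c \<in> carrier R \<Longrightarrow> x \<in> carrier M \<Longrightarrow> y \<in> carrier N \<Longrightarrow> B (c \<odot>\<^bsub>M\<^esub> x) y = c \<odot>\<^bsub>L\<^esub> B x y"
    "c \<in> carrier R \<Longrightarrow> x \<in> carrier M \<Longrightarrow> y \<in> carrier N \<Longrightarrow> B x (c \<odot>\<^bsub>N\<^esub> y) = c \<odot>\<^bsub>L\<^esub> B x y"
  using assms by (auto simp: bilinear_def)

lemma bilinearI:
  assumes "\<And>x y. x \<in> carrier M \<Longrightarrow> y \<in> carrier N \<Longrightarrow> B x y \<in> carrier L"
    "\<And>x x' y. x \<in> carrier M \<Longrightarrow> x' \<in> carrier M \<Longrightarrow> y \<in> carrier N \<Longrightarrow> B (x \<oplus>\<^bsub>M\<^esub> x') y = B x y \<oplus>\<^bsub>L\<^esub> B x' y"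
    "\<And>x y y'. x \<in> carrier M \<Longrightarrow> y \<in> carrier N \<Longrightarrow> y' \<in> carrier N \<Longrightarrow> B x (y \<oplus>\<^bsub>N\<^esub> y') = B x y \<oplus>\<^bsub>L\<^esub> B x y'"
    "\<And>c x y. c \<in> carrier R \<Longrightarrow> x \<in> carrier M \<Longrightarrow> y \<in> carrier N \<Longrightarrow> B (c \<odot>\<^bsub>M\<^esub> x) y = c \<odot>\<^bsub>L\<^esub> B x y"
    "\<And>c x y. c \<in> carrier R \<Longrightarrow> x \<in> carrier M \<Longrightarrow> y \<in> carrier N \<Longrightarrow> B x (c \<odot>\<^bsub>N\<^esub> y) = c \<odot>\<^bsub>L\<^esub> B x y"
  shows "bilinear R M N L B"
  using assms by (auto simp: bilinear_def)

lemma bilinear_comp: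
  assumes "bilinear R M N L B" "f \<in> linear_maps R M' M" "h \<in> linear_maps R N' N"
  shows "bilinear R M' N' L (\<lambda>x y. B (f x) (h y))"
  by (rule bilinearI)
    (auto simp: linear_closed[OF assms(2)] linear_closed[OF assms(3)] linear_add[OF assms(2)] linear_add[OF assms(3)]
      linear_smult[OF assms(2)] linear_smult[OF assms(3)] bilinearD[OF assms(1)])

lemma bilinear_additive:
  assumes "bilinear R M N L B" "module R M" "module R N" "module R L"
  shows "x \<in> carrier M \<Longrightarrow> additive N L (B x)" "y \<in> carrier N \<Longrightarrow> additive M L (\<lambda>x. B x y)"
  using assms by (auto intro!: additiveI bilinearD[OF assms(1)] module_abelian_group)

context cring
begin

context
  fixes M :: "('a, 'm) module" and N :: "('a, 'n) module"
  assumes M: "module R M" and N: "module R N"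
begin

lemma tensor_rels_subset: "tensor_rels R M N \<subseteq> carrier (free_module R (carrier M \<times> carrier N))"
proof -
  interpret F: module R "free_module R (carrier M \<times> carrier N)" by (rule module_free_module)
  show ?thesis unfolding tensor_rels_def Let_def
    by (auto intro!: F.minus_closed F.a_closed F.smult_closed basis_vec_closed)
qed

lemma module_tensor: "module R (tensor_module R M N)"
  unfolding tensor_module_def by (rule module_presented[OF tensor_rels_subset])

lemma tensor_gen_bilinear: "bilinear R M N (tensor_module R M N) (tensor_gen R M N)"
proof (rule bilinearI)
  note S = tensor_rels_subset
  note g = presented_gen_rels[OF S] and defs = tensor_module_def tensor_gen_def
  show "tensor_gen R M N x y \<in> carrier (tensor_module R M N)" for x y
    unfolding defs by (rule presented_gen_closed[OF S])
  show "tensor_gen R M N (x \<oplus>\<^bsub>M\<^esub> x') y = tensor_gen R M N x y \<oplus>\<^bsub>tensor_module R M N\<^esub> tensor_gen R M N x' y"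
    if "x \<in> carrier M" "x' \<in> carrier M" "y \<in> carrier N" for x x' y
    unfolding defs using that by (intro g) (unfold tensor_rels_def Let_def, blast)
  show "tensor_gen R M N x (y \<oplus>\<^bsub>N\<^esub> y') = tensor_gen R M N x y \<oplus>\<^bsub>tensor_module R M N\<^esub> tensor_gen R M N x y'"
    if "x \<in> carrier M" "y \<in> carrier N" "y' \<in> carrier N" for x y y'
    unfolding defs using that by (intro g) (unfold tensor_rels_def Let_def, blast)
  show "tensor_gen R M N (c \<odot>\<^bsub>M\<^esub> x) y = c \<odot>\<^bsub>tensor_module R M N\<^esub> tensor_gen R M N x y"
    if "c \<in> carrier R" "x \<in> carrier M" "y \<in> carrier N" for c x y
    unfolding defs using that by (intro g) (assumption, unfold tensor_rels_def Let_def, blast)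
  show "tensor_gen R M N x (c \<odot>\<^bsub>N\<^esub> y) = c \<odot>\<^bsub>tensor_module R M N\<^esub> tensor_gen R M N x y"
    if "c \<in> carrier R" "x \<in> carrier M" "y \<in> carrier N" for c x y
    unfolding defs using that by (intro g) (assumption, unfold tensor_rels_def Let_def, blast)
qed

lemma tensor_lift:
  assumes L: "module R L" and B: "bilinear R M N L B"
  shows "presented_map R (carrier M \<times> carrier N) (tensor_rels R M N) L (\<lambda>(x, y). B x y)
      \<in> linear_maps R (tensor_module R M N) L"
    and "x \<in> carrier M \<Longrightarrow> y \<in> carrier N \<Longrightarrow>
      presented_map R (carrier M \<times> carrier N) (tensor_rels R M N) L (\<lambda>(x, y). B x y) (tensor_gen R M N x y) = B x y"
proof -
  let ?X = "carrier M \<times> carrier N"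
  let ?\<phi> = "\<lambda>(x, y). B x y"
  interpret M: module R M by (rule M)
  interpret N: module R N by (rule N)
  have \<phi>: "?\<phi> \<in> ?X \<rightarrow> carrier L" by (auto simp: bilinearD[OF B])
  have rel: "(\<lambda>f\<in>carrier (free_module R ?X). free_eval ?X L ?\<phi> f) s = \<zero>\<^bsub>L\<^esub>" if "s \<in> tensor_rels R M N" for s
    using that unfolding tensor_rels_def Let_def
    by (elim UnE CollectE exE conjE) (simp only:, (rule free_eval_rels[OF L \<phi>]; simp add: bilinearD[OF B]))+
  note * = presented_map[OF tensor_rels_subset L \<phi> rel]
  show "presented_map R ?X (tensor_rels R M N) L ?\<phi> \<in> linear_maps R (tensor_module R M N) L"
    unfolding tensor_module_def by (rule *(1))
  show "presented_map R ?X (tensor_rels R M N) L ?\<phi> (tensor_gen R M N x y) = B x y"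
    if "x \<in> carrier M" "y \<in> carrier N"
    using *(2)[of "(x, y)"] that by (simp add: tensor_gen_def)
qed

text \<open>A scalar multiple of a pure tensor is again pure, as the scalar can be moved into the
  left factor; sums of pure tensors therefore exhaust the module.\<close>

lemma tensor_induct [consumes 1, case_names zero add gen]:
  assumes "u \<in> carrier (tensor_module R M N)" "Q \<zero>\<^bsub>tensor_module R M N\<^esub>"
    and "\<And>u v. u \<in> carrier (tensor_module R M N) \<Longrightarrow> v \<in> carrier (tensor_module R M N) \<Longrightarrow>
      Q u \<Longrightarrow> Q v \<Longrightarrow> Q (u \<oplus>\<^bsub>tensor_module R M N\<^esub> v)"
    and "\<And>x y. x \<in> carrier M \<Longrightarrow> y \<in> carrier N \<Longrightarrow> Q (tensor_gen R M N x y)"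
  shows "Q u"
proof -
  interpret M: module R M by (rule M)
  show ?thesis
  proof (rule presented_induct_absorb[OF tensor_rels_subset])
    show "\<exists>y\<in>carrier M \<times> carrier N. c \<odot>\<^bsub>presented_module R (carrier M \<times> carrier N) (tensor_rels R M N)\<^esub>
        presented_gen R (carrier M \<times> carrier N) (tensor_rels R M N) x =
        presented_gen R (carrier M \<times> carrier N) (tensor_rels R M N) y"
      if "c \<in> carrier R" "x \<in> carrier M \<times> carrier N" for c x
      using that bilinearD(4)[OF tensor_gen_bilinear, of c "fst x" "snd x", symmetric]
      by (intro bexI[of _ "(c \<odot>\<^bsub>M\<^esub> fst x, snd x)"]) (auto simp: tensor_gen_def tensor_module_def)
  qed (use assms in \<open>auto simp: tensor_module_def tensor_gen_def\<close>)
qed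

lemma tensor_ext:
  assumes "additive (tensor_module R M N) L f" "additive (tensor_module R M N) L h"
    and "\<And>x y. x \<in> carrier M \<Longrightarrow> y \<in> carrier N \<Longrightarrow> f (tensor_gen R M N x y) = h (tensor_gen R M N x y)"
    and "u \<in> carrier (tensor_module R M N)"
  shows "f u = h u"
  using assms(4)
  by (induction rule: tensor_induct)
    (auto simp: additive_zero[OF assms(1)] additive_zero[OF assms(2)] additive_add[OF assms(1)] additive_add[OF assms(2)] assms(3))

lemma tensor_map:
  assumes "f \<in> linear_maps R M M" "h \<in> linear_maps R N N"
  shows "tensor_map R M N f h \<in> linear_maps R (tensor_module R M N) (tensor_module R M N)"
    and "x \<in> carrier M \<Longrightarrow> y \<in> carrier N \<Longrightarrow>
      tensor_map R M N f h (tensor_gen R M N x y) = tensor_gen R M N (f x) (h y)"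
  unfolding tensor_map_def
  using tensor_lift[OF module_tensor bilinear_comp[OF tensor_gen_bilinear assms]] by auto

end

context
  fixes G :: "'g monoid" and H :: "'h monoid" and \<iota> :: "'h \<Rightarrow> 'g" and V :: "('a, 'v) module" and \<alpha>
  assumes G: "group G" and \<iota>': "\<iota> \<in> carrier H \<rightarrow> carrier G"
    and V: "module R V" and \<alpha>': "\<alpha> \<in> carrier H \<rightarrow> carrier V \<rightarrow> carrier V"
begin

lemma ind_iota_closed: "h \<in> carrier H \<Longrightarrow> \<iota> h \<in> carrier G"
  and ind_alpha_closed: "h \<in> carrier H \<Longrightarrow> v \<in> carrier V \<Longrightarrow> \<alpha> h v \<in> carrier V"
  using \<iota>' \<alpha>' by auto

abbreviation (input) "I_mod \<equiv> ind_module R G H \<iota> V \<alpha>"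
abbreviation (input) "I_gen \<equiv> ind_gen R G H \<iota> V \<alpha>"

lemma ind_rels_subset: "ind_rels R G H \<iota> V \<alpha> \<subseteq> carrier (free_module R (carrier G \<times> carrier V))"
proof -
  interpret F: module R "free_module R (carrier G \<times> carrier V)" by (rule module_free_module)
  show ?thesis unfolding ind_rels_def Let_def
    by (auto intro!: F.minus_closed F.a_closed F.smult_closed basis_vec_closed)
qed

lemma module_ind: "module R I_mod"
  unfolding ind_module_def by (rule module_presented[OF ind_rels_subset])

lemma ind_gen_closed: "I_gen k v \<in> carrier I_mod"
  unfolding ind_module_def ind_gen_def by (rule presented_gen_closed[OF ind_rels_subset])

lemma ind_gen_add:
  "k \<in> carrier G \<Longrightarrow> v \<in> carrier V \<Longrightarrow> w \<in> carrier V \<Longrightarrow> I_gen k (v \<oplus>\<^bsub>V\<^esub> w) = I_gen k v \<oplus>\<^bsub>I_mod\<^esub> I_gen k w"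
  unfolding ind_module_def ind_gen_def
  by (intro presented_gen_rels[OF ind_rels_subset]) (unfold ind_rels_def Let_def, blast)

lemma ind_gen_smult:
  "c \<in> carrier R \<Longrightarrow> k \<in> carrier G \<Longrightarrow> v \<in> carrier V \<Longrightarrow> I_gen k (c \<odot>\<^bsub>V\<^esub> v) = c \<odot>\<^bsub>I_mod\<^esub> I_gen k v"
  unfolding ind_module_def ind_gen_def
  by (intro presented_gen_rels[OF ind_rels_subset]) (assumption, unfold ind_rels_def Let_def, blast)

lemma ind_gen_act:
  "k \<in> carrier G \<Longrightarrow> h \<in> carrier H \<Longrightarrow> v \<in> carrier V \<Longrightarrow> I_gen (k \<otimes>\<^bsub>G\<^esub> \<iota> h) v = I_gen k (\<alpha> h v)"
  unfolding ind_module_def ind_gen_def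
  by (intro presented_gen_rels[OF ind_rels_subset]) (unfold ind_rels_def Let_def, blast)

text \<open>The last three hypotheses on \<open>\<phi>\<close> match the three kinds of relation in
  \<open>ind_rels\<close>; for group representations this is Frobenius reciprocity.\<close>

lemma ind_map:
  assumes N: "module R N"
    and \<phi>: "\<And>k v. k \<in> carrier G \<Longrightarrow> v \<in> carrier V \<Longrightarrow> \<phi> k v \<in> carrier N"
    and add: "\<And>k v w. k \<in> carrier G \<Longrightarrow> v \<in> carrier V \<Longrightarrow> w \<in> carrier V \<Longrightarrow> \<phi> k (v \<oplus>\<^bsub>V\<^esub> w) = \<phi> k v \<oplus>\<^bsub>N\<^esub> \<phi> k w"
    and smult: "\<And>c k v. c \<in> carrier R \<Longrightarrow> k \<in> carrier G \<Longrightarrow> v \<in> carrier V \<Longrightarrow> \<phi> k (c \<odot>\<^bsub>V\<^esub> v) = c \<odot>\<^bsub>N\<^esub> \<phi> k v"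
    and act: "\<And>k h v. k \<in> carrier G \<Longrightarrow> h \<in> carrier H \<Longrightarrow> v \<in> carrier V \<Longrightarrow> \<phi> (k \<otimes>\<^bsub>G\<^esub> \<iota> h) v = \<phi> k (\<alpha> h v)"
  shows "ind_map R G H \<iota> V \<alpha> N \<phi> \<in> linear_maps R I_mod N"
    and "k \<in> carrier G \<Longrightarrow> v \<in> carrier V \<Longrightarrow> ind_map R G H \<iota> V \<alpha> N \<phi> (I_gen k v) = \<phi> k v"
proof -
  let ?X = "carrier G \<times> carrier V"
  let ?\<phi> = "\<lambda>(k, v). \<phi> k v"
  interpret V: module R V by (rule V)
  interpret G: group G by (rule G)
  have \<phi>': "?\<phi> \<in> ?X \<rightarrow> carrier N" by (auto simp: \<phi>)
  have rel: "(\<lambda>f\<in>carrier (free_module R ?X). free_eval ?X N ?\<phi> f) s = \<zero>\<^bsub>N\<^esub>" if "s \<in> ind_rels R G H \<iota> V \<alpha>" for s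
    using that unfolding ind_rels_def Let_def
    by (elim UnE CollectE exE conjE) (simp only:, (rule free_eval_rels[OF N \<phi>']; simp add: add smult act ind_iota_closed ind_alpha_closed))+
  note * = presented_map[OF ind_rels_subset N \<phi>' rel]
  show "ind_map R G H \<iota> V \<alpha> N \<phi> \<in> linear_maps R I_mod N"
    unfolding ind_module_def ind_map_def by (rule *(1))
  show "ind_map R G H \<iota> V \<alpha> N \<phi> (I_gen k v) = \<phi> k v" if "k \<in> carrier G" "v \<in> carrier V"
    using *(2)[of "(k, v)"] that by (simp add: ind_gen_def ind_map_def)
qed

lemma ind_induct [consumes 1, case_names zero add gen]:
  assumes "u \<in> carrier I_mod" "Q \<zero>\<^bsub>I_mod\<^esub>"
    and "\<And>u v. u \<in> carrier I_mod \<Longrightarrow> v \<in> carrier I_mod \<Longrightarrow> Q u \<Longrightarrow> Q v \<Longrightarrow> Q (u \<oplus>\<^bsub>I_mod\<^esub> v)"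
    and "\<And>k v. k \<in> carrier G \<Longrightarrow> v \<in> carrier V \<Longrightarrow> Q (I_gen k v)"
  shows "Q u"
proof -
  interpret V: module R V by (rule V)
  show ?thesis
  proof (rule presented_induct_absorb[OF ind_rels_subset])
    show "\<exists>y\<in>carrier G \<times> carrier V. c \<odot>\<^bsub>presented_module R (carrier G \<times> carrier V) (ind_rels R G H \<iota> V \<alpha>)\<^esub>
        presented_gen R (carrier G \<times> carrier V) (ind_rels R G H \<iota> V \<alpha>) x =
        presented_gen R (carrier G \<times> carrier V) (ind_rels R G H \<iota> V \<alpha>) y"
      if "c \<in> carrier R" "x \<in> carrier G \<times> carrier V" for c x
      using that ind_gen_smult[of c "fst x" "snd x", symmetric]
      by (intro bexI[of _ "(fst x, c \<odot>\<^bsub>V\<^esub> snd x)"]) (auto simp: ind_gen_def ind_module_def)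
  qed (use assms in \<open>auto simp: ind_module_def ind_gen_def\<close>)
qed

lemma ind_ext:
  assumes "additive I_mod L f" "additive I_mod L h"
    and "\<And>k v. k \<in> carrier G \<Longrightarrow> v \<in> carrier V \<Longrightarrow> f (I_gen k v) = h (I_gen k v)"
    and "u \<in> carrier I_mod"
  shows "f u = h u"
  using assms(4)
  by (induction rule: ind_induct)
    (auto simp: additive_zero[OF assms(1)] additive_zero[OF assms(2)] additive_add[OF assms(1)] additive_add[OF assms(2)] assms(3))

text \<open>Translation on the left commutes with multiplication by \<open>\<iota> h\<close> on the
  right, hence it respects the relations.\<close>

lemma ind_act:
  assumes "k \<in> carrier G"
  shows "ind_act R G H \<iota> V \<alpha> k \<in> linear_maps R I_mod I_mod"
    and "l \<in> carrier G \<Longrightarrow> v \<in> carrier V \<Longrightarrow> ind_act R G H \<iota> V \<alpha> k (I_gen l v) = I_gen (k \<otimes>\<^bsub>G\<^esub> l) v"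
proof -
  interpret G: group G by (rule G)
  have act: "I_gen (k \<otimes>\<^bsub>G\<^esub> (l \<otimes>\<^bsub>G\<^esub> \<iota> h)) v = I_gen (k \<otimes>\<^bsub>G\<^esub> l) (\<alpha> h v)"
    if "l \<in> carrier G" "h \<in> carrier H" "v \<in> carrier V" for l h v
    using assms that ind_gen_act[of "k \<otimes>\<^bsub>G\<^esub> l" h v] ind_iota_closed by (simp add: G.m_assoc)
  note m = ind_map[OF module_ind, of "\<lambda>l v. I_gen (k \<otimes>\<^bsub>G\<^esub> l) v", folded ind_act_def]
  show "ind_act R G H \<iota> V \<alpha> k \<in> linear_maps R I_mod I_mod"
    using assms by (intro m) (auto simp: ind_gen_closed ind_gen_add ind_gen_smult act)
  show "ind_act R G H \<iota> V \<alpha> k (I_gen l v) = I_gen (k \<otimes>\<^bsub>G\<^esub> l) v" if "l \<in> carrier G" "v \<in> carrier V"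
    using assms that by (intro m) (auto simp: ind_gen_closed ind_gen_add ind_gen_smult act)
qed

lemma ind_act_one: "u \<in> carrier I_mod \<Longrightarrow> ind_act R G H \<iota> V \<alpha> \<one>\<^bsub>G\<^esub> u = u"
proof -
  interpret G: group G by (rule G)
  note a = ind_act[OF G.one_closed]
  show "u \<in> carrier I_mod \<Longrightarrow> ind_act R G H \<iota> V \<alpha> \<one>\<^bsub>G\<^esub> u = u"
    by (rule ind_ext[OF linear_additive[OF a(1) module_ind module_ind] additive_ident[OF module_abelian_group[OF module_ind]]])
      (auto simp: a)
qed

lemma ind_act_mult:
  assumes k: "k \<in> carrier G" "l \<in> carrier G" and u: "u \<in> carrier I_mod"
  shows "ind_act R G H \<iota> V \<alpha> (k \<otimes>\<^bsub>G\<^esub> l) u = ind_act R G H \<iota> V \<alpha> k (ind_act R G H \<iota> V \<alpha> l u)"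
proof -
  interpret G: group G by (rule G)
  note a = ind_act(1)[THEN linear_additive, OF _ module_ind module_ind]
  show ?thesis
    by (rule ind_ext[OF a additive_comp[OF a a] _ u]) (use k in \<open>auto simp: ind_act(2) G.m_assoc\<close>)
qed

end

end

text \<open>Keeps the literal \<open>1\<close>, in which intervals such as \<open>{1..n}\<close> and
  the group \<open>young_group a 1\<close> are written.\<close>

declare One_nat_def [simp del]

section \<open>Finite direct sums as coproducts\<close>

section \<open>Finite direct sums\<close>

definition dsum_incl :: "'i set \<Rightarrow> ('i \<Rightarrow> ('a, 'b) module) \<Rightarrow> 'i \<Rightarrow> 'b \<Rightarrow> 'i \<Rightarrow> 'b"
  where "dsum_incl I M i x = (\<lambda>j\<in>I. if j = i then x else \<zero>\<^bsub>M j\<^esub>)"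

lemma dsum_simps:
  "carrier (direct_sum I M) = (\<Pi>\<^sub>E i\<in>I. carrier (M i))"
  "\<zero>\<^bsub>direct_sum I M\<^esub> = (\<lambda>i\<in>I. \<zero>\<^bsub>M i\<^esub>)"
  "u \<oplus>\<^bsub>direct_sum I M\<^esub> v = (\<lambda>i\<in>I. u i \<oplus>\<^bsub>M i\<^esub> v i)"
  "c \<odot>\<^bsub>direct_sum I M\<^esub> u = (\<lambda>i\<in>I. c \<odot>\<^bsub>M i\<^esub> u i)"
  by (simp_all add: direct_sum_def)

lemma dsum_at: "u \<in> carrier (direct_sum I M) \<Longrightarrow> i \<in> I \<Longrightarrow> u i \<in> carrier (M i)"
  by (auto simp: dsum_simps)

lemma dsum_ext:
  "u \<in> carrier (direct_sum I M) \<Longrightarrow> v \<in> carrier (direct_sum I M) \<Longrightarrow> (\<And>i. i \<in> I \<Longrightarrow> u i = v i) \<Longrightarrow> u = v"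
  by (auto simp: dsum_simps intro: PiE_ext)

context cring
begin

context
  fixes I :: "'i set" and M :: "'i \<Rightarrow> ('a, 'm) module"
  assumes M: "\<And>i. i \<in> I \<Longrightarrow> module R (M i)"
begin

lemma dsum_grp: "i \<in> I \<Longrightarrow> abelian_group (M i)"
  by (rule module_abelian_group[OF M])

lemma module_direct_sum: "module R (direct_sum I M)"
proof (intro moduleI abelian_groupI is_cring)
  note c = abelian_group.a_inv_closed[OF dsum_grp] abelian_monoid.a_closed[OF abelian_group.axioms(1)[OF dsum_grp]]
    abelian_monoid.zero_closed[OF abelian_group.axioms(1)[OF dsum_grp]] module.smult_closed[OF M]
  let ?D = "direct_sum I M"
  show "\<zero>\<^bsub>?D\<^esub> \<in> carrier ?D" by (auto simp: dsum_simps c)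
  fix x assume x: "x \<in> carrier ?D"
  show "\<zero>\<^bsub>?D\<^esub> \<oplus>\<^bsub>?D\<^esub> x = x"
    using x by (intro dsum_ext) (auto simp: dsum_simps c abelian_monoid.l_zero[OF abelian_group.axioms(1)[OF dsum_grp]] PiE_iff)
  show "\<one> \<odot>\<^bsub>?D\<^esub> x = x"
    using x by (intro dsum_ext) (auto simp: dsum_simps c module.smult_one[OF M] PiE_iff)
  show "\<exists>y\<in>carrier ?D. y \<oplus>\<^bsub>?D\<^esub> x = \<zero>\<^bsub>?D\<^esub>"
    using x by (intro bexI[of _ "\<lambda>i\<in>I. \<ominus>\<^bsub>M i\<^esub> x i"])
      (auto simp: dsum_simps c abelian_group.l_neg[OF dsum_grp] PiE_iff intro!: restrict_ext)
  fix y assume y: "y \<in> carrier ?D"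
  show "x \<oplus>\<^bsub>?D\<^esub> y \<in> carrier ?D" using x y by (auto simp: dsum_simps c PiE_iff)
  show "x \<oplus>\<^bsub>?D\<^esub> y = y \<oplus>\<^bsub>?D\<^esub> x"
    using x y by (auto simp: dsum_simps abelian_monoid.a_comm[OF abelian_group.axioms(1)[OF dsum_grp]] PiE_iff intro!: restrict_ext)
  {
    fix z assume z: "z \<in> carrier ?D"
    show "x \<oplus>\<^bsub>?D\<^esub> y \<oplus>\<^bsub>?D\<^esub> z = x \<oplus>\<^bsub>?D\<^esub> (y \<oplus>\<^bsub>?D\<^esub> z)"
      using x y z by (auto simp: dsum_simps abelian_monoid.a_assoc[OF abelian_group.axioms(1)[OF dsum_grp]] PiE_iff intro!: restrict_ext)
  }
  fix a assume a: "a \<in> carrier R"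
  show "a \<odot>\<^bsub>?D\<^esub> x \<in> carrier ?D" using x a by (auto simp: dsum_simps c PiE_iff)
  show "a \<odot>\<^bsub>?D\<^esub> (x \<oplus>\<^bsub>?D\<^esub> y) = (a \<odot>\<^bsub>?D\<^esub> x) \<oplus>\<^bsub>?D\<^esub> (a \<odot>\<^bsub>?D\<^esub> y)"
    using x y a by (auto simp: dsum_simps module.smult_r_distr[OF M] PiE_iff intro!: restrict_ext)
  fix b assume b: "b \<in> carrier R"
  show "(a \<oplus> b) \<odot>\<^bsub>?D\<^esub> x = (a \<odot>\<^bsub>?D\<^esub> x) \<oplus>\<^bsub>?D\<^esub> (b \<odot>\<^bsub>?D\<^esub> x)"
    using x b a by (auto simp: dsum_simps module.smult_l_distr[OF M] PiE_iff intro!: restrict_ext)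
  show "(a \<otimes> b) \<odot>\<^bsub>?D\<^esub> x = a \<odot>\<^bsub>?D\<^esub> (b \<odot>\<^bsub>?D\<^esub> x)"
    using x b a by (auto simp: dsum_simps module.smult_assoc1[OF M] PiE_iff intro!: restrict_ext)
qed

lemma dsum_incl_linear:
  assumes i: "i \<in> I"
  shows "(\<lambda>x\<in>carrier (M i). dsum_incl I M i x) \<in> linear_maps R (M i) (direct_sum I M)"
proof (rule linear_mapsI'[OF M[OF i]])
  note g = abelian_group.axioms(1)[OF dsum_grp]
  show "dsum_incl I M i x \<in> carrier (direct_sum I M)" if "x \<in> carrier (M i)" for x
    using that by (auto simp: dsum_incl_def dsum_simps abelian_monoid.zero_closed[OF g])
qed (auto simp: dsum_incl_def dsum_simps abelian_monoid.l_zero[OF abelian_group.axioms(1)[OF dsum_grp]]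
    abelian_monoid.zero_closed[OF abelian_group.axioms(1)[OF dsum_grp]] module.smult_r_null[OF M] intro!: restrict_ext)

lemma dsum_incl_closed: "i \<in> I \<Longrightarrow> x \<in> carrier (M i) \<Longrightarrow> dsum_incl I M i x \<in> carrier (direct_sum I M)"
  using linear_closed[OF dsum_incl_linear] by simp

lemma dsum_induct [consumes 2, case_names zero add incl]:
  assumes fin: "finite I" and u: "u \<in> carrier (direct_sum I M)" and zero: "Q \<zero>\<^bsub>direct_sum I M\<^esub>"
    and add: "\<And>u v. u \<in> carrier (direct_sum I M) \<Longrightarrow> v \<in> carrier (direct_sum I M) \<Longrightarrow> Q u \<Longrightarrow> Q v \<Longrightarrow>
      Q (u \<oplus>\<^bsub>direct_sum I M\<^esub> v)"
    and incl: "\<And>i x. i \<in> I \<Longrightarrow> x \<in> carrier (M i) \<Longrightarrow> Q (dsum_incl I M i x)"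
  shows "Q u"
proof -
  note z = abelian_monoid.zero_closed[OF abelian_group.axioms(1)[OF dsum_grp]]
    abelian_monoid.l_zero[OF abelian_group.axioms(1)[OF dsum_grp]]
    abelian_monoid.r_zero[OF abelian_group.axioms(1)[OF dsum_grp]]
  \<comment> \<open>The truncations of \<open>u\<close> to subsets \<open>J\<close> of the index set
    interpolate between zero and \<open>u\<close>, adding one summand at a time.\<close>
  let ?u = "\<lambda>J. \<lambda>i\<in>I. if i \<in> J then u i else \<zero>\<^bsub>M i\<^esub>"
  have c: "?u J \<in> carrier (direct_sum I M)" for J
    using u by (auto simp: dsum_simps z)
  have "finite J \<Longrightarrow> J \<subseteq> I \<Longrightarrow> Q (?u J)" for J
  proof (induction J rule: finite_induct)
    case empty
    then show ?case using zero by (simp add: dsum_simps restrict_def)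
  next
    case (insert j J)
    have j: "u j \<in> carrier (M j)" "j \<in> I" using insert dsum_at[OF u] by auto
    have "?u (insert j J) = dsum_incl I M j (u j) \<oplus>\<^bsub>direct_sum I M\<^esub> ?u J"
      using insert(2) dsum_at[OF u] by (auto simp: dsum_simps(2-) dsum_incl_def z intro!: restrict_ext)
    moreover have "Q (dsum_incl I M j (u j) \<oplus>\<^bsub>direct_sum I M\<^esub> ?u J)"
      by (rule add[OF dsum_incl_closed[OF j(2,1)] c incl[OF j(2,1)] insert(3)]) (use insert in auto)
    ultimately show ?case by (simp only:)
  qed
  moreover have "?u I = u" using u by (auto simp: dsum_simps PiE_iff extensional_def fun_eq_iff)
  ultimately show ?thesis using fin by (metis subset_refl)
qed

lemma dsum_lift:
  assumes fin: "finite I" and L: "module R L" and f: "\<And>i. i \<in> I \<Longrightarrow> f i \<in> linear_maps R (M i) L"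
  shows "\<exists>F\<in>linear_maps R (direct_sum I M) L. \<forall>i\<in>I. \<forall>x\<in>carrier (M i). F (dsum_incl I M i x) = f i x"
proof (intro bexI ballI)
  interpret L: module R L by fact
  let ?D = "direct_sum I M"
  let ?F = "\<lambda>u\<in>carrier ?D. \<Oplus>\<^bsub>L\<^esub>i\<in>I. f i (u i)"
  show "?F \<in> linear_maps R ?D L"
  proof (rule linear_mapsI'[OF module_direct_sum])
    fix u assume u: "u \<in> carrier ?D"
    have c: "f i (u i) \<in> carrier L" if "u \<in> carrier ?D" "i \<in> I" for u i
      using that linear_closed[OF f] dsum_at by metis
    show "(\<Oplus>\<^bsub>L\<^esub>i\<in>I. f i (u i)) \<in> carrier L" using c u by auto
    {
      fix v assume v: "v \<in> carrier ?D"
      have "(\<Oplus>\<^bsub>L\<^esub>i\<in>I. f i ((u \<oplus>\<^bsub>?D\<^esub> v) i)) = (\<Oplus>\<^bsub>L\<^esub>i\<in>I. f i (u i) \<oplus>\<^bsub>L\<^esub> f i (v i))"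
        using u v c by (intro L.finsum_cong') (auto simp: dsum_simps(2-) linear_add[OF f] dsum_at)
      then show "(\<Oplus>\<^bsub>L\<^esub>i\<in>I. f i ((u \<oplus>\<^bsub>?D\<^esub> v) i)) = (\<Oplus>\<^bsub>L\<^esub>i\<in>I. f i (u i)) \<oplus>\<^bsub>L\<^esub> (\<Oplus>\<^bsub>L\<^esub>i\<in>I. f i (v i))"
        using c u v by (simp add: L.finsum_addf Pi_iff)
    }
    fix k assume k: "k \<in> carrier R"
    have "(\<Oplus>\<^bsub>L\<^esub>i\<in>I. f i ((k \<odot>\<^bsub>?D\<^esub> u) i)) = (\<Oplus>\<^bsub>L\<^esub>i\<in>I. k \<odot>\<^bsub>L\<^esub> f i (u i))"
      using u k c by (intro L.finsum_cong') (auto simp: dsum_simps(2-) linear_smult[OF f] dsum_at)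
    then show "(\<Oplus>\<^bsub>L\<^esub>i\<in>I. f i ((k \<odot>\<^bsub>?D\<^esub> u) i)) = k \<odot>\<^bsub>L\<^esub> (\<Oplus>\<^bsub>L\<^esub>i\<in>I. f i (u i))"
      using c u k fin by (simp add: L.finsum_smult_ldistr Pi_iff)
  qed
  fix i x assume i: "i \<in> I" and x: "x \<in> carrier (M i)"
  have fx: "f j (if j = i then x else \<zero>\<^bsub>M j\<^esub>) = (if i = j then f i x else \<zero>\<^bsub>L\<^esub>)" if "j \<in> I" for j
    using that linear_zero[OF f M L] by auto
  have "?F (dsum_incl I M i x) = (\<Oplus>\<^bsub>L\<^esub>j\<in>I. f j (dsum_incl I M i x j))"
    using dsum_incl_closed[OF i x] by simp
  also have "\<dots> = (\<Oplus>\<^bsub>L\<^esub>j\<in>I. if i = j then f i x else \<zero>\<^bsub>L\<^esub>)"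
    using fx i linear_closed[OF f[OF i] x]
    by (intro L.finsum_cong') (auto simp: dsum_incl_def)
  also have "\<dots> = f i x"
    using L.finsum_singleton[OF i fin, of "\<lambda>_. f i x"] linear_closed[OF f[OF i] x] by simp
  finally show "?F (dsum_incl I M i x) = f i x" .
qed

end

end

section \<open>S-modules and morphisms out of their tensor products\<close>

section \<open>S-modules and their tensor product\<close>

lemma sym_group_carrier_eq: "carrier (sym_group n) = {p. p permutes {1..n}}"
  by (simp add: sym_group_def)

lemmas sym_group_simps = sym_group_carrier_eq sym_group_mult sym_group_one

text \<open>Membership in \<open>BijGroup\<close> asks for bijectivity, which is supplied by the
  action of the inverse group element, and for extensionality, which comes with
  \<open>linear_maps\<close>.\<close>

lemma group_action_linearI:
  assumes G: "group G"
    and lin: "\<And>\<sigma>. \<sigma> \<in> carrier G \<Longrightarrow> \<phi> \<sigma> \<in> linear_maps R M M"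
    and one: "\<And>x. x \<in> carrier M \<Longrightarrow> \<phi> \<one>\<^bsub>G\<^esub> x = x"
    and mult: "\<And>\<sigma> \<tau> x. \<sigma> \<in> carrier G \<Longrightarrow> \<tau> \<in> carrier G \<Longrightarrow> x \<in> carrier M \<Longrightarrow>
      \<phi> (\<sigma> \<otimes>\<^bsub>G\<^esub> \<tau>) x = \<phi> \<sigma> (\<phi> \<tau> x)"
  shows "group_action G (carrier M) \<phi>"
proof -
  interpret G: group G by fact
  have inv: "\<phi> \<sigma> (\<phi> (inv\<^bsub>G\<^esub> \<sigma>) x) = x" "\<phi> (inv\<^bsub>G\<^esub> \<sigma>) (\<phi> \<sigma> x) = x" if "\<sigma> \<in> carrier G" "x \<in> carrier M" for \<sigma> x
    using that one mult[of \<sigma> "inv\<^bsub>G\<^esub> \<sigma>" x] mult[of "inv\<^bsub>G\<^esub> \<sigma>" \<sigma> x] by auto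
  have bij: "\<phi> \<sigma> \<in> Bij (carrier M)" if s: "\<sigma> \<in> carrier G" for \<sigma>
  proof -
    have "bij_betw (\<phi> \<sigma>) (carrier M) (carrier M)"
      using s by (intro bij_betw_byWitness[of _ "\<phi> (inv\<^bsub>G\<^esub> \<sigma>)"]) (auto simp: inv linear_closed[OF lin])
    moreover have "\<phi> \<sigma> \<in> extensional (carrier M)"
      using linear_undefined[OF lin[OF s]] by (auto simp: extensional_def)
    ultimately show ?thesis by (simp add: Bij_def)
  qed
  show ?thesis
  proof (intro group_action.intro group_hom.intro group_hom_axioms.intro G group_BijGroup)
    show "\<phi> \<in> hom G (BijGroup (carrier M))"
    proof (intro homI)
      show "\<phi> x \<in> carrier (BijGroup (carrier M))" if "x \<in> carrier G" for x
        using bij[OF that] by (simp add: BijGroup_def)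
      fix \<sigma> \<tau> assume s: "\<sigma> \<in> carrier G" and t: "\<tau> \<in> carrier G"
      have "\<phi> (\<sigma> \<otimes>\<^bsub>G\<^esub> \<tau>) = compose (carrier M) (\<phi> \<sigma>) (\<phi> \<tau>)"
        using s t mult linear_undefined[OF lin[OF G.m_closed[OF s t]]] by (auto simp: compose_def fun_eq_iff)
      then show "\<phi> (\<sigma> \<otimes>\<^bsub>G\<^esub> \<tau>) = \<phi> \<sigma> \<otimes>\<^bsub>BijGroup (carrier M)\<^esub> \<phi> \<tau>"
        using bij s t by (simp add: BijGroup_def)
    qed
  qed
qed

lemma S_moduleI:
  assumes "\<And>m. module R (component M m)"
    and "\<And>m \<sigma>. \<sigma> permutes {1..m} \<Longrightarrow> sym_act M m \<sigma> \<in> linear_maps R (component M m) (component M m)"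
    and "\<And>m x. x \<in> hom_elts M m \<Longrightarrow> sym_act M m id x = x"
    and "\<And>m \<sigma> \<tau> x. \<sigma> permutes {1..m} \<Longrightarrow> \<tau> permutes {1..m} \<Longrightarrow> x \<in> hom_elts M m \<Longrightarrow>
      sym_act M m (\<sigma> \<circ> \<tau>) x = sym_act M m \<sigma> (sym_act M m \<tau> x)"
  shows "S_module R M"
  unfolding S_module_def using assms
  by (auto simp: sym_group_simps intro!: group_action_linearI[where R = R] sym_group_is_group)

context
  fixes R :: "('a, 'r) ring_scheme" and M :: "('a, 'm) smodule"
  assumes M: "S_module R M"
begin

lemma S_module_module: "module R (component M m)"
  using M by (simp add: S_module_def)

lemma S_module_linear: "\<sigma> permutes {1..m} \<Longrightarrow> sym_act M m \<sigma> \<in> linear_maps R (component M m) (component M m)"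
  using M by (auto simp: S_module_def sym_group_simps)

lemma S_module_closed: "\<sigma> permutes {1..m} \<Longrightarrow> x \<in> hom_elts M m \<Longrightarrow> sym_act M m \<sigma> x \<in> hom_elts M m"
  by (rule linear_closed[OF S_module_linear])

lemma S_module_additive: "\<sigma> permutes {1..m} \<Longrightarrow> additive (component M m) (component M m) (sym_act M m \<sigma>)"
  by (rule linear_additive[OF S_module_linear S_module_module S_module_module])

lemma S_module_one: "x \<in> hom_elts M m \<Longrightarrow> sym_act M m id x = x"
  using M group_action.id_eq_one[of "sym_group m" "hom_elts M m" "sym_act M m"]
  by (auto simp: S_module_def sym_group_simps fun_eq_iff split: if_splits)

lemma S_module_comp:
  assumes "\<sigma> permutes {1..m}" "\<tau> permutes {1..m}" "x \<in> hom_elts M m"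
  shows "sym_act M m (\<sigma> \<circ> \<tau>) x = sym_act M m \<sigma> (sym_act M m \<tau> x)"
proof -
  interpret group_action "sym_group m" "hom_elts M m" "sym_act M m"
    using M by (simp add: S_module_def)
  show ?thesis using composition_rule[of x \<sigma> \<tau>] assms by (simp add: sym_group_simps)
qed

end

lemma perm_cross_comp:
  assumes "\<sigma>' permutes {1..m}" "\<tau>' permutes {1..n}"
  shows "perm_cross m (\<sigma>, \<tau>) \<circ> perm_cross m (\<sigma>', \<tau>') = perm_cross m (\<sigma> \<circ> \<sigma>', \<tau> \<circ> \<tau>')"
proof
  fix i
  show "(perm_cross m (\<sigma>, \<tau>) \<circ> perm_cross m (\<sigma>', \<tau>')) i = perm_cross m (\<sigma> \<circ> \<sigma>', \<tau> \<circ> \<tau>') i"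
  proof (cases "i \<le> m")
    case True
    \<comment> \<open>The test \<open>i \<le> m\<close> also admits position 0, which
      \<open>\<sigma>'\<close> fixes as it lies outside \<open>{1..m}\<close>.\<close>
    then have "\<sigma>' i \<le> m"
      using permutes_in_image[OF assms(1), of i] permutes_not_in[OF assms(1), of i] by (cases "i = 0") auto
    then show ?thesis using True by (simp add: perm_cross_def)
  next
    case False
    \<comment> \<open>The value must not be 0, since \<open>m + 0\<close> would fall into the left
      branch of \<open>perm_cross m\<close>.\<close>
    then have "\<tau>' (i - m) \<noteq> 0"
      using permutes_in_image[OF assms(2), of "i - m"] permutes_not_in[OF assms(2), of "i - m"]
      by (cases "i - m \<le> n") auto
    then show ?thesis using False by (simp add: perm_cross_def)
  qed
qed

lemma perm_cross_permutes:
  assumes "\<sigma> permutes {1..m}" "\<tau> permutes {1..n}"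
  shows "perm_cross m (\<sigma>, \<tau>) permutes {1..m + n}"
proof -
  have id: "perm_cross m (id, id) = id" by (auto simp: perm_cross_def)
  have "bij (perm_cross m (\<sigma>, \<tau>))"
    using perm_cross_comp[OF assms, of "inv' \<sigma>" "inv' \<tau>"]
      perm_cross_comp[OF permutes_inv[OF assms(1)] permutes_inv[OF assms(2)], of \<sigma> \<tau>] assms
    by (intro o_bij[of "perm_cross m (inv' \<sigma>, inv' \<tau>)"]) (simp_all add: id permutes_inv permutes_inv_o)
  moreover have "perm_cross m (\<sigma>, \<tau>) i = i" if "i \<notin> {1..m + n}" for i
  proof (cases "i = 0")
    case False
    with that have i: "i > m + n" by auto
    then have "\<tau> (i - m) = i - m" by (intro permutes_not_in[OF assms(2)]) auto
    with i show ?thesis by (simp add: perm_cross_def)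
  qed (use permutes_not_in[OF assms(1), of 0] in \<open>simp add: perm_cross_def\<close>)
  ultimately show ?thesis by (auto simp: permutes_def bij_iff)
qed

lemma young_perm_cross: "perm_cross m \<in> carrier (young_group m n) \<rightarrow> carrier (sym_group (m + n))"
  by (auto simp: sym_group_simps perm_cross_permutes)

text \<open>\<open>\<pi>\<close> fixes every position above \<open>p\<close>, so adding an identity
  block changes nothing. A permutation of this form occurs in \<open>rmult_t\<close>.\<close>

lemma perm_cross_ident: "\<pi> permutes {1..p} \<Longrightarrow> perm_cross p (\<pi>, id) = \<pi>"
  by (auto simp: perm_cross_def fun_eq_iff permutes_not_in)

lemma finite_bidegrees: "finite (bidegrees p)"
  by (rule finite_subset[of _ "{..p} \<times> {..p}"]) auto

context cring
begin

context
  fixes M :: "('a, 'm) smodule" and N :: "('a, 'n) smodule"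
  assumes M: "S_module R M" and N: "S_module R N"
begin

abbreviation (input) "T_part \<equiv> \<lambda>(m, n). S_tensor_part R M N m n"
abbreviation (input) "T_mod m n \<equiv> tensor_module R (component M m) (component N n)"
abbreviation (input) "T_gen m n \<equiv> tensor_gen R (component M m) (component N n)"
abbreviation (input) "TT \<equiv> S_tensor R M N"

lemma mod_M: "module R (component M m)" and mod_N: "module R (component N n)"
  using S_module_module M N by auto

lemma T_mod_module: "module R (T_mod m n)"
  by (intro module_tensor mod_M mod_N)

lemma tensor_young_act:
  assumes "h \<in> carrier (young_group m n)"
  shows "tensor_young_act R M N m n h \<in> linear_maps R (T_mod m n) (T_mod m n)"
    and "x \<in> hom_elts M m \<Longrightarrow> y \<in> hom_elts N n \<Longrightarrow>
      tensor_young_act R M N m n h (T_gen m n x y) = T_gen m n (sym_act M m (fst h) x) (sym_act N n (snd h) y)"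
  using assms tensor_map[OF mod_M mod_N S_module_linear[OF M] S_module_linear[OF N]]
  by (auto simp: tensor_young_act_def sym_group_simps)

lemma tensor_young_act_closed:
  "tensor_young_act R M N m n \<in> carrier (young_group m n) \<rightarrow> carrier (T_mod m n) \<rightarrow> carrier (T_mod m n)"
  using linear_closed[OF tensor_young_act(1)] by blast

lemmas part_defs = S_tensor_part_def S_tensor_part_gen_def S_tensor_part_act_def
lemmas part_ind = sym_group_is_group young_perm_cross T_mod_module tensor_young_act_closed

context
  fixes m n :: nat
begin

text \<open>The facts on induced modules, specialised to the Young subgroup that defines one
  bidegree of the tensor product.\<close>

lemmas module_part = module_ind[where G = "sym_group (m + n)" and H = "young_group m n" and \<iota> = "perm_cross m" and V = "T_mod m n" and \<alpha> = "tensor_young_act R M N m n", OF part_ind, folded part_defs]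
lemmas part_gen_closed = ind_gen_closed[where G = "sym_group (m + n)" and H = "young_group m n" and \<iota> = "perm_cross m" and V = "T_mod m n" and \<alpha> = "tensor_young_act R M N m n", OF part_ind, folded part_defs]
lemmas part_gen_add = ind_gen_add[where G = "sym_group (m + n)" and H = "young_group m n" and \<iota> = "perm_cross m" and V = "T_mod m n" and \<alpha> = "tensor_young_act R M N m n", OF part_ind, folded part_defs]
lemmas part_gen_smult = ind_gen_smult[where G = "sym_group (m + n)" and H = "young_group m n" and \<iota> = "perm_cross m" and V = "T_mod m n" and \<alpha> = "tensor_young_act R M N m n", OF part_ind, folded part_defs]
lemmas part_gen_act0 = ind_gen_act[where G = "sym_group (m + n)" and H = "young_group m n" and \<iota> = "perm_cross m" and V = "T_mod m n" and \<alpha> = "tensor_young_act R M N m n", OF part_ind, folded part_defs]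
lemmas part_map = ind_map[where G = "sym_group (m + n)" and H = "young_group m n" and \<iota> = "perm_cross m" and V = "T_mod m n" and \<alpha> = "tensor_young_act R M N m n", OF part_ind, folded part_defs]
lemmas part_induct = ind_induct[where G = "sym_group (m + n)" and H = "young_group m n" and \<iota> = "perm_cross m" and V = "T_mod m n" and \<alpha> = "tensor_young_act R M N m n", OF part_ind, folded part_defs, consumes 1, case_names zero add gen]
lemmas part_act0 = ind_act[where G = "sym_group (m + n)" and H = "young_group m n" and \<iota> = "perm_cross m" and V = "T_mod m n" and \<alpha> = "tensor_young_act R M N m n", OF part_ind, folded part_defs]

end

lemma part_gen_act:
  "\<sigma> permutes {1..m} \<Longrightarrow> \<tau> permutes {1..n} \<Longrightarrow> v \<in> carrier (T_mod m n) \<Longrightarrow>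
    S_tensor_part_gen R M N m n (perm_cross m (\<sigma>, \<tau>)) v =
    S_tensor_part_gen R M N m n id (tensor_young_act R M N m n (\<sigma>, \<tau>) v)"
  using part_gen_act0[of id m n "(\<sigma>, \<tau>)" v] by (simp add: sym_group_simps permutes_id)

lemma part_act:
  assumes "\<rho> permutes {1..m + n}"
  shows "S_tensor_part_act R M N m n \<rho> \<in> linear_maps R (S_tensor_part R M N m n) (S_tensor_part R M N m n)"
    and "\<pi> permutes {1..m + n} \<Longrightarrow> v \<in> carrier (T_mod m n) \<Longrightarrow>
      S_tensor_part_act R M N m n \<rho> (S_tensor_part_gen R M N m n \<pi> v) = S_tensor_part_gen R M N m n (\<rho> \<circ> \<pi>) v"
  using part_act0[of \<rho> m n] assms by (auto simp: sym_group_simps)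

lemma component_S_tensor: "component TT p = direct_sum (bidegrees p) T_part"
  by (simp add: S_tensor_def Let_def)

lemma module_T_part: "i \<in> bidegrees p \<Longrightarrow> module R (T_part i)"
  by (cases i) (simp add: module_part)

lemma module_S_tensor: "module R (component TT p)"
  unfolding component_S_tensor by (rule module_direct_sum[OF module_T_part])

lemma S_tensor_gen_eq:
  "S_tensor_gen R M N m n x y =
    dsum_incl (bidegrees (m + n)) T_part (m, n) (S_tensor_part_gen R M N m n id (T_gen m n x y))"
  by (auto simp: S_tensor_gen_def dsum_incl_def restrict_def fun_eq_iff)

lemma sym_act_S_tensor_linear:
  assumes "\<rho> permutes {1..p}"
  shows "sym_act TT p \<rho> \<in> linear_maps R (component TT p) (component TT p)"
proof -
  have lin: "S_tensor_part_act R M N m n \<rho> \<in> linear_maps R (S_tensor_part R M N m n) (S_tensor_part R M N m n)"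
    if "m + n = p" for m n
    using part_act(1)[of \<rho> m n] assms that by simp
  have eq: "sym_act TT p \<rho> = (\<lambda>u\<in>carrier (component TT p). \<lambda>(m, n)\<in>bidegrees p. S_tensor_part_act R M N m n \<rho> (u (m, n)))"
    by (simp add: S_tensor_def Let_def)
  show ?thesis
    unfolding eq
  proof (rule linear_mapsI'[OF module_S_tensor])
    fix u assume u: "u \<in> carrier (component TT p)"
    have at: "u (m, n) \<in> carrier (S_tensor_part R M N m n)" if "m + n = p" "u \<in> carrier (component TT p)" for m n u
      using that dsum_at[of u "bidegrees p" T_part "(m, n)"] by (simp add: component_S_tensor)
    show "(\<lambda>(m, n)\<in>bidegrees p. S_tensor_part_act R M N m n \<rho> (u (m, n))) \<in> carrier (component TT p)"
      unfolding component_S_tensor dsum_simps using u at linear_closed[OF lin] by auto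
    show "(\<lambda>(m, n)\<in>bidegrees p. S_tensor_part_act R M N m n \<rho> ((u \<oplus>\<^bsub>component TT p\<^esub> v) (m, n))) =
        (\<lambda>(m, n)\<in>bidegrees p. S_tensor_part_act R M N m n \<rho> (u (m, n))) \<oplus>\<^bsub>component TT p\<^esub>
        (\<lambda>(m, n)\<in>bidegrees p. S_tensor_part_act R M N m n \<rho> (v (m, n)))" if "v \<in> carrier (component TT p)" for v
      using u that at linear_add[OF lin]
      unfolding component_S_tensor dsum_simps by (auto intro!: restrict_ext)
    show "(\<lambda>(m, n)\<in>bidegrees p. S_tensor_part_act R M N m n \<rho> ((c \<odot>\<^bsub>component TT p\<^esub> u) (m, n))) =
        c \<odot>\<^bsub>component TT p\<^esub> (\<lambda>(m, n)\<in>bidegrees p. S_tensor_part_act R M N m n \<rho> (u (m, n)))" if "c \<in> carrier R" for c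
      using u that at linear_smult[OF lin]
      unfolding component_S_tensor dsum_simps by (auto intro!: restrict_ext)
  qed
qed

lemma sym_act_S_tensor_incl:
  assumes \<rho>: "\<rho> permutes {1..m + n}" and w: "w \<in> carrier (S_tensor_part R M N m n)"
  shows "sym_act TT (m + n) \<rho> (dsum_incl (bidegrees (m + n)) T_part (m, n) w) =
    dsum_incl (bidegrees (m + n)) T_part (m, n) (S_tensor_part_act R M N m n \<rho> w)"
proof -
  have z: "S_tensor_part_act R M N m' n' \<rho> \<zero>\<^bsub>S_tensor_part R M N m' n'\<^esub> = \<zero>\<^bsub>S_tensor_part R M N m' n'\<^esub>"
    if "m' + n' = m + n" for m' n'
    using linear_zero[OF part_act(1) module_part module_part, of \<rho> m' n'] \<rho> that by simp
  have "dsum_incl (bidegrees (m + n)) T_part (m, n) w \<in> carrier (component TT (m + n))"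
    unfolding component_S_tensor using w by (intro dsum_incl_closed module_T_part) auto
  then show ?thesis
    by (auto simp: S_tensor_def Let_def dsum_incl_def z intro!: restrict_ext)
qed

lemma sym_act_S_tensor_gen:
  assumes "\<rho> permutes {1..m + n}" "x \<in> hom_elts M m" "y \<in> hom_elts N n"
  shows "sym_act TT (m + n) \<rho> (S_tensor_gen R M N m n x y) =
    dsum_incl (bidegrees (m + n)) T_part (m, n) (S_tensor_part_gen R M N m n \<rho> (T_gen m n x y))"
  using assms part_act(2)[of \<rho> m n id "T_gen m n x y"] bilinearD(1)[OF tensor_gen_bilinear[OF mod_M mod_N]]
  by (simp add: S_tensor_gen_eq sym_act_S_tensor_incl part_gen_closed sym_group_simps permutes_id)

text \<open>The three layers are undone one after the other: direct sum, induction, tensor product.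
  A generator of the induced module at \<open>\<pi>\<close> is the \<open>\<pi>\<close>-translate of
  the one at the identity, so translates of \<open>S_tensor_gen\<close> suffice.\<close>

lemma S_tensor_induct [consumes 1, case_names zero add gen]:
  assumes u: "u \<in> carrier (component TT p)" and zero: "Q \<zero>\<^bsub>component TT p\<^esub>"
    and add: "\<And>u v. u \<in> carrier (component TT p) \<Longrightarrow> v \<in> carrier (component TT p) \<Longrightarrow> Q u \<Longrightarrow> Q v \<Longrightarrow>
      Q (u \<oplus>\<^bsub>component TT p\<^esub> v)"
    and gen: "\<And>m n \<pi> x y. p = m + n \<Longrightarrow> \<pi> permutes {1..p} \<Longrightarrow> x \<in> hom_elts M m \<Longrightarrow> y \<in> hom_elts N n \<Longrightarrow>
      Q (sym_act TT p \<pi> (S_tensor_gen R M N m n x y))"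
  shows "Q u"
proof (rule dsum_induct[OF module_T_part finite_bidegrees u[unfolded component_S_tensor]])
  fix i w assume i: "i \<in> bidegrees p" and w: "w \<in> carrier (T_part i)"
  obtain m n where mn: "i = (m, n)" "p = m + n" using i by auto
  let ?i = "dsum_incl (bidegrees p) T_part i"
  have *: "(\<lambda>x\<in>carrier (T_part i). ?i x) \<in> linear_maps R (T_part i) (component TT p)"
    unfolding component_S_tensor using i by (intro dsum_incl_linear module_T_part) auto
  note i_add = additive_add[OF linear_additive[OF * module_T_part[OF i] module_S_tensor]]
  interpret P: module R "S_tensor_part R M N m n" by (rule module_part)
  interpret V: module R "T_mod m n" by (rule T_mod_module)
  have w: "w \<in> carrier (S_tensor_part R M N m n)" using w mn by simp
  show "Q (?i w)" using w
  proof (induction rule: part_induct)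
    case zero
    then show ?case using assms(2) linear_zero[OF * module_T_part[OF i] module_S_tensor] mn by simp
  next
    case (add u v)
    then show ?case using assms(3) linear_add[OF *] linear_closed[OF *] mn by simp
  next
    case (gen \<pi> v)
    from gen(2) show ?case
    proof (induction rule: tensor_induct[OF mod_M mod_N, consumes 1, case_names zero add gen])
      case zero
      \<comment> \<open>Linearity in the tensor is available as compatibility with sums and scalars,
        so zero is treated as a multiple by the scalar zero.\<close>
      have "S_tensor_part_gen R M N m n \<pi> \<zero>\<^bsub>T_mod m n\<^esub> = \<zero>\<^bsub>S_tensor_part R M N m n\<^esub>"
        using part_gen_smult[OF zero_closed gen(1) V.zero_closed] by (simp add: part_gen_closed)
      then show ?case using assms(2) linear_zero[OF * module_T_part[OF i] module_S_tensor] mn by simp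
    next
      case (add u v)
      then show ?case using assms(3) linear_add[OF *] linear_closed[OF *] mn part_gen_add[OF gen(1) add(1,2)]
        by (simp add: part_gen_closed)
    next
      case (gen x y)
      then show ?case using assms(4)[of m n \<pi> x y] \<open>\<pi> \<in> _\<close> mn by (simp add: sym_act_S_tensor_gen sym_group_simps)
    qed
  qed
qed (use assms in \<open>auto simp: component_S_tensor\<close>)

lemma S_tensor_ext:
  assumes f: "additive (component TT p) L f" and h: "additive (component TT p) L h"
    and gen: "\<And>m n \<pi> x y. p = m + n \<Longrightarrow> \<pi> permutes {1..p} \<Longrightarrow> x \<in> hom_elts M m \<Longrightarrow> y \<in> hom_elts N n \<Longrightarrow>
      f (sym_act TT p \<pi> (S_tensor_gen R M N m n x y)) = h (sym_act TT p \<pi> (S_tensor_gen R M N m n x y))"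
    and "u \<in> carrier (component TT p)"
  shows "f u = h u"
  using assms(4)
proof (induction rule: S_tensor_induct)
  case (gen m n \<pi> x y)
  then show ?case by (rule assms(3))
qed (simp_all add: additive_zero[OF f] additive_zero[OF h] additive_add[OF f] additive_add[OF h])

lemma S_tensor_gen_bilinear:
  "bilinear R (component M m) (component N n) (component TT (m + n)) (S_tensor_gen R M N m n)"
proof -
  have *: "(\<lambda>x\<in>carrier (T_part (m, n)). dsum_incl (bidegrees (m + n)) T_part (m, n) x) \<in>
    linear_maps R (T_part (m, n)) (component TT (m + n))"
    unfolding component_S_tensor by (intro dsum_incl_linear module_T_part) auto
  note B = bilinearD[OF tensor_gen_bilinear[OF mod_M mod_N]]
  have id: "id \<in> carrier (sym_group (m + n))" by (simp add: sym_group_simps permutes_id)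
  interpret P: module R "S_tensor_part R M N m n" by (rule module_part)
  show ?thesis
    unfolding S_tensor_gen_eq
    by (rule bilinearI)
      (use linear_closed[OF *] linear_add[OF *] linear_smult[OF *] in
        \<open>simp_all add: B part_gen_closed part_gen_add[OF id] part_gen_smult[OF _ id]\<close>)
qed

lemma S_tensor_gen_closed:
  "x \<in> hom_elts M m \<Longrightarrow> y \<in> hom_elts N n \<Longrightarrow> S_tensor_gen R M N m n x y \<in> carrier (component TT (m + n))"
  by (rule bilinearD(1)[OF S_tensor_gen_bilinear])

text \<open>This is the relation that defines induction: an element of the Young subgroup may be
  moved into the tensor factor.\<close>

lemma S_tensor_gen_equivariant:
  assumes "\<sigma> permutes {1..m}" "\<tau> permutes {1..n}" "x \<in> hom_elts M m" "y \<in> hom_elts N n"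
  shows "S_tensor_gen R M N m n (sym_act M m \<sigma> x) (sym_act N n \<tau> y) =
    sym_act TT (m + n) (perm_cross m (\<sigma>, \<tau>)) (S_tensor_gen R M N m n x y)"
proof -
  have h: "(\<sigma>, \<tau>) \<in> carrier (young_group m n)" using assms by (simp add: sym_group_simps)
  have "S_tensor_part_gen R M N m n (perm_cross m (\<sigma>, \<tau>)) (T_gen m n x y) =
    S_tensor_part_gen R M N m n id (tensor_young_act R M N m n (\<sigma>, \<tau>) (T_gen m n x y))"
    using part_gen_act[of \<sigma> m \<tau> n "T_gen m n x y"] assms bilinearD(1)[OF tensor_gen_bilinear[OF mod_M mod_N]]
    by (simp add: sym_group_simps permutes_id)
  then show ?thesis
    unfolding sym_act_S_tensor_gen[OF perm_cross_permutes[OF assms(1,2)] assms(3,4)]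
    using assms tensor_young_act(2)[OF h] by (simp add: S_tensor_gen_eq)
qed

lemma S_module_S_tensor: "S_module R TT"
proof (rule S_moduleI)
  note a = sym_act_S_tensor_linear[THEN linear_additive, OF _ module_S_tensor module_S_tensor]
  have c: "sym_act TT (m + n) (\<rho> \<circ> \<pi>) (S_tensor_gen R M N m n x y) =
    sym_act TT (m + n) \<rho> (sym_act TT (m + n) \<pi> (S_tensor_gen R M N m n x y))"
    if "\<rho> permutes {1..m + n}" "\<pi> permutes {1..m + n}" "x \<in> hom_elts M m" "y \<in> hom_elts N n" for \<rho> \<pi> m n x y
    using that part_act(2)[of \<rho> m n \<pi> "T_gen m n x y"] bilinearD(1)[OF tensor_gen_bilinear[OF mod_M mod_N]]
    by (simp add: sym_act_S_tensor_gen sym_act_S_tensor_incl permutes_compose part_gen_closed sym_group_simps)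
  show "module R (component TT m)" for m by (rule module_S_tensor)
  show "sym_act TT m \<sigma> \<in> linear_maps R (component TT m) (component TT m)" if "\<sigma> permutes {1..m}" for m \<sigma>
    using that by (rule sym_act_S_tensor_linear)
  show "sym_act TT p id u = u" if "u \<in> hom_elts TT p" for p u
  proof (rule S_tensor_ext[OF a additive_ident _ that])
    fix m n \<pi> x y assume *: "p = m + n" "\<pi> permutes {1..p}" "x \<in> hom_elts M m" "y \<in> hom_elts N n"
    then show "sym_act TT p id (sym_act TT p \<pi> (S_tensor_gen R M N m n x y)) = sym_act TT p \<pi> (S_tensor_gen R M N m n x y)"
      using c[of id m n \<pi> x y] by (simp add: permutes_id)
  qed (auto simp: permutes_id intro: module_abelian_group[OF module_S_tensor])
  show "sym_act TT p (\<sigma> \<circ> \<tau>) u = sym_act TT p \<sigma> (sym_act TT p \<tau> u)"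
    if "\<sigma> permutes {1..p}" "\<tau> permutes {1..p}" "u \<in> hom_elts TT p" for p u \<sigma> \<tau>
  proof (rule S_tensor_ext[OF a additive_comp[OF a a] _ that(3)])
    fix m n \<pi> x y assume *: "p = m + n" "\<pi> permutes {1..p}" "x \<in> hom_elts M m" "y \<in> hom_elts N n"
    then show "sym_act TT p (\<sigma> \<circ> \<tau>) (sym_act TT p \<pi> (S_tensor_gen R M N m n x y)) =
      sym_act TT p \<sigma> (sym_act TT p \<tau> (sym_act TT p \<pi> (S_tensor_gen R M N m n x y)))"
      using c[of \<sigma> m n "\<tau> \<circ> \<pi>" x y] c[of "\<sigma> \<circ> \<tau>" m n \<pi> x y] c[of \<tau> m n \<pi> x y] that
      by (simp add: permutes_compose o_assoc)
  qed (use that in \<open>auto simp: permutes_compose\<close>)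
qed

text \<open>Three universal properties in succession: bilinearity yields a map on each tensor
  product, the condition on Young subgroups makes these maps descend to the induced module, and the
  finitely many bidegrees are summed. \<open>\<phi>\<close> depends on \<open>\<pi>\<close> because
  the target carries no group action here.\<close>

lemma S_tensor_lift:
  assumes L: "module R L"
    and bil: "\<And>m n \<pi>. m + n = p \<Longrightarrow> \<pi> permutes {1..p} \<Longrightarrow> bilinear R (component M m) (component N n) L (\<phi> m n \<pi>)"
    and eqv: "\<And>m n \<pi> \<sigma> \<tau> x y. m + n = p \<Longrightarrow> \<pi> permutes {1..p} \<Longrightarrow> \<sigma> permutes {1..m} \<Longrightarrow> \<tau> permutes {1..n} \<Longrightarrow>
      x \<in> hom_elts M m \<Longrightarrow> y \<in> hom_elts N n \<Longrightarrow>
      \<phi> m n (\<pi> \<circ> perm_cross m (\<sigma>, \<tau>)) x y = \<phi> m n \<pi> (sym_act M m \<sigma> x) (sym_act N n \<tau> y)"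
  shows "\<exists>F\<in>linear_maps R (component TT p) L. \<forall>m n \<pi> x y. m + n = p \<longrightarrow> \<pi> permutes {1..p} \<longrightarrow>
    x \<in> hom_elts M m \<longrightarrow> y \<in> hom_elts N n \<longrightarrow> F (sym_act TT p \<pi> (S_tensor_gen R M N m n x y)) = \<phi> m n \<pi> x y"
proof -
  define \<psi> where "\<psi> = (\<lambda>m n \<pi>. presented_map R (hom_elts M m \<times> hom_elts N n)
    (tensor_rels R (component M m) (component N n)) L (\<lambda>(x, y). \<phi> m n \<pi> x y))"
  have \<psi>: "\<psi> m n \<pi> \<in> linear_maps R (T_mod m n) L"
    "\<And>x y. x \<in> hom_elts M m \<Longrightarrow> y \<in> hom_elts N n \<Longrightarrow> \<psi> m n \<pi> (T_gen m n x y) = \<phi> m n \<pi> x y"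
    if "m + n = p" "\<pi> permutes {1..p}" for m n \<pi>
    unfolding \<psi>_def using tensor_lift[OF mod_M mod_N L bil[OF that]] by auto
  have "\<exists>f\<in>linear_maps R (S_tensor_part R M N m n) L. \<forall>\<pi> v. \<pi> permutes {1..p} \<longrightarrow> v \<in> carrier (T_mod m n) \<longrightarrow>
    f (S_tensor_part_gen R M N m n \<pi> v) = \<psi> m n \<pi> v" if mn: "m + n = p" for m n
  proof -
    have act: "\<psi> m n (\<pi> \<circ> perm_cross m h) v = \<psi> m n \<pi> (tensor_young_act R M N m n h v)"
      if p: "\<pi> permutes {1..p}" and h: "h \<in> carrier (young_group m n)" and v: "v \<in> carrier (T_mod m n)" for \<pi> h v
    proof -
      have c: "\<pi> \<circ> perm_cross m h permutes {1..p}"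
        using funcset_mem[OF young_perm_cross h] mn p by (auto simp: sym_group_simps intro: permutes_compose)
      note a = linear_additive[OF _ T_mod_module L] linear_additive[OF _ T_mod_module T_mod_module]
      show ?thesis
      proof (rule tensor_ext[OF mod_M mod_N a(1)[OF \<psi>(1)[OF mn c]]
            additive_comp[OF a(2)[OF tensor_young_act(1)[OF h]] a(1)[OF \<psi>(1)[OF mn p]]] _ v])
        show "\<psi> m n (\<pi> \<circ> perm_cross m h) (T_gen m n x y) = \<psi> m n \<pi> (tensor_young_act R M N m n h (T_gen m n x y))"
          if "x \<in> hom_elts M m" "y \<in> hom_elts N n" for x y
          using that h p c eqv[OF mn p, of "fst h" "snd h" x y]
          by (auto simp: tensor_young_act \<psi>[OF mn] sym_group_simps S_module_closed[OF M] S_module_closed[OF N])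
      qed
    qed
    note pm = part_map[OF L, where \<phi> = "\<psi> m n" and m = m and n = n]
    show ?thesis
      using mn linear_closed[OF \<psi>(1)[OF mn]] linear_add[OF \<psi>(1)[OF mn]] linear_smult[OF \<psi>(1)[OF mn]] act
      by (intro bexI[OF _ pm(1)] allI impI pm(2)) (auto simp: sym_group_simps)
  qed
  then obtain f where f: "\<And>m n. m + n = p \<Longrightarrow> f m n \<in> linear_maps R (S_tensor_part R M N m n) L"
    "\<And>m n \<pi> v. m + n = p \<Longrightarrow> \<pi> permutes {1..p} \<Longrightarrow> v \<in> carrier (T_mod m n) \<Longrightarrow>
      f m n (S_tensor_part_gen R M N m n \<pi> v) = \<psi> m n \<pi> v"
    by metis
  obtain F where F: "F \<in> linear_maps R (direct_sum (bidegrees p) T_part) L"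
    "\<And>i w. i \<in> bidegrees p \<Longrightarrow> w \<in> carrier (T_part i) \<Longrightarrow> F (dsum_incl (bidegrees p) T_part i w) = (case i of (m, n) \<Rightarrow> f m n) w"
  proof -
    have "\<exists>F\<in>linear_maps R (direct_sum (bidegrees p) T_part) L. \<forall>i\<in>bidegrees p. \<forall>w\<in>carrier (T_part i).
        F (dsum_incl (bidegrees p) T_part i w) = (case i of (m, n) \<Rightarrow> f m n) w"
      using f(1) by (intro dsum_lift finite_bidegrees L module_T_part) auto
    then show thesis using that by blast
  qed
  show ?thesis
  proof (intro bexI allI impI)
    show "F \<in> linear_maps R (component TT p) L" using F(1) by (simp add: component_S_tensor)
    fix m n \<pi> x y assume *: "m + n = p" "\<pi> permutes {1..p}" "x \<in> hom_elts M m" "y \<in> hom_elts N n"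
    show "F (sym_act TT p \<pi> (S_tensor_gen R M N m n x y)) = \<phi> m n \<pi> x y"
      using * F(2)[of "(m, n)"] f(2)[of m n \<pi> "T_gen m n x y"] \<psi>[of m n \<pi>]
        sym_act_S_tensor_gen[of \<pi> m n x y] bilinearD(1)[OF tensor_gen_bilinear[OF mod_M mod_N]]
      by (simp add: part_gen_closed)
  qed
qed

lemma S_morphismD:
  assumes "f \<in> S_morphisms R TT L"
  shows "f p \<in> linear_maps R (component TT p) (component L p)"
    "\<sigma> permutes {1..p} \<Longrightarrow> u \<in> hom_elts TT p \<Longrightarrow> f p (sym_act TT p \<sigma> u) = sym_act L p \<sigma> (f p u)"
  using assms by (auto simp: S_morphisms_def sym_group_simps)

text \<open>Equivariance forces the value \<open>\<pi> B(x, y)\<close> on the translate by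
  \<open>\<pi>\<close>. The hypothesis on \<open>\<sigma>\<close> and \<open>\<tau>\<close> makes
  this independent of how a translate is written.\<close>

lemma S_morphism_exists:
  assumes L: "S_module R L"
    and bil: "\<And>m n. bilinear R (component M m) (component N n) (component L (m + n)) (B m n)"
    and eqv: "\<And>m n \<sigma> \<tau> x y. \<sigma> permutes {1..m} \<Longrightarrow> \<tau> permutes {1..n} \<Longrightarrow> x \<in> hom_elts M m \<Longrightarrow> y \<in> hom_elts N n \<Longrightarrow>
      B m n (sym_act M m \<sigma> x) (sym_act N n \<tau> y) = sym_act L (m + n) (perm_cross m (\<sigma>, \<tau>)) (B m n x y)"
  shows "\<exists>f\<in>S_morphisms R TT L. \<forall>m n. \<forall>x\<in>hom_elts M m. \<forall>y\<in>hom_elts N n.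
    f (m + n) (S_tensor_gen R M N m n x y) = B m n x y"
proof -
  note Lm = S_module_module[OF L] and Llin = S_module_linear[OF L]
  have "\<exists>F\<in>linear_maps R (component TT p) (component L p). \<forall>m n \<pi> x y. m + n = p \<longrightarrow> \<pi> permutes {1..p} \<longrightarrow>
    x \<in> hom_elts M m \<longrightarrow> y \<in> hom_elts N n \<longrightarrow>
    F (sym_act TT p \<pi> (S_tensor_gen R M N m n x y)) = sym_act L p \<pi> (B m n x y)" for p
  proof (rule S_tensor_lift[OF Lm])
    fix m n \<pi> assume *: "m + n = p" "\<pi> permutes {1..p}"
    show "bilinear R (component M m) (component N n) (component L p) (\<lambda>x y. sym_act L p \<pi> (B m n x y))"
      using * bilinearD[OF bil[of m n]] linear_closed[OF Llin[OF *(2)]] linear_add[OF Llin[OF *(2)]] linear_smult[OF Llin[OF *(2)]]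
      by (intro bilinearI) auto
    fix \<sigma> \<tau> x y assume **: "\<sigma> permutes {1..m}" "\<tau> permutes {1..n}" "x \<in> hom_elts M m" "y \<in> hom_elts N n"
    then show "sym_act L p (\<pi> \<circ> perm_cross m (\<sigma>, \<tau>)) (B m n x y) = sym_act L p \<pi> (B m n (sym_act M m \<sigma> x) (sym_act N n \<tau> y))"
      using * S_module_comp[OF L *(2), of "perm_cross m (\<sigma>, \<tau>)" "B m n x y"] perm_cross_permutes[OF **(1,2)] bilinearD(1)[OF bil[of m n]] eqv
      by auto
  qed
  then obtain f where f: "\<And>p. f p \<in> linear_maps R (component TT p) (component L p)"
    "\<And>p m n \<pi> x y. m + n = p \<Longrightarrow> \<pi> permutes {1..p} \<Longrightarrow> x \<in> hom_elts M m \<Longrightarrow> y \<in> hom_elts N n \<Longrightarrow>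
    f p (sym_act TT p \<pi> (S_tensor_gen R M N m n x y)) = sym_act L p \<pi> (B m n x y)"
    by metis
  have "f \<in> S_morphisms R TT L"
    unfolding S_morphisms_def
  proof (intro CollectI allI conjI ballI f(1))
    fix p \<sigma> u assume s: "\<sigma> \<in> carrier (sym_group p)" and u: "u \<in> hom_elts TT p"
    have s: "\<sigma> permutes {1..p}" using s by (simp add: sym_group_simps)
    note fa = linear_additive[OF f(1) module_S_tensor Lm]
    show "f p (sym_act TT p \<sigma> u) = sym_act L p \<sigma> (f p u)"
    proof (rule S_tensor_ext[OF additive_comp[OF S_module_additive[OF S_module_S_tensor s] fa]
          additive_comp[OF fa S_module_additive[OF L s]] _ u])
      fix m n \<pi> x y assume *: "p = m + n" "\<pi> permutes {1..p}" "x \<in> hom_elts M m" "y \<in> hom_elts N n"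
      then show "f p (sym_act TT p \<sigma> (sym_act TT p \<pi> (S_tensor_gen R M N m n x y))) =
        sym_act L p \<sigma> (f p (sym_act TT p \<pi> (S_tensor_gen R M N m n x y)))"
        using s S_module_comp[OF S_module_S_tensor s, of \<pi> "S_tensor_gen R M N m n x y"]
          S_module_comp[OF L s, of \<pi> "B m n x y"] f(2)[of m n p "\<sigma> \<circ> \<pi>" x y] f(2)[of m n p \<pi> x y] bilinearD(1)[OF bil[of m n]]
        by (auto simp: S_tensor_gen_closed permutes_compose)
    qed
  qed
  moreover have "f (m + n) (S_tensor_gen R M N m n x y) = B m n x y" if "x \<in> hom_elts M m" "y \<in> hom_elts N n" for m n x y
    using that f(2)[of m n "m + n" id x y] S_module_one[OF S_module_S_tensor S_tensor_gen_closed]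
      S_module_one[OF L bilinearD(1)[OF bil[of m n]]]
    by (simp add: permutes_id)
  ultimately show ?thesis by blast
qed

text \<open>The components are extensional, so agreement on generators gives equality of functions
  and not only on the carriers. The uniqueness claims of the theorem depend on this.\<close>

lemma S_morphism_eqI:
  assumes L: "S_module R L" and f: "f \<in> S_morphisms R TT L" and h: "h \<in> S_morphisms R TT L"
    and eq: "\<And>m n x y. x \<in> hom_elts M m \<Longrightarrow> y \<in> hom_elts N n \<Longrightarrow>
      f (m + n) (S_tensor_gen R M N m n x y) = h (m + n) (S_tensor_gen R M N m n x y)"
  shows "f = h"
proof (rule ext, rule linear_eqI[OF S_morphismD(1)[OF f] S_morphismD(1)[OF h]])
  fix p u assume u: "u \<in> hom_elts TT p"
  note a = linear_additive[OF S_morphismD(1) module_S_tensor S_module_module[OF L]]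
  show "f p u = h p u"
    by (rule S_tensor_ext[OF a[OF f] a[OF h] _ u]) (auto simp: S_morphismD(2)[OF f] S_morphismD(2)[OF h] S_tensor_gen_closed eq)
qed

end

end

section \<open>Completing partial injections to permutations\<close>

section \<open>Extending and comparing permutations\<close>

text \<open>In a finite set the complements of the domain and of the image of an injection have
  equally many elements and can be matched.\<close>

lemma permutes_extension:
  assumes S: "finite S" and A: "A \<subseteq> S" and f: "inj_on f A" "f ` A \<subseteq> S"
  shows "\<exists>\<pi>. \<pi> permutes S \<and> (\<forall>x\<in>A. \<pi> x = f x)"
proof -
  have "card (S - A) = card (S - f ` A)"
    using S A f by (simp add: card_Diff_subset finite_subset card_image)
  then obtain h where h: "bij_betw h (S - A) (S - f ` A)"
    using S by (meson finite_Diff finite_same_card_bij)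
  let ?\<pi> = "\<lambda>x. if x \<in> A then f x else if x \<in> S then h x else x"
  have "bij_betw ?\<pi> (A \<union> (S - A)) (f ` A \<union> (S - f ` A))"
  proof (rule bij_betw_combine)
    show "bij_betw ?\<pi> A (f ` A)" using f by (simp add: bij_betw_def inj_on_def)
    show "bij_betw ?\<pi> (S - A) (S - f ` A)" using h by (subst bij_betw_cong[of _ _ h]) auto
  qed auto
  moreover have "A \<union> (S - A) = S" "f ` A \<union> (S - f ` A) = S" using A f by auto
  ultimately have "?\<pi> permutes S" using A by (intro bij_imp_permutes) auto
  then show ?thesis by (intro exI[of _ ?\<pi>]) auto
qed

text \<open>Meant for the quotient of two completions of the same placement: such a permutation
  fixes the labels and \<open>s\<close> and can only move the positions of \<open>t\<close>.\<close>

lemma permutes_fix_prefix: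
  assumes \<delta>: "\<delta> permutes {1..k + n}" and pre: "\<And>j. j \<in> {1..k} \<Longrightarrow> \<delta> j = j"
  shows "\<exists>\<tau>. \<tau> permutes {1..n} \<and> \<delta> = perm_cross k (id, \<tau>)"
proof (intro exI conjI)
  let ?\<tau> = "\<lambda>j. if j \<in> {1..n} then \<delta> (k + j) - k else j"
  have r: "\<delta> (k + j) > k \<and> \<delta> (k + j) \<le> k + n" if "j \<in> {1..n}" for j
  proof -
    have "\<delta> (k + j) \<in> {1..k + n}" using permutes_in_image[OF \<delta>, of "k + j"] that by auto
    moreover have "\<delta> (k + j) \<notin> {1..k}"
    proof
      assume *: "\<delta> (k + j) \<in> {1..k}"
      then have "\<delta> (\<delta> (k + j)) = \<delta> (k + j)" by (rule pre)
      then have "\<delta> (k + j) = k + j" using permutes_inj[OF \<delta>] by (meson injD)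
      with * that show False by auto
    qed
    ultimately show ?thesis by auto
  qed
  have "inj_on ?\<tau> {1..n}"
  proof (rule inj_onI)
    fix i j assume ij: "i \<in> {1..n}" "j \<in> {1..n}" "?\<tau> i = ?\<tau> j"
    then have "\<delta> (k + i) = \<delta> (k + j)" using r[OF ij(1)] r[OF ij(2)] by (simp add: eq_diff_iff)
    then show "i = j" using permutes_inj[OF \<delta>] by (metis add_left_cancel injD)
  qed
  moreover have "?\<tau> ` {1..n} \<subseteq> {1..n}"
  proof
    fix y assume "y \<in> ?\<tau> ` {1..n}"
    then obtain j where j: "j \<in> {1..n}" "y = \<delta> (k + j) - k" by auto
    then show "y \<in> {1..n}" using r[OF j(1)] by auto
  qed
  ultimately have "bij_betw ?\<tau> {1..n} {1..n}"
    unfolding bij_betw_def using endo_inj_surj[OF finite_atLeastAtMost] by blast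
  then show "?\<tau> permutes {1..n}" by (rule bij_imp_permutes) auto
  show "\<delta> = perm_cross k (id, ?\<tau>)"
  proof
    fix i
    show "\<delta> i = perm_cross k (id, ?\<tau>) i"
    proof (cases "i \<in> {1..k + n}")
      case True
      then show ?thesis using pre[of i] r[of "i - k"] by (auto simp: perm_cross_def)
    next
      case False
      then show ?thesis using permutes_not_in[OF \<delta>, of i] by (auto simp: perm_cross_def)
    qed
  qed
qed

lemma perm_cross_permutes_Suc: "\<sigma> permutes {1..a} \<Longrightarrow> perm_cross a (\<sigma>, id) permutes {1..Suc a}"
  using perm_cross_permutes[of \<sigma> a id 1] by (simp add: permutes_id Suc_eq_plus1)

section \<open>The suspension over \<open>k[t]\<close> presented by placements\<close>

section \<open>The suspension and its polynomial extension\<close>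

text \<open>
  \<open>placed p a f i\<close>: the labels \<open>1, \<dots>, a\<close> of an element of \<open>g\<close> are placed at \<open>f 1, \<dots>, f a\<close> and the
  parameter \<open>s\<close> at \<open>i\<close> among \<open>p\<close> positions; the other positions are filled with \<open>t\<close>.
\<close>

definition placed :: "nat \<Rightarrow> nat \<Rightarrow> (nat \<Rightarrow> nat) \<Rightarrow> nat \<Rightarrow> bool"
  where "placed p a f i \<longleftrightarrow> inj_on f {1..a} \<and> f ` {1..a} \<subseteq> {1..p} \<and> i \<in> {1..p} \<and> i \<notin> f ` {1..a}"

text \<open>A completion of the placement to a permutation of all positions, with \<open>s\<close>
  as label number \<open>a + 1\<close>. The order given to the remaining positions is arbitrary;
  \<open>act_susp_t_gen\<close> shows that it does not matter.\<close>

definition placing :: "nat \<Rightarrow> nat \<Rightarrow> (nat \<Rightarrow> nat) \<Rightarrow> nat \<Rightarrow> nat \<Rightarrow> nat"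
  where "placing p a f i = (SOME \<pi>. \<pi> permutes {1..p} \<and> (\<forall>j\<in>{1..a}. \<pi> j = f j) \<and> \<pi> (Suc a) = i)"

lemma placed_Suc_le: "placed p a f i \<Longrightarrow> Suc a \<le> p"
proof -
  assume p: "placed p a f i"
  have "Suc a = card (insert i (f ` {1..a}))" using p by (simp add: placed_def card_image)
  also have "\<dots> \<le> card {1..p}" using p by (intro card_mono) (auto simp: placed_def)
  finally show ?thesis by simp
qed

lemma placing:
  assumes "placed p a f i"
  shows "placing p a f i permutes {1..p}" "j \<in> {1..a} \<Longrightarrow> placing p a f i j = f j" "placing p a f i (Suc a) = i"
proof -
  \<comment> \<open>\<open>s\<close> is appended as one more label, so that a single injection has
    to be completed.\<close>
  let ?f = "\<lambda>j. if j = Suc a then i else f j"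
  have im: "?f ` {1..a} = f ` {1..a}" by (intro image_cong) auto
  have "inj_on ?f {1..a} = inj_on f {1..a}" by (intro inj_on_cong) auto
  then have "inj_on ?f {1..a}" using assms by (simp add: placed_def)
  then have "inj_on ?f (insert (Suc a) {1..a})"
    unfolding inj_on_insert using assms im by (simp add: placed_def)
  moreover have "?f ` insert (Suc a) {1..a} \<subseteq> {1..p}"
    unfolding image_insert im using assms by (simp add: placed_def)
  moreover have "insert (Suc a) {1..a} \<subseteq> {1..p}" using placed_Suc_le[OF assms] by auto
  ultimately have "\<exists>\<pi>. \<pi> permutes {1..p} \<and> (\<forall>x\<in>insert (Suc a) {1..a}. \<pi> x = ?f x)"
    by (intro permutes_extension finite_atLeastAtMost)
  then obtain \<pi> where "\<pi> permutes {1..p}" "\<forall>x\<in>insert (Suc a) {1..a}. \<pi> x = ?f x" by blast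
  then have "\<exists>\<pi>. \<pi> permutes {1..p} \<and> (\<forall>j\<in>{1..a}. \<pi> j = f j) \<and> \<pi> (Suc a) = i"
    by (intro exI[of _ \<pi>]) auto
  then have *: "placing p a f i permutes {1..p} \<and> (\<forall>j\<in>{1..a}. placing p a f i j = f j) \<and> placing p a f i (Suc a) = i"
    unfolding placing_def by (rule someI_ex)
  show "placing p a f i permutes {1..p}" "j \<in> {1..a} \<Longrightarrow> placing p a f i j = f j" "placing p a f i (Suc a) = i"
    using * by auto
qed

lemma placed_permutes:
  assumes "\<pi> permutes {1..p}" "Suc a \<le> p"
  shows "placed p a \<pi> (\<pi> (Suc a))"
proof -
  have "\<pi> (Suc a) \<notin> \<pi> ` {1..a}"
    using permutes_inj[OF assms(1)] by (simp add: inj_image_mem_iff)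
  moreover have "\<pi> ` {1..a} \<subseteq> {1..p}" "\<pi> (Suc a) \<in> {1..p}"
    using assms permutes_image[OF assms(1)] permutes_in_image[OF assms(1), of "Suc a"] by auto
  ultimately show ?thesis using permutes_inj_on[OF assms(1)] by (simp add: placed_def)
qed

lemma placed_comp:
  assumes "placed p a f i" "\<rho> permutes {1..p}"
  shows "placed p a (\<rho> \<circ> f) (\<rho> i)"
proof -
  have "\<rho> i \<notin> \<rho> ` f ` {1..a}"
    using assms(1) permutes_inj[OF assms(2)] by (simp add: placed_def inj_image_mem_iff)
  moreover have "\<rho> ` f ` {1..a} \<subseteq> {1..p}" "\<rho> i \<in> {1..p}"
    using assms(1) image_mono[of "f ` {1..a}" "{1..p}" \<rho>] permutes_image[OF assms(2)] permutes_in_image[OF assms(2), of i]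
    by (simp_all add: placed_def)
  ultimately show ?thesis
    using assms(1) permutes_inj_on[OF assms(2)] by (auto simp: placed_def image_comp intro: comp_inj_on)
qed

lemma placed_rearrange:
  assumes "placed p a f i" "\<sigma> permutes {1..a}"
  shows "placed p a (f \<circ> \<sigma>) i"
proof -
  have "inj_on (f \<circ> \<sigma>) {1..a}"
    using assms permutes_image[OF assms(2)] by (intro comp_inj_on) (auto simp: placed_def permutes_inj_on)
  moreover have "(f \<circ> \<sigma>) ` {1..a} = f ` {1..a}" by (metis assms(2) image_comp permutes_image)
  ultimately show ?thesis using assms(1) unfolding placed_def by simp
qed

lemma placed_cong: "(\<And>j. j \<in> {1..a} \<Longrightarrow> f j = h j) \<Longrightarrow> placed p a f i = placed p a h i"
  using inj_on_cong[of "{1..a}" f h] image_cong[of "{1..a}" "{1..a}" f h] by (simp add: placed_def)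

context cring
begin

lemma S_module_poly_t: "S_module R (poly_t R)"
proof (rule S_moduleI)
  show "module R (component (poly_t R) m)" for m
    by (intro moduleI abelian_groupI is_cring)
      (auto simp: poly_t_def a_ac m_assoc l_distr r_distr l_neg intro!: bexI[of _ "\<ominus> _"])
qed (auto simp: poly_t_def linear_maps_def)

lemma poly_t_simps:
  "component (poly_t R) (Suc n) = component (poly_t R) n" "hom_elts (poly_t R) n = carrier R"
  "sym_act (poly_t R) (Suc n) \<tau> = sym_act (poly_t R) n \<tau>"
  "c \<in> carrier R \<Longrightarrow> sym_act (poly_t R) n \<tau> c = c"
  "c \<odot>\<^bsub>component (poly_t R) n\<^esub> d = c \<otimes> d"
  "c \<oplus>\<^bsub>component (poly_t R) n\<^esub> d = c \<oplus> d"
  by (simp_all add: poly_t_def)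

end

locale S_module_over = cring R for R (structure) +
  fixes g :: "('a, 'm) smodule"
  assumes g: "S_module R g"
begin

abbreviation (input) "Sg \<equiv> suspension R g"
abbreviation (input) "Kt \<equiv> poly_t R"
abbreviation (input) "T \<equiv> suspension_t R g"

abbreviation (input) "susp_gen a \<equiv> ind_gen R (sym_group (Suc a)) (young_group a 1) (perm_cross a)
  (component g a) (\<lambda>(\<sigma>, \<tau>). sym_act g a \<sigma>)"

lemma susp_ind:
  "group (sym_group (Suc a))" "perm_cross a \<in> carrier (young_group a 1) \<rightarrow> carrier (sym_group (Suc a))"
  "module R (component g a)"
  "(\<lambda>(\<sigma>, \<tau>). sym_act g a \<sigma>) \<in> carrier (young_group a 1) \<rightarrow> hom_elts g a \<rightarrow> hom_elts g a"
  using young_perm_cross[of a 1]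
  by (auto simp: Suc_eq_plus1 sym_group_is_group S_module_module[OF g] S_module_closed[OF g] sym_group_simps)

lemma susp_component:
  "component Sg 0 = presented_module R {} {}"
  "component Sg (Suc a) = ind_module R (sym_group (Suc a)) (young_group a 1) (perm_cross a)
    (component g a) (\<lambda>(\<sigma>, \<tau>). sym_act g a \<sigma>)"
  "sym_act Sg 0 \<rho> = (\<lambda>u\<in>hom_elts Sg 0. u)"
  "sym_act Sg (Suc a) \<rho> = ind_act R (sym_group (Suc a)) (young_group a 1) (perm_cross a)
    (component g a) (\<lambda>(\<sigma>, \<tau>). sym_act g a \<sigma>) \<rho>"
  by (simp_all add: suspension_def)

text \<open>There are no generators in degree 0, so sums and multiples never leave zero.\<close>

lemma susp_zero: "u \<in> hom_elts Sg 0 \<Longrightarrow> u = \<zero>\<^bsub>component Sg 0\<^esub>"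
proof -
  interpret P: module R "presented_module R {} {}" by (rule module_presented) simp
  show "u \<in> hom_elts Sg 0 \<Longrightarrow> u = \<zero>\<^bsub>component Sg 0\<^esub>"
    unfolding susp_component
    by (induction rule: presented_induct[OF empty_subsetI, consumes 1, case_names zero add smult gen]) auto
qed

lemma S_module_suspension: "S_module R Sg"
proof (rule S_moduleI)
  note P = module_presented[of "{}" "{}", OF empty_subsetI]
  show "module R (component Sg m)" for m
    by (cases m) (auto simp: susp_component P module_ind[OF susp_ind])
  show "sym_act Sg m \<sigma> \<in> linear_maps R (component Sg m) (component Sg m)"
    if "\<sigma> permutes {1..m}" for m \<sigma>
  proof (cases m)
    case 0
    interpret P: module R "presented_module R {} {}" by (rule P)
    show ?thesis unfolding 0 susp_component by (rule linear_mapsI'[OF P]) auto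
  next
    case (Suc a)
    then show ?thesis using that ind_act(1)[OF susp_ind, of \<sigma> a] by (simp add: susp_component sym_group_simps)
  qed
  show "sym_act Sg m id x = x" if "x \<in> hom_elts Sg m" for m x
    using that ind_act_one[OF susp_ind] by (cases m) (auto simp: susp_component sym_group_simps)
  show "sym_act Sg m (\<sigma> \<circ> \<tau>) x = sym_act Sg m \<sigma> (sym_act Sg m \<tau> x)"
    if "\<sigma> permutes {1..m}" "\<tau> permutes {1..m}" "x \<in> hom_elts Sg m" for m \<sigma> \<tau> x
    using that ind_act_mult[OF susp_ind, of \<sigma> _ \<tau>] by (cases m) (auto simp: susp_component sym_group_simps)
qed

lemmas susp_poly_S_modules = S_module_suspension S_module_poly_t

lemma S_module_T: "S_module R T"
  unfolding suspension_t_def by (rule S_module_S_tensor[OF susp_poly_S_modules])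

lemma T_module: "module R (component T p)"
  by (rule S_module_module[OF S_module_T])

text \<open>The element \<open>x s t^n\<close> in standard position: the labels of \<open>x\<close>
  first, then \<open>s\<close> at \<open>a + 1\<close>, then the \<open>t\<close>'s.\<close>

abbreviation (input) "t_gen a n x \<equiv> S_tensor_gen R Sg Kt (Suc a) n (susp_gen a id x) \<one>"

lemma susp_gen_closed: "susp_gen a \<pi> x \<in> hom_elts Sg (Suc a)"
  unfolding susp_component by (rule ind_gen_closed[OF susp_ind])

lemma susp_t_gen_closed: "t_gen a n x \<in> hom_elts T (Suc a + n)"
  unfolding suspension_t_def by (rule S_tensor_gen_closed[OF susp_poly_S_modules susp_gen_closed]) (simp add: poly_t_simps)

lemma susp_t_gen_additive: "additive (component g a) (component T (Suc a + n)) (t_gen a n)"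
proof -
  have "additive (component g a) (component Sg (Suc a)) (susp_gen a id)"
    using ind_gen_closed[OF susp_ind] ind_gen_add[OF susp_ind, of id] S_module_suspension
    by (intro additiveI) (auto simp: susp_component(2)[symmetric] sym_group_simps permutes_id
        intro!: module_abelian_group[where R = R] S_module_module g)
  from additive_comp[OF this bilinear_additive(2)[OF S_tensor_gen_bilinear[OF susp_poly_S_modules]]]
  show ?thesis
    unfolding suspension_t_def
    by (auto simp: poly_t_simps intro: S_module_module[OF S_module_suspension] S_module_module[OF S_module_poly_t] module_S_tensor[OF susp_poly_S_modules])
qed

lemma susp_t_gen_smult:
  assumes "c \<in> carrier R" "x \<in> hom_elts g a"
  shows "t_gen a n (c \<odot>\<^bsub>component g a\<^esub> x) = c \<odot>\<^bsub>component T (Suc a + n)\<^esub> t_gen a n x"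
proof -
  have "susp_gen a id (c \<odot>\<^bsub>component g a\<^esub> x) = c \<odot>\<^bsub>component Sg (Suc a)\<^esub> susp_gen a id x"
    unfolding susp_component using assms by (intro ind_gen_smult[OF susp_ind]) (auto simp: sym_group_simps permutes_id)
  then show ?thesis
    unfolding suspension_t_def
    using bilinearD(4)[OF S_tensor_gen_bilinear[OF susp_poly_S_modules] assms(1) susp_gen_closed] by (simp add: poly_t_simps)
qed

text \<open>Of the subgroup \<open>S_a x S_1 x S_n\<close> only the first factor is felt: it acts on
  \<open>x\<close>, the middle one is trivial, and \<open>S_n\<close> fixes \<open>t^n\<close>. All
  identifications between placements come from here.\<close>

lemma susp_t_gen_stabilizer:
  assumes "\<sigma> permutes {1..a}" "\<tau> permutes {1..n}" "x \<in> hom_elts g a"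
  shows "sym_act T (Suc a + n) (perm_cross (Suc a) (perm_cross a (\<sigma>, id), \<tau>)) (t_gen a n x) =
    t_gen a n (sym_act g a \<sigma> x)"
proof -
  have p: "perm_cross a (\<sigma>, id) permutes {1..Suc a}"
    by (rule perm_cross_permutes_Suc[OF assms(1)])
  have "susp_gen a (perm_cross a (\<sigma>, id)) x = susp_gen a id (sym_act g a \<sigma> x)"
    using ind_gen_act[OF susp_ind, of id a "(\<sigma>, id)" x] assms by (simp add: sym_group_simps permutes_id)
  moreover have "sym_act Sg (Suc a) (perm_cross a (\<sigma>, id)) (susp_gen a id x) = susp_gen a (perm_cross a (\<sigma>, id)) x"
    unfolding susp_component
    using ind_act(2)[OF susp_ind, of "perm_cross a (\<sigma>, id)" a id x] assms p by (simp add: sym_group_simps permutes_id)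
  ultimately show ?thesis
    unfolding suspension_t_def
    using S_tensor_gen_equivariant[OF susp_poly_S_modules p assms(2) susp_gen_closed, of \<one> id x] by (simp add: poly_t_simps)
qed

lemma susp_zero_tensor:
  assumes "u \<in> hom_elts Sg 0" "c \<in> carrier R"
  shows "S_tensor_gen R Sg Kt 0 n u c = \<zero>\<^bsub>component T n\<^esub>"
proof -
  interpret P: module R "presented_module R {} {}" by (rule module_presented) simp
  interpret T: module R "component T n" by (rule T_module)
  \<comment> \<open>Written as a multiple by the scalar zero, \<open>u\<close> can be pulled out by
    bilinearity.\<close>
  have "u = \<zero> \<odot>\<^bsub>component Sg 0\<^esub> u"
    using assms(1) susp_zero[OF assms(1)] by (simp add: susp_component)
  then show ?thesis
    using bilinearD(4)[OF S_tensor_gen_bilinear[OF susp_poly_S_modules], of \<zero> u 0 c n] bilinearD(1)[OF S_tensor_gen_bilinear[OF susp_poly_S_modules], of u 0 c n] assms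
    by (simp add: poly_t_simps suspension_t_def[symmetric])
qed

text \<open>Two kinds of redundancy are removed from the generators of the tensor product: the
  coefficient of \<open>t^n\<close> moves into \<open>x\<close>, and a permutation applied inside
  the suspension is absorbed by the outer \<open>\<pi>\<close>.\<close>

lemma susp_t_induct_gen:
  assumes u: "u \<in> hom_elts T p" and zero: "Q \<zero>\<^bsub>component T p\<^esub>"
    and add: "\<And>u v. u \<in> hom_elts T p \<Longrightarrow> v \<in> hom_elts T p \<Longrightarrow> Q u \<Longrightarrow> Q v \<Longrightarrow>
      Q (u \<oplus>\<^bsub>component T p\<^esub> v)"
    and gen: "\<And>a n \<pi> x. p = Suc a + n \<Longrightarrow> \<pi> permutes {1..p} \<Longrightarrow> x \<in> hom_elts g a \<Longrightarrow>
      Q (sym_act T p \<pi> (t_gen a n x))"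
  shows "Q u"
  using u[unfolded suspension_t_def]
proof (induction rule: S_tensor_induct[OF susp_poly_S_modules, consumes 1, case_names zero add gen])
  case (gen m n \<pi> u c)
  have c: "c \<in> carrier R" using gen by (simp add: poly_t_simps)
  interpret T: module R "component T p" by (rule T_module)
  note act = S_module_additive[OF S_module_T gen(2)]
  note B = S_tensor_gen_bilinear[OF susp_poly_S_modules, of m n, folded suspension_t_def]
  \<comment> \<open>For fixed \<open>c\<close> and \<open>\<pi>\<close> the generator is additive in
    \<open>u\<close>, so the induction can be continued inside the suspension.\<close>
  let ?f = "\<lambda>u. sym_act T p \<pi> (S_tensor_gen R Sg Kt m n u c)"
  have add_f: "additive (component Sg m) (component T p) ?f"
    using gen(1,4) by (intro additive_comp[OF bilinear_additive(2)[OF B] act[unfolded gen(1)], folded gen(1)])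
      (auto simp: S_module_module[OF S_module_suspension] S_module_module[OF S_module_poly_t] T_module)
  show ?case
  proof (cases m)
    case 0
    then show ?thesis using susp_zero_tensor[of u c n] gen c zero additive_zero[OF act]
      by (simp add: suspension_t_def[symmetric])
  next
    case (Suc a)
    have "Q (?f u)" using gen(3) unfolding Suc susp_component(2)
    proof (induction rule: ind_induct[OF susp_ind, consumes 1, case_names zero add gen])
      case zero
      then show ?case using additive_zero[OF add_f] assms(2) by (simp add: Suc susp_component)
    next
      case (add u v)
      then show ?case
        using assms(3) additive_add[OF add_f, of u v] additive_closed[OF add_f] by (simp add: Suc susp_component)
    next
      case (gen \<sigma> x)
      interpret Mg: module R "component g a" by (rule S_module_module[OF g])
      have s: "\<sigma> permutes {1..Suc a}" using gen by (simp add: sym_group_simps)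
      have x: "susp_gen a \<sigma> (c \<odot>\<^bsub>component g a\<^esub> x) = c \<odot>\<^bsub>component Sg (Suc a)\<^esub> susp_gen a \<sigma> x"
        unfolding susp_component using gen c by (intro ind_gen_smult[OF susp_ind])
      have "S_tensor_gen R Sg Kt (Suc a) n (susp_gen a \<sigma> x) c =
          S_tensor_gen R Sg Kt (Suc a) n (susp_gen a \<sigma> (c \<odot>\<^bsub>component g a\<^esub> x)) \<one>"
        unfolding x using bilinearD(4)[OF B, of c "susp_gen a \<sigma> x" \<one>] bilinearD(5)[OF B, of c "susp_gen a \<sigma> x" \<one>] Suc c
          susp_gen_closed by (simp add: poly_t_simps)
      also have "susp_gen a \<sigma> (c \<odot>\<^bsub>component g a\<^esub> x) =
          sym_act Sg (Suc a) \<sigma> (susp_gen a id (c \<odot>\<^bsub>component g a\<^esub> x))"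
        unfolding susp_component using gen c ind_act(2)[OF susp_ind, of \<sigma> a id] by (simp add: sym_group_simps permutes_id)
      also have "S_tensor_gen R Sg Kt (Suc a) n \<dots> \<one> =
          sym_act T p (perm_cross (Suc a) (\<sigma>, id)) (t_gen a n (c \<odot>\<^bsub>component g a\<^esub> x))"
        using S_tensor_gen_equivariant[OF susp_poly_S_modules s permutes_id susp_gen_closed, of \<one> n] \<open>p = m + n\<close> Suc
        by (simp add: poly_t_simps suspension_t_def)
      finally have "?f (susp_gen a \<sigma> x) = sym_act T p (\<pi> \<circ> perm_cross (Suc a) (\<sigma>, id)) (t_gen a n (c \<odot>\<^bsub>component g a\<^esub> x))"
        using S_module_comp[OF S_module_T \<open>\<pi> permutes {1..p}\<close>] perm_cross_permutes[OF s permutes_id, of n] susp_t_gen_closed[of a n] \<open>p = m + n\<close> Suc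
        by simp
      then show ?case
        using assms(4)[of a n "\<pi> \<circ> perm_cross (Suc a) (\<sigma>, id)" "c \<odot>\<^bsub>component g a\<^esub> x"] gen c \<open>p = m + n\<close> Suc \<open>\<pi> permutes {1..p}\<close>
          perm_cross_permutes[OF s permutes_id, of n]
        by (simp add: permutes_compose)
    qed
    then show ?thesis by (simp add: suspension_t_def)
  qed
qed (use assms in \<open>simp_all add: suspension_t_def\<close>)

text \<open>Since the suspension is itself induced, a second descent is nested in the first:
  \<open>\<psi>\<close> handles the inner induction from \<open>S_a x S_1\<close>, and
  \<open>\<Phi>\<close> adds the coefficient of \<open>t^n\<close>. The condition \<open>eqv\<close>
  is invariance under the stabilizer found above.\<close>

lemma susp_t_lift_gen:
  assumes L: "module R L"
    and lin: "\<And>a n \<pi>. p = Suc a + n \<Longrightarrow> \<pi> permutes {1..p} \<Longrightarrow>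
      (\<lambda>x\<in>hom_elts g a. \<phi> a n \<pi> x) \<in> linear_maps R (component g a) L"
    and eqv: "\<And>a n \<pi> \<sigma> \<tau> x. p = Suc a + n \<Longrightarrow> \<pi> permutes {1..p} \<Longrightarrow> \<sigma> permutes {1..a} \<Longrightarrow> \<tau> permutes {1..n} \<Longrightarrow>
      x \<in> hom_elts g a \<Longrightarrow>
      \<phi> a n (\<pi> \<circ> perm_cross (Suc a) (perm_cross a (\<sigma>, id), \<tau>)) x = \<phi> a n \<pi> (sym_act g a \<sigma> x)"
  shows "\<exists>F\<in>linear_maps R (component T p) L. \<forall>a n \<pi> x. p = Suc a + n \<longrightarrow> \<pi> permutes {1..p} \<longrightarrow>
    x \<in> hom_elts g a \<longrightarrow> F (sym_act T p \<pi> (t_gen a n x)) = \<phi> a n \<pi> x"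
proof -
  interpret L: module R L by (rule L)
  define \<psi> where "\<psi> = (\<lambda>a n \<pi>. ind_map R (sym_group (Suc a)) (young_group a 1) (perm_cross a)
    (component g a) (\<lambda>(\<sigma>, \<tau>). sym_act g a \<sigma>) L (\<lambda>\<sigma> x. \<phi> a n (\<pi> \<circ> perm_cross (Suc a) (\<sigma>, id)) x))"
  have \<psi>: "\<psi> a n \<pi> \<in> linear_maps R (component Sg (Suc a)) L"
    "\<And>\<sigma> x. \<sigma> permutes {1..Suc a} \<Longrightarrow> x \<in> hom_elts g a \<Longrightarrow>
      \<psi> a n \<pi> (susp_gen a \<sigma> x) = \<phi> a n (\<pi> \<circ> perm_cross (Suc a) (\<sigma>, id)) x"
    if p: "p = Suc a + n" and \<pi>: "\<pi> permutes {1..p}" for a n \<pi>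
  proof -
    interpret Mg: module R "component g a" by (rule S_module_module[OF g])
    have pc: "\<pi> \<circ> perm_cross (Suc a) (\<sigma>, id) permutes {1..p}" if "\<sigma> permutes {1..Suc a}" for \<sigma>
      using p \<pi> perm_cross_permutes[OF that permutes_id, of n] by (simp add: permutes_compose)
    have act: "\<phi> a n (\<pi> \<circ> perm_cross (Suc a) (\<sigma> \<circ> perm_cross a (\<rho>, \<tau>), id)) x =
        \<phi> a n (\<pi> \<circ> perm_cross (Suc a) (\<sigma>, id)) (sym_act g a \<rho> x)"
      if "\<sigma> permutes {1..Suc a}" "\<rho> permutes {1..a}" "\<tau> permutes {1..1}" "x \<in> hom_elts g a" for \<sigma> \<rho> \<tau> x
    proof -
      \<comment> \<open>The factor \<open>S_1\<close> belonging to \<open>s\<close> is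
        trivial.\<close>
      have "\<tau> = id" using that(3) by simp
      moreover have "perm_cross (Suc a) (\<sigma>, id) \<circ> perm_cross (Suc a) (perm_cross a (\<rho>, id), id) =
          perm_cross (Suc a) (\<sigma> \<circ> perm_cross a (\<rho>, id), id)"
        using perm_cross_comp[OF _ permutes_id, of "perm_cross a (\<rho>, id)" "Suc a" \<sigma> id]
          perm_cross_permutes_Suc[OF that(2)] by simp
      ultimately show ?thesis
        using eqv[OF p pc[OF that(1)] that(2) permutes_id that(4)] by (simp add: o_assoc[symmetric])
    qed
    note l = lin[OF p pc]
    have l_at: "\<phi> a n (\<pi> \<circ> perm_cross (Suc a) (\<sigma>, id)) x \<in> carrier L"
      "y \<in> hom_elts g a \<Longrightarrow> \<phi> a n (\<pi> \<circ> perm_cross (Suc a) (\<sigma>, id)) (x \<oplus>\<^bsub>component g a\<^esub> y) =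
        \<phi> a n (\<pi> \<circ> perm_cross (Suc a) (\<sigma>, id)) x \<oplus>\<^bsub>L\<^esub> \<phi> a n (\<pi> \<circ> perm_cross (Suc a) (\<sigma>, id)) y"
      "c \<in> carrier R \<Longrightarrow> \<phi> a n (\<pi> \<circ> perm_cross (Suc a) (\<sigma>, id)) (c \<odot>\<^bsub>component g a\<^esub> x) =
        c \<odot>\<^bsub>L\<^esub> \<phi> a n (\<pi> \<circ> perm_cross (Suc a) (\<sigma>, id)) x"
      if "\<sigma> permutes {1..Suc a}" "x \<in> hom_elts g a" for \<sigma> x y c
      using linear_closed[OF l[OF that(1)], of x] linear_add[OF l[OF that(1)], of x y] linear_smult[OF l[OF that(1)], of c x] that
      by simp_all
    note im = ind_map[OF susp_ind L, of a "\<lambda>\<sigma> x. \<phi> a n (\<pi> \<circ> perm_cross (Suc a) (\<sigma>, id)) x", folded \<psi>_def]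
    show "\<psi> a n \<pi> \<in> linear_maps R (component Sg (Suc a)) L"
      unfolding susp_component \<psi>_def by (rule im[folded \<psi>_def, unfolded \<psi>_def]) (auto simp: sym_group_simps l_at act)
    show "\<psi> a n \<pi> (susp_gen a \<sigma> x) = \<phi> a n (\<pi> \<circ> perm_cross (Suc a) (\<sigma>, id)) x"
      if "\<sigma> permutes {1..Suc a}" "x \<in> hom_elts g a" for \<sigma> x
      unfolding \<psi>_def by (rule im[folded \<psi>_def, unfolded \<psi>_def]) (use that in \<open>auto simp: sym_group_simps l_at act\<close>)
  qed
  \<comment> \<open>In degree 0 the suspension vanishes, so zero is the only possible value
    there.\<close>
  define \<Phi> where "\<Phi> = (\<lambda>m n \<pi> u c. case m of 0 \<Rightarrow> \<zero>\<^bsub>L\<^esub> | Suc a \<Rightarrow> c \<odot>\<^bsub>L\<^esub> \<psi> a n \<pi> u)"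
  have "\<exists>F\<in>linear_maps R (component (S_tensor R Sg Kt) p) L. \<forall>m n \<pi> u c. m + n = p \<longrightarrow> \<pi> permutes {1..p} \<longrightarrow>
    u \<in> hom_elts Sg m \<longrightarrow> c \<in> hom_elts Kt n \<longrightarrow>
    F (sym_act (S_tensor R Sg Kt) p \<pi> (S_tensor_gen R Sg Kt m n u c)) = \<Phi> m n \<pi> u c"
  proof (rule S_tensor_lift[OF susp_poly_S_modules L])
    fix m n \<pi> assume p: "m + n = p" and \<pi>: "\<pi> permutes {1..p}"
    show "bilinear R (component Sg m) (component Kt n) L (\<Phi> m n \<pi>)"
    proof (cases m)
      case 0
      then show ?thesis by (intro bilinearI) (auto simp: \<Phi>_def)
    next
      case (Suc a)
      have pa: "p = Suc a + n" using p Suc by simp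
      note l = \<psi>(1)[OF pa \<pi>]
      show ?thesis unfolding Suc
        by (rule bilinearI)
          (auto simp: \<Phi>_def poly_t_simps linear_closed[OF l] linear_add[OF l] linear_smult[OF l] L.smult_l_distr L.smult_r_distr
            L.smult_assoc1[symmetric] m_comm)
    qed
    fix \<sigma> \<tau> u c assume s: "\<sigma> permutes {1..m}" and t: "\<tau> permutes {1..n}"
      and u: "u \<in> hom_elts Sg m" and c: "c \<in> hom_elts Kt n"
    show "\<Phi> m n (\<pi> \<circ> perm_cross m (\<sigma>, \<tau>)) u c = \<Phi> m n \<pi> (sym_act Sg m \<sigma> u) (sym_act Kt n \<tau> c)"
    proof (cases m)
      case (Suc a)
      have pa: "p = Suc a + n" using p Suc by simp
      have c: "c \<in> carrier R" using c by (simp add: poly_t_simps)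
      have s: "\<sigma> permutes {1..Suc a}" using s Suc by simp
      have pc: "\<pi> \<circ> perm_cross (Suc a) (\<sigma>, \<tau>) permutes {1..p}"
        using perm_cross_permutes[OF s t] pa \<pi> by (simp add: permutes_compose)
      note SM = S_module_module[OF S_module_suspension]
      have "\<psi> a n (\<pi> \<circ> perm_cross (Suc a) (\<sigma>, \<tau>)) u = \<psi> a n \<pi> (sym_act Sg (Suc a) \<sigma> u)"
      proof (rule ind_ext[OF susp_ind, folded susp_component, OF linear_additive[OF \<psi>(1)[OF pa pc] SM L]
            additive_comp[OF S_module_additive[OF S_module_suspension s] linear_additive[OF \<psi>(1)[OF pa \<pi>] SM L]]])
        show "u \<in> hom_elts Sg (Suc a)" using u Suc by simp
        fix \<rho> x assume "\<rho> \<in> carrier (sym_group (Suc a))" and x: "x \<in> hom_elts g a"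
        then have r: "\<rho> permutes {1..Suc a}" by (simp add: sym_group_simps)
        have sr: "\<sigma> \<circ> \<rho> permutes {1..Suc a}" using s r by (simp add: permutes_compose)
        have pc': "\<pi> \<circ> perm_cross (Suc a) (\<sigma> \<circ> \<rho>, id) permutes {1..p}"
          using perm_cross_permutes[OF sr permutes_id, of n] pa \<pi> by (simp add: permutes_compose)
        have id: "perm_cross a (id, id) = id" by (auto simp: perm_cross_def)
        \<comment> \<open>\<open>\<tau>\<close> acts on the \<open>t\<close>'s only and commutes
          with \<open>\<rho>\<close>; it is moved to the right, where \<open>eqv\<close> with the
          identity on the labels removes it.\<close>
        have "perm_cross (Suc a) (\<sigma>, \<tau>) \<circ> perm_cross (Suc a) (\<rho>, id) =
            perm_cross (Suc a) (\<sigma> \<circ> \<rho>, id) \<circ> perm_cross (Suc a) (perm_cross a (id, id), \<tau>)"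
          using perm_cross_comp[OF r permutes_id, of \<sigma> \<tau>] perm_cross_comp[OF permutes_id t, of "Suc a" "\<sigma> \<circ> \<rho>" id] by (simp add: id)
        then have "\<psi> a n (\<pi> \<circ> perm_cross (Suc a) (\<sigma>, \<tau>)) (susp_gen a \<rho> x) = \<phi> a n (\<pi> \<circ> perm_cross (Suc a) (\<sigma> \<circ> \<rho>, id)) (sym_act g a id x)"
          using \<psi>(2)[OF pa pc r x] eqv[OF pa pc' permutes_id t x] by (simp add: o_assoc[symmetric])
        also have "\<dots> = \<psi> a n \<pi> (susp_gen a (\<sigma> \<circ> \<rho>) x)"
          using \<psi>(2)[OF pa \<pi> sr x] S_module_one[OF g x] by simp
        also have "susp_gen a (\<sigma> \<circ> \<rho>) x = sym_act Sg (Suc a) \<sigma> (susp_gen a \<rho> x)"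
          unfolding susp_component using ind_act(2)[OF susp_ind, of \<sigma> a \<rho> x] s r x by (simp add: sym_group_simps)
        finally show "\<psi> a n (\<pi> \<circ> perm_cross (Suc a) (\<sigma>, \<tau>)) (susp_gen a \<rho> x) =
          \<psi> a n \<pi> (sym_act Sg (Suc a) \<sigma> (susp_gen a \<rho> x))" .
      qed
      then show ?thesis using c Suc by (simp add: \<Phi>_def poly_t_simps)
    qed (simp add: \<Phi>_def)
  qed
  then obtain F where F: "F \<in> linear_maps R (component T p) L"
    "\<And>m n \<pi> u c. m + n = p \<Longrightarrow> \<pi> permutes {1..p} \<Longrightarrow> u \<in> hom_elts Sg m \<Longrightarrow> c \<in> carrier R \<Longrightarrow>
      F (sym_act T p \<pi> (S_tensor_gen R Sg Kt m n u c)) = \<Phi> m n \<pi> u c"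
    unfolding suspension_t_def poly_t_simps by metis
  show ?thesis
  proof (intro bexI[OF _ F(1)] allI impI)
    fix a n \<pi> x assume *: "p = Suc a + n" "\<pi> permutes {1..p}" "x \<in> hom_elts g a"
    have id: "perm_cross (Suc a) (id, id) = id" by (auto simp: perm_cross_def)
    show "F (sym_act T p \<pi> (t_gen a n x)) = \<phi> a n \<pi> x"
      using F(2)[of "Suc a" n \<pi> "susp_gen a id x" \<one>] * \<psi>[OF *(1,2)] susp_gen_closed linear_closed[OF lin[OF *(1,2)], of x]
      by (simp add: \<Phi>_def permutes_id id)
  qed
qed

end

text \<open>The triple \<open>(f, i, x)\<close> of the overview: \<open>x s t^n\<close> with
  \<open>n = p - (a + 1)\<close>, moved to its positions. The choice in \<open>placing\<close> is
  meaningful only for a placement, hence the hypotheses \<open>placed\<close> in what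
  follows.\<close>

definition susp_t_elt ::
    "('a, 'r) ring_scheme \<Rightarrow> ('a, 'b) smodule \<Rightarrow> nat \<Rightarrow> nat \<Rightarrow> (nat \<Rightarrow> nat) \<Rightarrow> nat \<Rightarrow> 'b \<Rightarrow> ('a, 'b) susp_t"
  where "susp_t_elt R g p a f i x = sym_act (suspension_t R g) p (placing p a f i)
    (S_tensor_gen R (suspension R g) (poly_t R) (Suc a) (p - Suc a)
      (ind_gen R (sym_group (Suc a)) (young_group a 1) (perm_cross a) (component g a) (\<lambda>(\<sigma>, \<tau>). sym_act g a \<sigma>) id x) \<one>\<^bsub>R\<^esub>)"

context S_module_over
begin

abbreviation (input) "t_elt \<equiv> susp_t_elt R g"

text \<open>The completion \<open>\<pi>\<close> and the chosen one differ by a permutation fixing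
  the first \<open>a + 1\<close> positions. It permutes the \<open>t\<close>'s alone and so fixes
  \<open>x s t^n\<close>.\<close>

lemma act_susp_t_gen:
  assumes \<pi>: "\<pi> permutes {1..p}" and p: "p = Suc a + n" and x: "x \<in> hom_elts g a"
    and f: "\<And>j. j \<in> {1..a} \<Longrightarrow> \<pi> j = f j" and i: "\<pi> (Suc a) = i"
  shows "sym_act T p \<pi> (t_gen a n x) = t_elt p a f i x"
proof -
  have "placed p a \<pi> i" using placed_permutes[OF \<pi>, of a] p i by simp
  then have pl: "placed p a f i" using placed_cong[of a \<pi> f p i, OF f] by blast
  note \<rho> = placing[OF pl]
  let ?\<rho> = "placing p a f i"
  let ?\<delta> = "inv' \<pi> \<circ> ?\<rho>"
  have \<delta>: "?\<delta> permutes {1..p}" using \<pi> \<rho>(1) by (simp add: permutes_compose permutes_inv)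
  have "?\<delta> j = j" if "j \<in> {1..Suc a}" for j
  proof -
    have "?\<rho> j = \<pi> j" using that \<rho>(2)[of j] \<rho>(3) f[of j] i by (cases "j = Suc a") auto
    then show ?thesis using permutes_inverses(2)[OF \<pi>] by simp
  qed
  then obtain \<tau> where t: "\<tau> permutes {1..n}" "?\<delta> = perm_cross (Suc a) (id, \<tau>)"
    using permutes_fix_prefix[of ?\<delta> "Suc a" n] \<delta> p by blast
  have "?\<rho> = \<pi> \<circ> ?\<delta>" using permutes_inv_o(1)[OF \<pi>] by (simp add: o_assoc)
  then have "t_elt p a f i x = sym_act T p \<pi> (sym_act T p ?\<delta> (t_gen a n x))"
    using S_module_comp[OF S_module_T \<pi> \<delta>, of "t_gen a n x"] susp_t_gen_closed[of a n x] p by (simp add: susp_t_elt_def)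
  also have "sym_act T p ?\<delta> (t_gen a n x) = t_gen a n x"
  proof -
    have id: "perm_cross a (id, id) = id" by (auto simp: perm_cross_def)
    show ?thesis using susp_t_gen_stabilizer[OF permutes_id t(1) x] S_module_one[OF g x]
      unfolding id t(2)[symmetric] p[symmetric] by (simp only:)
  qed
  finally show ?thesis by simp
qed

context
  fixes p a f i
  assumes pl: "placed p a f i"
begin

lemma susp_t_elt_additive: "additive (component g a) (component T p) (t_elt p a f i)"
  using additive_comp[OF susp_t_gen_additive[of a "p - Suc a"] S_module_additive[OF S_module_T], of "placing p a f i"]
    placing(1)[OF pl] placed_Suc_le[OF pl]
  by (simp add: susp_t_elt_def[abs_def])

lemma susp_t_elt_closed: "x \<in> hom_elts g a \<Longrightarrow> t_elt p a f i x \<in> hom_elts T p"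
  by (rule additive_closed[OF susp_t_elt_additive])

lemma susp_t_elt_smult:
  "c \<in> carrier R \<Longrightarrow> x \<in> hom_elts g a \<Longrightarrow> t_elt p a f i (c \<odot>\<^bsub>component g a\<^esub> x) = c \<odot>\<^bsub>component T p\<^esub> t_elt p a f i x"
  using susp_t_gen_smult[of c x a "p - Suc a"] linear_smult[OF S_module_linear[OF S_module_T placing(1)[OF pl]]]
    susp_t_gen_closed[of a "p - Suc a" x] placed_Suc_le[OF pl]
  by (simp add: susp_t_elt_def)

lemma sym_act_susp_t_elt:
  assumes "\<rho> permutes {1..p}" "x \<in> hom_elts g a"
  shows "sym_act T p \<rho> (t_elt p a f i x) = t_elt p a (\<rho> \<circ> f) (\<rho> i) x"
proof -
  have "sym_act T p \<rho> (t_elt p a f i x) = sym_act T p (\<rho> \<circ> placing p a f i) (t_gen a (p - Suc a) x)"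
    using S_module_comp[OF S_module_T assms(1) placing(1)[OF pl]] susp_t_gen_closed[of a "p - Suc a" x] placed_Suc_le[OF pl]
    by (simp add: susp_t_elt_def)
  also have "\<dots> = t_elt p a (\<rho> \<circ> f) (\<rho> i) x"
    using assms placed_Suc_le[OF pl] placing[OF pl] by (intro act_susp_t_gen permutes_compose) auto
  finally show ?thesis .
qed

text \<open>Renaming labels before placing them amounts to applying \<open>\<sigma>\<close> to the
  first \<open>a\<close> positions of \<open>x s t^n\<close>, which acts through \<open>x\<close> by
  \<open>susp_t_gen_stabilizer\<close>.\<close>

lemma susp_t_elt_rearrange:
  assumes s: "\<sigma> permutes {1..a}" and x: "x \<in> hom_elts g a"
  shows "t_elt p a (f \<circ> \<sigma>) i x = t_elt p a f i (sym_act g a \<sigma> x)"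
proof -
  define n where "n = p - Suc a"
  have p: "p = Suc a + n" using placed_Suc_le[OF pl] by (simp add: n_def)
  let ?\<rho> = "placing p a f i"
  let ?\<kappa> = "perm_cross (Suc a) (perm_cross a (\<sigma>, id), id)"
  have k: "?\<kappa> permutes {1..p}"
    unfolding p by (intro perm_cross_permutes perm_cross_permutes_Suc s permutes_id)
  have "t_elt p a f i (sym_act g a \<sigma> x) = sym_act T p ?\<rho> (sym_act T p ?\<kappa> (t_gen a n x))"
    using susp_t_gen_stabilizer[OF s permutes_id x, of n] p by (simp add: susp_t_elt_def)
  also have "\<dots> = sym_act T p (?\<rho> \<circ> ?\<kappa>) (t_gen a n x)"
    using S_module_comp[OF S_module_T placing(1)[OF pl] k] susp_t_gen_closed[of a n x] p by simp
  also have "\<dots> = t_elt p a (f \<circ> \<sigma>) i x"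
  proof (rule act_susp_t_gen[OF _ p x])
    show "?\<rho> \<circ> ?\<kappa> permutes {1..p}" using k placing(1)[OF pl] by (rule permutes_compose)
    show "(?\<rho> \<circ> ?\<kappa>) j = (f \<circ> \<sigma>) j" if "j \<in> {1..a}" for j
      using that permutes_in_image[OF s, of j] placing(2)[OF pl, of "\<sigma> j"] by (auto simp: perm_cross_def)
    show "(?\<rho> \<circ> ?\<kappa>) (Suc a) = i" using placing(3)[OF pl] by (simp add: perm_cross_def)
  qed
  finally show ?thesis by simp
qed

end

lemma susp_t_elt_cong:
  assumes "\<And>j. j \<in> {1..a} \<Longrightarrow> f j = h j"
  shows "t_elt p a f i x = t_elt p a h i x"
proof -
  have "placing p a f i = placing p a h i" using assms by (simp add: placing_def)
  then show ?thesis by (simp add: susp_t_elt_def)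
qed

lemma susp_t_induct [consumes 1, case_names zero add elt]:
  assumes u: "u \<in> hom_elts T p" and zero: "Q \<zero>\<^bsub>component T p\<^esub>"
    and add: "\<And>u v. u \<in> hom_elts T p \<Longrightarrow> v \<in> hom_elts T p \<Longrightarrow> Q u \<Longrightarrow> Q v \<Longrightarrow> Q (u \<oplus>\<^bsub>component T p\<^esub> v)"
    and gen: "\<And>a f i x. placed p a f i \<Longrightarrow> x \<in> hom_elts g a \<Longrightarrow> Q (t_elt p a f i x)"
  shows "Q u"
  using u
proof (induction rule: susp_t_induct_gen[consumes 1, case_names zero add gen])
  case (gen a n \<pi> x)
  then have "sym_act T p \<pi> (t_gen a n x) = t_elt p a \<pi> (\<pi> (Suc a)) x" by (intro act_susp_t_gen) auto
  then show ?case using assms(4)[of a \<pi> "\<pi> (Suc a)" x] gen placed_permutes[of \<pi> p a] by simp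
qed (use assms in auto)

lemma susp_t_ext:
  assumes f: "additive (component T p) L F" and h: "additive (component T p) L H"
    and gen: "\<And>a f i x. placed p a f i \<Longrightarrow> x \<in> hom_elts g a \<Longrightarrow> F (t_elt p a f i x) = H (t_elt p a f i x)"
    and u: "u \<in> hom_elts T p"
  shows "F u = H u"
  using u
  by (induction rule: susp_t_induct)
    (simp_all add: additive_zero[OF f] additive_zero[OF h] additive_add[OF f] additive_add[OF h] gen)

text \<open>\<open>eqv\<close> is the only genuine relation between the generators;
  \<open>cong\<close> expresses that \<open>\<phi>\<close> may look at \<open>f\<close> on
  \<open>{1..a}\<close> only.\<close>

lemma susp_t_lift:
  assumes L: "module R L"
    and add: "\<And>a f i. placed p a f i \<Longrightarrow> additive (component g a) L (\<phi> a f i)"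
    and smult: "\<And>a f i c x. placed p a f i \<Longrightarrow> c \<in> carrier R \<Longrightarrow> x \<in> hom_elts g a \<Longrightarrow>
      \<phi> a f i (c \<odot>\<^bsub>component g a\<^esub> x) = c \<odot>\<^bsub>L\<^esub> \<phi> a f i x"
    and eqv: "\<And>a f i \<sigma> x. placed p a f i \<Longrightarrow> \<sigma> permutes {1..a} \<Longrightarrow> x \<in> hom_elts g a \<Longrightarrow>
      \<phi> a (f \<circ> \<sigma>) i x = \<phi> a f i (sym_act g a \<sigma> x)"
    and cong: "\<And>a f h i x. placed p a f i \<Longrightarrow> (\<And>j. j \<in> {1..a} \<Longrightarrow> f j = h j) \<Longrightarrow> x \<in> hom_elts g a \<Longrightarrow>
      \<phi> a f i x = \<phi> a h i x"
  shows "\<exists>F\<in>linear_maps R (component T p) L. \<forall>a f i x. placed p a f i \<longrightarrow> x \<in> hom_elts g a \<longrightarrow>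
    F (t_elt p a f i x) = \<phi> a f i x"
proof -
  have "\<exists>F\<in>linear_maps R (component T p) L. \<forall>a n \<pi> x. p = Suc a + n \<longrightarrow> \<pi> permutes {1..p} \<longrightarrow>
    x \<in> hom_elts g a \<longrightarrow> F (sym_act T p \<pi> (t_gen a n x)) = \<phi> a \<pi> (\<pi> (Suc a)) x"
  proof (rule susp_t_lift_gen[OF L])
    fix a n \<pi> assume p: "p = Suc a + n" and \<pi>: "\<pi> permutes {1..p}"
    have pl: "placed p a \<pi> (\<pi> (Suc a))" using p by (intro placed_permutes[OF \<pi>]) simp
    show "(\<lambda>x\<in>hom_elts g a. \<phi> a \<pi> (\<pi> (Suc a)) x) \<in> linear_maps R (component g a) L"
      using add[OF pl] smult[OF pl] by (intro linear_mapsI' S_module_module[OF g]) (auto dest: additive_closed additive_add)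
    fix \<sigma> \<tau> x assume s: "\<sigma> permutes {1..a}" and "\<tau> permutes {1..n}" and x: "x \<in> hom_elts g a"
    let ?\<kappa> = "perm_cross (Suc a) (perm_cross a (\<sigma>, id), \<tau>)"
    \<comment> \<open>\<open>?\<kappa>\<close> fixes \<open>a + 1\<close>, so \<open>s\<close> keeps
      its place, and on the labels it agrees with \<open>\<sigma>\<close>; its effect on the
      \<open>t\<close>'s is invisible to \<open>\<phi>\<close>.\<close>
    have "\<phi> a (\<pi> \<circ> ?\<kappa>) ((\<pi> \<circ> ?\<kappa>) (Suc a)) x = \<phi> a (\<pi> \<circ> ?\<kappa>) (\<pi> (Suc a)) x"
      by (simp add: perm_cross_def)
    also have "\<dots> = \<phi> a (\<pi> \<circ> \<sigma>) (\<pi> (Suc a)) x"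
      using placed_rearrange[OF pl s] x permutes_in_image[OF s]
      by (intro cong[symmetric]) (auto simp: perm_cross_def)
    also have "\<dots> = \<phi> a \<pi> (\<pi> (Suc a)) (sym_act g a \<sigma> x)" by (rule eqv[OF pl s x])
    finally show "\<phi> a (\<pi> \<circ> ?\<kappa>) ((\<pi> \<circ> ?\<kappa>) (Suc a)) x = \<phi> a \<pi> (\<pi> (Suc a)) (sym_act g a \<sigma> x)" .
  qed
  then obtain F where F: "F \<in> linear_maps R (component T p) L"
    "\<And>a n \<pi> x. p = Suc a + n \<Longrightarrow> \<pi> permutes {1..p} \<Longrightarrow> x \<in> hom_elts g a \<Longrightarrow>
      F (sym_act T p \<pi> (t_gen a n x)) = \<phi> a \<pi> (\<pi> (Suc a)) x" by metis
  show ?thesis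
  proof (intro bexI[OF _ F(1)] allI impI)
    fix a f i x assume pl: "placed p a f i" and x: "x \<in> hom_elts g a"
    have "F (t_elt p a f i x) = \<phi> a (placing p a f i) i x"
      using F(2)[of a "p - Suc a" "placing p a f i" x] placing[OF pl] placed_Suc_le[OF pl] x by (simp add: susp_t_elt_def)
    also have "\<dots> = \<phi> a f i x" using placing[OF pl] pl x by (intro cong[symmetric]) auto
    finally show "F (t_elt p a f i x) = \<phi> a f i x" .
  qed
qed

text \<open>Adding a \<open>t\<close> at the end enlarges the Young subgroup from
  \<open>S_m x S_n\<close> to \<open>S_m x S_(n+1)\<close> without changing the module, because all
  degrees of \<open>poly_t\<close> coincide. The generators may therefore keep their
  \<open>\<pi>\<close>.\<close>

lemma rmult_t_part:
  assumes "m + n = p"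
  defines "r \<equiv> ind_map R (sym_group (m + n)) (young_group m n) (perm_cross m)
     (tensor_module R (component Sg m) (component Kt n)) (tensor_young_act R Sg Kt m n)
     (S_tensor_part R Sg Kt m (Suc n))
     (\<lambda>\<pi> v. S_tensor_part_gen R Sg Kt m (Suc n) (perm_cross p (\<pi>, id)) v)"
  shows "r \<in> linear_maps R (S_tensor_part R Sg Kt m n) (S_tensor_part R Sg Kt m (Suc n))"
    and "\<pi> permutes {1..m + n} \<Longrightarrow> v \<in> carrier (tensor_module R (component Sg m) (component Kt n)) \<Longrightarrow>
      r (S_tensor_part_gen R Sg Kt m n \<pi> v) = S_tensor_part_gen R Sg Kt m (Suc n) \<pi> v"
proof -
  note susp_poly_S_modules = susp_poly_S_modules
  let ?M = "Sg"
  let ?K = "Kt"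
  have up: "\<pi> permutes {1..m + n} \<Longrightarrow> \<pi> permutes {1..m + Suc n}" for \<pi>
    by (erule permutes_subset) auto
  have up': "\<pi> permutes {1..n} \<Longrightarrow> \<pi> permutes {1..Suc n}" for \<pi>
    by (erule permutes_subset) auto
  have y: "tensor_young_act R ?M ?K m (Suc n) h = tensor_young_act R ?M ?K m n h" for h
    by (cases h) (simp add: tensor_young_act_def poly_t_simps)
  have c: "S_tensor_part_gen R ?M ?K m (Suc n) (perm_cross p (\<pi>, id)) v = S_tensor_part_gen R ?M ?K m (Suc n) \<pi> v"
    if "\<pi> permutes {1..m + n}" for \<pi> v using that assms(1) by (simp add: perm_cross_ident)
  have act: "S_tensor_part_gen R ?M ?K m (Suc n) (perm_cross p (\<pi> \<circ> perm_cross m (\<sigma>, \<tau>), id)) v =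
      S_tensor_part_gen R ?M ?K m (Suc n) (perm_cross p (\<pi>, id)) (tensor_young_act R ?M ?K m n (\<sigma>, \<tau>) v)"
    if "\<pi> permutes {1..m + n}" "\<sigma> permutes {1..m}" "\<tau> permutes {1..n}"
      "v \<in> carrier (tensor_module R (component ?M m) (component ?K n))" for \<pi> \<sigma> \<tau> v
    using part_gen_act0[OF susp_poly_S_modules, of \<pi> m "Suc n" "(\<sigma>, \<tau>)" v] that up[of \<pi>] up'[of \<tau>] perm_cross_permutes[OF that(2,3)]
    by (simp add: c permutes_compose sym_group_simps y poly_t_simps)
  note pm = part_map[OF susp_poly_S_modules module_part[OF susp_poly_S_modules, of m "Suc n"], where m = m and n = n and \<phi> = "\<lambda>\<pi> v. S_tensor_part_gen R ?M ?K m (Suc n) (perm_cross p (\<pi>, id)) v", folded r_def]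
  have A: "\<And>\<pi> v w. \<pi> permutes {1..m + n} \<Longrightarrow> v \<in> carrier (tensor_module R (component ?M m) (component ?K n)) \<Longrightarrow>
     w \<in> carrier (tensor_module R (component ?M m) (component ?K n)) \<Longrightarrow>
     S_tensor_part_gen R ?M ?K m (Suc n) \<pi> (v \<oplus>\<^bsub>tensor_module R (component ?M m) (component ?K n)\<^esub> w) =
     S_tensor_part_gen R ?M ?K m (Suc n) \<pi> v \<oplus>\<^bsub>S_tensor_part R ?M ?K m (Suc n)\<^esub> S_tensor_part_gen R ?M ?K m (Suc n) \<pi> w"
    "\<And>k \<pi> v. k \<in> carrier R \<Longrightarrow> \<pi> permutes {1..m + n} \<Longrightarrow> v \<in> carrier (tensor_module R (component ?M m) (component ?K n)) \<Longrightarrow>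
     S_tensor_part_gen R ?M ?K m (Suc n) \<pi> (k \<odot>\<^bsub>tensor_module R (component ?M m) (component ?K n)\<^esub> v) =
     k \<odot>\<^bsub>S_tensor_part R ?M ?K m (Suc n)\<^esub> S_tensor_part_gen R ?M ?K m (Suc n) \<pi> v"
    using part_gen_add[OF susp_poly_S_modules, of _ m "Suc n"] part_gen_smult[OF susp_poly_S_modules, of _ _ m "Suc n"] up
    by (auto simp: sym_group_simps poly_t_simps)
  show "r \<in> linear_maps R (S_tensor_part R ?M ?K m n) (S_tensor_part R ?M ?K m (Suc n))"
    by (rule pm(1)) (auto simp: part_gen_closed[OF susp_poly_S_modules] sym_group_simps c A act)
  show "r (S_tensor_part_gen R ?M ?K m n \<pi> v) = S_tensor_part_gen R ?M ?K m (Suc n) \<pi> v"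
    if "\<pi> permutes {1..m + n}" "v \<in> carrier (tensor_module R (component ?M m) (component ?K n))"
    using pm(2)[of \<pi> v] that by (auto simp: part_gen_closed[OF susp_poly_S_modules] sym_group_simps c A act)
qed

lemma rmult_t_additive: "additive (component T p) (component T (Suc p)) (rmult_t R g p)"
proof -
  note susp_poly_S_modules = susp_poly_S_modules
  let ?M = "Sg"
  let ?K = "Kt"
  let ?P = "\<lambda>(m, n). S_tensor_part R ?M ?K m n"
  note r = rmult_t_part(1)
  have at: "u (m, n) \<in> carrier (S_tensor_part R ?M ?K m n)" if "m + n = p" "u \<in> carrier (component T p)" for m n u
    using that dsum_at[of u "bidegrees p" ?P "(m, n)"] by (simp add: suspension_t_def component_S_tensor[OF susp_poly_S_modules])
  note z = abelian_group.axioms(1)[OF module_abelian_group[OF module_part[OF susp_poly_S_modules]]]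
  show ?thesis
  proof (rule additiveI)
    show "rmult_t R g p u \<in> hom_elts T (Suc p)" if "u \<in> hom_elts T p" for u
      unfolding suspension_t_def component_S_tensor[OF susp_poly_S_modules] dsum_simps rmult_t_def Let_def
      using at[OF _ that] linear_closed[OF r]
      by (auto split: nat.split simp: abelian_monoid.zero_closed[OF z])
    show "rmult_t R g p (u \<oplus>\<^bsub>component T p\<^esub> v) = rmult_t R g p u \<oplus>\<^bsub>component T (Suc p)\<^esub> rmult_t R g p v"
      if "u \<in> hom_elts T p" "v \<in> hom_elts T p" for u v
      using at[OF _ that(1)] at[OF _ that(2)] linear_add[OF r]
      unfolding suspension_t_def component_S_tensor[OF susp_poly_S_modules] dsum_simps rmult_t_def Let_def
      by (auto intro!: restrict_ext split: nat.split simp: abelian_monoid.zero_closed[OF z] abelian_monoid.l_zero[OF z])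
  qed (auto intro: module_abelian_group T_module)
qed

lemma rmult_t_gen:
  assumes \<pi>: "\<pi> permutes {1..m + n}" and u: "u \<in> hom_elts Sg m" and c: "c \<in> carrier R"
  shows "rmult_t R g (m + n) (sym_act T (m + n) \<pi> (S_tensor_gen R Sg Kt m n u c)) =
    sym_act T (Suc (m + n)) \<pi> (S_tensor_gen R Sg Kt m (Suc n) u c)"
proof -
  note susp_poly_S_modules = susp_poly_S_modules
  let ?M = "Sg"
  let ?K = "Kt"
  let ?P = "\<lambda>(m, n). S_tensor_part R ?M ?K m n"
  let ?v = "tensor_gen R (component ?M m) (component ?K n) u c"
  let ?w = "S_tensor_part_gen R ?M ?K m n \<pi> ?v"
  have v: "?v \<in> carrier (tensor_module R (component ?M m) (component ?K n))"
    using u c by (intro bilinearD(1)[OF tensor_gen_bilinear] S_module_module[OF susp_poly_S_modules(1)] S_module_module[OF susp_poly_S_modules(2)]) (auto simp: poly_t_simps)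
  have up: "\<pi> permutes {1..m + Suc n}" by (rule permutes_subset[OF \<pi>]) auto
  have z: "ind_map R (sym_group (m' + n')) (young_group m' n') (perm_cross m')
     (tensor_module R (component ?M m') (component ?K n')) (tensor_young_act R ?M ?K m' n')
     (S_tensor_part R ?M ?K m' (Suc n'))
     (\<lambda>\<pi> v. S_tensor_part_gen R ?M ?K m' (Suc n') (perm_cross (m + n) (\<pi>, id)) v) \<zero>\<^bsub>S_tensor_part R ?M ?K m' n'\<^esub> =
     \<zero>\<^bsub>S_tensor_part R ?M ?K m' (Suc n')\<^esub>" if "m' + n' = m + n" for m' n'
    by (rule linear_zero[OF rmult_t_part(1)[OF that] module_part[OF susp_poly_S_modules] module_part[OF susp_poly_S_modules]])
  have "rmult_t R g (m + n) (dsum_incl (bidegrees (m + n)) ?P (m, n) ?w) =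
    dsum_incl (bidegrees (Suc (m + n))) ?P (m, Suc n) (S_tensor_part_gen R ?M ?K m (Suc n) \<pi> ?v)"
    unfolding rmult_t_def Let_def dsum_incl_def
  proof (rule restrict_ext, goal_cases)
    \<comment> \<open>The component with \<open>n' = 0\<close> vanishes on both sides; in the others
      the second degree is shifted by one.\<close>
    case (1 ij)
    then obtain m' n' where ij: "ij = (m', n')" "m' + n' = Suc (m + n)" by auto
    show ?case
    proof (cases n')
      case 0
      then show ?thesis by (simp add: ij)
    next
      case (Suc k)
      then have k: "m' + k = m + n" using ij by simp
      show ?thesis using rmult_t_part(2)[OF k] \<pi> v k z[OF k] by (auto simp: ij Suc)
    qed
  qed
  then show ?thesis
    using sym_act_S_tensor_gen[OF susp_poly_S_modules \<pi> u, of c] sym_act_S_tensor_gen[OF susp_poly_S_modules up u, of c] c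
    by (simp add: suspension_t_def poly_t_simps)
qed

end

section \<open>Block permutations as piecewise shifts\<close>

section \<open>Block permutations\<close>

declare cycle_of_list.simps [simp del]

lemma sum_list_take_mono: "j \<le> k \<Longrightarrow> sum_list (take j ds) \<le> sum_list (take k (ds :: nat list))"
proof -
  assume "j \<le> k"
  then have "take k ds = take j ds @ take (k - j) (drop j ds)"
    by (metis le_add_diff_inverse take_add)
  then show ?thesis by simp
qed

text \<open>Replaces the \<open>LEAST\<close> of the definition by a known block index. The sum runs
  over all blocks with a condition inside, a form that simplification can evaluate for two or three
  blocks.\<close>

lemma block_perm_in_block:
  assumes k: "k < length ds" and q: "sum_list (take k ds) < q" "q \<le> sum_list (take (Suc k) ds)"
  shows "block_perm \<sigma> ds q =
    (\<Sum>l\<in>{1..length ds}. if \<sigma> l < \<sigma> (Suc k) then ds ! (l - 1) else 0) + (q - sum_list (take k ds))"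
proof -
  have "(LEAST j. q \<le> sum_list (take j ds)) = Suc k"
  proof (rule Least_equality)
    fix y assume "q \<le> sum_list (take y ds)"
    then show "Suc k \<le> y" using q(1) sum_list_take_mono[of y k ds] by (cases "y \<le> k") auto
  qed (rule q(2))
  moreover have "q \<in> {1..sum_list ds}"
    using q sum_list_take_mono[of "Suc k" "length ds" ds] k by auto
  moreover have "(\<Sum>l | l \<in> {1..length ds} \<and> \<sigma> l < \<sigma> (Suc k). ds ! (l - 1)) =
      (\<Sum>l\<in>{1..length ds}. if \<sigma> l < \<sigma> (Suc k) then ds ! (l - 1) else 0)"
    by (rule sum.inter_filter) simp
  ultimately show ?thesis by (simp add: block_perm_def Let_def)
qed

lemma block_perm_outside: "q \<notin> {1..sum_list ds} \<Longrightarrow> block_perm \<sigma> ds q = q"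
  unfolding block_perm_def by (rule if_not_P)

lemma atLeastAtMost_1_2_3: "{1..2::nat} = {1, 2}" "{1..3::nat} = {1, 2, 3}"
  by auto

lemma block_perm_2:
  "block_perm (cycle_of_list [1, 2]) [m, n] q =
    (if q \<in> {1..m} then n + q else if q \<in> {m + 1..m + n} then q - m else q)"
  using block_perm_in_block[of 0 "[m, n]" q "cycle_of_list [1, 2]"] block_perm_in_block[of 1 "[m, n]" q "cycle_of_list [1, 2]"]
    block_perm_outside[of q "[m, n]" "cycle_of_list [1, 2]"]
  by (auto simp: cycle_of_list.simps transpose_def atLeastAtMost_1_2_3 numeral_2_eq_2[symmetric] take_Cons')

text \<open>\<open>s t\<close> is the total length of the blocks sent to places before
  \<open>t\<close>, hence the offset of the block sent to \<open>t\<close>.\<close>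

lemma block_perm_3:
  "block_perm \<sigma> [m, n, k] q =
    (let s = \<lambda>t. (if \<sigma> 1 < t then m else 0) + (if \<sigma> 2 < t then n else 0) + (if \<sigma> 3 < t then k else 0) in
      if q \<in> {1..m} then s (\<sigma> 1) + q else if q \<in> {m + 1..m + n} then s (\<sigma> 2) + (q - m)
      else if q \<in> {m + n + 1..m + n + k} then s (\<sigma> 3) + (q - (m + n)) else q)"
proof -
  define s where "s = (\<lambda>t. (if \<sigma> 1 < t then m else 0) + (if \<sigma> 2 < t then n else 0) + (if \<sigma> 3 < t then k else 0))"
  have sum: "(\<Sum>l\<in>{1..length [m, n, k]}. if \<sigma> l < t then [m, n, k] ! (l - 1) else 0) = s t" for t
  proof -
    have "{1..length [m, n, k]} = {1, 2, 3}" by auto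
    then show ?thesis by (simp add: s_def numeral_2_eq_2 numeral_3_eq_3)
  qed
  consider "q \<in> {1..m}" | "q \<in> {m + 1..m + n}" | "q \<in> {m + n + 1..m + n + k}" | "q \<notin> {1..m + n + k}"
    by fastforce
  then show ?thesis
  proof cases
    case 1
    then show ?thesis using block_perm_in_block[of 0 "[m, n, k]" q \<sigma>] unfolding sum by (simp add: One_nat_def s_def Let_def)
  next
    case 2
    then show ?thesis using block_perm_in_block[of 1 "[m, n, k]" q \<sigma>] unfolding sum by (simp add: numeral_2_eq_2 One_nat_def s_def Let_def)
  next
    case 3
    then show ?thesis using block_perm_in_block[of 2 "[m, n, k]" q \<sigma>] unfolding sum
      by (simp add: numeral_2_eq_2 numeral_3_eq_3 One_nat_def s_def Let_def)
  next
    case 4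
    then show ?thesis using block_perm_outside[of q "[m, n, k]" \<sigma>] by (auto simp: Let_def)
  qed
qed

lemma block_perm_123:
  "block_perm (cycle_of_list [1, 2, 3]) [m, n, k] q =
    (if q \<in> {1..m + n} then k + q else if q \<in> {m + n + 1..m + n + k} then q - (m + n) else q)"
proof -
  have "cycle_of_list [1, 2, 3] 1 = (2::nat)" "cycle_of_list [1, 2, 3] 2 = (3::nat)" "cycle_of_list [1, 2, 3] 3 = (1::nat)"
    by (simp_all add: cycle_of_list.simps transpose_def)
  then show ?thesis unfolding block_perm_3 Let_def by simp
qed

lemma block_perm_132:
  "block_perm (cycle_of_list [1, 3, 2]) [m, n, k] q =
    (if q \<in> {1..m} then n + k + q else if q \<in> {m + 1..m + n + k} then q - m else q)"
proof -
  have "cycle_of_list [1, 3, 2] 1 = (3::nat)" "cycle_of_list [1, 3, 2] 2 = (1::nat)" "cycle_of_list [1, 3, 2] 3 = (2::nat)"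
    by (simp_all add: cycle_of_list.simps transpose_def)
  then show ?thesis unfolding block_perm_3 Let_def by simp
qed

lemma block_perm_23:
  "block_perm (cycle_of_list [2, 3]) [m, n, k] q =
    (if q \<in> {m + 1..m + n} then k + q else if q \<in> {m + n + 1..m + n + k} then q - n else q)"
proof -
  have "cycle_of_list [2, 3] 1 = (1::nat)" "cycle_of_list [2, 3] 2 = (3::nat)" "cycle_of_list [2, 3] 3 = (2::nat)"
    by (simp_all add: cycle_of_list.simps transpose_def)
  then show ?thesis unfolding block_perm_3 Let_def by simp
qed

lemma permutes_finiteI:
  assumes "finite S" "inj_on f S" "f ` S \<subseteq> S" "\<And>x. x \<notin> S \<Longrightarrow> f x = x"
  shows "f permutes S"
  using assms endo_inj_surj[of S f] by (intro bij_imp_permutes) (auto simp: bij_betw_def)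

lemma block_perm_permutes:
  "block_perm (cycle_of_list [1, 2]) [m, n] permutes {1..m + n}"
  "block_perm (cycle_of_list [1, 2, 3]) [m, n, k] permutes {1..m + n + k}"
  "block_perm (cycle_of_list [1, 3, 2]) [m, n, k] permutes {1..m + n + k}"
  "block_perm (cycle_of_list [2, 3]) [m, n, k] permutes {1..m + n + k}"
  by (rule permutes_finiteI; auto simp: block_perm_2 block_perm_123 block_perm_132 block_perm_23 inj_on_def)+

lemma block_perm_2_involution:
  "block_perm (cycle_of_list [1, 2]) [n, m] \<circ> block_perm (cycle_of_list [1, 2]) [m, n] = id"
  by (auto simp: block_perm_2 fun_eq_iff)

text \<open>Naturality of the exchange of two blocks, on which the equivariance of the second term
  of the bracket rests.\<close>

lemma block_perm_2_perm_cross: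
  assumes "\<sigma> permutes {1..m}" "\<tau> permutes {1..n}"
  shows "block_perm (cycle_of_list [1, 2]) [n, m] \<circ> perm_cross n (\<tau>, \<sigma>) =
    perm_cross m (\<sigma>, \<tau>) \<circ> block_perm (cycle_of_list [1, 2]) [n, m]"
proof
  fix q
  have s: "\<sigma> j \<in> {1..m} \<longleftrightarrow> j \<in> {1..m}" "\<tau> j \<in> {1..n} \<longleftrightarrow> j \<in> {1..n}" for j
    using permutes_in_image[OF assms(1)] permutes_in_image[OF assms(2)] by auto
  have o: "\<sigma> j = j" if "j \<notin> {1..m}" for j using permutes_not_in[OF assms(1) that] .
  have o': "\<tau> j = j" if "j \<notin> {1..n}" for j using permutes_not_in[OF assms(2) that] .
  show "(block_perm (cycle_of_list [1, 2]) [n, m] \<circ> perm_cross n (\<tau>, \<sigma>)) q =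
    (perm_cross m (\<sigma>, \<tau>) \<circ> block_perm (cycle_of_list [1, 2]) [n, m]) q"
  proof (cases "q \<in> {1..n}")
    case True
    then show ?thesis using s(2)[of q] by (simp add: block_perm_2 perm_cross_def)
  next
    case F: False
    show ?thesis
    proof (cases "q \<in> {n + 1..n + m}")
      case True
      then have "\<sigma> (q - n) \<in> {1..m}" using s(1)[of "q - n"] by auto
      then show ?thesis using True F by (auto simp: block_perm_2 perm_cross_def)
    next
      case False
      \<comment> \<open>Position 0 and the positions beyond \<open>n + m\<close> lie outside both
        blocks, yet \<open>perm_cross\<close> sorts them into one of its branches.\<close>
      then have "q = 0 \<or> q > n + m" using F by auto
      then show ?thesis
      proof
        assume "q = 0"
        then show ?thesis using o[of 0] o'[of 0] by (simp add: block_perm_2 perm_cross_def)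
      next
        assume q: "q > n + m"
        have "\<sigma> (q - n) = q - n" using q by (intro o) auto
        moreover have "\<tau> (q - m) = q - m" using q by (intro o') auto
        ultimately show ?thesis using q by (simp add: block_perm_2 perm_cross_def)
      qed
    qed
  qed
qed

text \<open>The cycle is a transposition times the cycle without the first entry, which gives the
  induction. The cycle in \<open>susp_elt\<close> is of this kind.\<close>

lemma cycle_of_list_upt:
  "i \<le> k \<Longrightarrow> cycle_of_list [i..<Suc k] j = (if i \<le> j \<and> j < k then Suc j else if j = k then i else j)"
proof (induction "k - i" arbitrary: i)
  case 0
  then show ?case by (auto simp: upt_rec cycle_of_list.simps)
next
  case (Suc n)
  then have "i < k" by simp
  then have "[i..<Suc k] = i # Suc i # [Suc (Suc i)..<Suc k]" "[Suc i..<Suc k] = Suc i # [Suc (Suc i)..<Suc k]"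
    by (simp_all add: upt_conv_Cons del: upt_Suc)
  then have "cycle_of_list [i..<Suc k] j = transpose i (Suc i) (cycle_of_list [Suc i..<Suc k] j)" by (simp add: cycle_of_list.simps)
  also have "cycle_of_list [Suc i..<Suc k] j = (if Suc i \<le> j \<and> j < k then Suc j else if j = k then Suc i else j)"
    using Suc by (intro Suc(1)) auto
  finally show ?case using \<open>i < k\<close> by (auto simp: transpose_def)
qed

section \<open>Placements under juxtaposition\<close>

section \<open>Juxtaposition of placements\<close>

text \<open>Labels are counted with offset \<open>a\<close>, positions with offset \<open>p\<close>;
  the two differ by the positions that \<open>s\<close> and \<open>t\<close> occupy in the first
  factor.\<close>

definition join :: "nat \<Rightarrow> nat \<Rightarrow> (nat \<Rightarrow> nat) \<Rightarrow> (nat \<Rightarrow> nat) \<Rightarrow> nat \<Rightarrow> nat"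
  where "join p a f h = (\<lambda>r. if r \<le> a then f r else p + h (r - a))"

lemma join_image:
  "join p a f h ` {1..a + b} = f ` {1..a} \<union> (\<lambda>r. p + h r) ` {1..b}"
proof -
  have "{1..a + b} = {1..a} \<union> {a + 1..a + b}" by auto
  moreover have "join p a f h ` {1..a} = f ` {1..a}" by (auto simp: join_def)
  moreover have "join p a f h ` {a + 1..a + b} = (\<lambda>r. p + h r) ` {1..b}"
  proof -
    have *: "{a + 1..a + b} = (\<lambda>r. a + r) ` {1..b}" by simp
    show ?thesis unfolding * image_image by (intro image_cong) (auto simp: join_def)
  qed
  ultimately show ?thesis by (simp add: image_Un)
qed

text \<open>Neither \<open>i\<close> nor \<open>p + j\<close> is taken by a label, one being left
  free by each factor. The product puts \<open>s\<close> at \<open>i\<close> and a \<open>t\<close>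
  at \<open>p + j\<close>; in brackets the parameter also appears at the other place.\<close>

lemma placed_join:
  assumes f: "placed p a f i" and h: "placed q b h j"
  shows "placed (p + q) (a + b) (join p a f h) i" "placed (p + q) (a + b) (join p a f h) (p + j)"
proof -
  have fr: "f r \<in> {1..p}" if "r \<in> {1..a}" for r using f that unfolding placed_def by blast
  have hr: "h r \<in> {1..q}" if "r \<in> {1..b}" for r using h that unfolding placed_def by blast
  have inj: "inj_on (join p a f h) {1..a + b}"
  proof (rule inj_onI)
    fix r s assume rs: "r \<in> {1..a + b}" "s \<in> {1..a + b}" "join p a f h r = join p a f h s"
    have fi: "f r = f s \<Longrightarrow> r \<in> {1..a} \<Longrightarrow> s \<in> {1..a} \<Longrightarrow> r = s" using f by (auto simp: placed_def dest: inj_onD)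
    have hi: "h (r - a) = h (s - a) \<Longrightarrow> r - a \<in> {1..b} \<Longrightarrow> s - a \<in> {1..b} \<Longrightarrow> r - a = s - a"
      using h by (auto simp: placed_def dest: inj_onD)
    show "r = s"
    proof (cases "r \<le> a"; cases "s \<le> a")
      assume "r \<le> a" "s \<le> a"
      then show ?thesis using rs fi by (auto simp: join_def)
    next
      assume "r \<le> a" "\<not> s \<le> a"
      moreover from this have "s - a \<in> {1..b}" "r \<in> {1..a}" using rs by auto
      ultimately show ?thesis using rs(3) fr[of r] hr[of "s - a"] by (auto simp: join_def)
    next
      assume "\<not> r \<le> a" "s \<le> a"
      moreover from this have "r - a \<in> {1..b}" "s \<in> {1..a}" using rs by auto
      ultimately show ?thesis using rs(3) fr[of s] hr[of "r - a"] by (auto simp: join_def)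
    next
      assume n: "\<not> r \<le> a" "\<not> s \<le> a"
      then have "h (r - a) = h (s - a)" "r - a \<in> {1..b}" "s - a \<in> {1..b}" using rs by (auto simp: join_def)
      then have "r - a = s - a" by (rule hi)
      then show ?thesis using n by simp
    qed
  qed
  have im: "join p a f h ` {1..a + b} \<subseteq> {1..p + q}"
    unfolding join_image
  proof (intro Un_least image_subsetI)
    show "f r \<in> {1..p + q}" if "r \<in> {1..a}" for r using fr[OF that] by simp
    show "p + h r \<in> {1..p + q}" if "r \<in> {1..b}" for r using hr[OF that] by simp
  qed
  have i: "i \<in> {1..p}" "i \<notin> f ` {1..a}" and j: "j \<in> {1..q}" "j \<notin> h ` {1..b}" using f h by (auto simp: placed_def)
  have "i \<notin> join p a f h ` {1..a + b}" unfolding join_image using i hr by fastforce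
  then show "placed (p + q) (a + b) (join p a f h) i" using inj im i by (simp add: placed_def)
  have "p + j \<notin> join p a f h ` {1..a + b}" unfolding join_image using j fr by fastforce
  then show "placed (p + q) (a + b) (join p a f h) (p + j)" using inj im j by (simp add: placed_def)
qed

lemma placed_mono: "placed p a f i \<Longrightarrow> p \<le> q \<Longrightarrow> placed q a f i"
  by (auto simp: placed_def)

lemma placed_Suc_comp: "placed p a f i \<Longrightarrow> placed (Suc p) a (Suc \<circ> f) (Suc i)"
  by (auto simp: placed_def intro: comp_inj_on)

lemma placed_id: "Suc a \<le> p \<Longrightarrow> placed p a id (Suc a)"
  by (auto simp: placed_def)

section \<open>The parameters \<open>s\<close> and \<open>t\<close> in terms of placements\<close>

section \<open>Multiplication by the parameter and the base elements\<close>

context S_module_over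
begin

text \<open>A permutation of \<open>p\<close> positions is also one of \<open>p + 1\<close>
  positions fixing the last, where the new \<open>t\<close> stands. Only the number of positions
  changes.\<close>

lemma rmult_t_elt:
  assumes pl: "placed p a f i" and x: "x \<in> hom_elts g a"
  shows "rmult_t R g p (t_elt p a f i x) = t_elt (Suc p) a f i x"
proof -
  define n where "n = p - Suc a"
  have p: "p = Suc a + n" using placed_Suc_le[OF pl] by (simp add: n_def)
  note \<rho> = placing[OF pl]
  have \<rho>': "placing p a f i permutes {1..Suc p}" by (rule permutes_subset[OF \<rho>(1)]) auto
  have "rmult_t R g p (t_elt p a f i x) = sym_act T (Suc p) (placing p a f i) (S_tensor_gen R Sg Kt (Suc a) (Suc n)
      (ind_gen R (sym_group (Suc a)) (young_group a 1) (perm_cross a) (component g a) (\<lambda>(\<sigma>, \<tau>). sym_act g a \<sigma>) id x) \<one>)"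
    using rmult_t_gen[of "placing p a f i" "Suc a" n] \<rho>(1) susp_gen_closed p by (simp add: susp_t_elt_def)
  also have "\<dots> = t_elt (Suc p) a f i x"
    using \<rho>' p x \<rho> by (intro act_susp_t_gen) auto
  finally show ?thesis .
qed

lemma lmult_t_additive: "additive (component T p) (component T (Suc p)) (lmult_t R g p)"
  using additive_comp[OF rmult_t_additive S_module_additive[OF S_module_T], of "block_perm (cycle_of_list [1, 2]) [p, 1]" p]
    block_perm_permutes(1)[of p 1]
  by (simp add: lmult_t_def[abs_def] Suc_eq_plus1)

text \<open>The block exchange carries the last \<open>t\<close> to the front and everything else up
  by one.\<close>

lemma lmult_t_elt:
  assumes pl: "placed p a f i" and x: "x \<in> hom_elts g a"
  shows "lmult_t R g p (t_elt p a f i x) = t_elt (Suc p) a (Suc \<circ> f) (Suc i) x"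
proof -
  let ?\<beta> = "block_perm (cycle_of_list [1, 2]) [p, 1]"
  have \<beta>: "?\<beta> permutes {1..Suc p}" using block_perm_permutes(1)[of p 1] by (simp add: Suc_eq_plus1)
  have "lmult_t R g p (t_elt p a f i x) = t_elt (Suc p) a (?\<beta> \<circ> f) (?\<beta> i) x"
    using sym_act_susp_t_elt[OF placed_mono[OF pl] \<beta> x] by (simp add: lmult_t_def rmult_t_elt[OF pl x])
  also have "?\<beta> i = Suc i" using pl by (auto simp: block_perm_2 placed_def)
  also have "t_elt (Suc p) a (?\<beta> \<circ> f) (Suc i) x = t_elt (Suc p) a (Suc \<circ> f) (Suc i) x"
    using pl by (intro susp_t_elt_cong) (auto simp: block_perm_2 placed_def image_subset_iff)
  finally show ?thesis .
qed

text \<open>\<open>bracket_t_linear\<close> speaks of multiplication from the left only, whereas the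
  elements \<open>x s t^n\<close> grow on the right. Equivariance translates one into the
  other.\<close>

lemma rmult_t_eq_act_lmult_t:
  assumes "u \<in> hom_elts T p"
  shows "rmult_t R g p u = sym_act T (Suc p) (block_perm (cycle_of_list [1, 2]) [1, p]) (lmult_t R g p u)"
proof -
  have \<beta>: "block_perm (cycle_of_list [1, 2]) [p, 1] permutes {1..Suc p}"
    "block_perm (cycle_of_list [1, 2]) [1, p] permutes {1..Suc p}"
    using block_perm_permutes(1)[of p 1] block_perm_permutes(1)[of 1 p] by (simp_all add: Suc_eq_plus1 add.commute)
  have u: "rmult_t R g p u \<in> hom_elts T (Suc p)" by (rule additive_closed[OF rmult_t_additive assms])
  show ?thesis
    unfolding lmult_t_def S_module_comp[OF S_module_T \<beta>(2,1) u, symmetric] block_perm_2_involution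
    by (simp add: S_module_one[OF S_module_T u])
qed

lemma susp_incl_base:
  assumes x: "x \<in> hom_elts g a"
  shows "susp_incl R g (Suc a) (susp_elt R g a 0 x) = t_elt (Suc a) a id (Suc a) x"
  using act_susp_t_gen[OF permutes_id, of "Suc a" a 0 x id "Suc a"] S_module_one[OF S_module_T susp_t_gen_closed[of a 0 x]] x
  by (simp add: susp_incl_def susp_elt_def Suc_eq_plus1[symmetric])

text \<open>The cycle \<open>(i, ..., m + 1)\<close> takes \<open>s\<close> from the last place to
  \<open>i\<close> and moves the labels from \<open>i\<close> on up by one. The labels therefore
  skip \<open>i\<close>.\<close>

lemma susp_elt_t_eq:
  assumes i: "1 \<le> i" "i \<le> Suc m" and w: "w \<in> hom_elts g m"
  shows "susp_elt_t R g m i w = t_elt (Suc (Suc m)) m (\<lambda>q. if q < i then q else Suc q) i w"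
proof -
  let ?c = "cycle_of_list [i..<m + 2]"
  let ?x = "ind_gen R (sym_group (Suc m)) (young_group m 1) (perm_cross m) (component g m) (\<lambda>(\<sigma>, \<tau>). sym_act g m \<sigma>) id w"
  have m2: "m + 2 = Suc (Suc m)" by simp
  have c: "?c permutes {1..Suc m}"
    by (rule permutes_subset[OF cycle_permutes]) (use i in auto)
  have cv: "?c j = (if i \<le> j \<and> j < Suc m then Suc j else if j = Suc m then i else j)" for j
    unfolding m2 by (rule cycle_of_list_upt[OF i(2)])
  have x: "?x \<in> hom_elts Sg (Suc m)" by (rule susp_gen_closed)
  have "susp_elt R g m i w = sym_act Sg (Suc m) ?c ?x"
  proof (cases "i \<le> m")
    \<comment> \<open>For \<open>i = m + 1\<close> the definition of \<open>susp_elt\<close> takes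
      the branch without a permutation, and the cycle has length one.\<close>
    case False
    then have "i = Suc m" using i by simp
    then have "?c = id" by (simp add: m2 cycle_of_list.simps)
    then show ?thesis using False S_module_one[OF S_module_suspension x] by (simp add: susp_elt_def)
  qed (use i in \<open>simp add: susp_elt_def Let_def\<close>)
  then have "susp_incl R g (m + 1) (susp_elt R g m i w) =
      sym_act T (Suc m) ?c (S_tensor_gen R Sg Kt (Suc m) 0 ?x \<one>)"
    using S_tensor_gen_equivariant[OF susp_poly_S_modules c permutes_id x, of \<one> 0] perm_cross_ident[OF c]
    by (simp add: susp_incl_def poly_t_simps suspension_t_def Suc_eq_plus1[symmetric])
  also have "\<dots> = t_elt (Suc m) m ?c i w"
    using cv by (intro act_susp_t_gen[OF c _ w]) auto
  finally have "susp_elt_t R g m i w = t_elt (Suc (Suc m)) m ?c i w"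
    using rmult_t_elt[of "Suc m" m ?c i w] placed_permutes[OF c, of m] w cv[of "Suc m"]
    by (simp add: susp_elt_t_def Suc_eq_plus1[symmetric])
  also have "\<dots> = t_elt (Suc (Suc m)) m (\<lambda>q. if q < i then q else Suc q) i w"
    by (rule susp_t_elt_cong) (unfold cv, auto)
  finally show ?thesis .
qed

text \<open>\<open>x s t^n\<close> arises from \<open>x s\<close> by repeated right multiplication,
  and every placement is a translate of it. The uniqueness proofs for the product and the bracket
  follow this rule; the degree \<open>p\<close> varies because multiplication by \<open>t\<close>
  raises it.\<close>

lemma susp_t_generated [consumes 1, case_names zero add act rmult base]:
  assumes u: "u \<in> hom_elts T p" and zero: "\<And>p. Q p \<zero>\<^bsub>component T p\<^esub>"
    and add: "\<And>p u v. u \<in> hom_elts T p \<Longrightarrow> v \<in> hom_elts T p \<Longrightarrow> Q p u \<Longrightarrow> Q p v \<Longrightarrow> Q p (u \<oplus>\<^bsub>component T p\<^esub> v)"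
    and act: "\<And>p u \<sigma>. u \<in> hom_elts T p \<Longrightarrow> \<sigma> permutes {1..p} \<Longrightarrow> Q p u \<Longrightarrow> Q p (sym_act T p \<sigma> u)"
    and rmult: "\<And>p u. u \<in> hom_elts T p \<Longrightarrow> Q p u \<Longrightarrow> Q (Suc p) (rmult_t R g p u)"
    and base: "\<And>a x. x \<in> hom_elts g a \<Longrightarrow> Q (Suc a) (t_elt (Suc a) a id (Suc a) x)"
  shows "Q p u"
  using u
proof (induction rule: susp_t_induct[consumes 1, case_names zero add elt])
  case (elt a f i x)
  define n where "n = p - Suc a"
  have p: "p = Suc a + n" using placed_Suc_le[OF elt(1)] by (simp add: n_def)
  have "Q (Suc a + n) (t_elt (Suc a + n) a id (Suc a) x)" for n
  proof (induction n)
    case (Suc n)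
    have pl: "placed (Suc a + n) a id (Suc a)" by (rule placed_id) simp
    show ?case using rmult[OF susp_t_elt_closed[OF pl elt(2)] Suc] unfolding rmult_t_elt[OF pl elt(2)] add_Suc_right .
  qed (simp only: add_0_right base[OF elt(2)])
  then have "Q p (t_elt p a id (Suc a) x)" by (simp add: p)
  note Q = this
  have pl: "placed p a id (Suc a)" by (rule placed_id) (simp add: p)
  note \<rho> = placing[OF elt(1)]
  have "Q p (sym_act T p (placing p a f i) (t_elt p a id (Suc a) x))"
    by (rule act[OF susp_t_elt_closed[OF pl elt(2)] \<rho>(1) Q])
  moreover have "t_elt p a (placing p a f i \<circ> id) i x = t_elt p a f i x"
    using \<rho> by (intro susp_t_elt_cong) auto
  ultimately show ?case using sym_act_susp_t_elt[OF pl \<rho>(1) elt(2)] \<rho>(3) by simp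
qed (use zero add in auto)

lemma susp_t_ext2:
  assumes F: "\<And>v. v \<in> hom_elts T q \<Longrightarrow> additive (component T p) L (\<lambda>u. F u v)" "\<And>u. u \<in> hom_elts T p \<Longrightarrow> additive (component T q) L (F u)"
    and H: "\<And>v. v \<in> hom_elts T q \<Longrightarrow> additive (component T p) L (\<lambda>u. H u v)" "\<And>u. u \<in> hom_elts T p \<Longrightarrow> additive (component T q) L (H u)"
    and gen: "\<And>a f i x b h j y. placed p a f i \<Longrightarrow> x \<in> hom_elts g a \<Longrightarrow> placed q b h j \<Longrightarrow> y \<in> hom_elts g b \<Longrightarrow>
      F (t_elt p a f i x) (t_elt q b h j y) = H (t_elt p a f i x) (t_elt q b h j y)"
    and u: "u \<in> hom_elts T p" "v \<in> hom_elts T q"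
  shows "F u v = H u v"
proof (rule susp_t_ext[OF F(1)[OF u(2)] H(1)[OF u(2)] _ u(1)])
  fix a f i x assume "placed p a f i" "x \<in> hom_elts g a"
  then show "F (t_elt p a f i x) v = H (t_elt p a f i x) v"
    using susp_t_ext[OF F(2) H(2), of "t_elt p a f i x"] gen u(2) susp_t_elt_closed by blast
qed

end

context cring
begin

lemma S_prod_bilinear:
  assumes "S_module R M" "\<mu> \<in> S_morphisms R (S_tensor R M M) M"
  shows "bilinear R (component M m) (component M n) (component M (m + n)) (S_prod R M \<mu> m n)"
proof -
  note B = bilinearD[OF S_tensor_gen_bilinear[OF assms(1,1), of m n]]
  note \<mu> = S_morphismD(1)[OF assms(1,1,2), of "m + n"]
  show ?thesis unfolding S_prod_def
    by (rule bilinearI) (simp_all add: B linear_closed[OF \<mu>] linear_add[OF \<mu>] linear_smult[OF \<mu>])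
qed

lemma S_prod_equivariant:
  assumes "S_module R M" "\<mu> \<in> S_morphisms R (S_tensor R M M) M"
    and "\<sigma> permutes {1..m}" "\<tau> permutes {1..n}" "x \<in> hom_elts M m" "y \<in> hom_elts M n"
  shows "S_prod R M \<mu> m n (sym_act M m \<sigma> x) (sym_act M n \<tau> y) = sym_act M (m + n) (perm_cross m (\<sigma>, \<tau>)) (S_prod R M \<mu> m n x y)"
  unfolding S_prod_def S_tensor_gen_equivariant[OF assms(1,1,3-6)]
  by (rule S_morphismD(2)[OF assms(1,1,2) perm_cross_permutes[OF assms(3,4)] S_tensor_gen_closed[OF assms(1,1,5,6)]])

end

lemma additive_scale:
  assumes "additive M N f" "c \<in> carrier R" "module R N"
  shows "additive M N (\<lambda>x. c \<odot>\<^bsub>N\<^esub> f x)"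
proof -
  interpret N: module R N by fact
  show ?thesis using assms(1,2) by (auto simp: additive_def Pi_iff N.smult_r_distr)
qed

section \<open>The product on placements\<close>

section \<open>The product on the suspension\<close>

locale S_module_op = S_module_over R g for R (structure) and g :: "('a, 'm) smodule" +
  fixes circ :: "nat \<Rightarrow> ('a, 'm, 'm) S_tensor \<Rightarrow> 'm"
  assumes circ: "circ \<in> S_morphisms R (S_tensor R g g) g"
begin

abbreviation (input) "C \<equiv> S_prod R g circ"

lemmas C_bilinear = S_prod_bilinear[OF g circ]
lemmas C_equivariant = S_prod_equivariant[OF g circ]
lemmas C_closed = bilinearD(1)[OF C_bilinear]

lemma g_module: "module R (component g a)"
  by (rule S_module_module[OF g])

lemma C_additive:
  "x \<in> hom_elts g a \<Longrightarrow> additive (component g b) (component g (a + b)) (C a b x)"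
  "y \<in> hom_elts g b \<Longrightarrow> additive (component g a) (component g (a + b)) (\<lambda>x. C a b x y)"
  using bilinear_additive[OF C_bilinear g_module g_module g_module] by auto

lemma C_act_left: "\<sigma> permutes {1..a} \<Longrightarrow> x \<in> hom_elts g a \<Longrightarrow> y \<in> hom_elts g b \<Longrightarrow>
    C a b (sym_act g a \<sigma> x) y = sym_act g (a + b) (perm_cross a (\<sigma>, id)) (C a b x y)"
  using C_equivariant[of \<sigma> a id b x y] S_module_one[OF g, of y b] by (simp add: permutes_id)

lemma C_act_right: "\<tau> permutes {1..b} \<Longrightarrow> x \<in> hom_elts g a \<Longrightarrow> y \<in> hom_elts g b \<Longrightarrow>
    C a b x (sym_act g b \<tau> y) = sym_act g (a + b) (perm_cross a (id, \<tau>)) (C a b x y)"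
  using C_equivariant[of id a \<tau> b x y] S_module_one[OF g, of x a] by (simp add: permutes_id)

text \<open>The presentation by placements is used once for each argument: \<open>L\<close> extends
  the formula in the left argument for a fixed right generator, and \<open>V u\<close> extends
  \<open>L\<close> in the right one. Each time the relabelling condition is the equivariance of
  \<open>circ\<close> in one variable.\<close>

lemma susp_prod_exists:
  "\<exists>B. bilinear R (component T p) (component T q) (component T (p + q)) B \<and>
    (\<forall>a f i x b h j y. placed p a f i \<longrightarrow> x \<in> hom_elts g a \<longrightarrow> placed q b h j \<longrightarrow> y \<in> hom_elts g b \<longrightarrow>
      B (t_elt p a f i x) (t_elt q b h j y) = t_elt (p + q) (a + b) (join p a f h) i (C a b x y))"
proof -
  let ?T = "component T (p + q)"
  \<comment> \<open>The value does not mention \<open>j\<close>: the \<open>s\<close> of the second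
    factor turns into a \<open>t\<close>, and \<open>t\<close>'s leave no trace in a
    placement.\<close>
  define \<Phi> where "\<Phi> = (\<lambda>a f i x b h (j::nat) y. t_elt (p + q) (a + b) (join p a f h) i (C a b x y))"
  note A = susp_t_elt_additive and Tm = T_module
  have left: "\<exists>F\<in>linear_maps R (component T p) ?T. \<forall>a f i x. placed p a f i \<longrightarrow> x \<in> hom_elts g a \<longrightarrow>
      F (t_elt p a f i x) = \<Phi> a f i x b h j y" if h: "placed q b h j" and y: "y \<in> hom_elts g b" for b h j y
  proof (rule susp_t_lift[OF Tm])
    fix a f i assume f: "placed p a f i"
    note pl = placed_join(1)[OF f h]
    show "additive (component g a) ?T (\<lambda>x. \<Phi> a f i x b h j y)"
      unfolding \<Phi>_def by (rule additive_comp[OF C_additive(2)[OF y] A[OF pl]])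
    show "\<Phi> a f i (c \<odot>\<^bsub>component g a\<^esub> x) b h j y = c \<odot>\<^bsub>?T\<^esub> \<Phi> a f i x b h j y"
      if "c \<in> carrier R" "x \<in> hom_elts g a" for c x
      unfolding \<Phi>_def bilinearD(4)[OF C_bilinear that y] by (rule susp_t_elt_smult[OF pl that(1) C_closed[OF that(2) y]])
    show "\<Phi> a (f \<circ> \<sigma>) i x b h j y = \<Phi> a f i (sym_act g a \<sigma> x) b h j y"
      if s: "\<sigma> permutes {1..a}" and x: "x \<in> hom_elts g a" for \<sigma> x
    proof -
      \<comment> \<open>Renaming the labels of \<open>x\<close> by \<open>\<sigma>\<close> renames
        those of the product by \<open>\<sigma>\<close> times the identity.\<close>
      have "t_elt (p + q) (a + b) (join p a (f \<circ> \<sigma>) h) i (C a b x y) =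
          t_elt (p + q) (a + b) (join p a f h \<circ> perm_cross a (\<sigma>, id)) i (C a b x y)"
        using permutes_in_image[OF s] by (intro susp_t_elt_cong) (auto simp: join_def perm_cross_def)
      then show ?thesis
        using susp_t_elt_rearrange[OF pl perm_cross_permutes[OF s permutes_id] C_closed[OF x y]]
        by (simp add: \<Phi>_def C_act_left[OF s x y])
    qed
    show "\<Phi> a f i x b h j y = \<Phi> a f' i x b h j y" if "\<And>k. k \<in> {1..a} \<Longrightarrow> f k = f' k" for f' x
      unfolding \<Phi>_def using that by (intro susp_t_elt_cong) (auto simp: join_def)
  qed
  \<comment> \<open>The conditions are moved under the existential quantifier, so that
    \<open>L\<close> can be chosen as one function of all arguments.\<close>
  have "\<forall>b h j y. \<exists>F. placed q b h j \<longrightarrow> y \<in> hom_elts g b \<longrightarrow> F \<in> linear_maps R (component T p) ?T \<and>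
      (\<forall>a f i x. placed p a f i \<longrightarrow> x \<in> hom_elts g a \<longrightarrow> F (t_elt p a f i x) = \<Phi> a f i x b h j y)"
    using left by blast
  then obtain L where L: "\<And>b h j y. placed q b h j \<Longrightarrow> y \<in> hom_elts g b \<Longrightarrow> L b h j y \<in> linear_maps R (component T p) ?T"
    "\<And>b h j y a f i x. placed q b h j \<Longrightarrow> y \<in> hom_elts g b \<Longrightarrow> placed p a f i \<Longrightarrow> x \<in> hom_elts g a \<Longrightarrow>
      L b h j y (t_elt p a f i x) = \<Phi> a f i x b h j y"
    by metis
  note La = linear_additive[OF L(1) Tm Tm]
  have right: "\<exists>F\<in>linear_maps R (component T q) ?T. \<forall>b h j y. placed q b h j \<longrightarrow> y \<in> hom_elts g b \<longrightarrow>
      F (t_elt q b h j y) = L b h j y u" if u: "u \<in> hom_elts T p" for u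
  proof (rule susp_t_lift[OF Tm])
    fix b h j assume h: "placed q b h j"
    interpret G: module R "component g b" by (rule g_module)
    \<comment> \<open>For arbitrary \<open>u\<close>, additivity in \<open>y\<close> is an equation
      between two additive maps of \<open>u\<close>, so it can be tested on placements.\<close>
    show "additive (component g b) ?T (\<lambda>y. L b h j y u)"
    proof (rule additiveI)
      show "L b h j (y \<oplus>\<^bsub>component g b\<^esub> y') u = L b h j y u \<oplus>\<^bsub>?T\<^esub> L b h j y' u"
        if y: "y \<in> hom_elts g b" "y' \<in> hom_elts g b" for y y'
      proof (rule susp_t_ext[OF La additive_plus[OF La La] _ u])
        show "L b h j (y \<oplus>\<^bsub>component g b\<^esub> y') (t_elt p a f i x) = L b h j y (t_elt p a f i x) \<oplus>\<^bsub>?T\<^esub> L b h j y' (t_elt p a f i x)"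
          if f: "placed p a f i" and x: "x \<in> hom_elts g a" for a f i x
          using y L(2)[OF h _ f x] additive_add[OF additive_comp[OF C_additive(1)[OF x] A[OF placed_join(1)[OF f h]]] y]
          by (simp add: \<Phi>_def)
      qed (use h y in auto)
    qed (use linear_closed[OF L(1)[OF h] u] in \<open>auto intro: module_abelian_group[OF g_module] module_abelian_group[OF Tm]\<close>)
    show "L b h j (c \<odot>\<^bsub>component g b\<^esub> y) u = c \<odot>\<^bsub>?T\<^esub> L b h j y u"
      if c: "c \<in> carrier R" and y: "y \<in> hom_elts g b" for c y
    proof (rule susp_t_ext[OF La additive_scale[OF La c Tm] _ u])
      show "L b h j (c \<odot>\<^bsub>component g b\<^esub> y) (t_elt p a f i x) = c \<odot>\<^bsub>?T\<^esub> L b h j y (t_elt p a f i x)"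
        if f: "placed p a f i" and x: "x \<in> hom_elts g a" for a f i x
        using c y L(2)[OF h _ f x] susp_t_elt_smult[OF placed_join(1)[OF f h] c C_closed[OF x y]] bilinearD(5)[OF C_bilinear c x y]
        by (simp add: \<Phi>_def)
    qed (use h y c in auto)
    show "L b (h \<circ> \<tau>) j y u = L b h j (sym_act g b \<tau> y) u"
      if t: "\<tau> permutes {1..b}" and y: "y \<in> hom_elts g b" for \<tau> y
    proof (rule susp_t_ext[OF La La _ u])
      note h' = placed_rearrange[OF h t]
      show "L b (h \<circ> \<tau>) j y (t_elt p a f i x) = L b h j (sym_act g b \<tau> y) (t_elt p a f i x)"
        if f: "placed p a f i" and x: "x \<in> hom_elts g a" for a f i x
      proof -
        have "t_elt (p + q) (a + b) (join p a f (h \<circ> \<tau>)) i (C a b x y) =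
            t_elt (p + q) (a + b) (join p a f h \<circ> perm_cross a (id, \<tau>)) i (C a b x y)"
        proof (rule susp_t_elt_cong)
          fix k assume k: "k \<in> {1..a + b}"
          \<comment> \<open>A label of the second factor stays above \<open>a\<close> after
            \<open>\<tau>\<close>, so \<open>join\<close> treats it by the same branch.\<close>
          have "1 \<le> \<tau> (k - a)" if "\<not> k \<le> a" using permutes_in_image[OF t, of "k - a"] k that by auto
          then show "join p a f (h \<circ> \<tau>) k = (join p a f h \<circ> perm_cross a (id, \<tau>)) k" by (auto simp: join_def perm_cross_def)
        qed
        then show ?thesis
          using susp_t_elt_rearrange[OF placed_join(1)[OF f h] perm_cross_permutes[OF permutes_id t] C_closed[OF x y]]
            L(2)[OF h' y f x] L(2)[OF h S_module_closed[OF g t y] f x]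
          by (simp add: \<Phi>_def C_act_right[OF t x y])
      qed
    qed (use h y S_module_closed[OF g t y] placed_rearrange[OF h t] in auto)
    show "L b h j y u = L b h' j y u" if eq: "\<And>k. k \<in> {1..b} \<Longrightarrow> h k = h' k" and y: "y \<in> hom_elts g b" for h' y
    proof (rule susp_t_ext[OF La La _ u])
      have h': "placed q b h' j" using placed_cong[of b h h' q j, OF eq] h by blast
      then show "placed q b h' j" .
      show "L b h j y (t_elt p a f i x) = L b h' j y (t_elt p a f i x)" if f: "placed p a f i" and x: "x \<in> hom_elts g a" for a f i x
        unfolding L(2)[OF h y f x] L(2)[OF h' y f x] \<Phi>_def
        by (rule susp_t_elt_cong) (auto simp: join_def intro!: eq)
    qed (use h y in auto)
  qed
  have "\<forall>u. \<exists>F. u \<in> hom_elts T p \<longrightarrow> F \<in> linear_maps R (component T q) ?T \<and>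
      (\<forall>b h j y. placed q b h j \<longrightarrow> y \<in> hom_elts g b \<longrightarrow> F (t_elt q b h j y) = L b h j y u)"
    using right by blast
  then obtain V where V: "\<And>u. u \<in> hom_elts T p \<Longrightarrow> V u \<in> linear_maps R (component T q) ?T"
    "\<And>u b h j y. u \<in> hom_elts T p \<Longrightarrow> placed q b h j \<Longrightarrow> y \<in> hom_elts g b \<Longrightarrow> V u (t_elt q b h j y) = L b h j y u"
    by metis
  note Va = linear_additive[OF V(1) Tm Tm]
  interpret Tp: module R "component T p" by (rule Tm)
  have "bilinear R (component T p) (component T q) ?T V"
  proof (rule bilinearI)
    fix u v assume u: "u \<in> hom_elts T p" and v: "v \<in> hom_elts T q"
    show "V u v \<in> hom_elts T (p + q)" by (rule linear_closed[OF V(1)[OF u] v])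
    show "V (u \<oplus>\<^bsub>component T p\<^esub> u') v = V u v \<oplus>\<^bsub>?T\<^esub> V u' v" if u': "u' \<in> hom_elts T p" for u'
      by (rule susp_t_ext[OF Va additive_plus[OF Va Va] _ v]) (use u u' in \<open>auto simp: V(2) linear_add[OF L(1)]\<close>)
    show "V (c \<odot>\<^bsub>component T p\<^esub> u) v = c \<odot>\<^bsub>?T\<^esub> V u v" if c: "c \<in> carrier R" for c
      by (rule susp_t_ext[OF Va additive_scale[OF Va c Tm] _ v]) (use u c in \<open>auto simp: V(2) linear_smult[OF L(1)]\<close>)
    show "V u (v \<oplus>\<^bsub>component T q\<^esub> v') = V u v \<oplus>\<^bsub>?T\<^esub> V u v'" if "v' \<in> hom_elts T q" for v'
      by (rule linear_add[OF V(1)[OF u] v that])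
    show "V u (c \<odot>\<^bsub>component T q\<^esub> v) = c \<odot>\<^bsub>?T\<^esub> V u v" if "c \<in> carrier R" for c
      by (rule linear_smult[OF V(1)[OF u] that v])
  qed
  moreover have "V (t_elt p a f i x) (t_elt q b h j y) = t_elt (p + q) (a + b) (join p a f h) i (C a b x y)"
    if f: "placed p a f i" "x \<in> hom_elts g a" and h: "placed q b h j" "y \<in> hom_elts g b" for a f i x b h j y
    using V(2)[OF susp_t_elt_closed[OF f] h] L(2)[OF h f] by (simp add: \<Phi>_def)
  ultimately show ?thesis by blast
qed

text \<open>The choice is unique on the carriers, because placements span both arguments.\<close>

definition susp_prod :: "nat \<Rightarrow> nat \<Rightarrow> ('a, 'm) susp_t \<Rightarrow> ('a, 'm) susp_t \<Rightarrow> ('a, 'm) susp_t"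
  where "susp_prod p q = (SOME B. bilinear R (component T p) (component T q) (component T (p + q)) B \<and>
    (\<forall>a f i x b h j y. placed p a f i \<longrightarrow> x \<in> hom_elts g a \<longrightarrow> placed q b h j \<longrightarrow> y \<in> hom_elts g b \<longrightarrow>
      B (t_elt p a f i x) (t_elt q b h j y) = t_elt (p + q) (a + b) (join p a f h) i (C a b x y)))"

lemma susp_prod_bilinear: "bilinear R (component T p) (component T q) (component T (p + q)) (susp_prod p q)"
  and susp_prod_elt: "placed p a f i \<Longrightarrow> x \<in> hom_elts g a \<Longrightarrow> placed q b h j \<Longrightarrow> y \<in> hom_elts g b \<Longrightarrow>
    susp_prod p q (t_elt p a f i x) (t_elt q b h j y) = t_elt (p + q) (a + b) (join p a f h) i (C a b x y)"
  using someI_ex[OF susp_prod_exists[of p q], folded susp_prod_def] by blast+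

lemmas susp_prod_closed = bilinearD(1)[OF susp_prod_bilinear]

lemma susp_prod_additive:
  "u \<in> hom_elts T p \<Longrightarrow> additive (component T q) (component T (p + q)) (susp_prod p q u)"
  "v \<in> hom_elts T q \<Longrightarrow> additive (component T p) (component T (p + q)) (\<lambda>u. susp_prod p q u v)"
  using bilinear_additive[OF susp_prod_bilinear T_module T_module T_module] by auto

lemmas T_act_additive = S_module_additive[OF S_module_T]
lemmas T_act_closed = S_module_closed[OF S_module_T]

lemma susp_prod_equivariant:
  assumes s: "\<sigma> permutes {1..p}" and t: "\<tau> permutes {1..q}" and u: "u \<in> hom_elts T p" and v: "v \<in> hom_elts T q"
  shows "susp_prod p q (sym_act T p \<sigma> u) (sym_act T q \<tau> v) = sym_act T (p + q) (perm_cross p (\<sigma>, \<tau>)) (susp_prod p q u v)"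
proof (rule susp_t_ext2[where p = p and q = q and L = "component T (p + q)", OF _ _ _ _ _ u v])
  note st = perm_cross_permutes[OF s t]
  fix a f i x b h j y
  assume f: "placed p a f i" and x: "x \<in> hom_elts g a" and h: "placed q b h j" and y: "y \<in> hom_elts g b"
  have "susp_prod p q (sym_act T p \<sigma> (t_elt p a f i x)) (sym_act T q \<tau> (t_elt q b h j y)) =
      t_elt (p + q) (a + b) (join p a (\<sigma> \<circ> f) (\<tau> \<circ> h)) (\<sigma> i) (C a b x y)"
    by (simp add: sym_act_susp_t_elt[OF f s x] sym_act_susp_t_elt[OF h t y] susp_prod_elt[OF placed_comp[OF f s] x placed_comp[OF h t] y])
  also have "\<dots> = t_elt (p + q) (a + b) (perm_cross p (\<sigma>, \<tau>) \<circ> join p a f h) (\<sigma> i) (C a b x y)"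
  proof (rule susp_t_elt_cong)
    fix k assume k: "k \<in> {1..a + b}"
    show "join p a (\<sigma> \<circ> f) (\<tau> \<circ> h) k = (perm_cross p (\<sigma>, \<tau>) \<circ> join p a f h) k"
    proof (cases "k \<le> a")
      case True
      then have "f k \<in> {1..p}" using k f unfolding placed_def by fastforce
      then show ?thesis using True by (simp add: join_def perm_cross_def)
    next
      case False
      then have "k - a \<in> {1..b}" using k by auto
      then have "h (k - a) \<in> {1..q}" using h unfolding placed_def by blast
      then show ?thesis using False by (simp add: join_def perm_cross_def)
    qed
  qed
  also have "\<sigma> i = perm_cross p (\<sigma>, \<tau>) i" using f by (simp add: placed_def perm_cross_def)
  also have "t_elt (p + q) (a + b) (perm_cross p (\<sigma>, \<tau>) \<circ> join p a f h) (perm_cross p (\<sigma>, \<tau>) i) (C a b x y) =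
      sym_act T (p + q) (perm_cross p (\<sigma>, \<tau>)) (susp_prod p q (t_elt p a f i x) (t_elt q b h j y))"
    using sym_act_susp_t_elt[OF placed_join(1)[OF f h] st C_closed[OF x y]] by (simp add: susp_prod_elt[OF f x h y])
  finally show "susp_prod p q (sym_act T p \<sigma> (t_elt p a f i x)) (sym_act T q \<tau> (t_elt q b h j y)) =
      sym_act T (p + q) (perm_cross p (\<sigma>, \<tau>)) (susp_prod p q (t_elt p a f i x) (t_elt q b h j y))" .
next
  note st = perm_cross_permutes[OF s t]
  show "additive (component T p) (component T (p + q)) (\<lambda>u. susp_prod p q (sym_act T p \<sigma> u) (sym_act T q \<tau> v))"
    if "v \<in> hom_elts T q" for v
    by (rule additive_comp[OF T_act_additive[OF s] susp_prod_additive(2)[OF T_act_closed[OF t that]]])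
  show "additive (component T q) (component T (p + q)) (\<lambda>v. susp_prod p q (sym_act T p \<sigma> u) (sym_act T q \<tau> v))"
    if "u \<in> hom_elts T p" for u
    by (rule additive_comp[OF T_act_additive[OF t] susp_prod_additive(1)[OF T_act_closed[OF s that]]])
  show "additive (component T p) (component T (p + q)) (\<lambda>u. sym_act T (p + q) (perm_cross p (\<sigma>, \<tau>)) (susp_prod p q u v))"
    if "v \<in> hom_elts T q" for v
    by (rule additive_comp[OF susp_prod_additive(2)[OF that] T_act_additive[OF st]])
  show "additive (component T q) (component T (p + q)) (\<lambda>v. sym_act T (p + q) (perm_cross p (\<sigma>, \<tau>)) (susp_prod p q u v))"
    if "u \<in> hom_elts T p" for u
    by (rule additive_comp[OF susp_prod_additive(1)[OF that] T_act_additive[OF st]])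
qed

text \<open>All three identities compare positions: \<open>(ut)v\<close> and \<open>u(tv)\<close>
  both insert a \<open>t\<close> between the two blocks, and the other two insert it before or after
  both.\<close>

lemma susp_prod_t_linear:
  assumes u: "u \<in> hom_elts T p" and v: "v \<in> hom_elts T q"
  shows "susp_prod (Suc p) q (rmult_t R g p u) v = susp_prod p (Suc q) u (lmult_t R g q v)"
    and "lmult_t R g (p + q) (susp_prod p q u v) = susp_prod (Suc p) q (lmult_t R g p u) v"
    and "rmult_t R g (p + q) (susp_prod p q u v) = susp_prod p (Suc q) u (rmult_t R g q v)"
proof -
  note r = additive_closed[OF rmult_t_additive] and l = additive_closed[OF lmult_t_additive]
  have e: "susp_prod (Suc p) q (rmult_t R g p (t_elt p a f i x)) (t_elt q b h j y) = susp_prod p (Suc q) (t_elt p a f i x) (lmult_t R g q (t_elt q b h j y))"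
    "lmult_t R g (p + q) (susp_prod p q (t_elt p a f i x) (t_elt q b h j y)) = susp_prod (Suc p) q (lmult_t R g p (t_elt p a f i x)) (t_elt q b h j y)"
    "rmult_t R g (p + q) (susp_prod p q (t_elt p a f i x) (t_elt q b h j y)) = susp_prod p (Suc q) (t_elt p a f i x) (rmult_t R g q (t_elt q b h j y))"
    if f: "placed p a f i" and x: "x \<in> hom_elts g a" and h: "placed q b h j" and y: "y \<in> hom_elts g b" for a f i x b h j y
  proof -
    have f': "placed (Suc p) a f i" and h': "placed (Suc q) b h j" using placed_mono f h le_SucI by blast+
    note f'' = placed_Suc_comp[OF f] and h'' = placed_Suc_comp[OF h]
    note pl = placed_join(1)[OF f h]
    have "join (Suc p) a f h = join p a f (Suc \<circ> h)" "join (Suc p) a (Suc \<circ> f) h = Suc \<circ> join p a f h"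
      by (auto simp: join_def fun_eq_iff)
    then show "susp_prod (Suc p) q (rmult_t R g p (t_elt p a f i x)) (t_elt q b h j y) = susp_prod p (Suc q) (t_elt p a f i x) (lmult_t R g q (t_elt q b h j y))"
      "lmult_t R g (p + q) (susp_prod p q (t_elt p a f i x) (t_elt q b h j y)) = susp_prod (Suc p) q (lmult_t R g p (t_elt p a f i x)) (t_elt q b h j y)"
      "rmult_t R g (p + q) (susp_prod p q (t_elt p a f i x) (t_elt q b h j y)) = susp_prod p (Suc q) (t_elt p a f i x) (rmult_t R g q (t_elt q b h j y))"
      by (simp_all add: rmult_t_elt[OF f x] rmult_t_elt[OF h y] lmult_t_elt[OF f x] lmult_t_elt[OF h y] susp_prod_elt[OF f x h y]
        susp_prod_elt[OF f' x h y] susp_prod_elt[OF f x h'' y] susp_prod_elt[OF f'' x h y] susp_prod_elt[OF f x h' y]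
        rmult_t_elt[OF pl C_closed[OF x y]] lmult_t_elt[OF pl C_closed[OF x y]])
  qed
  note a1 = additive_comp[OF _ susp_prod_additive(1)] and a2 = additive_comp[OF _ susp_prod_additive(2)]
  note P1 = susp_prod_additive(1) and P2 = susp_prod_additive(2)
  show "susp_prod (Suc p) q (rmult_t R g p u) v = susp_prod p (Suc q) u (lmult_t R g q v)"
    by (rule susp_t_ext2[where p = p and q = q and L = "component T (Suc (p + q))"
        and F = "\<lambda>u v. susp_prod (Suc p) q (rmult_t R g p u) v" and H = "\<lambda>u v. susp_prod p (Suc q) u (lmult_t R g q v)", OF _ _ _ _ e(1) u v])
      (use a2[OF rmult_t_additive] P1[of _ "Suc p" q, OF r] P2[of _ "Suc q" p, OF l] a1[OF lmult_t_additive] in \<open>simp_all\<close>)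
  show "lmult_t R g (p + q) (susp_prod p q u v) = susp_prod (Suc p) q (lmult_t R g p u) v"
    by (rule susp_t_ext2[where p = p and q = q and L = "component T (Suc (p + q))"
        and F = "\<lambda>u v. lmult_t R g (p + q) (susp_prod p q u v)" and H = "\<lambda>u v. susp_prod (Suc p) q (lmult_t R g p u) v", OF _ _ _ _ e(2) u v])
      (use additive_comp[OF P1 lmult_t_additive] additive_comp[OF P2 lmult_t_additive] a2[OF lmult_t_additive] P1[of _ "Suc p" q, OF l] in \<open>simp_all\<close>)
  show "rmult_t R g (p + q) (susp_prod p q u v) = susp_prod p (Suc q) u (rmult_t R g q v)"
    by (rule susp_t_ext2[where p = p and q = q and L = "component T (Suc (p + q))"
        and F = "\<lambda>u v. rmult_t R g (p + q) (susp_prod p q u v)" and H = "\<lambda>u v. susp_prod p (Suc q) u (rmult_t R g q v)", OF _ _ _ _ e(3) u v])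
      (use additive_comp[OF P1 rmult_t_additive] additive_comp[OF P2 rmult_t_additive] a1[OF rmult_t_additive] P2[of _ "Suc q" p, OF r] in \<open>simp_all\<close>)
qed

end

section \<open>The commutator bracket\<close>

section \<open>The bracket on the suspension\<close>

abbreviation swap_perm :: "nat \<Rightarrow> nat \<Rightarrow> nat \<Rightarrow> nat"
  where "swap_perm m n \<equiv> block_perm (cycle_of_list [1, 2]) [m, n]"

definition join3 :: "nat \<Rightarrow> nat \<Rightarrow> (nat \<Rightarrow> nat) \<Rightarrow> (nat \<Rightarrow> nat) \<Rightarrow> (nat \<Rightarrow> nat) \<Rightarrow> nat \<Rightarrow> nat"
  where "join3 a b F1 F2 F3 s = (if s \<le> a then F1 s else if s \<le> a + b then F2 (s - a) else F3 (s - (a + b)))"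

text \<open>
  \<open>seated \<rho> d a f i F I\<close>: shifting the placement \<open>f\<close>, \<open>i\<close> by \<open>d\<close> and then permuting all positions
  by \<open>\<rho>\<close> gives the placement \<open>F\<close>, \<open>I\<close>.
\<close>

definition seated :: "(nat \<Rightarrow> nat) \<Rightarrow> nat \<Rightarrow> nat \<Rightarrow> (nat \<Rightarrow> nat) \<Rightarrow> nat \<Rightarrow> (nat \<Rightarrow> nat) \<Rightarrow> nat \<Rightarrow> bool"
  where "seated \<rho> d a f i F I \<longleftrightarrow> (\<forall>s\<in>{1..a}. F s = \<rho> (d + f s)) \<and> I = \<rho> (d + i)"

lemma swap_perm_permutes: "swap_perm n m permutes {1..m + n}"
  using block_perm_permutes(1)[of n m] by (simp add: add.commute)

lemma placed_range: "placed p a f i \<Longrightarrow> s \<in> {1..a} \<Longrightarrow> f s \<in> {1..p}" "placed p a f i \<Longrightarrow> i \<in> {1..p}"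
  by (auto simp: placed_def image_subset_iff)

text \<open>A seat depends on the permutation only through its values on the block in question. This
  allows the frame of one bracketing to be transferred to another in which the block starts
  elsewhere.\<close>

lemma seated_comp:
  assumes "placed p a f i" "seated \<rho> d a f i F I" "\<And>s. s \<in> {1..p} \<Longrightarrow> \<rho>' (d' + s) = \<rho> (d + s)"
  shows "seated \<rho>' d' a f i F I"
  using assms placed_range[OF assms(1)] by (auto simp: seated_def)

context S_module_over
begin

lemma susp_t_ext3:
  assumes F: "\<And>v w. v \<in> hom_elts T q \<Longrightarrow> w \<in> hom_elts T r \<Longrightarrow> additive (component T p) L (\<lambda>u. F u v w)"
      "\<And>u w. u \<in> hom_elts T p \<Longrightarrow> w \<in> hom_elts T r \<Longrightarrow> additive (component T q) L (\<lambda>v. F u v w)"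
      "\<And>u v. u \<in> hom_elts T p \<Longrightarrow> v \<in> hom_elts T q \<Longrightarrow> additive (component T r) L (F u v)"
    and H: "\<And>v w. v \<in> hom_elts T q \<Longrightarrow> w \<in> hom_elts T r \<Longrightarrow> additive (component T p) L (\<lambda>u. H u v w)"
      "\<And>u w. u \<in> hom_elts T p \<Longrightarrow> w \<in> hom_elts T r \<Longrightarrow> additive (component T q) L (\<lambda>v. H u v w)"
      "\<And>u v. u \<in> hom_elts T p \<Longrightarrow> v \<in> hom_elts T q \<Longrightarrow> additive (component T r) L (H u v)"
    and gen: "\<And>a f i x b h j y c l k z. placed p a f i \<Longrightarrow> x \<in> hom_elts g a \<Longrightarrow> placed q b h j \<Longrightarrow> y \<in> hom_elts g b \<Longrightarrow>
      placed r c l k \<Longrightarrow> z \<in> hom_elts g c \<Longrightarrow>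
      F (t_elt p a f i x) (t_elt q b h j y) (t_elt r c l k z) = H (t_elt p a f i x) (t_elt q b h j y) (t_elt r c l k z)"
    and u: "u \<in> hom_elts T p" "v \<in> hom_elts T q" "w \<in> hom_elts T r"
  shows "F u v w = H u v w"
proof (rule susp_t_ext2[where F = "\<lambda>u v. F u v w" and H = "\<lambda>u v. H u v w", OF F(1,2) H(1,2) _ u(1,2)])
  fix a f i x b h j y
  assume *: "placed p a f i" "x \<in> hom_elts g a" "placed q b h j" "y \<in> hom_elts g b"
  note c = susp_t_elt_closed[OF *(1,2)] susp_t_elt_closed[OF *(3,4)]
  show "F (t_elt p a f i x) (t_elt q b h j y) w = H (t_elt p a f i x) (t_elt q b h j y) w"
    by (rule susp_t_ext[OF F(3)[OF c] H(3)[OF c] gen[OF *] u(3)])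
qed (use u in auto)

end

context S_module_op
begin

lemma T_group: "abelian_group (component T p)"
  by (rule module_abelian_group[OF T_module])

definition susp_bracket :: "nat \<Rightarrow> nat \<Rightarrow> ('a, 'm) susp_t \<Rightarrow> ('a, 'm) susp_t \<Rightarrow> ('a, 'm) susp_t"
  where "susp_bracket p q u v =
    susp_prod p q u v \<ominus>\<^bsub>component T (p + q)\<^esub> sym_act T (p + q) (swap_perm q p) (susp_prod q p v u)"

lemma swapped_prod_additive:
  "v \<in> hom_elts T q \<Longrightarrow> additive (component T p) (component T (p + q)) (\<lambda>u. sym_act T (p + q) (swap_perm q p) (susp_prod q p v u))"
  "u \<in> hom_elts T p \<Longrightarrow> additive (component T q) (component T (p + q)) (\<lambda>v. sym_act T (p + q) (swap_perm q p) (susp_prod q p v u))"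
  using additive_comp[OF susp_prod_additive(1)[of v q p] T_act_additive[OF swap_perm_permutes, of p q, unfolded add.commute[of p q]]]
    additive_comp[OF susp_prod_additive(2)[of u p q] T_act_additive[OF swap_perm_permutes, of p q, unfolded add.commute[of p q]]]
  by (simp_all add: add.commute)

lemma susp_bracket_additive:
  "v \<in> hom_elts T q \<Longrightarrow> additive (component T p) (component T (p + q)) (\<lambda>u. susp_bracket p q u v)"
  "u \<in> hom_elts T p \<Longrightarrow> additive (component T q) (component T (p + q)) (susp_bracket p q u)"
  unfolding susp_bracket_def[abs_def]
  by (intro additive_minus susp_prod_additive swapped_prod_additive; assumption)+

lemmas susp_bracket_closed = additive_closed[OF susp_bracket_additive(1)]

lemma swapped_prod_closed:
  "u \<in> hom_elts T p \<Longrightarrow> v \<in> hom_elts T q \<Longrightarrow> susp_prod q p v u \<in> hom_elts T (p + q)"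
  using susp_prod_closed[of v q u p] by (simp add: add.commute)

lemma susp_bracket_bilinear: "bilinear R (component T p) (component T q) (component T (p + q)) (susp_bracket p q)"
proof (rule bilinearI)
  interpret N: module R "component T (p + q)" by (rule T_module)
  note B = bilinearD[OF susp_prod_bilinear]
  note act = linear_smult[OF S_module_linear[OF S_module_T swap_perm_permutes]]
  note tc = T_act_closed[OF swap_perm_permutes]
  fix u v assume u: "u \<in> hom_elts T p" and v: "v \<in> hom_elts T q"
  note c = susp_prod_closed[OF u v] swapped_prod_closed[OF u v] tc[OF swapped_prod_closed[OF u v]]
  show "susp_bracket p q u v \<in> hom_elts T (p + q)" by (rule susp_bracket_closed[OF v u])
  show "susp_bracket p q (u \<oplus>\<^bsub>component T p\<^esub> u') v = susp_bracket p q u v \<oplus>\<^bsub>component T (p + q)\<^esub> susp_bracket p q u' v"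
    if "u' \<in> hom_elts T p" for u' by (rule additive_add[OF susp_bracket_additive(1)[OF v] u that])
  show "susp_bracket p q u (v \<oplus>\<^bsub>component T q\<^esub> v') = susp_bracket p q u v \<oplus>\<^bsub>component T (p + q)\<^esub> susp_bracket p q u v'"
    if "v' \<in> hom_elts T q" for v' by (rule additive_add[OF susp_bracket_additive(2)[OF u] v that])
  fix k assume k: "k \<in> carrier R"
  have s: "susp_prod q p (k \<odot>\<^bsub>component T q\<^esub> v) u = k \<odot>\<^bsub>component T (p + q)\<^esub> susp_prod q p v u"
    "susp_prod q p v (k \<odot>\<^bsub>component T p\<^esub> u) = k \<odot>\<^bsub>component T (p + q)\<^esub> susp_prod q p v u"
    using B(4)[OF k v u] B(5)[OF k v u] by (simp_all add: add.commute)
  show "susp_bracket p q (k \<odot>\<^bsub>component T p\<^esub> u) v = k \<odot>\<^bsub>component T (p + q)\<^esub> susp_bracket p q u v"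
    "susp_bracket p q u (k \<odot>\<^bsub>component T q\<^esub> v) = k \<odot>\<^bsub>component T (p + q)\<^esub> susp_bracket p q u v"
    unfolding susp_bracket_def s B(4)[OF k u v] B(5)[OF k u v] act[OF k c(2)] a_minus_def
    using c k by (simp_all add: N.smult_r_distr N.smult_r_minus)
qed

lemma susp_bracket_equivariant:
  assumes s: "\<sigma> permutes {1..p}" and t: "\<tau> permutes {1..q}" and u: "u \<in> hom_elts T p" and v: "v \<in> hom_elts T q"
  shows "susp_bracket p q (sym_act T p \<sigma> u) (sym_act T q \<tau> v) = sym_act T (p + q) (perm_cross p (\<sigma>, \<tau>)) (susp_bracket p q u v)"
proof -
  have ts: "perm_cross q (\<tau>, \<sigma>) permutes {1..p + q}" using perm_cross_permutes[OF t s] by (simp add: add.commute)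
  have c: "susp_prod q p v u \<in> hom_elts T (p + q)" by (rule swapped_prod_closed[OF u v])
  have "sym_act T (p + q) (swap_perm q p) (susp_prod q p (sym_act T q \<tau> v) (sym_act T p \<sigma> u)) =
      sym_act T (p + q) (swap_perm q p \<circ> perm_cross q (\<tau>, \<sigma>)) (susp_prod q p v u)"
    using S_module_comp[OF S_module_T swap_perm_permutes ts c] susp_prod_equivariant[OF t s v u] by (simp add: add.commute)
  also have "\<dots> = sym_act T (p + q) (perm_cross p (\<sigma>, \<tau>)) (sym_act T (p + q) (swap_perm q p) (susp_prod q p v u))"
    unfolding block_perm_2_perm_cross[OF s t] by (rule S_module_comp[OF S_module_T perm_cross_permutes[OF s t] swap_perm_permutes c])
  finally show ?thesis
    unfolding susp_bracket_def susp_prod_equivariant[OF s t u v]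
    using additive_diff[OF T_act_additive[OF perm_cross_permutes[OF s t]] susp_prod_closed[OF u v] T_act_closed[OF swap_perm_permutes c]]
    by simp
qed

text \<open>Exchanging the blocks twice is the identity, so the two terms of the commutator trade
  places.\<close>

lemma susp_bracket_skew:
  assumes u: "u \<in> hom_elts T p" and v: "v \<in> hom_elts T q"
  shows "susp_bracket p q u v = \<ominus>\<^bsub>component T (p + q)\<^esub> sym_act T (p + q) (swap_perm q p) (susp_bracket q p v u)"
proof -
  interpret N: module R "component T (p + q)" by (rule T_module)
  note c = susp_prod_closed[OF u v] swapped_prod_closed[OF u v]
  note \<beta> = swap_perm_permutes[of q p] 
  have \<beta>': "swap_perm p q permutes {1..p + q}" using swap_perm_permutes[of p q] by (simp add: add.commute)
  note d = T_act_closed[OF \<beta> c(2)] T_act_closed[OF \<beta>' c(1)]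
  have "susp_bracket q p v u = susp_prod q p v u \<ominus>\<^bsub>component T (p + q)\<^esub> sym_act T (p + q) (swap_perm p q) (susp_prod p q u v)"
    by (simp add: susp_bracket_def add.commute)
  then have "sym_act T (p + q) (swap_perm q p) (susp_bracket q p v u) =
      sym_act T (p + q) (swap_perm q p) (susp_prod q p v u) \<ominus>\<^bsub>component T (p + q)\<^esub> susp_prod p q u v"
    using additive_diff[OF T_act_additive[OF \<beta>] c(2) d(2)] S_module_comp[OF S_module_T \<beta> \<beta>' c(1)] S_module_one[OF S_module_T c(1)]
    by (simp add: block_perm_2_involution)
  then show ?thesis using c d by (simp add: susp_bracket_def N.minus_eq N.minus_add N.a_comm)
qed

text \<open>Only the second term needs an argument: in the product of \<open>v\<close> with
  \<open>tu\<close> the \<open>t\<close> stands between the blocks, and the exchange of blocks of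
  sizes \<open>q\<close> and \<open>p + 1\<close> takes it to the front.\<close>

lemma susp_bracket_t_linear:
  assumes u: "u \<in> hom_elts T p" and v: "v \<in> hom_elts T q"
  shows "susp_bracket (Suc p) q (lmult_t R g p u) v = lmult_t R g (p + q) (susp_bracket p q u v)"
proof -
  note c = susp_prod_closed[OF u v] swapped_prod_closed[OF u v]
  have "sym_act T (Suc (p + q)) (swap_perm q (Suc p)) (susp_prod q (Suc p) v (lmult_t R g p u)) =
      lmult_t R g (p + q) (sym_act T (p + q) (swap_perm q p) (susp_prod q p v u))"
  proof (rule susp_t_ext2[where p = p and q = q and L = "component T (Suc (p + q))"
        and F = "\<lambda>u v. sym_act T (Suc (p + q)) (swap_perm q (Suc p)) (susp_prod q (Suc p) v (lmult_t R g p u))"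
        and H = "\<lambda>u v. lmult_t R g (p + q) (sym_act T (p + q) (swap_perm q p) (susp_prod q p v u))", OF _ _ _ _ _ u v])
    fix a f i x b h j y
    assume f: "placed p a f i" and x: "x \<in> hom_elts g a" and h: "placed q b h j" and y: "y \<in> hom_elts g b"
    note f' = placed_Suc_comp[OF f]
    have yx: "C b a y x \<in> hom_elts g (b + a)" by (rule C_closed[OF y x])
    have pl: "placed (p + q) (b + a) (join q b h f) j" "placed (Suc (p + q)) (b + a) (join q b h (Suc \<circ> f)) j"
      using placed_join(1)[OF h f] placed_join(1)[OF h f'] by (simp_all add: add.commute)
    have \<beta>: "swap_perm q (Suc p) permutes {1..Suc (p + q)}" using swap_perm_permutes[of q "Suc p"] by simp
    have jr: "j \<in> {1..q}" using placed_range(2)[OF h] .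
    have "sym_act T (Suc (p + q)) (swap_perm q (Suc p)) (susp_prod q (Suc p) (t_elt q b h j y) (lmult_t R g p (t_elt p a f i x))) =
        t_elt (Suc (p + q)) (b + a) (swap_perm q (Suc p) \<circ> join q b h (Suc \<circ> f)) (swap_perm q (Suc p) j) (C b a y x)"
      using sym_act_susp_t_elt[OF pl(2) \<beta> yx] by (simp add: lmult_t_elt[OF f x] susp_prod_elt[OF h y f' x] add.commute)
    \<comment> \<open>The block of \<open>v\<close> now passes \<open>p + 1\<close> positions
      instead of \<open>p\<close>.\<close>
    also have "swap_perm q (Suc p) j = Suc (swap_perm q p j)" using jr by (auto simp: block_perm_2)
    also have "t_elt (Suc (p + q)) (b + a) (swap_perm q (Suc p) \<circ> join q b h (Suc \<circ> f)) (Suc (swap_perm q p j)) (C b a y x) =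
        t_elt (Suc (p + q)) (b + a) (Suc \<circ> (swap_perm q p \<circ> join q b h f)) (Suc (swap_perm q p j)) (C b a y x)"
    proof (rule susp_t_elt_cong)
      fix s assume s: "s \<in> {1..b + a}"
      show "(swap_perm q (Suc p) \<circ> join q b h (Suc \<circ> f)) s = (Suc \<circ> (swap_perm q p \<circ> join q b h f)) s"
      proof (cases "s \<le> b")
        case True
        then show ?thesis using placed_range(1)[OF h, of s] s by (auto simp: join_def block_perm_2)
      next
        case False
        then have "s - b \<in> {1..a}" using s by auto
        then show ?thesis using False placed_range(1)[OF f, of "s - b"] by (auto simp: join_def block_perm_2)
      qed
    qed
    also have "\<dots> = lmult_t R g (p + q) (sym_act T (p + q) (swap_perm q p) (susp_prod q p (t_elt q b h j y) (t_elt p a f i x)))"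
      using sym_act_susp_t_elt[OF pl(1) swap_perm_permutes yx] lmult_t_elt[OF placed_comp[OF pl(1) swap_perm_permutes] yx]
      by (simp add: susp_prod_elt[OF h y f x] add.commute)
    finally show "sym_act T (Suc (p + q)) (swap_perm q (Suc p)) (susp_prod q (Suc p) (t_elt q b h j y) (lmult_t R g p (t_elt p a f i x))) =
      lmult_t R g (p + q) (sym_act T (p + q) (swap_perm q p) (susp_prod q p (t_elt q b h j y) (t_elt p a f i x)))" .
  next
    note l = additive_closed[OF lmult_t_additive]
    show "additive (component T p) (component T (Suc (p + q)))
        (\<lambda>u. sym_act T (Suc (p + q)) (swap_perm q (Suc p)) (susp_prod q (Suc p) v (lmult_t R g p u)))" if "v \<in> hom_elts T q" for v
      using additive_comp[OF lmult_t_additive swapped_prod_additive(1)[OF that]] by simp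
    show "additive (component T q) (component T (Suc (p + q)))
        (\<lambda>v. sym_act T (Suc (p + q)) (swap_perm q (Suc p)) (susp_prod q (Suc p) v (lmult_t R g p u)))" if "u \<in> hom_elts T p" for u
      using swapped_prod_additive(2)[OF l[OF that], of q] by simp
    show "additive (component T p) (component T (Suc (p + q)))
        (\<lambda>u. lmult_t R g (p + q) (sym_act T (p + q) (swap_perm q p) (susp_prod q p v u)))" if "v \<in> hom_elts T q" for v
      by (rule additive_comp[OF swapped_prod_additive(1)[OF that] lmult_t_additive])
    show "additive (component T q) (component T (Suc (p + q)))
        (\<lambda>v. lmult_t R g (p + q) (sym_act T (p + q) (swap_perm q p) (susp_prod q p v u)))" if "u \<in> hom_elts T p" for u
      by (rule additive_comp[OF swapped_prod_additive(2)[OF that] lmult_t_additive])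
  qed
  then show ?thesis
    using additive_diff[OF lmult_t_additive c(1) T_act_closed[OF swap_perm_permutes c(2)]] susp_prod_t_linear(2)[OF u v]
    by (simp add: susp_bracket_def)
qed

section \<open>Double products and double brackets in a common frame\<close>

section \<open>Iterated products and brackets\<close>

text \<open>The difference of the two sides of the pre-Lie identity, as a single element that can be
  placed among other positions and projected out again.\<close>

definition preLie_defect :: "nat \<Rightarrow> nat \<Rightarrow> nat \<Rightarrow> 'm \<Rightarrow> 'm \<Rightarrow> 'm \<Rightarrow> 'm"
  where "preLie_defect a b c x y z =
    (C (a + b) c (C a b x y) z \<ominus>\<^bsub>component g (a + b + c)\<^esub> C a (b + c) x (C b c y z)) \<ominus>\<^bsub>component g (a + b + c)\<^esub>
    sym_act g (a + b + c) (block_perm (cycle_of_list [2, 3]) [a, c, b])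
      (C (a + c) b (C a c x z) y \<ominus>\<^bsub>component g (a + b + c)\<^esub> C a (c + b) x (C c b z y))"

lemma C_C_closed:
  assumes "x \<in> hom_elts g a" "y \<in> hom_elts g b" "z \<in> hom_elts g c"
  shows "C (a + b) c (C a b x y) z \<in> hom_elts g (a + b + c)" "C a (b + c) x (C b c y z) \<in> hom_elts g (a + b + c)"
  using C_closed[OF C_closed[OF assms(1,2)] assms(3)] C_closed[OF assms(1) C_closed[OF assms(2,3)]]
  by (simp_all add: add.assoc)

lemma preLie_defect_closed:
  assumes "x \<in> hom_elts g a" "y \<in> hom_elts g b" "z \<in> hom_elts g c"
  shows "preLie_defect a b c x y z \<in> hom_elts g (a + b + c)"
proof -
  interpret G: module R "component g (a + b + c)" by (rule g_module)
  have \<beta>: "block_perm (cycle_of_list [2, 3]) [a, c, b] permutes {1..a + b + c}"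
    using block_perm_permutes(4)[of a c b] by (simp add: add_ac)
  have "a + c + b = a + b + c" by simp
  then have "C (a + c) b (C a c x z) y \<in> hom_elts g (a + b + c)" "C a (c + b) x (C c b z y) \<in> hom_elts g (a + b + c)"
    using C_C_closed[OF assms(1,3,2)] by metis+
  then show ?thesis
    unfolding preLie_defect_def using C_C_closed[OF assms] by (intro G.minus_closed S_module_closed[OF g \<beta>])
qed

lemma twisted_preLie_iff_defect:
  "twisted_preLie_algebra R g circ \<longleftrightarrow>
    (\<forall>a b c. \<forall>x\<in>hom_elts g a. \<forall>y\<in>hom_elts g b. \<forall>z\<in>hom_elts g c.
      preLie_defect a b c x y z = \<zero>\<^bsub>component g (a + b + c)\<^esub>)"
proof -
  have "preLie_defect a b c x y z = \<zero>\<^bsub>component g (a + b + c)\<^esub> \<longleftrightarrow>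
    C (a + b) c (C a b x y) z \<ominus>\<^bsub>component g (a + b + c)\<^esub> C a (b + c) x (C b c y z) =
    sym_act g (a + b + c) (block_perm (cycle_of_list [2, 3]) [a, c, b])
      (C (a + c) b (C a c x z) y \<ominus>\<^bsub>component g (a + b + c)\<^esub> C a (c + b) x (C c b z y))"
    if xyz: "x \<in> hom_elts g a" "y \<in> hom_elts g b" "z \<in> hom_elts g c" for a b c x y z
  proof -
    interpret G: module R "component g (a + b + c)" by (rule g_module)
    have \<beta>: "block_perm (cycle_of_list [2, 3]) [a, c, b] permutes {1..a + b + c}"
      using block_perm_permutes(4)[of a c b] by (simp add: add_ac)
    have "a + c + b = a + b + c" by simp
    then have "C (a + c) b (C a c x z) y \<in> hom_elts g (a + b + c)" "C a (c + b) x (C c b z y) \<in> hom_elts g (a + b + c)"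
      using C_C_closed[OF xyz(1,3,2)] by metis+
    then show ?thesis
      unfolding preLie_defect_def using C_C_closed[OF xyz]
      by (intro G.diff_eq_zero G.minus_closed S_module_closed[OF g \<beta>])
  qed
  then show ?thesis unfolding twisted_preLie_algebra_def using g circ by (simp cong: ball_cong)
qed

lemma join3_swap:
  "s \<in> {1..a + c + b} \<Longrightarrow> join3 a c F1 F3 F2 s = (join3 a b F1 F2 F3 \<circ> block_perm (cycle_of_list [2, 3]) [a, c, b]) s"
  by (auto simp: join3_def block_perm_23 add.commute[of c a])

text \<open>The permutation \<open>(23)\<close> on blocks of sizes \<open>a\<close>,
  \<open>c\<close>, \<open>b\<close> is the relabelling between the orders \<open>x, z, y\<close>
  and \<open>x, y, z\<close>. On placements it is absorbed by joining \<open>F1\<close>,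
  \<open>F3\<close>, \<open>F2\<close> instead of \<open>F1\<close>, \<open>F2\<close>,
  \<open>F3\<close>.\<close>

lemma susp_t_elt_join3_swap:
  assumes pl: "placed N (a + b + c) (join3 a b F1 F2 F3) I" and w: "w \<in> hom_elts g (a + c + b)"
  shows "t_elt N (a + c + b) (join3 a c F1 F3 F2) I w =
    t_elt N (a + b + c) (join3 a b F1 F2 F3) I (sym_act g (a + b + c) (block_perm (cycle_of_list [2, 3]) [a, c, b]) w)"
proof -
  have e: "a + c + b = a + b + c" by simp
  have \<beta>: "block_perm (cycle_of_list [2, 3]) [a, c, b] permutes {1..a + b + c}"
    using block_perm_permutes(4)[of a c b] unfolding e .
  have "t_elt N (a + b + c) (join3 a c F1 F3 F2) I w =
      t_elt N (a + b + c) (join3 a b F1 F2 F3 \<circ> block_perm (cycle_of_list [2, 3]) [a, c, b]) I w"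
    by (rule susp_t_elt_cong) (rule join3_swap[of _ a c b, unfolded e])
  then show ?thesis unfolding e using susp_t_elt_rearrange[OF pl \<beta> w[unfolded e]] by simp
qed

text \<open>In placed form the permutation in the defect disappears, leaving the four products side
  by side.\<close>

lemma susp_t_elt_defect:
  assumes pl: "placed N (a + b + c) (join3 a b F1 F2 F3) I"
    and xyz: "x \<in> hom_elts g a" "y \<in> hom_elts g b" "z \<in> hom_elts g c"
  shows "t_elt N (a + b + c) (join3 a b F1 F2 F3) I (preLie_defect a b c x y z) =
    (t_elt N (a + b + c) (join3 a b F1 F2 F3) I (C (a + b) c (C a b x y) z) \<ominus>\<^bsub>component T N\<^esub>
     t_elt N (a + b + c) (join3 a b F1 F2 F3) I (C a (b + c) x (C b c y z))) \<ominus>\<^bsub>component T N\<^esub>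
    (t_elt N (a + c + b) (join3 a c F1 F3 F2) I (C (a + c) b (C a c x z) y) \<ominus>\<^bsub>component T N\<^esub>
     t_elt N (a + c + b) (join3 a c F1 F3 F2) I (C a (c + b) x (C c b z y)))"
proof -
  interpret G: module R "component g (a + b + c)" by (rule g_module)
  have e: "a + c + b = a + b + c" by simp
  have \<beta>: "block_perm (cycle_of_list [2, 3]) [a, c, b] permutes {1..a + b + c}"
    using block_perm_permutes(4)[of a c b] unfolding e .
  note c1 = C_C_closed[OF xyz] and c2 = C_C_closed[OF xyz(1,3,2)] and c3 = C_C_closed[OF xyz(1,3,2), unfolded e]
  note A = additive_diff[OF susp_t_elt_additive[OF pl]] and S = S_module_additive[OF g \<beta>]
  show ?thesis
    unfolding preLie_defect_def susp_t_elt_join3_swap[OF pl c2(1)] susp_t_elt_join3_swap[OF pl c2(2)]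
    using c1 c3 by (simp add: A additive_diff[OF S] S_module_closed[OF g \<beta>])
qed

end

context S_module_op
begin

context
  fixes p a f i x q b h j y r c l k z \<rho> F1 F2 F3 I J K
  assumes f: "placed p a f i" and x: "x \<in> hom_elts g a"
    and h: "placed q b h j" and y: "y \<in> hom_elts g b"
    and l: "placed r c l k" and z: "z \<in> hom_elts g c"
    and \<rho>: "\<rho> permutes {1..p + q + r}"
    and s1: "seated \<rho> 0 a f i F1 I" and s2: "seated \<rho> p b h j F2 J" and s3: "seated \<rho> (p + q) c l k F3 K"
begin

text \<open>Associativity of juxtaposition. \<open>F1\<close>, \<open>F2\<close>, \<open>F3\<close>
  are absolute positions after \<open>\<rho>\<close>, so that both bracketings, and later other
  orders of the factors, are described by the same three maps.\<close>

lemma join_join_eq: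
  assumes "s \<in> {1..a + b + c}"
  shows "(\<rho> \<circ> join (p + q) (a + b) (join p a f h) l) s = join3 a b F1 F2 F3 s"
    and "(\<rho> \<circ> join p a f (join q b h l)) s = join3 a b F1 F2 F3 s"
proof -
  have "s \<in> {1..a} \<or> s - a \<in> {1..b} \<and> \<not> s \<le> a \<or> s - (a + b) \<in> {1..c} \<and> \<not> s \<le> a + b" using assms by auto
  then show "(\<rho> \<circ> join (p + q) (a + b) (join p a f h) l) s = join3 a b F1 F2 F3 s"
    "(\<rho> \<circ> join p a f (join q b h l)) s = join3 a b F1 F2 F3 s"
    using s1 s2 s3 assms by (auto simp: join_def join3_def seated_def add.assoc)
qed

lemma placed_join3:
  "placed (p + q + r) (a + b + c) (join3 a b F1 F2 F3) I"
  "placed (p + q + r) (a + b + c) (join3 a b F1 F2 F3) J"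
  "placed (p + q + r) (a + b + c) (join3 a b F1 F2 F3) K"
proof -
  have e: "I = \<rho> i" "J = \<rho> (p + j)" "K = \<rho> (p + q + k)" using s1 s2 s3 by (auto simp: seated_def)
  note c = placed_cong[OF join_join_eq(1), THEN iffD1, OF _ placed_comp[OF _ \<rho>]]
  show "placed (p + q + r) (a + b + c) (join3 a b F1 F2 F3) I"
    "placed (p + q + r) (a + b + c) (join3 a b F1 F2 F3) J"
    "placed (p + q + r) (a + b + c) (join3 a b F1 F2 F3) K"
    unfolding e by (rule c; use placed_join placed_join[OF placed_join(1)[OF f h] l] placed_join(1)[OF placed_join(2)[OF f h] l] in simp)+
qed

text \<open>In this bracketing as in the other one, \<open>s\<close> stays with the leftmost factor,
  at \<open>I\<close>, and the other two parameters become \<open>t\<close>.\<close>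

lemma susp_prod_left_elt:
  "sym_act T (p + q + r) \<rho> (susp_prod (p + q) r (susp_prod p q (t_elt p a f i x) (t_elt q b h j y)) (t_elt r c l k z)) =
    t_elt (p + q + r) (a + b + c) (join3 a b F1 F2 F3) I (C (a + b) c (C a b x y) z)"
proof -
  note fh = placed_join(1)[OF f h]
  have "susp_prod (p + q) r (susp_prod p q (t_elt p a f i x) (t_elt q b h j y)) (t_elt r c l k z) =
      t_elt (p + q + r) (a + b + c) (join (p + q) (a + b) (join p a f h) l) i (C (a + b) c (C a b x y) z)"
    unfolding susp_prod_elt[OF f x h y] susp_prod_elt[OF fh C_closed[OF x y] l z] ..
  then have "sym_act T (p + q + r) \<rho> (susp_prod (p + q) r (susp_prod p q (t_elt p a f i x) (t_elt q b h j y)) (t_elt r c l k z)) =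
      t_elt (p + q + r) (a + b + c) (\<rho> \<circ> join (p + q) (a + b) (join p a f h) l) (\<rho> i) (C (a + b) c (C a b x y) z)"
    using sym_act_susp_t_elt[OF placed_join(1)[OF fh l] \<rho> C_C_closed(1)[OF x y z]] by (simp only:)
  also have "\<dots> = t_elt (p + q + r) (a + b + c) (join3 a b F1 F2 F3) (\<rho> i) (C (a + b) c (C a b x y) z)"
    by (rule susp_t_elt_cong[OF join_join_eq(1)])
  finally show ?thesis using s1 by (simp add: seated_def)
qed

lemma susp_prod_right_elt:
  "sym_act T (p + q + r) \<rho> (susp_prod p (q + r) (t_elt p a f i x) (susp_prod q r (t_elt q b h j y) (t_elt r c l k z))) =
    t_elt (p + q + r) (a + b + c) (join3 a b F1 F2 F3) I (C a (b + c) x (C b c y z))"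
proof -
  note hl = placed_join(1)[OF h l]
  have "susp_prod p (q + r) (t_elt p a f i x) (susp_prod q r (t_elt q b h j y) (t_elt r c l k z)) =
      t_elt (p + (q + r)) (a + (b + c)) (join p a f (join q b h l)) i (C a (b + c) x (C b c y z))"
    unfolding susp_prod_elt[OF h y l z] susp_prod_elt[OF f x hl C_closed[OF y z]] ..
  then have "sym_act T (p + q + r) \<rho> (susp_prod p (q + r) (t_elt p a f i x) (susp_prod q r (t_elt q b h j y) (t_elt r c l k z))) =
      t_elt (p + q + r) (a + b + c) (\<rho> \<circ> join p a f (join q b h l)) (\<rho> i) (C a (b + c) x (C b c y z))"
    using sym_act_susp_t_elt[OF placed_join(1)[OF f hl, unfolded add.assoc[symmetric]] \<rho> C_C_closed(2)[OF x y z]]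
    by (simp only: add.assoc)
  also have "\<dots> = t_elt (p + q + r) (a + b + c) (join3 a b F1 F2 F3) (\<rho> i) (C a (b + c) x (C b c y z))"
    by (rule susp_t_elt_cong[OF join_join_eq(2)])
  finally show ?thesis using s1 by (simp add: seated_def)
qed

end

text \<open>The four terms are \<open>x(yz)\<close>, \<open>x(zy)\<close>, \<open>(yz)x\<close>,
  \<open>(zy)x\<close>, with \<open>s\<close> staying at the seat of the leftmost factor:
  \<open>I\<close>, \<open>I\<close>, \<open>J\<close>, \<open>K\<close>.\<close>

lemma susp_bracket_bracket_elt:
  assumes f: "placed p a f i" and x: "x \<in> hom_elts g a"
    and h: "placed q b h j" and y: "y \<in> hom_elts g b"
    and l: "placed r c l k" and z: "z \<in> hom_elts g c"
    and \<rho>: "\<rho> permutes {1..p + q + r}"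
    and s1: "seated \<rho> 0 a f i F1 I" and s2: "seated \<rho> p b h j F2 J" and s3: "seated \<rho> (p + q) c l k F3 K"
  shows "sym_act T (p + q + r) \<rho> (susp_bracket p (q + r) (t_elt p a f i x) (susp_bracket q r (t_elt q b h j y) (t_elt r c l k z))) =
    (t_elt (p + q + r) (a + b + c) (join3 a b F1 F2 F3) I (C a (b + c) x (C b c y z)) \<ominus>\<^bsub>component T (p + q + r)\<^esub>
     t_elt (p + q + r) (a + c + b) (join3 a c F1 F3 F2) I (C a (c + b) x (C c b z y))) \<ominus>\<^bsub>component T (p + q + r)\<^esub>
    (t_elt (p + q + r) (b + c + a) (join3 b c F2 F3 F1) J (C (b + c) a (C b c y z) x) \<ominus>\<^bsub>component T (p + q + r)\<^esub>
     t_elt (p + q + r) (c + b + a) (join3 c b F3 F2 F1) K (C (c + b) a (C c b z y) x))"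
proof -
  let ?N = "p + q + r"
  let ?U = "t_elt p a f i x" and ?V = "t_elt q b h j y" and ?W = "t_elt r c l k z"
  note U = susp_t_elt_closed[OF f x] and V = susp_t_elt_closed[OF h y] and W = susp_t_elt_closed[OF l z]
  let ?A = "susp_prod q r ?V ?W" and ?A' = "susp_prod r q ?W ?V"
  let ?s = "swap_perm r q" and ?t = "swap_perm (q + r) p"
  note A = susp_prod_closed[OF V W] and A' = swapped_prod_closed[OF V W]
  have s: "?s permutes {1..q + r}" and t: "?t permutes {1..?N}"
    using swap_perm_permutes[of r q] swap_perm_permutes[of "q + r" p] by (simp_all add: add.assoc)
  let ?sA = "sym_act T (q + r) ?s ?A'"
  note sA = T_act_closed[OF s A']
  \<comment> \<open>The total degree occurs with different groupings of its summands; these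
    equations identify the modules.\<close>
  have N: "p + (q + r) = ?N" "q + r + p = ?N" "p + r + q = ?N" "r + q + p = ?N" "r + q = q + r" by simp_all
  note cl = susp_prod_closed[OF U A, unfolded N] susp_prod_closed[OF U sA, unfolded N]
    susp_prod_closed[OF A U, unfolded N] susp_prod_closed[OF sA U, unfolded N]
  note P1 = additive_diff[OF susp_prod_additive(1)[OF U, of "q + r", unfolded N(1)] A sA]
  note P2 = additive_diff[OF susp_prod_additive(2)[OF U, of "q + r", unfolded N(2)] A sA]
  note dt = additive_diff[OF T_act_additive[OF t]] and d\<rho> = additive_diff[OF T_act_additive[OF \<rho>]]
  interpret TN: module R "component T ?N" by (rule T_module)
  note tc = T_act_closed[OF t]
  have expand: "sym_act T ?N \<rho> (susp_bracket p (q + r) ?U (susp_bracket q r ?V ?W)) =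
    (sym_act T ?N \<rho> (susp_prod p (q + r) ?U ?A) \<ominus>\<^bsub>component T ?N\<^esub> sym_act T ?N \<rho> (susp_prod p (q + r) ?U ?sA)) \<ominus>\<^bsub>component T ?N\<^esub>
    (sym_act T ?N \<rho> (sym_act T ?N ?t (susp_prod (q + r) p ?A ?U)) \<ominus>\<^bsub>component T ?N\<^esub>
     sym_act T ?N \<rho> (sym_act T ?N ?t (susp_prod (q + r) p ?sA ?U)))"
    unfolding susp_bracket_def N P1 P2 dt[OF cl(3,4)]
    using cl tc by (simp add: d\<rho>)
  have id: "perm_cross m (id, id) = id" for m by (auto simp: perm_cross_def)
  \<comment> \<open>An exchange inside the second argument becomes, by equivariance, a permutation
    of all positions that leaves the block of \<open>x\<close> alone.\<close>
  let ?ps = "perm_cross p (id, ?s)"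
  have ps: "?ps permutes {1..?N}" using perm_cross_permutes[OF permutes_id s, of p] by (simp add: add.assoc)
  have t2: "sym_act T ?N \<rho> (susp_prod p (q + r) ?U ?sA) =
      t_elt ?N (a + c + b) (join3 a c F1 F3 F2) I (C a (c + b) x (C c b z y))"
  proof -
    have "susp_prod p (q + r) ?U ?sA = sym_act T ?N ?ps (susp_prod p (q + r) ?U ?A')"
      using susp_prod_equivariant[OF permutes_id s U A'] by (simp add: S_module_one[OF S_module_T U] add.assoc)
    then have "sym_act T ?N \<rho> (susp_prod p (q + r) ?U ?sA) = sym_act T ?N (\<rho> \<circ> ?ps) (susp_prod p (q + r) ?U ?A')"
      using S_module_comp[OF S_module_T \<rho> ps susp_prod_closed[OF U A', unfolded N]] by (simp only:)
    also have "\<dots> = t_elt ?N (a + c + b) (join3 a c F1 F3 F2) I (C a (c + b) x (C c b z y))"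
    \<comment> \<open>The composite permutation takes the blocks of \<open>x\<close>,
      \<open>z\<close>, \<open>y\<close>, standing in this order, to the seats that
      \<open>\<rho>\<close> gives them from the order \<open>x\<close>, \<open>y\<close>,
      \<open>z\<close>. The frame \<open>F1\<close>, \<open>F2\<close>, \<open>F3\<close> is
      unchanged.\<close>
    proof (rule susp_prod_right_elt[OF f x l z h y, where \<rho> = "\<rho> \<circ> ?ps", unfolded N])
      show "\<rho> \<circ> ?ps permutes {1..?N}" using ps \<rho> by (rule permutes_compose)
      show "seated (\<rho> \<circ> ?ps) 0 a f i F1 I" by (rule seated_comp[OF f s1]) (auto simp: perm_cross_def)
      show "seated (\<rho> \<circ> ?ps) p c l k F3 K" by (rule seated_comp[OF l s3]) (auto simp: perm_cross_def block_perm_2 add.assoc)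
      show "seated (\<rho> \<circ> ?ps) (p + r) b h j F2 J" by (rule seated_comp[OF h s2]) (auto simp: perm_cross_def block_perm_2)
    qed
    finally show ?thesis .
  qed
  have t3: "sym_act T ?N \<rho> (sym_act T ?N ?t (susp_prod (q + r) p ?A ?U)) =
      t_elt ?N (b + c + a) (join3 b c F2 F3 F1) J (C (b + c) a (C b c y z) x)"
    unfolding S_module_comp[OF S_module_T \<rho> t cl(3), symmetric]
  proof (rule susp_prod_left_elt[OF h y l z f x, where \<rho> = "\<rho> \<circ> ?t", unfolded N])
    show "\<rho> \<circ> ?t permutes {1..?N}" using t \<rho> by (rule permutes_compose)
    show "seated (\<rho> \<circ> ?t) 0 b h j F2 J" by (rule seated_comp[OF h s2]) (auto simp: block_perm_2)
    show "seated (\<rho> \<circ> ?t) q c l k F3 K" by (rule seated_comp[OF l s3]) (auto simp: block_perm_2 add.assoc)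
    show "seated (\<rho> \<circ> ?t) (q + r) a f i F1 I" by (rule seated_comp[OF f s1]) (auto simp: block_perm_2)
  qed
  \<comment> \<open>Here the exchange takes place in the first argument, so the permutation acts on
    the first \<open>q + r\<close> positions.\<close>
  let ?sp = "perm_cross (q + r) (?s, id)"
  have sp: "?sp permutes {1..?N}" using perm_cross_permutes[OF s permutes_id, of p] unfolding N .
  have t4: "sym_act T ?N \<rho> (sym_act T ?N ?t (susp_prod (q + r) p ?sA ?U)) =
      t_elt ?N (c + b + a) (join3 c b F3 F2 F1) K (C (c + b) a (C c b z y) x)"
  proof -
    have "susp_prod (q + r) p ?sA ?U = sym_act T ?N ?sp (susp_prod (q + r) p ?A' ?U)"
      using susp_prod_equivariant[OF s permutes_id A' U] by (simp add: S_module_one[OF S_module_T U] N)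
    then have "sym_act T ?N \<rho> (sym_act T ?N ?t (susp_prod (q + r) p ?sA ?U)) = sym_act T ?N (\<rho> \<circ> (?t \<circ> ?sp)) (susp_prod (q + r) p ?A' ?U)"
      using S_module_comp[OF S_module_T t sp susp_prod_closed[OF A' U, unfolded N]]
        S_module_comp[OF S_module_T \<rho> permutes_compose[OF sp t] susp_prod_closed[OF A' U, unfolded N]] by (simp only:)
    also have "\<dots> = t_elt ?N (c + b + a) (join3 c b F3 F2 F1) K (C (c + b) a (C c b z y) x)"
    proof (rule susp_prod_left_elt[OF l z h y f x, where \<rho> = "\<rho> \<circ> (?t \<circ> ?sp)", unfolded N])
      show "\<rho> \<circ> (?t \<circ> ?sp) permutes {1..?N}" using permutes_compose[OF sp t] \<rho> by (rule permutes_compose)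
      show "seated (\<rho> \<circ> (?t \<circ> ?sp)) 0 c l k F3 K" by (rule seated_comp[OF l s3]) (auto simp: perm_cross_def block_perm_2 add.assoc)
      show "seated (\<rho> \<circ> (?t \<circ> ?sp)) r b h j F2 J" by (rule seated_comp[OF h s2]) (auto simp: perm_cross_def block_perm_2)
      show "seated (\<rho> \<circ> (?t \<circ> ?sp)) (q + r) a f i F1 I" by (rule seated_comp[OF f s1]) (auto simp: perm_cross_def block_perm_2)
    qed
    finally show ?thesis .
  qed
  have t1: "sym_act T ?N \<rho> (susp_prod p (q + r) ?U ?A) =
      t_elt ?N (a + b + c) (join3 a b F1 F2 F3) I (C a (b + c) x (C b c y z))"
    by (rule susp_prod_right_elt[OF f x h y l z \<rho> s1 s2 s3])
  show ?thesis unfolding expand t1 t2 t3 t4 ..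
qed

end

text \<open>For index 1 the letters \<open>l\<close>, \<open>m\<close>, \<open>p\<close>,
  \<open>q\<close> stand for \<open>(xy)z\<close>, \<open>x(yz)\<close>, \<open>(xz)y\<close>,
  \<open>x(zy)\<close>, for 2 and 3 for the cyclic shifts; the index thus tells which element is
  leftmost. A double bracket contains two terms of its own index and one of each other index, and
  collecting by index gives minus the three defects.\<close>

lemma (in abelian_group) cyclic_sum_regroup:
  assumes "l1 \<in> carrier G" "m1 \<in> carrier G" "p1 \<in> carrier G" "q1 \<in> carrier G"
    "l2 \<in> carrier G" "m2 \<in> carrier G" "p2 \<in> carrier G" "q2 \<in> carrier G"
    "l3 \<in> carrier G" "m3 \<in> carrier G" "p3 \<in> carrier G" "q3 \<in> carrier G"
  shows "((m1 \<ominus> q1) \<ominus> (l2 \<ominus> p3)) \<oplus> ((m2 \<ominus> q2) \<ominus> (l3 \<ominus> p1)) \<oplus> ((m3 \<ominus> q3) \<ominus> (l1 \<ominus> p2)) =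
    \<ominus> (((l1 \<ominus> m1) \<ominus> (p1 \<ominus> q1)) \<oplus> ((l2 \<ominus> m2) \<ominus> (p2 \<ominus> q2)) \<oplus> ((l3 \<ominus> m3) \<ominus> (p3 \<ominus> q3)))"
  using assms by (simp add: minus_eq minus_add a_ac)

context S_module_op
begin

definition susp_Jacobi :: "nat \<Rightarrow> nat \<Rightarrow> nat \<Rightarrow> ('a, 'm) susp_t \<Rightarrow> ('a, 'm) susp_t \<Rightarrow> ('a, 'm) susp_t \<Rightarrow> ('a, 'm) susp_t"
  where "susp_Jacobi p q r u v w =
    susp_bracket p (q + r) u (susp_bracket q r v w) \<oplus>\<^bsub>component T (p + q + r)\<^esub>
    sym_act T (p + q + r) (block_perm (cycle_of_list [1, 2, 3]) [q, r, p]) (susp_bracket q (r + p) v (susp_bracket r p w u))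
    \<oplus>\<^bsub>component T (p + q + r)\<^esub>
    sym_act T (p + q + r) (block_perm (cycle_of_list [1, 3, 2]) [r, p, q]) (susp_bracket r (p + q) w (susp_bracket p q u v))"

text \<open>The permutations \<open>(123)\<close> and \<open>(132)\<close> of the Jacobi identity
  bring the blocks of the cyclic shifts back to the order \<open>x\<close>, \<open>y\<close>,
  \<open>z\<close>. All twelve terms are then written in one frame, and sorting them by the position
  of \<open>s\<close> leaves one defect for each of the three positions.\<close>

lemma susp_Jacobi_elt:
  assumes f: "placed p a f i" and x: "x \<in> hom_elts g a"
    and h: "placed q b h j" and y: "y \<in> hom_elts g b"
    and l: "placed r c l k" and z: "z \<in> hom_elts g c"
  defines "F1 \<equiv> f" and "F2 \<equiv> \<lambda>s. p + h s" and "F3 \<equiv> \<lambda>s. p + q + l s"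
  shows "susp_Jacobi p q r (t_elt p a f i x) (t_elt q b h j y) (t_elt r c l k z) = \<ominus>\<^bsub>component T (p + q + r)\<^esub>
    (t_elt (p + q + r) (a + b + c) (join3 a b F1 F2 F3) i (preLie_defect a b c x y z) \<oplus>\<^bsub>component T (p + q + r)\<^esub>
     t_elt (p + q + r) (b + c + a) (join3 b c F2 F3 F1) (p + j) (preLie_defect b c a y z x) \<oplus>\<^bsub>component T (p + q + r)\<^esub>
     t_elt (p + q + r) (c + a + b) (join3 c a F3 F1 F2) (p + q + k) (preLie_defect c a b z x y))"
    and "placed (p + q + r) (a + b + c) (join3 a b F1 F2 F3) i"
    and "placed (p + q + r) (b + c + a) (join3 b c F2 F3 F1) (p + j)"
    and "placed (p + q + r) (c + a + b) (join3 c a F3 F1 F2) (p + q + k)"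
proof -
  let ?N = "p + q + r"
  interpret TN: module R "component T ?N" by (rule T_module)
  let ?\<beta> = "block_perm (cycle_of_list [1, 2, 3]) [q, r, p]" and ?\<gamma> = "block_perm (cycle_of_list [1, 3, 2]) [r, p, q]"
  have N: "q + r + p = ?N" "r + p + q = ?N" "p + (q + r) = ?N" by simp_all
  have \<beta>: "?\<beta> permutes {1..?N}" and \<gamma>: "?\<gamma> permutes {1..?N}"
    using block_perm_permutes(2)[of q r p] block_perm_permutes(3)[of r p q] unfolding N .
  have s: "seated id 0 a f i F1 i" "seated id p b h j F2 (p + j)" "seated id (p + q) c l k F3 (p + q + k)"
    by (simp_all add: seated_def F1_def F2_def F3_def)
  note U = susp_t_elt_closed[OF f x] and V = susp_t_elt_closed[OF h y] and W = susp_t_elt_closed[OF l z]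
  have J1c: "susp_bracket p (q + r) (t_elt p a f i x) (susp_bracket q r (t_elt q b h j y) (t_elt r c l k z)) \<in> hom_elts T ?N"
    using susp_bracket_closed[OF susp_bracket_closed[OF W V] U] unfolding N .
  note J1 = susp_bracket_bracket_elt[OF f x h y l z permutes_id s, unfolded S_module_one[OF S_module_T J1c]]
  \<comment> \<open>The shifted double brackets are read with \<open>?\<beta>\<close> and
    \<open>?\<gamma>\<close> as frame permutations; their blocks end up on the seats given by the
    identity.\<close>
  have S2: "seated ?\<beta> 0 b h j F2 (p + j)" "seated ?\<beta> q c l k F3 (p + q + k)" "seated ?\<beta> (q + r) a f i F1 i"
    by (rule seated_comp[OF h s(2)] seated_comp[OF l s(3)] seated_comp[OF f s(1)]; simp add: block_perm_123)+
  have S3: "seated ?\<gamma> 0 c l k F3 (p + q + k)" "seated ?\<gamma> r a f i F1 i" "seated ?\<gamma> (r + p) b h j F2 (p + j)"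
    by (rule seated_comp[OF l s(3)] seated_comp[OF f s(1)] seated_comp[OF h s(2)]; simp add: block_perm_132)+
  note J2 = susp_bracket_bracket_elt[OF h y l z f x, of ?\<beta>, unfolded N, OF \<beta> S2]
    and pl2 = placed_join3[OF h y l z f x, of ?\<beta>, unfolded N, OF \<beta> S2]
  note J3 = susp_bracket_bracket_elt[OF l z f x h y, of ?\<gamma>, unfolded N, OF \<gamma> S3]
    and pl3 = placed_join3[OF l z f x h y, of ?\<gamma>, unfolded N, OF \<gamma> S3]
  note pl1 = placed_join3[OF f x h y l z permutes_id s]
  show pl: "placed ?N (a + b + c) (join3 a b F1 F2 F3) i" "placed ?N (b + c + a) (join3 b c F2 F3 F1) (p + j)"
    "placed ?N (c + a + b) (join3 c a F3 F1 F2) (p + q + k)"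
    using pl1 pl2 pl3 by blast+
  \<comment> \<open>The regrouping needs all twelve terms in one carrier; those with the last two
    factors exchanged get there by the rewriting to the standard order.\<close>
  have swap: "t_elt ?N (a + c + b) (join3 a c F1 F3 F2) I w \<in> hom_elts T ?N"
    if pl: "placed ?N (a + b + c) (join3 a b F1 F2 F3) I" and w: "w \<in> hom_elts g (a + c + b)" for a b c F1 F2 F3 I w
  proof -
    have e: "a + c + b = a + b + c" by simp
    have "block_perm (cycle_of_list [2, 3]) [a, c, b] permutes {1..a + b + c}"
      using block_perm_permutes(4)[of a c b] unfolding e .
    then show ?thesis
      unfolding susp_t_elt_join3_swap[OF that] by (rule susp_t_elt_closed[OF pl S_module_closed[OF g _ w[unfolded e]]])
  qed
  note cl = susp_t_elt_closed[OF pl(1)] susp_t_elt_closed[OF pl(2)] susp_t_elt_closed[OF pl(3)]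
    and sw = swap[OF pl(1)] swap[OF pl(2)] swap[OF pl(3)]
  show "susp_Jacobi p q r (t_elt p a f i x) (t_elt q b h j y) (t_elt r c l k z) = \<ominus>\<^bsub>component T ?N\<^esub>
    (t_elt ?N (a + b + c) (join3 a b F1 F2 F3) i (preLie_defect a b c x y z) \<oplus>\<^bsub>component T ?N\<^esub>
     t_elt ?N (b + c + a) (join3 b c F2 F3 F1) (p + j) (preLie_defect b c a y z x) \<oplus>\<^bsub>component T ?N\<^esub>
     t_elt ?N (c + a + b) (join3 c a F3 F1 F2) (p + q + k) (preLie_defect c a b z x y))"
    unfolding susp_Jacobi_def J1 J2 J3 susp_t_elt_defect[OF pl(1) x y z] susp_t_elt_defect[OF pl(2) y z x] susp_t_elt_defect[OF pl(3) z x y]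
    by (rule TN.cyclic_sum_regroup[OF
          cl(1)[OF C_C_closed(1)[OF x y z]] cl(1)[OF C_C_closed(2)[OF x y z]] sw(1)[OF C_C_closed(1)[OF x z y]] sw(1)[OF C_C_closed(2)[OF x z y]]
          cl(2)[OF C_C_closed(1)[OF y z x]] cl(2)[OF C_C_closed(2)[OF y z x]] sw(2)[OF C_C_closed(1)[OF y x z]] sw(2)[OF C_C_closed(2)[OF y x z]]
          cl(3)[OF C_C_closed(1)[OF z x y]] cl(3)[OF C_C_closed(2)[OF z x y]] sw(3)[OF C_C_closed(1)[OF z y x]] sw(3)[OF C_C_closed(2)[OF z y x]]])
qed

end

section \<open>The Jacobi identity against the pre-Lie identity\<close>

section \<open>The Lie and pre-Lie identities on the suspension\<close>

context S_module_over
begin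

text \<open>Reads off the coefficient of the placement \<open>F\<close>, \<open>I\<close>. It is
  well defined because the placements with the same \<open>I\<close> and the same set of labelled
  positions form one orbit under relabelling, on which \<open>S_n\<close> acts freely.\<close>

lemma susp_t_projection:
  assumes pl: "placed N n F I"
  shows "\<exists>\<psi>. additive (component T N) (component g n) \<psi> \<and> (\<forall>w\<in>hom_elts g n. \<psi> (t_elt N n F I w) = w) \<and>
    (\<forall>m F' I' w. placed N m F' I' \<longrightarrow> w \<in> hom_elts g m \<longrightarrow> I' \<noteq> I \<longrightarrow> \<psi> (t_elt N m F' I' w) = \<zero>\<^bsub>component g n\<^esub>)"
proof -
  \<comment> \<open>The relabelling that turns \<open>F\<close> into \<open>f\<close>, extended by
    the identity to be a permutation of \<open>{1..n}\<close>.\<close>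
  define \<kappa> where "\<kappa> = (\<lambda>f j. if j \<in> {1..n} then inv_into {1..n} F (f j) else j)"
  define good where "good = (\<lambda>m (f :: nat \<Rightarrow> nat) i. m = n \<and> i = I \<and> f ` {1..n} = F ` {1..n})"
  define \<phi> where "\<phi> = (\<lambda>m f i x. if good m f i then sym_act g n (\<kappa> f) x else \<zero>\<^bsub>component g n\<^esub>)"
  have F: "inj_on F {1..n}" using pl by (simp add: placed_def)
  have gm: "module R (component g m)" for m by (rule S_module_module[OF g])
  interpret G: module R "component g n" by (rule gm)
  have \<kappa>: "\<kappa> f permutes {1..n}" if "placed N m f i" "good m f i" for m f i
  proof (rule bij_imp_permutes)
    have "bij_betw f {1..n} (F ` {1..n})" using that by (auto simp: placed_def good_def bij_betw_def)
    then have "bij_betw (inv_into {1..n} F \<circ> f) {1..n} {1..n}"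
      using bij_betw_inv_into[of F "{1..n}" "F ` {1..n}"] F by (intro bij_betw_trans) (auto simp: bij_betw_def)
    moreover have "bij_betw (\<kappa> f) {1..n} {1..n} = bij_betw (inv_into {1..n} F \<circ> f) {1..n} {1..n}"
      by (rule bij_betw_cong) (simp add: \<kappa>_def)
    ultimately show "bij_betw (\<kappa> f) {1..n} {1..n}" by simp
  qed (unfold \<kappa>_def, rule if_not_P)
  have "\<exists>\<psi>\<in>linear_maps R (component T N) (component g n). \<forall>a f i x. placed N a f i \<longrightarrow> x \<in> hom_elts g a \<longrightarrow>
    \<psi> (t_elt N a f i x) = \<phi> a f i x"
  proof (rule susp_t_lift[OF gm])
    fix a f i assume f: "placed N a f i"
    show "additive (component g a) (component g n) (\<phi> a f i)"
    proof (cases "good a f i")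
      case True
      then show ?thesis using S_module_additive[OF g \<kappa>[OF f True]] by (simp add: \<phi>_def good_def)
    next
      case False
      then show ?thesis using additive_const_zero[OF module_abelian_group[OF gm] module_abelian_group[OF gm]] by (simp add: \<phi>_def)
    qed
    show "\<phi> a f i (c \<odot>\<^bsub>component g a\<^esub> x) = c \<odot>\<^bsub>component g n\<^esub> \<phi> a f i x" if "c \<in> carrier R" "x \<in> hom_elts g a" for c x
      using linear_smult[OF S_module_linear[OF g \<kappa>[OF f]]] that by (auto simp: \<phi>_def good_def)
    show "\<phi> a (f \<circ> \<sigma>) i x = \<phi> a f i (sym_act g a \<sigma> x)" if s: "\<sigma> permutes {1..a}" and x: "x \<in> hom_elts g a" for \<sigma> x
    proof (cases "good a f i")
      case True
      then have an: "a = n" by (simp add: good_def)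
      have "(f \<circ> \<sigma>) ` {1..n} = f ` {1..n}" using s an by (metis image_comp permutes_image)
      then have "good a (f \<circ> \<sigma>) i" using True by (simp add: good_def)
      \<comment> \<open>With this the coefficient respects the relation
        \<open>(f o \<sigma>, i, x) = (f, i, \<sigma> x)\<close>.\<close>
      moreover have "\<kappa> (f \<circ> \<sigma>) = \<kappa> f \<circ> \<sigma>"
        using permutes_in_image[OF s] permutes_not_in[OF s] an by (auto simp: \<kappa>_def fun_eq_iff)
      ultimately show ?thesis
        using True S_module_comp[OF g \<kappa>[OF f True], of \<sigma> x] s x an by (simp add: \<phi>_def)
    next
      case False
      have "\<not> good a (f \<circ> \<sigma>) i"
      proof
        assume *: "good a (f \<circ> \<sigma>) i"
        then have "(f \<circ> \<sigma>) ` {1..n} = f ` {1..n}" using s by (metis good_def image_comp permutes_image)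
        with * False show False by (simp add: good_def)
      qed
      then show ?thesis using False by (simp add: \<phi>_def)
    qed
    show "\<phi> a f i x = \<phi> a h i x" if eq: "\<And>j. j \<in> {1..a} \<Longrightarrow> f j = h j" for h x
    proof (cases "a = n")
      case True
      then have "f ` {1..n} = h ` {1..n}" "\<kappa> f = \<kappa> h" using eq by (auto simp: \<kappa>_def fun_eq_iff intro: image_cong)
      then show ?thesis by (simp add: \<phi>_def good_def)
    qed (simp add: \<phi>_def good_def)
  qed
  then obtain \<psi> where \<psi>: "\<psi> \<in> linear_maps R (component T N) (component g n)"
    "\<And>a f i x. placed N a f i \<Longrightarrow> x \<in> hom_elts g a \<Longrightarrow> \<psi> (t_elt N a f i x) = \<phi> a f i x" by blast
  show ?thesis
  proof (intro exI conjI ballI allI impI)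
    show "additive (component T N) (component g n) \<psi>" by (rule linear_additive[OF \<psi>(1) T_module gm])
    have "\<kappa> F = id" using F by (auto simp: \<kappa>_def fun_eq_iff)
    then show "\<psi> (t_elt N n F I w) = w" if "w \<in> hom_elts g n" for w
      using that S_module_one[OF g that] by (simp add: \<psi>(2)[OF pl] \<phi>_def good_def)
    show "\<psi> (t_elt N m F' I' w) = \<zero>\<^bsub>component g n\<^esub>" if "placed N m F' I'" "w \<in> hom_elts g m" "I' \<noteq> I" for m F' I' w
      using that by (simp add: \<psi>(2) \<phi>_def good_def)
  qed
qed

end

lemma (in abelian_group) uminus_eq_zeroD: "\<ominus> x = \<zero> \<Longrightarrow> x \<in> carrier G \<Longrightarrow> x = \<zero>"
  using minus_minus[of x] by (simp add: add.inv_one)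

context S_module_op
begin

text \<open>The Jacobi sum of \<open>x^(0)\<close>, \<open>y^(0)\<close>, \<open>z^(0)\<close>
  already suffices: the three defects in it carry \<open>s\<close> at \<open>a + 1\<close>,
  \<open>a + b + 2\<close> and \<open>a + b + c + 3\<close>, and projecting to the first place
  isolates the defect of \<open>x\<close>, \<open>y\<close>, \<open>z\<close>.\<close>

lemma defect_zero_if_susp_Jacobi:
  assumes J: "\<And>p q r u v w. u \<in> hom_elts T p \<Longrightarrow> v \<in> hom_elts T q \<Longrightarrow> w \<in> hom_elts T r \<Longrightarrow>
      susp_Jacobi p q r u v w = \<zero>\<^bsub>component T (p + q + r)\<^esub>"
    and x: "x \<in> hom_elts g a" and y: "y \<in> hom_elts g b" and z: "z \<in> hom_elts g c"
  shows "preLie_defect a b c x y z = \<zero>\<^bsub>component g (a + b + c)\<^esub>"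
proof -
  have f: "placed (Suc a) a id (Suc a)" for a by (rule placed_id) simp
  let ?N = "Suc a + Suc b + Suc c"
  let ?X = "\<lambda>a x. t_elt (Suc a) a id (Suc a) x"
  interpret TN: module R "component T ?N" by (rule T_module)
  interpret G: module R "component g (a + b + c)" by (rule g_module)
  note J_elt = susp_Jacobi_elt[OF f x f y f z]
  note X = susp_t_elt_closed[OF f]
  let ?D1 = "t_elt ?N (a + b + c) (join3 a b id (\<lambda>s. Suc a + id s) (\<lambda>s. Suc a + Suc b + id s)) (Suc a) (preLie_defect a b c x y z)"
  let ?D2 = "t_elt ?N (b + c + a) (join3 b c (\<lambda>s. Suc a + id s) (\<lambda>s. Suc a + Suc b + id s) id) (Suc a + Suc b) (preLie_defect b c a y z x)"
  let ?D3 = "t_elt ?N (c + a + b) (join3 c a (\<lambda>s. Suc a + Suc b + id s) id (\<lambda>s. Suc a + id s)) (Suc a + Suc b + Suc c) (preLie_defect c a b z x y)"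
  note D = preLie_defect_closed[OF x y z] preLie_defect_closed[OF y z x] preLie_defect_closed[OF z x y]
  have c: "?D1 \<in> hom_elts T ?N" "?D2 \<in> hom_elts T ?N" "?D3 \<in> hom_elts T ?N"
    by (rule susp_t_elt_closed[OF J_elt(2) D(1)] susp_t_elt_closed[OF J_elt(3) D(2)] susp_t_elt_closed[OF J_elt(4) D(3)])+
  have "\<ominus>\<^bsub>component T ?N\<^esub> (?D1 \<oplus>\<^bsub>component T ?N\<^esub> ?D2 \<oplus>\<^bsub>component T ?N\<^esub> ?D3) = \<zero>\<^bsub>component T ?N\<^esub>"
    using J_elt(1) J[OF X[OF x] X[OF y] X[OF z]] by (simp only:)
  then have sum: "?D1 \<oplus>\<^bsub>component T ?N\<^esub> ?D2 \<oplus>\<^bsub>component T ?N\<^esub> ?D3 = \<zero>\<^bsub>component T ?N\<^esub>"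
    by (rule TN.uminus_eq_zeroD[OF _ TN.a_closed[OF TN.a_closed[OF c(1,2)] c(3)]])
  \<comment> \<open>All three placements label the same set of positions, so they are told apart by
    the place of \<open>s\<close> alone.\<close>
  have ne: "Suc a + Suc b \<noteq> Suc a" "Suc a + Suc b + Suc c \<noteq> Suc a" by simp_all
  obtain \<psi> where proj: "additive (component T ?N) (component g (a + b + c)) \<psi>"
    "\<forall>w\<in>hom_elts g (a + b + c). \<psi> (t_elt ?N (a + b + c) (join3 a b id (\<lambda>s. Suc a + id s) (\<lambda>s. Suc a + Suc b + id s)) (Suc a) w) = w"
    "\<forall>m F' I' w. placed ?N m F' I' \<longrightarrow> w \<in> hom_elts g m \<longrightarrow> I' \<noteq> Suc a \<longrightarrow> \<psi> (t_elt ?N m F' I' w) = \<zero>\<^bsub>component g (a + b + c)\<^esub>"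
    using susp_t_projection[OF J_elt(2)] by (elim exE conjE)
  have \<psi>: "\<psi> ?D1 = preLie_defect a b c x y z" "\<psi> ?D2 = \<zero>\<^bsub>component g (a + b + c)\<^esub>" "\<psi> ?D3 = \<zero>\<^bsub>component g (a + b + c)\<^esub>"
    using proj(2)[rule_format, OF D(1)] proj(3)[rule_format, OF J_elt(3) D(2) ne(1)] proj(3)[rule_format, OF J_elt(4) D(3) ne(2)]
    by (simp_all only:)
  have "\<psi> ?D1 \<oplus>\<^bsub>component g (a + b + c)\<^esub> \<psi> ?D2 \<oplus>\<^bsub>component g (a + b + c)\<^esub> \<psi> ?D3 = \<zero>\<^bsub>component g (a + b + c)\<^esub>"
    using additive_add[OF proj(1) TN.a_closed[OF c(1,2)] c(3)] additive_add[OF proj(1) c(1,2)] additive_zero[OF proj(1)]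
    by (simp only: sum)
  then show ?thesis using D(1) unfolding \<psi> by simp
qed

lemma susp_t_elt_zero: "placed p a f i \<Longrightarrow> t_elt p a f i \<zero>\<^bsub>component g a\<^esub> = \<zero>\<^bsub>component T p\<^esub>"
  by (rule additive_zero[OF susp_t_elt_additive])

text \<open>On placements all three defects vanish. The rest is additivity in each argument, where
  the total degree again appears in different groupings.\<close>

lemma susp_Jacobi_if_preLie:
  assumes pre: "twisted_preLie_algebra R g circ"
    and u: "u \<in> hom_elts T p" and v: "v \<in> hom_elts T q" and w: "w \<in> hom_elts T r"
  shows "susp_Jacobi p q r u v w = \<zero>\<^bsub>component T (p + q + r)\<^esub>"
proof (rule susp_t_ext3[where F = "susp_Jacobi p q r" and H = "\<lambda>_ _ _. \<zero>\<^bsub>component T (p + q + r)\<^esub>", OF _ _ _ _ _ _ _ u v w])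
  fix a f i x b h j y c l k z
  assume *: "placed p a f i" "x \<in> hom_elts g a" "placed q b h j" "y \<in> hom_elts g b" "placed r c l k" "z \<in> hom_elts g c"
  interpret TN: module R "component T (p + q + r)" by (rule T_module)
  note J = susp_Jacobi_elt[OF *]
  have D: "preLie_defect a b c x y z = \<zero>\<^bsub>component g (a + b + c)\<^esub>" "preLie_defect b c a y z x = \<zero>\<^bsub>component g (b + c + a)\<^esub>"
    "preLie_defect c a b z x y = \<zero>\<^bsub>component g (c + a + b)\<^esub>"
    using pre * unfolding twisted_preLie_iff_defect by blast+
  show "susp_Jacobi p q r (t_elt p a f i x) (t_elt q b h j y) (t_elt r c l k z) = \<zero>\<^bsub>component T (p + q + r)\<^esub>"
    unfolding J(1) D susp_t_elt_zero[OF J(2)] susp_t_elt_zero[OF J(3)] susp_t_elt_zero[OF J(4)] by simp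
next
  have N: "q + r + p = p + q + r" "r + p + q = p + q + r" "p + (q + r) = p + q + r" "q + (r + p) = p + q + r" "r + (p + q) = p + q + r" by simp_all
  let ?\<beta> = "block_perm (cycle_of_list [1, 2, 3]) [q, r, p]" and ?\<gamma> = "block_perm (cycle_of_list [1, 3, 2]) [r, p, q]"
  have \<beta>: "?\<beta> permutes {1..p + q + r}" and \<gamma>: "?\<gamma> permutes {1..p + q + r}"
    using block_perm_permutes(2)[of q r p] block_perm_permutes(3)[of r p q] unfolding N .
  note A = susp_bracket_additive and C = additive_comp[OF _ T_act_additive[OF \<beta>]] additive_comp[OF _ T_act_additive[OF \<gamma>]]
  note cl = susp_bracket_closed
  show "additive (component T p) (component T (p + q + r)) (\<lambda>u. susp_Jacobi p q r u v w)"
    if v: "v \<in> hom_elts T q" and w: "w \<in> hom_elts T r" for v w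
    unfolding susp_Jacobi_def
  proof (intro additive_plus C)
    show "additive (component T p) (component T (p + q + r)) (\<lambda>u. susp_bracket p (q + r) u (susp_bracket q r v w))"
      using A(1)[OF cl[OF w v], of p] unfolding N .
    show "additive (component T p) (component T (p + q + r)) (\<lambda>u. susp_bracket q (r + p) v (susp_bracket r p w u))"
      using additive_comp[OF A(2)[OF w, of p] A(2)[OF v]] unfolding N .
    show "additive (component T p) (component T (p + q + r)) (\<lambda>u. susp_bracket r (p + q) w (susp_bracket p q u v))"
      using additive_comp[OF A(1)[OF v, of p] A(2)[OF w]] unfolding N .
  qed
  show "additive (component T q) (component T (p + q + r)) (\<lambda>v. susp_Jacobi p q r u v w)"
    if u: "u \<in> hom_elts T p" and w: "w \<in> hom_elts T r" for u w
    unfolding susp_Jacobi_def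
  proof (intro additive_plus C)
    show "additive (component T q) (component T (p + q + r)) (\<lambda>v. susp_bracket p (q + r) u (susp_bracket q r v w))"
      using additive_comp[OF A(1)[OF w, of q] A(2)[OF u]] unfolding N .
    show "additive (component T q) (component T (p + q + r)) (\<lambda>v. susp_bracket q (r + p) v (susp_bracket r p w u))"
      using A(1)[OF cl[OF u w], of q] unfolding N .
    show "additive (component T q) (component T (p + q + r)) (\<lambda>v. susp_bracket r (p + q) w (susp_bracket p q u v))"
      using additive_comp[OF A(2)[OF u, of q] A(2)[OF w]] unfolding N .
  qed
  show "additive (component T r) (component T (p + q + r)) (susp_Jacobi p q r u v)"
    if u: "u \<in> hom_elts T p" and v: "v \<in> hom_elts T q" for u v
    unfolding susp_Jacobi_def[abs_def]
  proof (intro additive_plus C)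
    show "additive (component T r) (component T (p + q + r)) (\<lambda>w. susp_bracket p (q + r) u (susp_bracket q r v w))"
      using additive_comp[OF A(2)[OF v, of r] A(2)[OF u]] unfolding N .
    show "additive (component T r) (component T (p + q + r)) (\<lambda>w. susp_bracket q (r + p) v (susp_bracket r p w u))"
      using additive_comp[OF A(1)[OF u, of r] A(2)[OF v]] unfolding N .
    show "additive (component T r) (component T (p + q + r)) (\<lambda>w. susp_bracket r (p + q) w (susp_bracket p q u v))"
      using A(1)[OF cl[OF v u], of r] unfolding N .
  qed
qed (rule additive_const_zero[OF T_group T_group])+

text \<open>On placements the difference of the two sides is the placed defect: all four products
  keep \<open>s\<close> at the place coming from \<open>u\<close>, so they share one placement up to
  relabelling.\<close>

lemma susp_prod_preLie:
  assumes pre: "twisted_preLie_algebra R g circ"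
    and u: "u \<in> hom_elts T p" and v: "v \<in> hom_elts T q" and w: "w \<in> hom_elts T r"
  shows "susp_prod (p + q) r (susp_prod p q u v) w \<ominus>\<^bsub>component T (p + q + r)\<^esub> susp_prod p (q + r) u (susp_prod q r v w) =
    sym_act T (p + q + r) (block_perm (cycle_of_list [2, 3]) [p, r, q])
      (susp_prod (p + r) q (susp_prod p r u w) v \<ominus>\<^bsub>component T (p + q + r)\<^esub> susp_prod p (r + q) u (susp_prod r q w v))"
proof -
  let ?N = "p + q + r" and ?\<beta> = "block_perm (cycle_of_list [2, 3]) [p, r, q]"
  have N: "p + r + q = ?N" "p + (q + r) = ?N" "p + (r + q) = ?N" by simp_all
  have \<beta>: "?\<beta> permutes {1..?N}" using block_perm_permutes(4)[of p r q] unfolding N .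
  note A = susp_prod_additive and cl = susp_prod_closed
  note C = additive_comp[OF _ T_act_additive[OF \<beta>]]
  show ?thesis
  proof (rule susp_t_ext3[where L = "component T ?N" and
        F = "\<lambda>u v w. susp_prod (p + q) r (susp_prod p q u v) w \<ominus>\<^bsub>component T ?N\<^esub> susp_prod p (q + r) u (susp_prod q r v w)" and
        H = "\<lambda>u v w. sym_act T ?N ?\<beta> (susp_prod (p + r) q (susp_prod p r u w) v \<ominus>\<^bsub>component T ?N\<^esub> susp_prod p (r + q) u (susp_prod r q w v))",
        OF _ _ _ _ _ _ _ u v w])
    fix a f i x b h j y c l k z
    assume *: "placed p a f i" "x \<in> hom_elts g a" "placed q b h j" "y \<in> hom_elts g b" "placed r c l k" "z \<in> hom_elts g c"
    let ?U = "t_elt p a f i x" and ?V = "t_elt q b h j y" and ?W = "t_elt r c l k z"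
    interpret TN: module R "component T ?N" by (rule T_module)
    note c = susp_t_elt_closed[OF *(1,2)] susp_t_elt_closed[OF *(3,4)] susp_t_elt_closed[OF *(5,6)]
    let ?F2 = "\<lambda>s. p + h s" and ?F3 = "\<lambda>s. p + q + l s"
    have s: "seated id 0 a f i f i" "seated id p b h j ?F2 (p + j)" "seated id (p + q) c l k ?F3 (p + q + k)"
      by (simp_all add: seated_def)
    \<comment> \<open>The permutation \<open>(23)\<close> for the degrees \<open>p\<close>,
      \<open>r\<close>, \<open>q\<close> takes the blocks of \<open>u\<close>, \<open>w\<close>,
      \<open>v\<close> to the frame of \<open>u\<close>, \<open>v\<close>, \<open>w\<close>.\<close>
    have t: "seated ?\<beta> 0 a f i f i" "seated ?\<beta> p c l k ?F3 (p + q + k)" "seated ?\<beta> (p + r) b h j ?F2 (p + j)"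
      by (rule seated_comp[OF *(1) s(1)] seated_comp[OF *(5) s(3)] seated_comp[OF *(3) s(2)]; simp add: block_perm_23)+
    note c1 = cl[OF cl[OF c(1,2)] c(3)] cl[OF c(1) cl[OF c(2,3)], unfolded N]
    note c2 = cl[OF cl[OF c(1,3)] c(2), unfolded N] cl[OF c(1) cl[OF c(3,2)], unfolded N]
    note L = susp_prod_left_elt[OF * permutes_id s, unfolded S_module_one[OF S_module_T c1(1)]]
      susp_prod_right_elt[OF * permutes_id s, unfolded S_module_one[OF S_module_T c1(2)]]
    note M = susp_prod_left_elt[OF *(1,2,5,6,3,4), of ?\<beta>, unfolded N, OF \<beta> t]
      susp_prod_right_elt[OF *(1,2,5,6,3,4), of ?\<beta>, unfolded N, OF \<beta> t]
    note pl = placed_join3(1)[OF * permutes_id s]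
    have D: "preLie_defect a b c x y z = \<zero>\<^bsub>component g (a + b + c)\<^esub>"
      using pre * unfolding twisted_preLie_iff_defect by blast
    have dz: "(susp_prod (p + q) r (susp_prod p q ?U ?V) ?W \<ominus>\<^bsub>component T ?N\<^esub> susp_prod p (q + r) ?U (susp_prod q r ?V ?W))
      \<ominus>\<^bsub>component T ?N\<^esub> sym_act T ?N ?\<beta> (susp_prod (p + r) q (susp_prod p r ?U ?W) ?V \<ominus>\<^bsub>component T ?N\<^esub> susp_prod p (r + q) ?U (susp_prod r q ?W ?V))
      = \<zero>\<^bsub>component T ?N\<^esub>"
      unfolding additive_diff[OF T_act_additive[OF \<beta>] c2] L M
      using susp_t_elt_defect[OF pl *(2,4,6)] susp_t_elt_zero[OF pl] unfolding D by simp
    show "susp_prod (p + q) r (susp_prod p q ?U ?V) ?W \<ominus>\<^bsub>component T ?N\<^esub> susp_prod p (q + r) ?U (susp_prod q r ?V ?W) =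
      sym_act T ?N ?\<beta> (susp_prod (p + r) q (susp_prod p r ?U ?W) ?V \<ominus>\<^bsub>component T ?N\<^esub> susp_prod p (r + q) ?U (susp_prod r q ?W ?V))"
      using dz c1 c2 T_act_closed[OF \<beta> TN.minus_closed[OF c2]] by (simp only: TN.diff_eq_zero TN.minus_closed)
  next
    show "additive (component T p) (component T ?N) (\<lambda>u. susp_prod (p + q) r (susp_prod p q u v) w \<ominus>\<^bsub>component T ?N\<^esub> susp_prod p (q + r) u (susp_prod q r v w))"
      if v: "v \<in> hom_elts T q" and w: "w \<in> hom_elts T r" for v w
      using additive_comp[OF A(2)[OF v, of p] A(2)[OF w]] A(2)[OF cl[OF v w], of p] unfolding N by (rule additive_minus)
    show "additive (component T q) (component T ?N) (\<lambda>v. susp_prod (p + q) r (susp_prod p q u v) w \<ominus>\<^bsub>component T ?N\<^esub> susp_prod p (q + r) u (susp_prod q r v w))"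
      if u: "u \<in> hom_elts T p" and w: "w \<in> hom_elts T r" for u w
      using additive_comp[OF A(1)[OF u, of q] A(2)[OF w]] additive_comp[OF A(2)[OF w, of q] A(1)[OF u]] unfolding N by (rule additive_minus)
    show "additive (component T r) (component T ?N) (\<lambda>w. susp_prod (p + q) r (susp_prod p q u v) w \<ominus>\<^bsub>component T ?N\<^esub> susp_prod p (q + r) u (susp_prod q r v w))"
      if u: "u \<in> hom_elts T p" and v: "v \<in> hom_elts T q" for u v
      using A(1)[OF cl[OF u v], of r] additive_comp[OF A(1)[OF v, of r] A(1)[OF u]] unfolding N by (rule additive_minus)
    show "additive (component T p) (component T ?N) (\<lambda>u. sym_act T ?N ?\<beta> (susp_prod (p + r) q (susp_prod p r u w) v \<ominus>\<^bsub>component T ?N\<^esub> susp_prod p (r + q) u (susp_prod r q w v)))"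
      if v: "v \<in> hom_elts T q" and w: "w \<in> hom_elts T r" for v w
      by (rule C[OF additive_minus[OF additive_comp[OF A(2)[OF w, of p] A(2)[OF v], unfolded N] A(2)[OF cl[OF w v], of p, unfolded N]]])
    show "additive (component T q) (component T ?N) (\<lambda>v. sym_act T ?N ?\<beta> (susp_prod (p + r) q (susp_prod p r u w) v \<ominus>\<^bsub>component T ?N\<^esub> susp_prod p (r + q) u (susp_prod r q w v)))"
      if u: "u \<in> hom_elts T p" and w: "w \<in> hom_elts T r" for u w
      by (rule C[OF additive_minus[OF A(1)[OF cl[OF u w], of q, unfolded N] additive_comp[OF A(1)[OF w, of q] A(1)[OF u], unfolded N]]])
    show "additive (component T r) (component T ?N) (\<lambda>w. sym_act T ?N ?\<beta> (susp_prod (p + r) q (susp_prod p r u w) v \<ominus>\<^bsub>component T ?N\<^esub> susp_prod p (r + q) u (susp_prod r q w v)))"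
      if u: "u \<in> hom_elts T p" and v: "v \<in> hom_elts T q" for u v
      by (rule C[OF additive_minus[OF additive_comp[OF A(1)[OF u, of r] A(2)[OF v], unfolded N] additive_comp[OF A(2)[OF v, of r] A(1)[OF u], unfolded N]]])
  qed
qed

section \<open>Determination by the values on the generators \<open>x^(0)\<close>\<close>

section \<open>Existence and uniqueness of the product and the bracket\<close>

text \<open>Explains the superscript in \<open>(x o y)^(|x|+1) t\<close>: the labels skip the
  position \<open>|x| + 1\<close>, where the \<open>s\<close> of \<open>x\<close> remains, and the
  last position, formerly the \<open>s\<close> of \<open>y\<close>, holds \<open>t\<close>.\<close>

lemma susp_prod_base:
  assumes x: "x \<in> hom_elts g a" and y: "y \<in> hom_elts g b"
  shows "susp_prod (Suc a) (Suc b) (t_elt (Suc a) a id (Suc a) x) (t_elt (Suc b) b id (Suc b) y) =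
    susp_elt_t R g (a + b) (Suc a) (C a b x y)"
proof -
  have f: "placed (Suc a) a id (Suc a)" for a by (rule placed_id) simp
  have "susp_prod (Suc a) (Suc b) (t_elt (Suc a) a id (Suc a) x) (t_elt (Suc b) b id (Suc b) y) =
      t_elt (Suc a + Suc b) (a + b) (join (Suc a) a id id) (Suc a) (C a b x y)"
    by (rule susp_prod_elt[OF f x f y])
  also have "\<dots> = t_elt (Suc a + Suc b) (a + b) (\<lambda>q. if q < Suc a then q else Suc q) (Suc a) (C a b x y)"
    by (rule susp_t_elt_cong) (auto simp: join_def)
  also have "\<dots> = susp_elt_t R g (a + b) (Suc a) (C a b x y)"
    using susp_elt_t_eq[of "Suc a" "a + b", OF _ _ C_closed[OF x y]] by simp
  finally show ?thesis .
qed

end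

context S_module_over
begin

abbreviation (input) "T_prod \<mu> \<equiv> S_prod R T \<mu>"

lemma T_prod_additive:
  assumes "\<mu> \<in> S_morphisms R (S_tensor R T T) T"
  shows "u \<in> hom_elts T p \<Longrightarrow> additive (component T q) (component T (p + q)) (T_prod \<mu> p q u)"
    "v \<in> hom_elts T q \<Longrightarrow> additive (component T p) (component T (p + q)) (\<lambda>u. T_prod \<mu> p q u v)"
  using bilinear_additive[OF S_prod_bilinear[OF S_module_T assms] T_module T_module T_module] by auto

text \<open>Induction on the left argument over its generation from \<open>x^(0)\<close>. The step
  for \<open>t\<close> combines left linearity with equivariance, since right multiplication is a
  translate of left multiplication.\<close>

lemma T_prod_eqI_left:
  assumes \<mu>: "\<mu> \<in> S_morphisms R (S_tensor R T T) T" "\<mu>' \<in> S_morphisms R (S_tensor R T T) T"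
    and lin: "\<And>p u. u \<in> hom_elts T p \<Longrightarrow> T_prod \<mu> (Suc p) q (lmult_t R g p u) v = lmult_t R g (p + q) (T_prod \<mu> p q u v)"
      "\<And>p u. u \<in> hom_elts T p \<Longrightarrow> T_prod \<mu>' (Suc p) q (lmult_t R g p u) v = lmult_t R g (p + q) (T_prod \<mu>' p q u v)"
    and v: "v \<in> hom_elts T q"
    and base: "\<And>a x. x \<in> hom_elts g a \<Longrightarrow> T_prod \<mu> (Suc a) q (t_elt (Suc a) a id (Suc a) x) v = T_prod \<mu>' (Suc a) q (t_elt (Suc a) a id (Suc a) x) v"
    and u: "u \<in> hom_elts T p"
  shows "T_prod \<mu> p q u v = T_prod \<mu>' p q u v"
proof -
  have act: "T_prod \<mu> p q (sym_act T p \<sigma> u) v = T_prod \<mu>' p q (sym_act T p \<sigma> u) v"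
    if "u \<in> hom_elts T p" "\<sigma> permutes {1..p}" "T_prod \<mu> p q u v = T_prod \<mu>' p q u v" for p u \<sigma>
    using S_prod_equivariant[OF S_module_T \<mu>(1) that(2) permutes_id that(1) v] S_prod_equivariant[OF S_module_T \<mu>(2) that(2) permutes_id that(1) v] that(3)
    by (simp add: S_module_one[OF S_module_T v])
  from u show ?thesis
  proof (induction rule: susp_t_generated)
    case (zero p)
    then show ?case using additive_zero[OF T_prod_additive(2)[OF \<mu>(1) v]] additive_zero[OF T_prod_additive(2)[OF \<mu>(2) v]] by simp
  next
    case (add p u u')
    then show ?case using additive_add[OF T_prod_additive(2)[OF \<mu>(1) v]] additive_add[OF T_prod_additive(2)[OF \<mu>(2) v]] by simp
  next
    case (act p u \<sigma>)
    then show ?case by (rule \<open>\<And>p u \<sigma>. _ \<Longrightarrow> _ \<Longrightarrow> _ \<Longrightarrow> T_prod \<mu> p q (sym_act T p \<sigma> u) v = _\<close>)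
  next
    case (rmult p u)
    have "swap_perm 1 p permutes {1..Suc p}" using swap_perm_permutes[of 1 p] by (simp add: Suc_eq_plus1)
    then show ?case
      unfolding rmult_t_eq_act_lmult_t[OF rmult(1)]
      using lin(1)[OF rmult(1)] lin(2)[OF rmult(1)] rmult(2) additive_closed[OF lmult_t_additive rmult(1)] by (intro act) simp_all
  next
    case (base a x)
    then show ?case by (rule assms(6))
  qed
qed

text \<open>Here linearity concerns \<open>t\<close> on the far right, so the generation rule
  applies directly.\<close>

lemma T_prod_eqI_right:
  assumes \<mu>: "\<mu> \<in> S_morphisms R (S_tensor R T T) T" "\<mu>' \<in> S_morphisms R (S_tensor R T T) T"
    and lin: "\<And>q v. v \<in> hom_elts T q \<Longrightarrow> T_prod \<mu> p (Suc q) u (rmult_t R g q v) = rmult_t R g (p + q) (T_prod \<mu> p q u v)"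
      "\<And>q v. v \<in> hom_elts T q \<Longrightarrow> T_prod \<mu>' p (Suc q) u (rmult_t R g q v) = rmult_t R g (p + q) (T_prod \<mu>' p q u v)"
    and u: "u \<in> hom_elts T p"
    and base: "\<And>a x. x \<in> hom_elts g a \<Longrightarrow> T_prod \<mu> p (Suc a) u (t_elt (Suc a) a id (Suc a) x) = T_prod \<mu>' p (Suc a) u (t_elt (Suc a) a id (Suc a) x)"
    and v: "v \<in> hom_elts T q"
  shows "T_prod \<mu> p q u v = T_prod \<mu>' p q u v"
  using v
proof (induction rule: susp_t_generated)
  case (zero q)
  then show ?case using additive_zero[OF T_prod_additive(1)[OF \<mu>(1) u]] additive_zero[OF T_prod_additive(1)[OF \<mu>(2) u]] by simp
next
  case (add q v v')
  then show ?case using additive_add[OF T_prod_additive(1)[OF \<mu>(1) u]] additive_add[OF T_prod_additive(1)[OF \<mu>(2) u]] by simp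
next
  case (act q v \<sigma>)
  then show ?case
    using S_prod_equivariant[OF S_module_T \<mu>(1) permutes_id act(2) u act(1)] S_prod_equivariant[OF S_module_T \<mu>(2) permutes_id act(2) u act(1)]
    by (simp add: S_module_one[OF S_module_T u])
next
  case (rmult q v)
  then show ?case using lin by simp
next
  case (base a x)
  then show ?case by (rule assms(6))
qed

end

context S_module_op
begin

lemma suspension_bracket_exists:
  "\<exists>br. is_suspension_bracket R g circ br \<and>
    (\<forall>p q. \<forall>u\<in>hom_elts T p. \<forall>v\<in>hom_elts T q. T_prod br p q u v = susp_bracket p q u v)"
proof -
  obtain br where mor: "br \<in> S_morphisms R (S_tensor R T T) T"
    and br: "\<And>p q u v. u \<in> hom_elts T p \<Longrightarrow> v \<in> hom_elts T q \<Longrightarrow> T_prod br p q u v = susp_bracket p q u v"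
    using S_morphism_exists[where B = susp_bracket, OF S_module_T S_module_T S_module_T susp_bracket_bilinear susp_bracket_equivariant]
    unfolding S_prod_def by blast
  have "twisted_skew_symmetric R T br"
    unfolding twisted_skew_symmetric_def
  proof (intro allI ballI)
    fix p q u v assume u: "u \<in> hom_elts T p" and v: "v \<in> hom_elts T q"
    show "T_prod br p q u v = \<ominus>\<^bsub>component T (p + q)\<^esub> sym_act T (p + q) (swap_perm q p) (T_prod br q p v u)"
      unfolding br[OF u v] br[OF v u] by (rule susp_bracket_skew[OF u v])
  qed
  moreover have "bracket_t_linear R g br"
    unfolding bracket_t_linear_def Let_def
    using br susp_bracket_t_linear additive_closed[OF lmult_t_additive] by simp
  moreover have "T_prod br (a + 1) (b + 1) (susp_incl R g (a + 1) (susp_elt R g a 0 x)) (susp_incl R g (b + 1) (susp_elt R g b 0 y))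
       = susp_elt_t R g (a + b) (a + 1) (C a b x y) \<ominus>\<^bsub>component T (a + b + 2)\<^esub>
         sym_act T (a + b + 2) (swap_perm (b + 1) (a + 1)) (susp_elt_t R g (b + a) (b + 1) (C b a y x))"
    if x: "x \<in> hom_elts g a" and y: "y \<in> hom_elts g b" for a b x y
  proof -
    have f: "placed (Suc a) a id (Suc a)" for a by (rule placed_id) simp
    have e: "a + b + 2 = Suc a + Suc b" by simp
    show ?thesis
      unfolding susp_incl_base[OF x] susp_incl_base[OF y] e Suc_eq_plus1[symmetric]
      using br[OF susp_t_elt_closed[OF f x] susp_t_elt_closed[OF f y]] susp_prod_base[OF x y] susp_prod_base[OF y x]
      by (simp only: susp_bracket_def)
  qed
  ultimately have "is_suspension_bracket R g circ br"
    unfolding is_suspension_bracket_def Let_def using mor by blast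
  then show ?thesis using br by blast
qed

text \<open>Linearity only controls the left argument. It is used with a generator on the right,
  then skew-symmetry exchanges the arguments, and then it is used a second time with an arbitrary
  right argument.\<close>

lemma suspension_bracket_unique:
  assumes br: "is_suspension_bracket R g circ br" and br': "is_suspension_bracket R g circ br'"
  shows "br = br'"
proof -
  have mor: "br \<in> S_morphisms R (S_tensor R T T) T" "br' \<in> S_morphisms R (S_tensor R T T) T"
    using br br' by (simp_all add: is_suspension_bracket_def Let_def)
  have lin: "T_prod \<beta> (Suc p) q (lmult_t R g p u) v = lmult_t R g (p + q) (T_prod \<beta> p q u v)"
    if "is_suspension_bracket R g circ \<beta>" "u \<in> hom_elts T p" "v \<in> hom_elts T q" for \<beta> p q u v
    using that unfolding is_suspension_bracket_def bracket_t_linear_def Let_def by blast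
  have skew: "T_prod \<beta> p q u v = \<ominus>\<^bsub>component T (p + q)\<^esub> sym_act T (p + q) (swap_perm q p) (T_prod \<beta> q p v u)"
    if "is_suspension_bracket R g circ \<beta>" "u \<in> hom_elts T p" "v \<in> hom_elts T q" for \<beta> p q u v
    using that unfolding is_suspension_bracket_def twisted_skew_symmetric_def Let_def by blast
  have f: "placed (Suc a) a id (Suc a)" for a by (rule placed_id) simp
  note base_closed = susp_t_elt_closed[OF f]
  have base: "T_prod br (Suc a) (Suc b) (t_elt (Suc a) a id (Suc a) x) (t_elt (Suc b) b id (Suc b) y) =
      T_prod br' (Suc a) (Suc b) (t_elt (Suc a) a id (Suc a) x) (t_elt (Suc b) b id (Suc b) y)"
    if x: "x \<in> hom_elts g a" and y: "y \<in> hom_elts g b" for a b x y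
  proof -
    have val: "T_prod \<beta> (a + 1) (b + 1) (susp_incl R g (a + 1) (susp_elt R g a 0 x)) (susp_incl R g (b + 1) (susp_elt R g b 0 y))
       = susp_elt_t R g (a + b) (a + 1) (C a b x y) \<ominus>\<^bsub>component T (a + b + 2)\<^esub>
         sym_act T (a + b + 2) (swap_perm (b + 1) (a + 1)) (susp_elt_t R g (b + a) (b + 1) (C b a y x))"
      if "is_suspension_bracket R g circ \<beta>" for \<beta>
      using that x y unfolding is_suspension_bracket_def Let_def by blast
    show ?thesis
      using val[OF br] val[OF br'] unfolding susp_incl_base[OF x] susp_incl_base[OF y] Suc_eq_plus1[symmetric] by simp
  qed
  have left: "T_prod br p (Suc b) u (t_elt (Suc b) b id (Suc b) y) = T_prod br' p (Suc b) u (t_elt (Suc b) b id (Suc b) y)"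
    if y: "y \<in> hom_elts g b" and u: "u \<in> hom_elts T p" for b y p u
    by (rule T_prod_eqI_left[OF mor lin[OF br _ base_closed[OF y]] lin[OF br' _ base_closed[OF y]] base_closed[OF y] base[OF _ y] u])
  have "T_prod br p q u v = T_prod br' p q u v" if u: "u \<in> hom_elts T p" and v: "v \<in> hom_elts T q" for p q u v
  proof (rule T_prod_eqI_left[OF mor lin[OF br _ v] lin[OF br' _ v] v _ u])
    \<comment> \<open>Skew-symmetry turns a generator on the left into a generator on the right,
      which \<open>left\<close> covers.\<close>
    show "T_prod br (Suc a) q (t_elt (Suc a) a id (Suc a) x) v = T_prod br' (Suc a) q (t_elt (Suc a) a id (Suc a) x) v"
      if x: "x \<in> hom_elts g a" for a x
      using skew[OF br base_closed[OF x] v] skew[OF br' base_closed[OF x] v] left[OF x v] by simp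
  qed
  then show ?thesis unfolding S_prod_def by (intro S_morphism_eqI[OF S_module_T S_module_T S_module_T mor])
qed

lemma suspension_product_exists:
  "\<exists>\<mu>. is_suspension_product R g circ \<mu> \<and>
    (\<forall>p q. \<forall>u\<in>hom_elts T p. \<forall>v\<in>hom_elts T q. T_prod \<mu> p q u v = susp_prod p q u v)"
proof -
  obtain \<mu> where mor: "\<mu> \<in> S_morphisms R (S_tensor R T T) T"
    and \<mu>: "\<And>p q u v. u \<in> hom_elts T p \<Longrightarrow> v \<in> hom_elts T q \<Longrightarrow> T_prod \<mu> p q u v = susp_prod p q u v"
    using S_morphism_exists[where B = susp_prod, OF S_module_T S_module_T S_module_T susp_prod_bilinear susp_prod_equivariant]
    unfolding S_prod_def by blast
  have "product_t_linear R g \<mu>"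
    unfolding product_t_linear_def Let_def
    using \<mu> susp_prod_t_linear additive_closed[OF lmult_t_additive] additive_closed[OF rmult_t_additive] by simp
  moreover have "T_prod \<mu> (a + 1) (b + 1) (susp_incl R g (a + 1) (susp_elt R g a 0 x)) (susp_incl R g (b + 1) (susp_elt R g b 0 y))
       = susp_elt_t R g (a + b) (a + 1) (C a b x y)"
    if x: "x \<in> hom_elts g a" and y: "y \<in> hom_elts g b" for a b x y
  proof -
    have f: "placed (Suc a) a id (Suc a)" for a by (rule placed_id) simp
    show ?thesis
      unfolding susp_incl_base[OF x] susp_incl_base[OF y] Suc_eq_plus1[symmetric]
      using \<mu>[OF susp_t_elt_closed[OF f x] susp_t_elt_closed[OF f y]] susp_prod_base[OF x y] by (simp only:)
  qed
  ultimately have "is_suspension_product R g circ \<mu>"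
    unfolding is_suspension_product_def Let_def using mor by blast
  then show ?thesis using \<mu> by blast
qed

text \<open>There is no skew-symmetry to exchange the arguments; instead the compatibility of the
  product with \<open>t\<close> on the far right takes care of the second one.\<close>

lemma suspension_product_unique:
  assumes \<mu>: "is_suspension_product R g circ \<mu>" and \<mu>': "is_suspension_product R g circ \<mu>'"
  shows "\<mu> = \<mu>'"
proof -
  have mor: "\<mu> \<in> S_morphisms R (S_tensor R T T) T" "\<mu>' \<in> S_morphisms R (S_tensor R T T) T"
    using \<mu> \<mu>' by (simp_all add: is_suspension_product_def Let_def)
  have lin: "T_prod \<beta> (Suc p) q (lmult_t R g p u) v = lmult_t R g (p + q) (T_prod \<beta> p q u v)"
      "T_prod \<beta> p (Suc q) u (rmult_t R g q v) = rmult_t R g (p + q) (T_prod \<beta> p q u v)"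
    if "is_suspension_product R g circ \<beta>" "u \<in> hom_elts T p" "v \<in> hom_elts T q" for \<beta> p q u v
    using that unfolding is_suspension_product_def product_t_linear_def Let_def by metis+
  have f: "placed (Suc a) a id (Suc a)" for a by (rule placed_id) simp
  note base_closed = susp_t_elt_closed[OF f]
  have base: "T_prod \<mu> (Suc a) (Suc b) (t_elt (Suc a) a id (Suc a) x) (t_elt (Suc b) b id (Suc b) y) =
      T_prod \<mu>' (Suc a) (Suc b) (t_elt (Suc a) a id (Suc a) x) (t_elt (Suc b) b id (Suc b) y)"
    if x: "x \<in> hom_elts g a" and y: "y \<in> hom_elts g b" for a b x y
  proof -
    have val: "T_prod \<beta> (a + 1) (b + 1) (susp_incl R g (a + 1) (susp_elt R g a 0 x)) (susp_incl R g (b + 1) (susp_elt R g b 0 y))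
       = susp_elt_t R g (a + b) (a + 1) (C a b x y)" if "is_suspension_product R g circ \<beta>" for \<beta>
      using that x y unfolding is_suspension_product_def Let_def by blast
    show ?thesis
      using val[OF \<mu>] val[OF \<mu>'] unfolding susp_incl_base[OF x] susp_incl_base[OF y] Suc_eq_plus1[symmetric] by simp
  qed
  have left: "T_prod \<mu> p (Suc b) u (t_elt (Suc b) b id (Suc b) y) = T_prod \<mu>' p (Suc b) u (t_elt (Suc b) b id (Suc b) y)"
    if y: "y \<in> hom_elts g b" and u: "u \<in> hom_elts T p" for b y p u
    by (rule T_prod_eqI_left[OF mor lin(1)[OF \<mu> _ base_closed[OF y]] lin(1)[OF \<mu>' _ base_closed[OF y]] base_closed[OF y] base[OF _ y] u])
  have "T_prod \<mu> p q u v = T_prod \<mu>' p q u v" if u: "u \<in> hom_elts T p" and v: "v \<in> hom_elts T q" for p q u v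
    by (rule T_prod_eqI_right[OF mor lin(2)[OF \<mu> u] lin(2)[OF \<mu>' u] u left[OF _ u] v])
  then show ?thesis unfolding S_prod_def by (intro S_morphism_eqI[OF S_module_T S_module_T S_module_T mor])
qed

text \<open>Since the bracket is unique, it agrees with the explicit commutator, and of the Lie
  axioms only the Jacobi identity is left to discuss.\<close>

lemma suspension_bracket_Lie_iff:
  assumes br: "is_suspension_bracket R g circ br"
  shows "twisted_Lie_algebra_over_t R g br \<longleftrightarrow> twisted_preLie_algebra R g circ"
proof -
  have val: "T_prod br p q u v = susp_bracket p q u v" if "u \<in> hom_elts T p" "v \<in> hom_elts T q" for p q u v
    using suspension_bracket_exists suspension_bracket_unique[OF br] that by blast
  have "twisted_Lie_algebra_over_t R g br \<longleftrightarrow> twisted_Jacobi R T br"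
    using br S_module_T by (simp add: twisted_Lie_algebra_over_t_def twisted_Lie_algebra_def is_suspension_bracket_def Let_def)
  also have "\<dots> \<longleftrightarrow> (\<forall>p q r. \<forall>u\<in>hom_elts T p. \<forall>v\<in>hom_elts T q. \<forall>w\<in>hom_elts T r.
      susp_Jacobi p q r u v w = \<zero>\<^bsub>component T (p + q + r)\<^esub>)"
    unfolding twisted_Jacobi_def susp_Jacobi_def by (simp add: val susp_bracket_closed cong: ball_cong)
  also have "\<dots> \<longleftrightarrow> twisted_preLie_algebra R g circ"
  proof
    assume J: "\<forall>p q r. \<forall>u\<in>hom_elts T p. \<forall>v\<in>hom_elts T q. \<forall>w\<in>hom_elts T r.
      susp_Jacobi p q r u v w = \<zero>\<^bsub>component T (p + q + r)\<^esub>"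
    show "twisted_preLie_algebra R g circ"
      unfolding twisted_preLie_iff_defect
      by (intro allI ballI) (rule defect_zero_if_susp_Jacobi[OF J[rule_format]])
  next
    assume "twisted_preLie_algebra R g circ"
    then show "\<forall>p q r. \<forall>u\<in>hom_elts T p. \<forall>v\<in>hom_elts T q. \<forall>w\<in>hom_elts T r.
      susp_Jacobi p q r u v w = \<zero>\<^bsub>component T (p + q + r)\<^esub>"
      by (intro allI ballI) (rule susp_Jacobi_if_preLie)
  qed
  finally show ?thesis .
qed

lemma suspension_product_preLie:
  assumes pre: "twisted_preLie_algebra R g circ" and \<mu>: "is_suspension_product R g circ \<mu>"
  shows "twisted_preLie_algebra R T \<mu>"
proof -
  have val: "T_prod \<mu> p q u v = susp_prod p q u v" if "u \<in> hom_elts T p" "v \<in> hom_elts T q" for p q u v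
    using suspension_product_exists suspension_product_unique[OF \<mu>] that by blast
  show ?thesis
    unfolding twisted_preLie_algebra_def
  proof (intro conjI allI ballI S_module_T)
    show "\<mu> \<in> S_morphisms R (S_tensor R T T) T" using \<mu> by (simp add: is_suspension_product_def Let_def)
    fix p q r u v w assume u: "u \<in> hom_elts T p" and v: "v \<in> hom_elts T q" and w: "w \<in> hom_elts T r"
    note cl = susp_prod_closed[OF u v] susp_prod_closed[OF v w] susp_prod_closed[OF u w] susp_prod_closed[OF w v]
    show "T_prod \<mu> (p + q) r (T_prod \<mu> p q u v) w \<ominus>\<^bsub>component T (p + q + r)\<^esub> T_prod \<mu> p (q + r) u (T_prod \<mu> q r v w)
      = sym_act T (p + q + r) (block_perm (cycle_of_list [2, 3]) [p, r, q])
          (T_prod \<mu> (p + r) q (T_prod \<mu> p r u w) v \<ominus>\<^bsub>component T (p + q + r)\<^esub> T_prod \<mu> p (r + q) u (T_prod \<mu> r q w v))"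
      unfolding val[OF u v] val[OF v w] val[OF u w] val[OF w v] val[OF cl(1) w] val[OF u cl(2)] val[OF cl(3) v] val[OF u cl(4)]
      by (rule susp_prod_preLie[OF pre u v w])
  qed
qed

end

theorem proposition4p6p6:
  fixes R :: "('a, 'r) ring_scheme"
    and g :: "('a, 'b) smodule"
    and circ :: "nat \<Rightarrow> ('a, 'b, 'b) S_tensor \<Rightarrow> 'b"
  assumes "cring R"
    and "S_module R g"
    and "circ \<in> S_morphisms R (S_tensor R g g) g"
  shows "(\<exists>!br. is_suspension_bracket R g circ br) \<and>
    (\<forall>br. is_suspension_bracket R g circ br \<longrightarrow>
      (twisted_Lie_algebra_over_t R g br \<longleftrightarrow> twisted_preLie_algebra R g circ)) \<and>
    (twisted_preLie_algebra R g circ \<longrightarrow>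
      (\<exists>!\<mu>. is_suspension_product R g circ \<mu>) \<and>
      (\<forall>\<mu>. is_suspension_product R g circ \<mu> \<longrightarrow> twisted_preLie_algebra R (suspension_t R g) \<mu>))"
proof -
  interpret S_module_op R g circ
    using assms by (intro S_module_op.intro S_module_over.intro S_module_over_axioms.intro S_module_op_axioms.intro)
  show ?thesis
  proof (intro conjI impI allI)
    show "\<exists>!br. is_suspension_bracket R g circ br"
      using suspension_bracket_exists suspension_bracket_unique by blast
    show "\<exists>!\<mu>. is_suspension_product R g circ \<mu>"
      using suspension_product_exists suspension_product_unique by blast
  qed (simp_all add: suspension_bracket_Lie_iff suspension_product_preLie)
qed

end
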